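(* Let $n\ge 1$ be an integer and let $D$ be a nice distribution on the space $\mathbb{R}^{n(n+1)/2}$ of real quadratic forms in $n$ variables. Then the probability $\rho_n^D$ that a random (with respect to $D$) integral quadratic form in $n$ variables is isotropic over $\mathbb{Z}$ (the limit defining it exists and) is given by the product of the local probabilities: $$\rho_n^D=\rho_n^D(\infty)\prod_{p}\rho_n(p),$$ where the product runs over all primes $p$.
   Context: A quadratic form in $n$ variables over a ring $R$ is $Q(x_1,\dots,x_n)=\sum_{1\le i\le j\le n}c_{ij}x_ix_j$ with all $c_{ij}\in R$; it is identified with its coefficient vector $(c_{ij})\in R^{n(n+1)/2}$. It is called integral if $R=\mathbb{Z}$. A form $Q$ is isotropic over $\mathbb{Z}$ (resp. $\mathbb{Z}_p$, $\mathbb{R}$) if there is a nonzero vector $k$ in $\mathbb{Z}^n$ (resp. $\mathbb{Z}_p^n$, $\mathbb{R}^n$) with $Q(k)=0$. A nice distribution is a piecewise smooth, rapidly decaying function $D$ on $\mathbb{R}^{n(n+1)/2}$ (rapidly decaying: $D(x)$ and all its partial derivatives are $o(|x|^{-N})$ for all $N>0$) with $\int D(Q)\,dQ=1$. The probability, with respect to $D$, that a random integral $n$-ary quadratic form has a property $P$ is $$\lim_{X\to\infty}\frac{\sum_{Q\text{ integral, with property }P}D(Q/X)}{\sum_{Q\text{ integral}}D(Q/X)},$$ if the limit exists. $\rho_n^D$ is the probability with respect to $D$ that a random integral $n$-ary quadratic form is isotropic over $\mathbb{Z}$; $\rho_n^D(\infty)$ is the probability with respect to $D$ that a random integral $n$-ary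 quadratic form is isotropic over $\mathbb{R}$ (this equals the $D$-integral over the set of real $n$-ary quadratic forms that are indefinite); $\rho_n(p)$ is the probability that a random $n$-ary quadratic form over $\mathbb{Z}_p$, with respect to the Haar probability measure on $\mathbb{Z}_p^{n(n+1)/2}$, is isotropic over $\mathbb{Z}_p$. *)

theory Defs
  imports
    "HOL-Probability.Probability"
    "HOL-Library.Uprod"
    "HOL-Library.Landau_Symbols"
    "HOL-Computational_Algebra.Primes"
    "HOL-Algebra.Ring"
begin

section \<open>Quadratic forms\<close>

instance uprod :: (finite) finite
  by standard simp

text \<open>
  With variables indexed by a finite linear order \<open>'n\<close>, so that \<open>n = CARD('n) \<ge> 1\<close>, the
  coefficient \<open>c\<^sub>i\<^sub>j\<close> for \<open>i \<le> j\<close> is stored at the unordered pair \<open>Upair i j\<close>. Thus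
  \<open>'r ^ 'n uprod\<close> is the space of coefficient vectors, of dimension \<open>n (n + 1) / 2\<close>.
\<close>

lemma bij_betw_Upair_le:
  "bij_betw (\<lambda>(i, j). Upair i j) {(i, j). i \<le> j} (UNIV :: 'n::linorder uprod set)"
proof (rule bij_betwI')
  fix u :: "'n uprod"
  obtain a b where u: "u = Upair a b" by (cases u) auto
  show "\<exists>x\<in>{(i, j). i \<le> j}. u = (case x of (i, j) \<Rightarrow> Upair i j)"
  proof (cases "a \<le> b")
    case True
    then show ?thesis using u by (intro bexI[of _ "(a, b)"]) auto
  next
    case False
    then show ?thesis using u by (intro bexI[of _ "(b, a)"]) auto
  qed
qed auto

definition qform_eval ::
  "('r, 'z) ring_scheme \<Rightarrow>
     'r ^ ('n::{finite,linorder}) uprod \<Rightarrow> 'r ^ ('n::{finite,linorder}) \<Rightarrow> 'r" where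
  "qform_eval R c x =
     (\<Oplus>\<^bsub>R\<^esub>i\<in>UNIV. \<Oplus>\<^bsub>R\<^esub>j\<in>{i..}. c $ Upair i j \<otimes>\<^bsub>R\<^esub> x $ i \<otimes>\<^bsub>R\<^esub> x $ j)"

definition isotropic ::
  "('r, 'z) ring_scheme \<Rightarrow> 'r ^ ('n::{finite,linorder}) uprod \<Rightarrow> bool" where
  "isotropic R c \<longleftrightarrow>
     (\<exists>k. (\<forall>i. k $ i \<in> carrier R) \<and> (\<exists>i. k $ i \<noteq> \<zero>\<^bsub>R\<^esub>) \<and> qform_eval R c k = \<zero>\<^bsub>R\<^esub>)"

definition ring_of_type :: "'a::comm_ring_1 ring" where
  "ring_of_type = \<lparr>carrier = UNIV, monoid.mult = (*), one = 1, ring.zero = 0, add = (+)\<rparr>"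

lemma cring_ring_of_type: "cring (ring_of_type :: 'a::comm_ring_1 ring)"
proof -
  have "\<exists>y. x + y = 0" for x :: 'a
    by (rule exI[of _ "- x"]) simp
  thus ?thesis
    unfolding ring_of_type_def using add.right_inverse
    by unfold_locales (auto simp: algebra_simps Units_def)
qed

lemma finsum_ring_of_type:
  fixes f :: "'b \<Rightarrow> 'a::comm_ring_1"
  assumes "finite A"
  shows "finsum ring_of_type f A = sum f A"
proof -
  interpret cring "ring_of_type :: 'a ring" by (rule cring_ring_of_type)
  have [simp]: "carrier (ring_of_type :: 'a ring) = UNIV" "\<zero>\<^bsub>ring_of_type :: 'a ring\<^esub> = 0"
    "a \<oplus>\<^bsub>ring_of_type\<^esub> b = a + b" for a b :: 'a
    by (simp_all add: ring_of_type_def)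
  show ?thesis
    using assms by induction (simp_all add: finsum_insert)
qed

lemma isotropic_ring_of_type:
  fixes c :: "'a::comm_ring_1 ^ ('n::{finite,linorder}) uprod"
  shows "isotropic ring_of_type c \<longleftrightarrow>
    (\<exists>k. k \<noteq> 0 \<and> (\<Sum>i\<in>UNIV. \<Sum>j\<in>{i..}. c $ Upair i j * k $ i * k $ j) = 0)"
proof -
  have "qform_eval ring_of_type c k = (\<Sum>i\<in>UNIV. \<Sum>j\<in>{i..}. c $ Upair i j * k $ i * k $ j)" for k
    by (simp add: qform_eval_def finsum_ring_of_type) (simp add: ring_of_type_def)
  thus ?thesis
    unfolding isotropic_def by (auto simp: ring_of_type_def vec_eq_iff)
qed

abbreviation real_qform :: "int ^ 'm \<Rightarrow> real ^ 'm" where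
  "real_qform Q \<equiv> \<chi> u. real_of_int (Q $ u)"

section \<open>Nice distributions and probabilities of integral forms\<close>

fun iter_partial :: "'a::euclidean_space list \<Rightarrow> ('a \<Rightarrow> real) \<Rightarrow> 'a \<Rightarrow> real" where
  "iter_partial [] f = f"
| "iter_partial (b # bs) f = (\<lambda>x. frechet_derivative (iter_partial bs f) (at x) b)"

definition smooth_on :: "'a::euclidean_space set \<Rightarrow> ('a \<Rightarrow> real) \<Rightarrow> bool" where
  "smooth_on U f \<longleftrightarrow>
     open U \<and> (\<forall>bs. set bs \<subseteq> Basis \<longrightarrow> (\<forall>x\<in>U. iter_partial bs f differentiable (at x)))"

text \<open>
  The space is covered by a locally finite family of pieces with boundaries of measure zero; on
  each piece \<open>f\<close> is the restriction of a smooth function on the whole space, that is, it is smooth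
  up to and including the boundary.
\<close>

definition piecewise_smooth :: "('a::euclidean_space \<Rightarrow> real) \<Rightarrow> bool" where
  "piecewise_smooth f \<longleftrightarrow>
     (\<exists>\<P>. locally_finite_in euclidean \<P> \<and> \<Union>\<P> = UNIV \<and>
        (\<forall>S\<in>\<P>. negligible (frontier S) \<and> (\<exists>g. smooth_on UNIV g \<and> (\<forall>x\<in>S. f x = g x))))"

text \<open>
  The decay of the partial derivatives is required where they exist, that is, on the open set where
  the function is smooth. The decay of the function itself (the case of no derivatives) is required
  everywhere.
\<close>

definition rapidly_decaying :: "('a::euclidean_space \<Rightarrow> real) \<Rightarrow> bool" where
  "rapidly_decaying f \<longleftrightarrow>
     (\<forall>N>0. f \<in> o[at_infinity](\<lambda>x. norm x powr - N)) \<and>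
     (\<forall>N>0. \<forall>bs. set bs \<subseteq> Basis \<longrightarrow>
        iter_partial bs f \<in>
          o[inf at_infinity (principal (\<Union>{U. smooth_on U f}))](\<lambda>x. norm x powr - N))"

definition nice_distribution :: "('a::euclidean_space \<Rightarrow> real) \<Rightarrow> bool" where
  "nice_distribution D \<longleftrightarrow>
     piecewise_smooth D \<and> rapidly_decaying D \<and> integrable lebesgue D \<and> integral\<^sup>L lebesgue D = 1"

definition has_probability ::
  "(real ^ 'm \<Rightarrow> real) \<Rightarrow> (int ^ 'm \<Rightarrow> bool) \<Rightarrow> real \<Rightarrow> bool" where
  "has_probability D P \<rho> \<longleftrightarrow>
     ((\<lambda>X. (\<Sum>\<^sub>\<infinity>Q\<in>{Q. P Q}. D (real_qform Q /\<^sub>R X)) / (\<Sum>\<^sub>\<infinity>Q. D (real_qform Q /\<^sub>R X)))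
        \<longlongrightarrow> \<rho>) at_top"

section \<open>The \<open>p\<close>-adic integers\<close>

text \<open>The ring of \<open>p\<close>-adic integers as the inverse limit of the rings of integers modulo \<open>p ^ k\<close>.\<close>

definition padic_int :: "nat \<Rightarrow> (nat \<Rightarrow> int) ring" where
  "padic_int p =
     \<lparr>carrier = {x. \<forall>k. x k \<in> {0..<int p ^ k} \<and> x (Suc k) mod int p ^ k = x k},
      monoid.mult = (\<lambda>x y k. (x k * y k) mod int p ^ k),
      one = (\<lambda>k. 1 mod int p ^ k),
      ring.zero = (\<lambda>k. 0),
      add = (\<lambda>x y k. (x k + y k) mod int p ^ k)\<rparr>"

definition padic_space :: "nat \<Rightarrow> ((nat \<Rightarrow> int) ^ 'm) set" where
  "padic_space p = {x. \<forall>u. x $ u \<in> carrier (padic_int p)}"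

definition padic_translate ::
  "nat \<Rightarrow> (nat \<Rightarrow> int) ^ 'm \<Rightarrow> (nat \<Rightarrow> int) ^ 'm \<Rightarrow> (nat \<Rightarrow> int) ^ 'm" where
  "padic_translate p a x = (\<chi> u. a $ u \<oplus>\<^bsub>padic_int p\<^esub> x $ u)"

text \<open>
  As \<open>int\<close> is discrete, \<^typ>\<open>(nat \<Rightarrow> int) ^ 'm\<close> carries the product topology of discrete spaces,
  which induces the usual topology on \<open>padic_space p\<close>.
\<close>

definition is_padic_haar :: "nat \<Rightarrow> ((nat \<Rightarrow> int) ^ 'm) measure \<Rightarrow> bool" where
  "is_padic_haar p M \<longleftrightarrow>
     sets M = sets (restrict_space borel (padic_space p)) \<and>
     prob_space M \<and>
     (\<forall>a\<in>padic_space p. distr M M (padic_translate p a) = M)"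

definition padic_haar :: "nat \<Rightarrow> ((nat \<Rightarrow> int) ^ 'm) measure" where
  "padic_haar p = (THE M. is_padic_haar p M)"

definition padic_isotropy_prob :: "('n::{finite,linorder}) itself \<Rightarrow> nat \<Rightarrow> real" where
  "padic_isotropy_prob _ p =
     measure (padic_haar p :: ((nat \<Rightarrow> int) ^ ('n::{finite,linorder}) uprod) measure)
       {c \<in> padic_space p. isotropic (padic_int p) c}"

text \<open>
  Existence and uniqueness of the Haar probability measure. It gives equal mass to all residue
  classes modulo \<open>p ^ k\<close>, and it is constructed from independent, uniformly distributed digits.
\<close>

lemma padic_int_level:
  assumes "x \<in> carrier (padic_int p)" "j \<le> k"
  shows "x k mod int p ^ j = x j"
  using assms(2)
proof (induction k rule: dec_induct)
  case base
  show ?case using assms(1) by (auto simp: padic_int_def)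
next
  case (step k)
  have "x (Suc k) mod int p ^ j = x (Suc k) mod int p ^ k mod int p ^ j"
    using step.hyps by (simp add: mod_mod_cancel le_imp_power_dvd)
  also have "x (Suc k) mod int p ^ k = x k"
    using assms(1) by (auto simp: padic_int_def)
  finally show ?case using step.IH by simp
qed

lemma padic_int_closed:
  assumes "p > 0" "\<And>k. f (Suc k) mod int p ^ k = f k mod int p ^ k"
  shows "(\<lambda>k. f k mod int p ^ k) \<in> carrier (padic_int p)"
  using assms by (auto simp: padic_int_def mod_mod_cancel le_imp_power_dvd)

lemma cring_padic_int:
  assumes "p > 0"
  shows "cring (padic_int p)"
proof (rule cringI)
  have suc: "x (Suc k) mod int p ^ k = x k mod int p ^ k" if "x \<in> carrier (padic_int p)" for x k
    using padic_int_level[OF that, of k "Suc k"] padic_int_level[OF that, of k k] by simp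
  have same: "x k mod int p ^ k = x k" if "x \<in> carrier (padic_int p)" for x k
    using padic_int_level[OF that, of k k] by simp
  have add_closed: "x \<oplus>\<^bsub>padic_int p\<^esub> y \<in> carrier (padic_int p)"
    if "x \<in> carrier (padic_int p)" "y \<in> carrier (padic_int p)" for x y
  proof -
    have "(\<lambda>k. (x k + y k) mod int p ^ k) \<in> carrier (padic_int p)"
      by (rule padic_int_closed[OF assms]) (metis mod_add_eq suc that)
    then show ?thesis by (simp add: padic_int_def)
  qed
  have mult_closed: "x \<otimes>\<^bsub>padic_int p\<^esub> y \<in> carrier (padic_int p)"
    if "x \<in> carrier (padic_int p)" "y \<in> carrier (padic_int p)" for x y
  proof -
    have "(\<lambda>k. (x k * y k) mod int p ^ k) \<in> carrier (padic_int p)"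
      by (rule padic_int_closed[OF assms]) (metis mod_mult_eq suc that)
    then show ?thesis by (simp add: padic_int_def)
  qed
  have one_closed: "\<one>\<^bsub>padic_int p\<^esub> \<in> carrier (padic_int p)"
    using padic_int_closed[OF assms, of "\<lambda>_. 1"] by (simp add: padic_int_def)
  have zero_closed: "\<zero>\<^bsub>padic_int p\<^esub> \<in> carrier (padic_int p)"
    using assms by (simp add: padic_int_def)
  show "abelian_group (padic_int p)"
  proof (rule abelian_groupI)
    fix x assume x: "x \<in> carrier (padic_int p)"
    have "(\<lambda>k. (- x k) mod int p ^ k) \<in> carrier (padic_int p)"
      by (rule padic_int_closed[OF assms]) (metis mod_minus_eq suc x)
    moreover have "(\<lambda>k. (- x k) mod int p ^ k) \<oplus>\<^bsub>padic_int p\<^esub> x = \<zero>\<^bsub>padic_int p\<^esub>"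
      by (simp add: padic_int_def mod_simps)
    ultimately show "\<exists>y\<in>carrier (padic_int p). y \<oplus>\<^bsub>padic_int p\<^esub> x = \<zero>\<^bsub>padic_int p\<^esub>"
      by blast
    show "\<zero>\<^bsub>padic_int p\<^esub> \<oplus>\<^bsub>padic_int p\<^esub> x = x"
      using same[OF x] by (simp add: padic_int_def)
    fix y assume y: "y \<in> carrier (padic_int p)"
    show "x \<oplus>\<^bsub>padic_int p\<^esub> y \<in> carrier (padic_int p)"
      using x y by (rule add_closed)
    show "x \<oplus>\<^bsub>padic_int p\<^esub> y = y \<oplus>\<^bsub>padic_int p\<^esub> x"
      by (simp add: padic_int_def add.commute)
    fix z
    show "(x \<oplus>\<^bsub>padic_int p\<^esub> y) \<oplus>\<^bsub>padic_int p\<^esub> z = x \<oplus>\<^bsub>padic_int p\<^esub> (y \<oplus>\<^bsub>padic_int p\<^esub> z)"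
      by (simp add: padic_int_def mod_simps add.assoc)
  qed (rule zero_closed)
  show "comm_monoid (padic_int p)"
  proof (rule comm_monoidI)
    fix x assume x: "x \<in> carrier (padic_int p)"
    show "\<one>\<^bsub>padic_int p\<^esub> \<otimes>\<^bsub>padic_int p\<^esub> x = x"
      using same[OF x] by (simp add: padic_int_def mod_simps)
    fix y assume y: "y \<in> carrier (padic_int p)"
    show "x \<otimes>\<^bsub>padic_int p\<^esub> y \<in> carrier (padic_int p)"
      using x y by (rule mult_closed)
    show "x \<otimes>\<^bsub>padic_int p\<^esub> y = y \<otimes>\<^bsub>padic_int p\<^esub> x"
      by (simp add: padic_int_def mult.commute)
    fix z
    show "(x \<otimes>\<^bsub>padic_int p\<^esub> y) \<otimes>\<^bsub>padic_int p\<^esub> z = x \<otimes>\<^bsub>padic_int p\<^esub> (y \<otimes>\<^bsub>padic_int p\<^esub> z)"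
      by (simp add: padic_int_def mod_simps mult.assoc)
  qed (rule one_closed)
  show "(x \<oplus>\<^bsub>padic_int p\<^esub> y) \<otimes>\<^bsub>padic_int p\<^esub> z =
      x \<otimes>\<^bsub>padic_int p\<^esub> z \<oplus>\<^bsub>padic_int p\<^esub> y \<otimes>\<^bsub>padic_int p\<^esub> z" for x y z
    by (simp add: padic_int_def mod_simps distrib_right)
qed

definition padic_cylinder ::
  "nat \<Rightarrow> nat \<Rightarrow> (nat \<Rightarrow> int) ^ 'm \<Rightarrow> ((nat \<Rightarrow> int) ^ 'm) set" where
  "padic_cylinder p k a = {x \<in> padic_space p. \<forall>u. (x $ u) k = (a $ u) k}"

lemma padic_cylinder_mono:
  assumes "a \<in> padic_space p" "j \<le> k"
  shows "padic_cylinder p k a \<subseteq> padic_cylinder p j a"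
proof
  fix x assume x: "x \<in> padic_cylinder p k a"
  have "(x $ u) j = (a $ u) j" for u
    using padic_int_level[of "x $ u" p j k] padic_int_level[of "a $ u" p j k] x assms
    by (auto simp: padic_cylinder_def padic_space_def)
  then show "x \<in> padic_cylinder p j a"
    using x by (simp add: padic_cylinder_def)
qed

lemma padic_cylinder_cong:
  "x \<in> padic_cylinder p k a \<Longrightarrow> padic_cylinder p k x = padic_cylinder p k a"
  by (auto simp: padic_cylinder_def)

lemma padic_cylinder_0:
  assumes "a \<in> padic_space p"
  shows "padic_cylinder p 0 a = padic_space p"
proof -
  have "(x $ u) 0 = 0" if "x \<in> padic_space p" for x :: "(nat \<Rightarrow> int) ^ 'a" and u
  proof -
    have "(x $ u) 0 \<in> {0..<int p ^ 0}"
      using that unfolding padic_space_def padic_int_def partial_object.simps by blast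
    then show ?thesis by simp
  qed
  then show ?thesis using assms by (auto simp: padic_cylinder_def)
qed

lemma zero_padic_space: "p > 0 \<Longrightarrow> (\<chi> u. (\<lambda>k. 0)) \<in> padic_space p"
  by (simp add: padic_space_def padic_int_def)

abbreviation padic_cylinders :: "nat \<Rightarrow> ((nat \<Rightarrow> int) ^ 'm) set set" where
  "padic_cylinders p \<equiv> insert {} {padic_cylinder p k a |k a. a \<in> padic_space p}"

lemma Int_stable_padic_cylinders: "Int_stable (padic_cylinders p)"
proof -
  have *: "padic_cylinder p j a \<inter> padic_cylinder p k b \<in> padic_cylinders p"
    if "b \<in> padic_space p" "j \<le> k" for j k and a b :: "(nat \<Rightarrow> int) ^ 'a"
  proof (cases "padic_cylinder p j a \<inter> padic_cylinder p k b = {}")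
    case False
    then obtain x where x: "x \<in> padic_cylinder p j a" "x \<in> padic_cylinder p k b" by auto
    then have "padic_cylinder p k b \<subseteq> padic_cylinder p j a"
      using padic_cylinder_mono[OF that] padic_cylinder_mono[of x p j k] that
      by (metis (lifting) padic_cylinder_cong padic_cylinder_def mem_Collect_eq)
    then have "padic_cylinder p j a \<inter> padic_cylinder p k b = padic_cylinder p k b" by auto
    then show ?thesis using that by auto
  qed auto
  show ?thesis
  proof (rule Int_stableI)
    fix A B :: "((nat \<Rightarrow> int) ^ 'a) set"
    assume AB: "A \<in> padic_cylinders p" "B \<in> padic_cylinders p"
    show "A \<inter> B \<in> padic_cylinders p"
    proof (cases "A = {} \<or> B = {}")
      case False
      then obtain j a k b where ab: "A = padic_cylinder p j a" "a \<in> padic_space p"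
        "B = padic_cylinder p k b" "b \<in> padic_space p"
        using AB by auto
      show ?thesis
        using *[of b j k a] *[of a k j b] ab by (cases "j \<le> k") (auto simp: Int_commute)
    qed auto
  qed
qed

lemma countable_padic_cylinders: "countable (padic_cylinders p :: ((nat \<Rightarrow> int) ^ 'm) set set)"
proof -
  have "{padic_cylinder p k a |k a. a \<in> padic_space p} \<subseteq>
    range (\<lambda>(k, v :: int ^ 'm). {x \<in> padic_space p. \<forall>u. (x $ u) k = v $ u})"
  proof clarify
    fix k and a :: "(nat \<Rightarrow> int) ^ 'm"
    show "padic_cylinder p k a \<in>
      range (\<lambda>(k, v :: int ^ 'm). {x \<in> padic_space p. \<forall>u. (x $ u) k = v $ u})"
      by (rule image_eqI[of _ _ "(k, \<chi> u. (a $ u) k)"]) (auto simp: padic_cylinder_def)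
  qed
  then show ?thesis
    by (metis (lifting) countable_insert countable_subset countable_image countableI_type)
qed

lemma padic_cylinder_open_basis:
  fixes x :: "(nat \<Rightarrow> int) ^ 'm"
  assumes "open S" "x \<in> S" "x \<in> padic_space p"
  shows "\<exists>k. padic_cylinder p k x \<subseteq> S"
proof -
  obtain A where A: "\<And>u. open (A u)" "\<And>u. x $ u \<in> A u" "\<And>y. (\<And>u. y $ u \<in> A u) \<Longrightarrow> y \<in> S"
    using assms unfolding open_vec_def by meson
  have "\<exists>k. \<forall>y\<in>carrier (padic_int p). y k = (x $ u) k \<longrightarrow> y \<in> A u" for u
  proof -
    have "openin (product_topology (\<lambda>i. euclidean) UNIV) (A u)"
      using A(1)[of u] by (simp add: open_fun_def)
    from product_topology_open_contains_basis[OF this A(2)]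
    obtain X where X: "x $ u \<in> (\<Pi>\<^sub>E i\<in>UNIV. X i)" "finite {i. X i \<noteq> UNIV}"
      "(\<Pi>\<^sub>E i\<in>UNIV. X i) \<subseteq> A u"
      by auto
    define k where "k = Max (insert 0 {i. X i \<noteq> UNIV})"
    show ?thesis
    proof (intro exI[of _ k] ballI impI)
      fix y assume y: "y \<in> carrier (padic_int p)" "y k = (x $ u) k"
      have "y i \<in> X i" for i
      proof (cases "X i = UNIV")
        case False
        then have "i \<le> k" unfolding k_def using X(2) by (intro Max_ge) auto
        then have "y i = (x $ u) i"
          using padic_int_level[OF y(1), of i k] padic_int_level[of "x $ u" p i k] y(2) assms(3)
          by (simp add: padic_space_def)
        then show ?thesis using X(1) by (auto simp: PiE_iff)
      qed auto
      then show "y \<in> A u" using X(3) by (auto simp: PiE_iff)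
    qed
  qed
  then obtain k where k: "\<And>u y. y \<in> carrier (padic_int p) \<Longrightarrow> y (k u) = (x $ u) (k u) \<Longrightarrow> y \<in> A u"
    by metis
  define K where "K = Max (range k)"
  have K: "k u \<le> K" for u unfolding K_def by (intro Max_ge) auto
  have "padic_cylinder p K x \<subseteq> S"
  proof
    fix y assume y: "y \<in> padic_cylinder p K x"
    show "y \<in> S"
    proof (rule A(3), rule k)
      fix u
      show "y $ u \<in> carrier (padic_int p)"
        using y by (simp add: padic_cylinder_def padic_space_def)
      show "(y $ u) (k u) = (x $ u) (k u)"
        using y padic_cylinder_mono[OF assms(3) K[of u]] by (auto simp: padic_cylinder_def)
    qed
  qed
  then show ?thesis by blast
qed

lemma sets_padic_space:
  "sets (restrict_space borel (padic_space p :: ((nat \<Rightarrow> int) ^ 'm) set)) =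
     sigma_sets (padic_space p) (padic_cylinders p)"
  (is "sets (restrict_space borel ?V) = sigma_sets ?V ?E")
proof
  have E: "?E \<subseteq> Pow ?V" by (auto simp: padic_cylinder_def)
  interpret sigma_algebra ?V "sigma_sets ?V ?E" by (rule sigma_algebra_sigma_sets) (rule E)
  have "(\<lambda>x. x) \<in> borel_measurable (sigma ?V ?E)"
  proof (rule borel_measurableI)
    fix S :: "((nat \<Rightarrow> int) ^ 'm) set"
    assume S: "open S"
    have "S \<inter> ?V = \<Union>{C \<in> ?E. C \<subseteq> S}"
    proof (intro equalityI subsetI)
      fix x assume "x \<in> S \<inter> ?V"
      then obtain k where k: "padic_cylinder p k x \<subseteq> S" "x \<in> ?V"
        using padic_cylinder_open_basis[OF S, of x p] by auto
      then have "x \<in> padic_cylinder p k x" by (simp add: padic_cylinder_def)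
      then show "x \<in> \<Union>{C \<in> ?E. C \<subseteq> S}" using k by blast
    qed (use E in blast)
    also have "\<dots> \<in> sigma_sets ?V ?E"
      by (rule countable_Union) (auto intro: countable_subset[OF _ countable_padic_cylinders])
    finally show "(\<lambda>x. x) -` S \<inter> space (sigma ?V ?E) \<in> sets (sigma ?V ?E)"
      using E by (simp add: space_measure_of sets_measure_of)
  qed
  from measurable_sets[OF this] show "sets (restrict_space borel ?V) \<subseteq> sigma_sets ?V ?E"
    using E by (auto simp: sets_restrict_space Int_commute)
next
  have *: "?V \<inter> {x. \<forall>u. (x $ u) k = (a $ u) k} \<in> sets (restrict_space borel ?V)" for k and a :: "(nat \<Rightarrow> int) ^ 'm"
  proof -
    have cont: "continuous_on UNIV (\<lambda>x :: (nat \<Rightarrow> int) ^ 'm. (x $ u) k)" for u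
      by (rule continuous_on_compose2[OF continuous_on_product_coordinates[of k], of UNIV "\<lambda>x. x $ u"])
         (auto intro!: continuous_intros)
    have "open {x :: (nat \<Rightarrow> int) ^ 'm. (x $ u) k = (a $ u) k}" for u
      using open_vimage[OF Topological_Spaces.open_discrete[of "{(a $ u) k}"] cont[of u]] by (simp add: vimage_def)
    then have "open (\<Inter>u. {x :: (nat \<Rightarrow> int) ^ 'm. (x $ u) k = (a $ u) k})"
      by (intro open_INT) auto
    also have "(\<Inter>u. {x :: (nat \<Rightarrow> int) ^ 'm. (x $ u) k = (a $ u) k}) = {x. \<forall>u. (x $ u) k = (a $ u) k}"
      by auto
    finally show ?thesis
      by (auto simp: sets_restrict_space)
  qed
  have sp: "space (restrict_space borel ?V) = ?V" by (simp add: space_restrict_space)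
  show "sigma_sets ?V ?E \<subseteq> sets (restrict_space borel ?V)"
    using sets.sigma_sets_subset[of ?E "restrict_space borel ?V"] * unfolding sp
    by (force simp: padic_cylinder_def Int_def)
qed

lemma padic_translate_cylinder:
  assumes "p > 0" "a \<in> padic_space p" "b \<in> padic_space p"
  shows "\<exists>c\<in>padic_space p. padic_translate p a -` padic_cylinder p k b \<inter> padic_space p =
           padic_cylinder p k c"
proof -
  interpret cring "padic_int p" by (rule cring_padic_int) fact
  have neg: "\<ominus>\<^bsub>padic_int p\<^esub> y = (\<lambda>k. (- y k) mod int p ^ k)" if "y \<in> carrier (padic_int p)" for y
  proof (rule minus_equality)
    show "(\<lambda>k. (- y k) mod int p ^ k) \<oplus>\<^bsub>padic_int p\<^esub> y = \<zero>\<^bsub>padic_int p\<^esub>"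
      by (simp add: padic_int_def mod_simps)
    show "(\<lambda>k. (- y k) mod int p ^ k) \<in> carrier (padic_int p)"
    proof (rule padic_int_closed[OF assms(1)])
      show "- y (Suc k) mod int p ^ k = - y k mod int p ^ k" for k
        using padic_int_level[OF that, of k "Suc k"] by (metis le_add2 mod_minus_eq plus_1_eq_Suc)
    qed
  qed (rule that)
  define c where "c = (\<chi> u. \<ominus>\<^bsub>padic_int p\<^esub> (a $ u) \<oplus>\<^bsub>padic_int p\<^esub> b $ u)"
  have c: "c \<in> padic_space p"
    using assms by (simp add: c_def padic_space_def)
  have "padic_translate p a x \<in> padic_cylinder p k b \<longleftrightarrow> x \<in> padic_cylinder p k c"
    if x: "x \<in> padic_space p" for x
  proof -
    have "(padic_translate p a x $ u) k = (b $ u) k \<longleftrightarrow> (x $ u) k = (c $ u) k" for u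
    proof -
      have cu: "c $ u = (\<lambda>k. ((- (a $ u) k) mod int p ^ k + (b $ u) k) mod int p ^ k)"
        using assms(2) by (simp add: c_def padic_space_def neg) (simp add: padic_int_def)
      have tu: "padic_translate p a x $ u = (\<lambda>k. ((a $ u) k + (x $ u) k) mod int p ^ k)"
        by (simp add: padic_translate_def padic_int_def)
      have xu: "(x $ u) k mod int p ^ k = (x $ u) k" and bu: "(b $ u) k mod int p ^ k = (b $ u) k"
        using x assms(3) padic_int_level[of _ p k k] by (auto simp: padic_space_def)
      have "(padic_translate p a x $ u) k = (b $ u) k \<longleftrightarrow>
          ((a $ u) k + (x $ u) k) mod int p ^ k = (b $ u) k mod int p ^ k"
        by (simp add: tu bu)
      also have "\<dots> \<longleftrightarrow> (x $ u) k mod int p ^ k = (- (a $ u) k + (b $ u) k) mod int p ^ k"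
        by (simp add: mod_eq_dvd_iff algebra_simps)
      also have "\<dots> \<longleftrightarrow> (x $ u) k = (c $ u) k"
        by (simp add: xu cu mod_simps)
      finally show ?thesis .
    qed
    moreover have "padic_translate p a x \<in> padic_space p"
      using assms x by (simp add: padic_translate_def padic_space_def)
    ultimately show ?thesis
      using x by (simp add: padic_cylinder_def)
  qed
  then have "padic_translate p a -` padic_cylinder p k b \<inter> padic_space p = padic_cylinder p k c"
    by (auto simp: padic_cylinder_def)
  with c show ?thesis by blast
qed

lemma padic_translate_measurable:
  fixes a :: "(nat \<Rightarrow> int) ^ 'm"
  assumes "p > 0" "a \<in> padic_space p" "sets M = sets (restrict_space borel (padic_space p))"
  shows "padic_translate p a \<in> measurable M M"
proof -
  interpret cring "padic_int p" by (rule cring_padic_int) fact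
  have sp: "space M = padic_space p"
    using sets_eq_imp_space_eq[OF assms(3)] by (simp add: space_restrict_space)
  have E: "padic_cylinders p \<subseteq> Pow (padic_space p)" by (auto simp: padic_cylinder_def)
  have "padic_translate p a \<in> measurable M (sigma (padic_space p) (padic_cylinders p))"
  proof (rule measurable_measure_of[OF E])
    show "padic_translate p a \<in> space M \<rightarrow> padic_space p"
      using assms(2) by (auto simp: sp padic_translate_def padic_space_def)
    fix C :: "((nat \<Rightarrow> int) ^ 'm) set"
    assume "C \<in> padic_cylinders p"
    then consider "C = {}" | k b where "C = padic_cylinder p k b" "b \<in> padic_space p" by auto
    then show "padic_translate p a -` C \<inter> space M \<in> sets M"
    proof cases
      case 2
      then obtain c where "c \<in> padic_space p" "padic_translate p a -` C \<inter> padic_space p = padic_cylinder p k c"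
        using padic_translate_cylinder[OF assms(1,2)] by blast
      then show ?thesis
        unfolding sp assms(3) sets_padic_space by (auto intro!: sigma_sets.Basic)
    qed auto
  qed
  moreover have "sets M = sets (sigma (padic_space p) (padic_cylinders p))"
    unfolding assms(3) sets_padic_space sets_measure_of[OF E] ..
  ultimately show ?thesis
    using measurable_cong_sets by blast
qed

lemma is_padic_haar_cylinder:
  fixes a :: "(nat \<Rightarrow> int) ^ 'm"
  assumes "p > 0" "is_padic_haar p M" "a \<in> padic_space p"
  shows "emeasure M (padic_cylinder p k a) =
    1 / of_nat (card (padic_cylinder p k ` (padic_space p :: ((nat \<Rightarrow> int) ^ 'm) set)))"
proof -
  let ?V = "padic_space p :: ((nat \<Rightarrow> int) ^ 'm) set"
  let ?C = "padic_cylinder p k ` ?V"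
  interpret cring "padic_int p" by (rule cring_padic_int) fact
  interpret prob_space M using assms(2) by (simp add: is_padic_haar_def)
  have M: "sets M = sets (restrict_space borel ?V)"
    and inv: "\<And>b. b \<in> ?V \<Longrightarrow> distr M M (padic_translate p b) = M"
    using assms(2) by (auto simp: is_padic_haar_def)
  have sp: "space M = ?V"
    using sets_eq_imp_space_eq[OF M] by (simp add: space_restrict_space)
  have cyl: "padic_cylinder p k b \<in> sets M" if "b \<in> ?V" for b
    using that unfolding M sets_padic_space by (auto intro!: sigma_sets.Basic)
  have eq: "emeasure M (padic_cylinder p k b) = emeasure M (padic_cylinder p k a)" if b: "b \<in> ?V" for b
  proof -
    define c where "c = (\<chi> u. a $ u \<oplus>\<^bsub>padic_int p\<^esub> \<ominus>\<^bsub>padic_int p\<^esub> (b $ u))"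
    have c: "c \<in> ?V" using assms(3) b by (simp add: c_def padic_space_def)
    have "padic_translate p c b = a"
      using assms(3) b
      by (simp add: c_def padic_translate_def padic_space_def vec_eq_iff a_assoc l_neg)
    then have "b \<in> padic_translate p c -` padic_cylinder p k a \<inter> ?V"
      using assms(3) b by (simp add: padic_cylinder_def)
    moreover obtain d where d: "padic_translate p c -` padic_cylinder p k a \<inter> ?V = padic_cylinder p k d"
      using padic_translate_cylinder[OF assms(1) c assms(3)] by blast
    ultimately have "padic_translate p c -` padic_cylinder p k a \<inter> ?V = padic_cylinder p k b"
      using padic_cylinder_cong by metis
    moreover have "emeasure M (padic_cylinder p k a) =
        emeasure (distr M M (padic_translate p c)) (padic_cylinder p k a)"
      by (simp add: inv[OF c])
    ultimately show ?thesis
      using emeasure_distr[OF padic_translate_measurable[OF assms(1) c M] cyl[OF assms(3)]]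
      by (simp add: sp)
  qed
  have "?C \<subseteq> (\<lambda>v. {x \<in> padic_space p. \<forall>u. (x $ u) k = v u}) ` (UNIV \<rightarrow>\<^sub>E {0..<int p ^ k})"
  proof clarify
    fix b :: "(nat \<Rightarrow> int) ^ 'm" assume "b \<in> ?V"
    then have "(b $ u) k \<in> {0..<int p ^ k}" for u
      unfolding padic_space_def padic_int_def partial_object.simps by blast
    then show "padic_cylinder p k b \<in>
      (\<lambda>v. {x \<in> padic_space p. \<forall>u. (x $ u) k = v u}) ` (UNIV \<rightarrow>\<^sub>E {0..<int p ^ k})"
      by (intro image_eqI[of _ _ "\<lambda>u. (b $ u) k"]) (auto simp: padic_cylinder_def)
  qed
  then have fin: "finite ?C"
    by (rule finite_subset) (intro finite_imageI finite_PiE; simp)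
  have "1 = emeasure M (\<Union>?C)"
  proof -
    have "\<Union>?C = space M"
      by (auto simp: sp padic_cylinder_def)
    then show ?thesis using emeasure_space_1 by simp
  qed
  also have "\<dots> = (\<Sum>C\<in>?C. emeasure M C)"
  proof -
    have "(\<lambda>C. C) ` ?C \<subseteq> sets M" using cyl by auto
    moreover have "disjoint_family_on (\<lambda>C. C) ?C"
      unfolding disjoint_family_on_def using padic_cylinder_cong by blast
    ultimately show ?thesis
      using sum_emeasure[of "\<lambda>C. C" ?C M] fin by simp
  qed
  also have "\<dots> = (\<Sum>C\<in>?C. emeasure M (padic_cylinder p k a))"
    by (rule sum.cong) (auto simp: eq)
  also have "\<dots> = of_nat (card ?C) * emeasure M (padic_cylinder p k a)" by simp
  finally have 1: "of_nat (card ?C) * emeasure M (padic_cylinder p k a) = 1" by simp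
  have "card ?C \<noteq> 0" using fin assms(3) by auto
  then show ?thesis
    using mult_divide_eq_ennreal[of "of_nat (card ?C)" "emeasure M (padic_cylinder p k a)"] 1
    by (simp add: mult.commute)
qed

lemma padic_digits:
  assumes "p > 0" "x \<in> carrier (padic_int p)" "\<And>j. d j \<in> {0..<int p}"
  shows "(\<Sum>j<k. d j * int p ^ j) \<in> {0..<int p ^ k} \<and>
    ((\<Sum>j<k. d j * int p ^ j) = x k \<longleftrightarrow> (\<forall>j<k. d j = x (Suc j) div int p ^ j))"
proof (induction k)
  case 0
  have "x 0 mod int p ^ 0 = x 0" using padic_int_level[OF assms(2), of 0 0] by simp
  then show ?case by simp
next
  case (Suc k)
  define S where "S = (\<Sum>j<k. d j * int p ^ j)"
  define q where "q = int p ^ k"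
  have q: "q > 0" using assms(1) by (simp add: q_def)
  have S: "0 \<le> S" "S < q" "S = x k \<longleftrightarrow> (\<forall>j<k. d j = x (Suc j) div int p ^ j)"
    using Suc.IH by (auto simp: S_def q_def)
  have d: "0 \<le> d k" "d k \<le> int p - 1" using assms(3)[of k] by auto
  have xk: "x (Suc k) mod q = x k"
    using padic_int_level[OF assms(2), of k "Suc k"] by (simp add: q_def)
  have "d k * q \<le> (int p - 1) * q" using d q by (intro mult_right_mono) auto
  then have "S + d k * q < int p * q" using S by (simp add: algebra_simps)
  moreover have "0 \<le> S + d k * q" using S d q by simp
  moreover have "S + d k * q = x (Suc k) \<longleftrightarrow> S = x k \<and> d k = x (Suc k) div q"
  proof
    assume *: "S + d k * q = x (Suc k)"
    have "(S + d k * q) mod q = S" "(S + d k * q) div q = d k" using S q by auto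
    then show "S = x k \<and> d k = x (Suc k) div q" using * xk by simp
  next
    assume "S = x k \<and> d k = x (Suc k) div q"
    then show "S + d k * q = x (Suc k)"
      using xk div_mult_mod_eq[of "x (Suc k)" q] by simp
  qed
  ultimately show ?case
    using S(3) by (auto simp: S_def q_def less_Suc_eq)
qed

lemma padic_haar_exists:
  assumes "p > 0"
  shows "\<exists>M :: ((nat \<Rightarrow> int) ^ 'm) measure. is_padic_haar p M"
proof -
  let ?V = "padic_space p :: ((nat \<Rightarrow> int) ^ 'm) set"
  define U where "U = uniform_count_measure {0..<int p}"
  interpret U: prob_space U
    unfolding U_def using assms by (intro prob_space_uniform_count_measure) auto
  interpret product_prob_space "\<lambda>_. U" "UNIV :: ('m \<times> nat) set" ..
  define P where "P = Pi\<^sub>M (UNIV :: ('m \<times> nat) set) (\<lambda>_. U)"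
  define f :: "('m \<times> nat \<Rightarrow> int) \<Rightarrow> (nat \<Rightarrow> int) ^ 'm"
    where "f \<omega> = (\<chi> u. (\<lambda>k. \<Sum>j<k. \<omega> (u, j) * int p ^ j))" for \<omega>
  have U: "space U = {0..<int p}" "sets U = Pow {0..<int p}"
    by (simp_all add: U_def space_uniform_count_measure sets_uniform_count_measure)
  have spP: "\<omega> \<in> space P \<longleftrightarrow> (\<forall>i. \<omega> i \<in> {0..<int p})" for \<omega>
    by (auto simp: P_def space_PiM U PiE_iff)
  have E: "padic_cylinders p \<subseteq> Pow ?V" by (auto simp: padic_cylinder_def)
  have f_space: "f \<omega> \<in> ?V" if "\<omega> \<in> space P" for \<omega>
  proof -
    have "(\<Sum>j<k. \<omega> (u, j) * int p ^ j) \<in> {0..<int p ^ k}" for u k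
      using padic_digits[OF assms, of "\<lambda>k. 0" "\<lambda>j. \<omega> (u, j)" k] that assms spP
      by (auto simp: padic_int_def)
    then show ?thesis
      by (auto simp: f_def padic_space_def padic_int_def)
  qed
  have vim: "f -` padic_cylinder p k a \<inter> space P =
      prod_emb UNIV (\<lambda>_. U) (UNIV \<times> {..<k})
        (\<Pi>\<^sub>E (u, j)\<in>UNIV \<times> {..<k}. {(a $ u) (Suc j) div int p ^ j})"
    if "a \<in> ?V" for k and a :: "(nat \<Rightarrow> int) ^ 'm"
  proof -
    have "f \<omega> \<in> padic_cylinder p k a \<longleftrightarrow> (\<forall>u. \<forall>j<k. \<omega> (u, j) = (a $ u) (Suc j) div int p ^ j)"
      if \<omega>: "\<omega> \<in> space P" for \<omega>
    proof -
      have "(f \<omega> $ u) k = (a $ u) k \<longleftrightarrow> (\<forall>j<k. \<omega> (u, j) = (a $ u) (Suc j) div int p ^ j)" for u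
        using padic_digits[OF assms, of "a $ u" "\<lambda>j. \<omega> (u, j)" k] \<omega> \<open>a \<in> ?V\<close>
        by (auto simp: f_def padic_space_def spP)
      then show ?thesis using f_space[OF \<omega>] by (simp add: padic_cylinder_def)
    qed
    then show ?thesis
      by (auto simp: prod_emb_def P_def space_PiM PiE_iff restrict_def extensional_def split: prod.splits)
  qed
  have digit: "(a $ u) (Suc j) div int p ^ j \<in> {0..<int p}" if "a \<in> ?V" for a :: "(nat \<Rightarrow> int) ^ 'm" and u j
  proof -
    have "(a $ u) (Suc j) \<in> {0..<int p ^ Suc j}"
      using that unfolding padic_space_def padic_int_def partial_object.simps by blast
    then have y: "0 \<le> (a $ u) (Suc j)" "(a $ u) (Suc j) < int p * int p ^ j" by auto
    have "(a $ u) (Suc j) div int p ^ j * int p ^ j \<le> (a $ u) (Suc j)"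
    proof -
      have "0 \<le> (a $ u) (Suc j) mod int p ^ j" using assms by simp
      then show ?thesis using div_mult_mod_eq[of "(a $ u) (Suc j)" "int p ^ j"] by linarith
    qed
    then have "(a $ u) (Suc j) div int p ^ j * int p ^ j < int p * int p ^ j"
      using y by linarith
    then have "(a $ u) (Suc j) div int p ^ j < int p"
      by (rule mult_right_less_imp_less) simp
    then show ?thesis
      using y assms by (simp add: pos_imp_zdiv_nonneg_iff)
  qed
  have meas: "f \<in> measurable P (sigma ?V (padic_cylinders p))"
  proof (rule measurable_measure_of[OF E])
    show "f \<in> space P \<rightarrow> ?V" using f_space by auto
    fix C :: "((nat \<Rightarrow> int) ^ 'm) set"
    assume "C \<in> padic_cylinders p"
    then consider "C = {}" | k a where "C = padic_cylinder p k a" "a \<in> padic_space p" by auto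
    then show "f -` C \<inter> space P \<in> sets P"
    proof cases
      case 2
      show ?thesis
        unfolding 2(1) vim[OF 2(2)] unfolding P_def
        by (rule sets_PiM_I) (use digit[OF 2(2)] in \<open>auto simp: U\<close>)
    qed auto
  qed
  define N where "N = distr P (sigma ?V (padic_cylinders p)) f"
  have sets_N: "sets N = sigma_sets ?V (padic_cylinders p)" using E by (simp add: N_def sets_measure_of)
  then have sets_N': "sets N = sets (restrict_space borel ?V)" by (simp add: sets_padic_space)
  have space_N: "space N = ?V" using E by (simp add: N_def space_measure_of)
  interpret N: prob_space N
    unfolding N_def P_def using meas[unfolded P_def] by (rule P.prob_space_distr)
  have N_cyl: "emeasure N (padic_cylinder p k a) = (\<Prod>i\<in>(UNIV :: 'm set) \<times> {..<k}. ennreal (1 / p))"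
    if a: "a \<in> ?V" for k a
  proof -
    have "emeasure N (padic_cylinder p k a) = emeasure P (f -` padic_cylinder p k a \<inter> space P)"
      unfolding N_def using E a by (intro emeasure_distr meas) (auto simp: sets_measure_of)
    also have "\<dots> = (\<Prod>(u, j)\<in>UNIV \<times> {..<k}. emeasure U {(a $ u) (Suc j) div int p ^ j})"
      unfolding vim[OF a] unfolding P_def
      by (subst emeasure_PiM_emb) (use digit[OF a] in \<open>auto simp: U intro!: prod.cong\<close>)
    also have "\<dots> = (\<Prod>i\<in>(UNIV :: 'm set) \<times> {..<k}. ennreal (1 / p))"
      unfolding U_def using digit[OF a]
      by (intro prod.cong refl) (auto simp: emeasure_uniform_count_measure)
    finally show ?thesis .
  qed
  have "distr N N (padic_translate p a) = N" if a: "a \<in> ?V" for a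
  proof (rule measure_eqI_generator_eq[OF Int_stable_padic_cylinders E, where A = "\<lambda>_. ?V"])
    note T = padic_translate_measurable[OF assms a sets_N']
    fix C :: "((nat \<Rightarrow> int) ^ 'm) set"
    assume "C \<in> padic_cylinders p"
    then consider "C = {}" | k b where "C = padic_cylinder p k b" "b \<in> padic_space p" by auto
    then show "emeasure (distr N N (padic_translate p a)) C = emeasure N C"
    proof cases
      case 2
      then obtain c where "c \<in> padic_space p" "padic_translate p a -` C \<inter> padic_space p = padic_cylinder p k c"
        using padic_translate_cylinder[OF assms a] by blast
      moreover have "C \<in> sets N" unfolding sets_N using 2 by (auto intro!: sigma_sets.Basic)
      ultimately show ?thesis
        using 2 by (simp add: emeasure_distr[OF T] space_N N_cyl)
    qed auto
  next
    show "range (\<lambda>_. ?V) \<subseteq> padic_cylinders p"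
      using padic_cylinder_0[OF a] a by auto
    interpret T: prob_space "distr N N (padic_translate p a)"
      by (rule N.prob_space_distr) (rule padic_translate_measurable[OF assms a sets_N'])
    show "emeasure (distr N N (padic_translate p a)) ?V \<noteq> \<infinity>" by simp
  qed (auto simp: sets_N)
  then show ?thesis
    unfolding is_padic_haar_def using sets_N' N.prob_space_axioms by blast
qed

lemma padic_haar_unique:
  fixes M N :: "((nat \<Rightarrow> int) ^ 'm) measure"
  assumes "p > 0" "is_padic_haar p M" "is_padic_haar p N"
  shows "M = N"
proof (rule measure_eqI_generator_eq[OF Int_stable_padic_cylinders, where A = "\<lambda>_. padic_space p"])
  have sets: "sets M = sets (restrict_space borel (padic_space p))"
    "sets N = sets (restrict_space borel (padic_space p))"
    using assms by (auto simp: is_padic_haar_def)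
  then show "sets M = sigma_sets (padic_space p) (padic_cylinders p)"
    "sets N = sigma_sets (padic_space p) (padic_cylinders p)"
    by (auto simp: sets_padic_space)
  show "padic_cylinders p \<subseteq> Pow (padic_space p)" by (auto simp: padic_cylinder_def)
  show "range (\<lambda>_. padic_space p) \<subseteq> padic_cylinders p"
    using padic_cylinder_0[OF zero_padic_space[OF assms(1)]] zero_padic_space[OF assms(1)] by auto
  interpret prob_space M using assms(2) by (simp add: is_padic_haar_def)
  show "emeasure M (padic_space p) \<noteq> \<infinity>" by simp
  show "emeasure M C = emeasure N C" if "C \<in> padic_cylinders p" for C
    using that is_padic_haar_cylinder[OF assms(1,2)] is_padic_haar_cylinder[OF assms(1,3)] by auto
qed auto

lemma is_padic_haar_padic_haar:
  assumes "p > 0"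
  shows "is_padic_haar p (padic_haar p)"
  unfolding padic_haar_def
  by (rule theI') (use padic_haar_exists[OF assms] padic_haar_unique[OF assms] in blast)

end

theory Submission
  imports Defs "HOL-Number_Theory.Number_Theory" "HOL-Real_Asymp.Real_Asymp"
    "HOL-Computational_Algebra.Squarefree" "HOL-Computational_Algebra.Polynomial"
begin

text \<open>
  A form that is isotropic over the integers is isotropic over the reals and has primitive zeros
  modulo all prime powers. Conversely, up to a set of forms of density zero, real and \<open>p\<close>-adic
  isotropy suffice. For \<open>n \<ge> 4\<close> and nonzero determinant this is the Hasse principle, which is proved
  for diagonal forms by Legendre's descent for three variables, the product formula for Hilbert
  symbols, and primes with prescribed quadratic symbols. For \<open>n \<le> 3\<close> the set of forms that are
  isotropic at all primes has density zero, since a form is anisotropic at \<open>p\<close> with probability at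
  least a constant times \<open>1 / p\<close>; then both sides vanish.

  Finitely many congruence conditions together with real isotropy have the expected density,
  because Riemann sums over cosets of a lattice converge. To let the number of primes tend to
  infinity for \<open>n = 4\<close>, note that a form that is anisotropic at an odd prime \<open>p\<close> has two ternary
  subforms that are degenerate modulo \<open>p\<close>. By a sieve argument, the forms in a large box for which
  this happens at some \<open>p > N\<close> have density \<open>O(1 / N)\<close>.
\<close>

section \<open>The Hilbert symbol\<close>

text \<open>The class of an integer modulo p-adic squares is fixed by its valuation and by a
  Legendre symbol or a residue modulo 8. So the auxiliary prime of the Hasse principle only has to
  satisfy quadratic symbols, the characters involved are real, and the nonvanishing of L(1, chi)
  follows from Monsky's elementary argument. Solubility over the p-adic integers is a condition at
  all levels p^k, whereas a density is computed at a finite level. The two meet outside the forms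
  whose determinant is divisible by a high power of p: for the others a primitive zero at one level,
  fixed by that power, lifts to all levels. Such divisibility has small density, and the same
  estimate disposes of determinant 0. Hence the cut-off N of the primes is chosen before the
  exponents, and these before the level k. D may change sign, so the inclusion of the isotropic
  forms in an approximating set does not bound one weighted sum by the other; the errors are
  measured with the weight |D|.\<close>

lemma Legendre_cong_mod: "[a = b] (mod p) \<Longrightarrow> Legendre a p = Legendre b p"
proof -
  assume ab: "[a = b] (mod p)"
  then have "[a = 0] (mod p) \<longleftrightarrow> [b = 0] (mod p)" "[y\<^sup>2 = a] (mod p) \<longleftrightarrow> [y\<^sup>2 = b] (mod p)" for y
    by (meson cong_sym cong_trans)+
  then show ?thesis unfolding Legendre_def QuadRes_def by simp
qed

lemma Legendre_values: "\<not> p dvd a \<Longrightarrow> Legendre a p = 1 \<or> Legendre a p = -1"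
  by (simp add: Legendre_def cong_0_iff)

lemma Legendre_mult:
  assumes "prime p" "p > (2::nat)"
  shows "Legendre (a * b) (int p) = Legendre a (int p) * Legendre b (int p)"
proof (cases "int p dvd a \<or> int p dvd b")
  case True
  then have "Legendre a (int p) = 0 \<or> Legendre b (int p) = 0" "int p dvd a * b"
    by (auto simp: Legendre_def cong_0_iff)
  then show ?thesis by (auto simp: Legendre_def cong_0_iff)
next
  case False
  then have ab: "\<not> int p dvd a * b" using assms(1) by (simp add: prime_dvd_mult_iff)
  have "[Legendre (a * b) p = (a * b) ^ ((p - 1) div 2)] (mod int p)"
    using euler_criterion[OF assms] by simp
  moreover have "[Legendre a p * Legendre b p = a ^ ((p - 1) div 2) * b ^ ((p - 1) div 2)] (mod int p)"
    using euler_criterion[OF assms] by (intro cong_mult) auto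
  ultimately have "[Legendre (a * b) p = Legendre a p * Legendre b p] (mod int p)"
    by (metis cong_sym cong_trans power_mult_distrib)
  \<comment> \<open>Both sides are 1 or -1, so they differ by at most 2, which is less than
    p.\<close>
  then have "int p dvd Legendre (a * b) p - Legendre a p * Legendre b p"
    by (simp add: cong_iff_dvd_diff)
  moreover have "\<bar>Legendre (a * b) p - Legendre a p * Legendre b p\<bar> \<le> 2"
    using Legendre_values[OF ab] Legendre_values[of "int p" a] Legendre_values[of "int p" b] False by auto
  ultimately have "\<not> Legendre (a * b) p - Legendre a p * Legendre b p \<noteq> 0"
    using dvd_imp_le_int[of "Legendre (a * b) p - Legendre a p * Legendre b p" "int p"] assms(2) by linarith
  then show ?thesis by simp
qed

lemma Legendre_square:
  assumes "prime p" "\<not> int p dvd x"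
  shows "Legendre (x^2) (int p) = 1"
proof -
  have "\<not> int p dvd x^2" using assms by (simp add: prime_dvd_power_iff)
  then show ?thesis unfolding Legendre_def QuadRes_def cong_0_iff using cong_refl by metis
qed

lemma Legendre_eq_1I:
  assumes "prime p" "p > 2" "\<not> int p dvd v" "\<not> int p dvd y" "[z\<^sup>2 = v * y^2] (mod int p)"
  shows "Legendre v (int p) = 1"
proof -
  have "\<not> int p dvd v * y^2"
    using assms by (simp add: prime_dvd_mult_iff prime_dvd_power_iff)
  then have "\<not> int p dvd z^2" using assms(5) by (simp add: cong_dvd_iff)
  then have "\<not> int p dvd z" by (metis dvd_power zero_less_numeral dvd_trans)
  then have "1 = Legendre (v * y^2) p"
    using Legendre_square[OF assms(1)] Legendre_cong_mod[OF assms(5)] by metis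
  then show ?thesis
    using Legendre_mult[OF assms(1,2)] Legendre_square[OF assms(1,4)] by simp
qed

text \<open>Gauss's lemma: with h = (p - 1) / 2, the numbers 2 x that exceed h come from h div 2 < x
  \<le> h, and the parity of h - h div 2 depends on h modulo 4, hence on p modulo 8.\<close>

lemma Legendre_2:
  assumes "prime p" "p > 2"
  shows "Legendre 2 (int p) = (if p mod 8 \<in> {1, 7} then 1 else -1)"
proof -
  have odd: "odd p" using assms prime_odd_nat by blast
  interpret GAUSS p 2
  proof
    show "[2 \<noteq> 0] (mod int p)" using assms(2) by (simp add: cong_0_iff zdvd_not_zless)
  qed (use assms in auto)
  define h where "h = (int p - 1) div 2"
  have h: "int p = 2 * h + 1" "h > 0" using odd assms(2) unfolding h_def by presburger+
  have "B = (\<lambda>x. 2 * x) ` {0<..h}" unfolding B_def A_def h_def by (auto simp: mult.commute)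
  \<comment> \<open>Doubling maps 1, ..., h into 2, ..., 2 h, so the reduction modulo p changes
    nothing.\<close>
  moreover have "C = B"
  proof -
    have "x mod int p = x" if "x \<in> B" for x
      using that h(1) unfolding \<open>B = _\<close> by auto
    then show ?thesis unfolding C_def by simp
  qed
  ultimately have "E = (\<lambda>x. 2 * x) ` {h div 2<..h}"
    unfolding E_def h_def[symmetric] by (auto simp: image_iff)
  then have "card E = nat (h - h div 2)"
    using h(2) by (simp add: card_image inj_on_def)
  moreover have "even (nat (h - h div 2)) \<longleftrightarrow> p mod 8 \<in> {1, 7}"
  proof -
    have "even (nat (h - h div 2)) \<longleftrightarrow> even (h - h div 2)"
      using h(2) by (simp add: even_nat_iff)
    also have "\<dots> \<longleftrightarrow> h mod 4 = 0 \<or> h mod 4 = 3" by presburger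
    also have "\<dots> \<longleftrightarrow> (2 * h + 1) mod 8 = 1 \<or> (2 * h + 1) mod 8 = 7" by presburger
    also have "2 * h + 1 = int p" using h(1) by simp
    also have "int p mod 8 = int (p mod 8)" by (simp add: zmod_int)
    also have "int (p mod 8) = 1 \<or> int (p mod 8) = 7 \<longleftrightarrow> p mod 8 \<in> {1, 7}" by auto
    finally show ?thesis .
  qed
  ultimately show ?thesis using gauss_lemma by auto
qed

lemma Legendre_minus_1:
  assumes "prime p" "p > 2"
  shows "Legendre (-1) (int p) = (if p mod 4 = 3 then -1 else 1)"
proof -
  have odd: "odd p" using assms prime_odd_nat by blast
  have c: "[Legendre (-1) p = (-1) ^ ((p - 1) div 2)] (mod int p)"
    using euler_criterion[OF assms] .
  have "even ((p - 1) div 2) \<longleftrightarrow> p mod 4 \<noteq> 3" using odd by presburger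
  then have e: "(-1 :: int) ^ ((p - 1) div 2) = (if p mod 4 = 3 then -1 else 1)"
    by (metis neg_one_even_power neg_one_odd_power)
  have v: "Legendre (-1) p = 1 \<or> Legendre (-1) p = -1"
    using assms(2) by (intro Legendre_values) (simp add: zdvd_not_zless)
  have "\<not> [1 = -1] (mod int p)" "\<not> [-1 = 1] (mod int p)"
    using assms(2) by (auto simp: cong_iff_dvd_diff zdvd_not_zless)
  then show ?thesis using c v e by (auto split: if_splits)
qed

section \<open>Valuations, unit parts and the explicit symbol\<close>

definition pval :: "nat \<Rightarrow> int \<Rightarrow> nat" where "pval p a = multiplicity (int p) a"
definition punit :: "nat \<Rightarrow> int \<Rightarrow> int" where "punit p a = a div int p ^ pval p a"

lemma pval_punit:
  assumes "prime p" "a \<noteq> 0"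
  shows "a = int p ^ pval p a * punit p a" "\<not> int p dvd punit p a" "punit p a \<noteq> 0"
proof -
  have nu: "\<not> is_unit (int p)" using prime_gt_1_nat[OF assms(1)] by simp
  show "a = int p ^ pval p a * punit p a"
    unfolding punit_def pval_def by (simp add: multiplicity_dvd)
  show "\<not> int p dvd punit p a"
    unfolding punit_def pval_def using multiplicity_decompose[OF assms(2) nu] .
  then show "punit p a \<noteq> 0" by auto
qed

lemma pval_eqI:
  assumes "prime p" "a = int p ^ k * u" "\<not> int p dvd u"
  shows "pval p a = k" "punit p a = u"
proof -
  show k: "pval p a = k"
    unfolding pval_def assms(2)
  proof (rule multiplicity_eqI)
    show "\<not> int p ^ Suc k dvd int p ^ k * u" using assms(1,3) prime_gt_0_nat[OF assms(1)] by auto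
  qed simp
  show "punit p a = u" unfolding punit_def k using assms prime_gt_0_nat[OF assms(1)] by simp
qed

lemma pval_mult:
  assumes "prime p" "a \<noteq> 0" "b \<noteq> 0"
  shows "pval p (a * b) = pval p a + pval p b" "punit p (a * b) = punit p a * punit p b"
proof -
  have "a * b = int p ^ (pval p a + pval p b) * (punit p a * punit p b)"
    using pval_punit(1)[OF assms(1,2)] pval_punit(1)[OF assms(1,3)]
    by (metis (no_types, lifting) mult.assoc mult.left_commute power_add)
  moreover have "\<not> int p dvd punit p a * punit p b"
    using pval_punit(2)[OF assms(1,2)] pval_punit(2)[OF assms(1,3)] assms(1)
    by (simp add: prime_dvd_mult_iff)
  ultimately show "pval p (a * b) = pval p a + pval p b" "punit p (a * b) = punit p a * punit p b"
    using pval_eqI[OF assms(1)] by blast+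
qed

lemma pval_unit:
  assumes "prime p" "\<not> int p dvd a"
  shows "pval p a = 0" "punit p a = a"
  using pval_eqI[OF assms(1), of a 0 a] assms by auto

lemma pval_self:
  assumes "prime p"
  shows "pval p (int p) = 1" "punit p (int p) = 1"
  using pval_eqI[OF assms, of "int p" 1 1] prime_gt_1_nat[OF assms] by auto

text \<open>For odd arguments \<open>chi8 u\<close> is (-1)^((u^2 - 1) / 8), the quadratic character
  of 2, and \<open>eps4 u v\<close> is (-1)^((u - 1) (v - 1) / 4), the sign in the reciprocity
  law.\<close>

definition chi8 :: "int \<Rightarrow> int" where "chi8 u = (if u mod 8 = 1 \<or> u mod 8 = 7 then 1 else -1)"
definition eps4 :: "int \<Rightarrow> int \<Rightarrow> int" where "eps4 u v = (if u mod 4 = 3 \<and> v mod 4 = 3 then -1 else 1)"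

lemma odd_mod_8_cases:
  assumes "odd (u::int)" obtains "u mod 8 = 1" | "u mod 8 = 3" | "u mod 8 = 5" | "u mod 8 = 7"
proof -
  have "u mod 8 = 1 \<or> u mod 8 = 3 \<or> u mod 8 = 5 \<or> u mod 8 = 7" using assms by presburger
  then show thesis using that by blast
qed

lemma chi8_mult: assumes "odd u" "odd v" shows "chi8 (u * v) = chi8 u * chi8 v"
proof -
  have "(u * v) mod 8 = (u mod 8) * (v mod 8) mod 8" by (simp add: mod_mult_eq)
  then show ?thesis
    by (rule_tac odd_mod_8_cases[OF assms(1)]; rule_tac odd_mod_8_cases[OF assms(2)])
      (simp_all add: chi8_def)
qed

lemma eps4_mult: assumes "odd u" "odd v" shows "eps4 (u * v) w = eps4 u w * eps4 v w"
proof -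
  have m: "(u * v) mod 4 = (u mod 4) * (v mod 4) mod 4" by (simp add: mod_mult_eq)
  have "u mod 4 = 1 \<or> u mod 4 = 3" "v mod 4 = 1 \<or> v mod 4 = 3" using assms by presburger+
  then show ?thesis using m by (elim disjE) (simp_all add: eps4_def)
qed

lemma eps4_commute: "eps4 u v = eps4 v u" by (auto simp: eps4_def)

text \<open>
  The symbol is given by its explicit formula; of its meaning only \<open>hilb_norm\<close> is needed.
\<close>

definition hilb :: "nat \<Rightarrow> int \<Rightarrow> int \<Rightarrow> int" where
  "hilb p a b =
    (if p = 2 then eps4 (punit p a) (punit p b) * chi8 (punit p a) ^ pval p b * chi8 (punit p b) ^ pval p a
     else Legendre (-1) (int p) ^ (pval p a * pval p b) *
       Legendre (punit p a) (int p) ^ pval p b * Legendre (punit p b) (int p) ^ pval p a)"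

text \<open>The Hilbert symbol of the real place.\<close>

definition hinf :: "int \<Rightarrow> int \<Rightarrow> int" where "hinf a b = (if a < 0 \<and> b < 0 then -1 else 1)"

lemma hilb_commute: "hilb p a b = hilb p b a"
  unfolding hilb_def by (simp add: eps4_commute mult_ac)

lemma hinf_commute: "hinf a b = hinf b a" by (auto simp: hinf_def)

lemma hilb_mult_left:
  assumes "prime p" "a \<noteq> 0" "a' \<noteq> 0" "b \<noteq> 0"
  shows "hilb p (a * a') b = hilb p a b * hilb p a' b"
proof (cases "p = 2")
  case True
  have "odd (punit 2 a)" "odd (punit 2 a')"
    using pval_punit(2)[OF assms(1,2)] pval_punit(2)[OF assms(1,3)] True by auto
  then show ?thesis
    using True assms by (simp add: hilb_def pval_mult chi8_mult eps4_mult power_add power_mult_distrib)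
next
  case False
  then have p: "p > 2" using assms(1) prime_ge_2_nat[of p] by linarith
  show ?thesis
    using False assms
    by (simp add: hilb_def pval_mult Legendre_mult[OF assms(1) p] power_add power_mult_distrib
        distrib_right)
qed

lemma hilb_mult_right:
  assumes "prime p" "a \<noteq> 0" "b \<noteq> 0" "b' \<noteq> 0"
  shows "hilb p a (b * b') = hilb p a b * hilb p a b'"
  using hilb_mult_left[OF assms(1,3,4,2)] by (simp add: hilb_commute)

lemma hinf_mult_left: "a \<noteq> 0 \<Longrightarrow> a' \<noteq> 0 \<Longrightarrow> hinf (a * a') b = hinf a b * hinf a' b"
  by (auto simp: hinf_def mult_less_0_iff)

lemma hilb_values:
  assumes "prime p" "a \<noteq> 0" "b \<noteq> 0"
  shows "hilb p a b = 1 \<or> hilb p a b = -1"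
proof -
  have pw: "x ^ k = 1 \<or> x ^ k = -1" if "x = 1 \<or> x = -1" for x :: int and k
    using that by (metis neg_one_even_power neg_one_odd_power power_one)
  have c8: "chi8 u = 1 \<or> chi8 u = -1" for u by (simp add: chi8_def)
  have e: "eps4 u v = 1 \<or> eps4 u v = -1" for u v by (simp add: eps4_def)
  show ?thesis
  proof (cases "p = 2")
    case True
    then show ?thesis
      using pw[OF c8, of "punit p a" "pval p b"] pw[OF c8, of "punit p b" "pval p a"] e[of "punit p a" "punit p b"]
      by (auto simp: hilb_def)
  next
    case False
    then have "p > 2" using assms(1) prime_ge_2_nat[of p] by linarith
    then have "\<not> int p dvd -1" by (simp add: zdvd_not_zless)
    then show ?thesis
      using pw[OF Legendre_values[OF pval_punit(2)[OF assms(1,2)]], of "pval p b"]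
        pw[OF Legendre_values[OF pval_punit(2)[OF assms(1,3)]], of "pval p a"]
        pw[OF Legendre_values[of "int p" "-1"], of "pval p a * pval p b"] False
      by (auto simp: hilb_def)
  qed
qed

lemma hilb_sq_self:
  assumes "prime p" "a \<noteq> 0" "b \<noteq> 0" shows "hilb p a b * hilb p a b = 1"
  using hilb_values[OF assms] by auto

lemma hilb_square_left:
  assumes "prime p" "a \<noteq> 0" "b \<noteq> 0" shows "hilb p (a^2) b = 1"
  using hilb_mult_left[OF assms(1,2,2,3)] hilb_sq_self[OF assms] by (simp add: power2_eq_square)

text \<open>Leaves only 2 and the prime divisors of a b to contribute to a product over all
  primes.\<close>

lemma hilb_unit:
  assumes "prime p" "p \<noteq> 2" "\<not> int p dvd a" "\<not> int p dvd b"
  shows "hilb p a b = 1"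
  using assms by (simp add: hilb_def pval_unit)

section \<open>Triviality of the symbol on norms\<close>

lemma square_mod_8: "(x::int)^2 mod 8 = (if odd x then 1 else if x mod 4 = 0 then 0 else 4)"
proof -
  have m: "x^2 mod 8 = (x mod 8)^2 mod 8" by (simp add: power_mod)
  have "x mod 8 = 0 \<or> x mod 8 = 1 \<or> x mod 8 = 2 \<or> x mod 8 = 3 \<or> x mod 8 = 4 \<or> x mod 8 = 5 \<or>
    x mod 8 = 6 \<or> x mod 8 = 7" by presburger
  moreover have "odd x \<longleftrightarrow> odd (x mod 8)" by (simp add: dvd_mod_iff)
  moreover have "x mod 4 = x mod 8 mod 4" by (simp add: mod_mod_cancel)
  ultimately show ?thesis unfolding m by (elim disjE) simp_all
qed

lemma mod_eqE: "(a::int) mod m = r \<Longrightarrow> \<exists>k. a = m * k + r"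
  by (metis mult_div_mod_eq)

lemma square_mod_4: "(x::int)^2 mod 4 = (if odd x then 1 else 0)"
proof -
  have "x^2 mod 4 = x^2 mod 8 mod 4" by (simp add: mod_mod_cancel)
  then show ?thesis by (simp add: square_mod_8)
qed

lemma chi8_mod_8: "chi8 (u mod 8) = chi8 u" by (simp add: chi8_def)
lemma eps4_mod_8: "eps4 (u mod 8) (v mod 8) = eps4 u v" by (simp add: eps4_def mod_mod_cancel)

lemma odd_mod_8_mem: "odd (u::int) \<Longrightarrow> u mod 8 \<in> {1, 3, 5, 7}"
  by (erule odd_mod_8_cases) simp_all

text \<open>Odd squares are 1 modulo 8 and even squares are 0 or 4, so a primitive solution leaves
  few residues of u and v modulo 8, and these are checked one by one. The four cases are the
  parities of the two coefficients.\<close>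

lemma hilb_2_norm:
  assumes "odd u" "odd v" "\<alpha> \<le> 1" "\<beta> \<le> 1"
    "z^2 = (2 ^ \<alpha> * u) * x^2 + (2 ^ \<beta> * v) * y^2" "\<not> (even x \<and> even y \<and> even z)"
  shows "eps4 u v * chi8 u ^ \<beta> * chi8 v ^ \<alpha> = (1::int)"
proof -
  \<comment> \<open>Exactly one coefficient is even; by symmetry this serves two of the four
    cases.\<close>
  have half: "chi8 v * eps4 u v = 1"
    if *: "odd u" "odd v" "z^2 = (2 * u) * x^2 + v * y^2" "\<not> (even x \<and> even y \<and> even z)" for u v x y z :: int
  proof -
    have yz: "even z \<longleftrightarrow> even y" proof -
      have "even (z^2) \<longleftrightarrow> even (2 * u * x^2 + v * y^2)" using *(3) by (rule arg_cong)
      then show ?thesis using *(2) by simp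
    qed
    have "odd y"
    proof
      assume y: "even y"
      then obtain y' z' where yz': "y = 2 * y'" "z = 2 * z'" using yz by (auto elim!: evenE)
      then have "2 * z'^2 = u * x^2 + 2 * (v * y'^2)" using *(3) by (simp add: power2_eq_square)
      then have "even (u * x^2)" by (metis dvd_add_left_iff dvd_triv_left)
      then show False using *(1,4) y yz by simp
    qed
    then have y8: "y^2 mod 8 = 1" "z^2 mod 8 = 1" using yz by (simp_all add: square_mod_8)
    obtain Y where Y: "y^2 = 8 * Y + 1" using mod_eqE[OF y8(1)] by blast
    obtain Z where Z: "z^2 = 8 * Z + 1" using mod_eqE[OF y8(2)] by blast
    have "\<exists>X. x\<^sup>2 = 4 * X \<or> x\<^sup>2 = 4 * X + 1"
      using mod_eqE[of "x^2" 4 0] mod_eqE[of "x^2" 4 1] square_mod_4[of x] by (cases "odd x") auto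
    then obtain X where X: "x^2 = 4 * X \<or> x\<^sup>2 = 4 * X + 1" by blast
    \<comment> \<open>Modulo 8 this leaves v = 1 for even x and 2 u + v = 1 for odd x.\<close>
    have "8 * (Z - v * Y - u * X) = v - 1 \<or> 8 * (Z - v * Y - u * X) = 2 * u + v - 1"
      using X *(3) unfolding Y Z by (auto simp: algebra_simps)
    then have "8 dvd v - 1 \<or> 8 dvd 2 * u + v - 1" by (metis dvd_triv_left)
    then have c: "v mod 8 = 1 \<or> (2 * u + v) mod 8 = 1"
      using mod_eq_dvd_iff[of v 8 1] mod_eq_dvd_iff[of "2 * u + v" 8 1] by simp
    show ?thesis
    proof -
      have fin: "\<forall>a\<in>{1, 3, 5, 7}. \<forall>b\<in>{1, 3, 5, 7}. b = 1 \<or> (2 * a + b) mod 8 = 1 \<longrightarrow> chi8 b * eps4 a b = 1"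
        by (simp add: chi8_def eps4_def)
      have "(2 * (u mod 8) + v mod 8) mod 8 = (2 * u + v) mod 8" by (intro mod_add_cong mod_mult_cong) simp_all
      then have "v mod 8 = 1 \<or> (2 * (u mod 8) + v mod 8) mod 8 = 1" using c by simp
      then show ?thesis
        using fin[rule_format, OF odd_mod_8_mem[OF *(1)] odd_mod_8_mem[OF *(2)]] by (simp only: chi8_mod_8 eps4_mod_8)
    qed
  qed
  consider "\<alpha> = 0" "\<beta> = 0" | "\<alpha> = 1" "\<beta> = 0" | "\<alpha> = 0" "\<beta> = 1" | "\<alpha> = 1" "\<beta> = 1"
    using assms(3,4) by linarith
  then show ?thesis
  proof cases
    case 1
    have "\<not> (u mod 4 = 3 \<and> v mod 4 = 3)"
    proof
      assume "u mod 4 = 3 \<and> v mod 4 = 3"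
      then have "(u * x^2 + v * y^2) mod 4 = (3 * (x^2 mod 4) + 3 * (y^2 mod 4)) mod 4"
        by (intro mod_add_cong mod_mult_cong) simp_all
      then have "z^2 mod 4 = (3 * (x^2 mod 4) + 3 * (y^2 mod 4)) mod 4"
        using assms(5) 1 by simp
      then show False using assms(6) by (auto simp: square_mod_4 split: if_splits)
    qed
    then show ?thesis using 1 by (simp add: eps4_def)
  next
    case 2
    then show ?thesis using half[OF assms(1,2), of z x y] assms(5,6) by (simp add: mult.commute)
  next
    case 3
    then show ?thesis using half[OF assms(2,1), of z y x] assms(5,6)
      by (simp add: mult.commute eps4_commute add.commute)
  next
    case 4
    \<comment> \<open>With both coefficients even, z is even, and division by 2 leaves 2 w^2 = u x^2
      + v y^2 with x and y odd.\<close>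
    have "even (z^2)" using assms(5) 4 by simp
    then obtain w where w: "z = 2 * w" by (auto elim!: evenE)
    have e: "2 * w^2 = u * x^2 + v * y^2" using assms(5) 4 by (simp add: w power2_eq_square algebra_simps)
    have xy: "odd x" "odd y"
    proof -
      have "even (2 * w^2) \<longleftrightarrow> even (u * x^2 + v * y^2)" using e by (rule arg_cong)
      then have "even x \<longleftrightarrow> even y" using assms(1,2) by simp
      moreover have "even z" using w by simp
      ultimately show "odd x" "odd y" using assms(6) by auto
    qed
    have x8: "x^2 mod 8 = 1" "y^2 mod 8 = 1" using xy by (simp_all add: square_mod_8)
    obtain X where X: "x^2 = 8 * X + 1" using mod_eqE[OF x8(1)] by blast
    obtain Y where Y: "y^2 = 8 * Y + 1" using mod_eqE[OF x8(2)] by blast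
    have "\<exists>W. w\<^sup>2 = 4 * W \<or> w\<^sup>2 = 4 * W + 1"
      using mod_eqE[of "w^2" 4 0] mod_eqE[of "w^2" 4 1] square_mod_4[of w] by (cases "odd w") auto
    then obtain W where W: "w^2 = 4 * W \<or> w\<^sup>2 = 4 * W + 1" by blast
    have "8 * (u * X + v * Y - W) = - (u + v) \<or> 8 * (u * X + v * Y - W) = 2 - (u + v)"
      using W e unfolding X Y by (auto simp: algebra_simps)
    then have "8 dvd - (u + v) \<or> 8 dvd 2 - (u + v)" by (metis dvd_triv_left)
    then have c: "(u + v) mod 8 = 0 \<or> (u + v) mod 8 = 2"
      using dvd_eq_mod_eq_0[of 8 "u + v"] mod_eq_dvd_iff[of 2 8 "u + v", simplified] dvd_minus_iff[of 8 "u + v"] by argo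
    have "eps4 u v * chi8 u * chi8 v = 1"
    proof -
      have fin: "\<forall>a\<in>{1, 3, 5, 7}. \<forall>b\<in>{1, 3, 5, 7}. (a + b) mod 8 = 0 \<or> (a + b) mod 8 = 2 \<longrightarrow>
          eps4 a b * chi8 a * chi8 b = 1"
        by (simp add: chi8_def eps4_def)
      have "(u mod 8 + v mod 8) mod 8 = (u + v) mod 8" by (intro mod_add_cong) simp_all
      then have "(u mod 8 + v mod 8) mod 8 = 0 \<or> (u mod 8 + v mod 8) mod 8 = 2" using c by simp
      then show ?thesis
        using fin[rule_format, OF odd_mod_8_mem[OF assms(1)] odd_mod_8_mem[OF assms(2)]] by (simp only: chi8_mod_8 eps4_mod_8)
    qed
    then show ?thesis using 4 by simp
  qed
qed

text \<open>Modulo p a primitive solution makes v, u or -u v a square, according to whether the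
  first, the second or both coefficients are divisible by p; with two unit coefficients all
  exponents are 0.\<close>

lemma hilb_odd_norm:
  assumes p: "prime p" "p > 2" and "\<not> int p dvd u" "\<not> int p dvd v" "\<alpha> \<le> 1" "\<beta> \<le> 1"
    "z^2 = (int p ^ \<alpha> * u) * x^2 + (int p ^ \<beta> * v) * y^2" "\<not> (int p dvd x \<and> int p dvd y \<and> int p dvd z)"
  shows "Legendre (-1) p ^ (\<alpha> * \<beta>) * Legendre u p ^ \<beta> * Legendre v p ^ \<alpha> = 1"
proof -
  have pp: "prime (int p)" "int p \<noteq> 0" using p by simp_all
  have sq: "int p dvd t^2 \<longleftrightarrow> int p dvd t" for t by (rule prime_dvd_power_iff) (use pp in simp_all)
  have half: "Legendre v p = 1"
    if *: "\<not> int p dvd u" "\<not> int p dvd v" "z^2 = (int p * u) * x^2 + v * y^2"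
      "\<not> (int p dvd x \<and> int p dvd y \<and> int p dvd z)" for u v x y z
  proof (rule Legendre_eq_1I[OF p *(2)])
    show "[z\<^sup>2 = v * y^2] (mod int p)" unfolding *(3) by (simp add: cong_iff_dvd_diff)
    show "\<not> int p dvd y"
    proof
      assume y: "int p dvd y"
      then have z: "int p dvd z" using *(3) sq by (metis dvd_add dvd_mult dvd_triv_left mult.assoc)
      obtain y' z' where yz: "y = int p * y'" "z = int p * z'" using y z by (auto elim!: dvdE)
      have "int p * (u * x^2) = int p * (int p * (z'^2 - v * y'^2))"
        using *(3) unfolding yz by (simp add: power2_eq_square algebra_simps)
      then have "int p dvd u * x^2" using pp(2) by (metis dvd_triv_left mult_cancel_left)
      then show False using *(1,4) y z pp(1) sq by (simp add: prime_dvd_mult_iff)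
    qed
  qed
  consider "\<alpha> = 0" "\<beta> = 0" | "\<alpha> = 1" "\<beta> = 0" | "\<alpha> = 0" "\<beta> = 1" | "\<alpha> = 1" "\<beta> = 1"
    using assms(5,6) by linarith
  then show ?thesis
  proof cases
    case 2
    then show ?thesis using half[OF assms(3,4), of z x y] assms(7,8) by (simp add: mult.commute)
  next
    case 3
    then show ?thesis using half[OF assms(4,3), of z y x] assms(7,8)
      by (simp add: mult.commute add.commute)
  next
    case 4
    have "int p dvd z^2" using assms(7) 4 by (simp add: algebra_simps)
    then obtain w where w: "z = int p * w" using sq by (auto elim!: dvdE)
    have "int p * (int p * w^2) = int p * (u * x^2 + v * y^2)"
      using assms(7) 4 by (simp add: w power2_eq_square algebra_simps)
    then have e: "int p * w^2 = u * x^2 + v * y^2" using pp(2) by (metis mult_cancel_left)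
    have y: "\<not> int p dvd y"
    proof
      assume y: "int p dvd y"
      then have "int p dvd u * x^2" using e sq by (metis dvd_add_left_iff dvd_mult dvd_triv_left)
      then have "int p dvd x" using assms(3) pp(1) sq by (simp add: prime_dvd_mult_iff)
      then show False using y w assms(8) by simp
    qed
    \<comment> \<open>Multiply u x^2 + v y^2 = p w^2 by u.\<close>
    have "[(u * x)\<^sup>2 = (- 1 * u * v) * y^2] (mod int p)"
    proof -
      have "(u * x)^2 - (- 1 * u * v) * y^2 = int p * (u * w^2)"
        using arg_cong[OF e, of "\<lambda>t. u * t"] by (simp add: power2_eq_square algebra_simps)
      then show ?thesis by (simp add: cong_iff_dvd_diff)
    qed
    moreover have "\<not> int p dvd - 1 * u * v" using assms(3,4) pp by (simp add: prime_dvd_mult_iff)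
    ultimately have "Legendre (- 1 * u * v) p = 1" using Legendre_eq_1I[OF p _ y] by blast
    then have "Legendre (-1) p * Legendre u p * Legendre v p = 1"
      by (simp only: Legendre_mult[OF p])
    then show ?thesis using 4 by simp
  qed simp
qed

text \<open>Even powers of p are absorbed into x and y and the common factor is divided out. This
  leaves exponents at most 1 and a primitive solution, to which the two reductions above
  apply.\<close>

lemma hilb_norm:
  assumes "prime p" "a \<noteq> 0" "b \<noteq> 0" "z^2 = a * x^2 + b * y^2" "x \<noteq> 0 \<or> y \<noteq> 0 \<or> z \<noteq> 0"
  shows "hilb p a b = 1"
proof -
  let ?u = "punit p a" and ?v = "punit p b"
  define \<alpha> \<beta> where "\<alpha> = pval p a mod 2" and "\<beta> = pval p b mod 2"
  define X Y where "X = int p ^ (pval p a div 2) * x" and "Y = int p ^ (pval p b div 2) * y"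
  have p0: "int p \<noteq> 0" using prime_gt_0_nat[OF assms(1)] by simp
  have split: "int p ^ k * t^2 = int p ^ (k mod 2) * (int p ^ (k div 2) * t)^2" for k t
  proof -
    have "int p ^ k = int p ^ (k mod 2) * (int p ^ (k div 2))^2"
      by (metis add.commute mult_div_mod_eq power_add power_mult mult.commute)
    then show ?thesis by (simp add: power_mult_distrib)
  qed
  have e: "z^2 = (int p ^ \<alpha> * ?u) * X^2 + (int p ^ \<beta> * ?v) * Y^2"
  proof -
    have "a * x^2 = ?u * (int p ^ pval p a * x^2)" "b * y^2 = ?v * (int p ^ pval p b * y^2)"
      using pval_punit(1)[OF assms(1,2)] pval_punit(1)[OF assms(1,3)] by (metis mult.assoc mult.commute)+
    then show ?thesis using assms(4) split[of "pval p a" x] split[of "pval p b" y]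
      by (simp add: X_def Y_def \<alpha>_def \<beta>_def mult.assoc mult.left_commute)
  qed
  define g where "g = gcd X (gcd Y z)"
  have g: "g \<noteq> 0" using assms(5) p0 by (auto simp: g_def X_def Y_def)
  define X' Y' z' where "X' = X div g" and "Y' = Y div g" and "z' = z div g"
  have g2: "X = g * X'" "Y = g * Y'" "z = g * z'"
    by (simp_all add: X'_def Y'_def z'_def g_def) (metis dvd_mult_div_cancel gcd_dvd1 gcd_dvd2 dvd_trans)+
  have "\<not> (int p dvd X' \<and> int p dvd Y' \<and> int p dvd z')"
  proof
    assume "int p dvd X' \<and> int p dvd Y' \<and> int p dvd z'"
    then have "g * int p dvd X" "g * int p dvd Y" "g * int p dvd z"
      unfolding g2 by (simp_all add: mult_dvd_mono)
    then have "g * int p dvd g * 1" by (simp add: g_def)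
    then have "int p dvd 1" using g by (metis dvd_mult_cancel_left mult.right_neutral)
    then show False using prime_gt_1_nat[OF assms(1)] by simp
  qed
  moreover have "z'^2 = (int p ^ \<alpha> * ?u) * X'^2 + (int p ^ \<beta> * ?v) * Y'^2"
  proof -
    have "g^2 * z'^2 = g^2 * ((int p ^ \<alpha> * ?u) * X'^2 + (int p ^ \<beta> * ?v) * Y'^2)"
      using e unfolding g2 by (simp add: power_mult_distrib algebra_simps)
    then show ?thesis using g by (metis mult_cancel_left power_not_zero)
  qed
  ultimately have prim: "z'^2 = (int p ^ \<alpha> * ?u) * X'^2 + (int p ^ \<beta> * ?v) * Y'^2"
    "\<not> (int p dvd X' \<and> int p dvd Y' \<and> int p dvd z')" by blast+
  note nd = pval_punit(2)[OF assms(1,2)] pval_punit(2)[OF assms(1,3)]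
  \<comment> \<open>Every factor of the symbol is a sign, so the valuations matter only through
    their parity.\<close>
  have pm: "s ^ k = s ^ (k mod 2)" if "s = 1 \<or> s = -1" for s :: int and k
    using that by (cases "even k") (auto simp: odd_iff_mod_2_eq_one)
  have le: "\<alpha> \<le> 1" "\<beta> \<le> 1" by (simp_all add: \<alpha>_def \<beta>_def)
  show ?thesis
  proof (cases "p = 2")
    case True
    have c8: "chi8 u = 1 \<or> chi8 u = -1" for u by (simp add: chi8_def)
    show ?thesis using hilb_2_norm[of ?u ?v \<alpha> \<beta> z' X' Y'] prim nd True le
        pm[OF c8, of ?u "pval p b"] pm[OF c8, of ?v "pval p a"]
      by (simp add: hilb_def \<alpha>_def \<beta>_def)
  next
    case False
    then have p: "p > 2" using assms(1) prime_ge_2_nat[of p] by linarith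
    then have "\<not> int p dvd -1" by (simp add: zdvd_not_zless)
    note v = Legendre_values[OF this] Legendre_values[OF nd(1)] Legendre_values[OF nd(2)]
    have "pval p a * pval p b mod 2 = \<alpha> * \<beta> mod 2" by (simp add: \<alpha>_def \<beta>_def mod_mult_eq)
    moreover have "\<alpha> * \<beta> mod 2 = \<alpha> * \<beta>" unfolding \<alpha>_def \<beta>_def by (cases "even (pval p a)"; cases "even (pval p b)") (simp_all add: odd_iff_mod_2_eq_one)
    ultimately show ?thesis
      using hilb_odd_norm[OF assms(1) p nd, of \<alpha> \<beta> z' X' Y'] prim False le
        pm[OF v(2), of "pval p b"] pm[OF v(3), of "pval p a"] pm[OF v(1), of "pval p a * pval p b"]
      by (simp add: hilb_def \<alpha>_def \<beta>_def)
  qed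
qed

section \<open>The product formula\<close>

text \<open>The product over all places, written with an arbitrary finite set P that contains 2 and
  the prime divisors of a b. The freedom in P lets several pairs share one set, as multiplicativity
  requires.\<close>

definition prodform :: "int \<Rightarrow> int \<Rightarrow> bool" where
  "prodform a b \<longleftrightarrow> (\<forall>P. finite P \<longrightarrow> (\<forall>p\<in>P. prime p) \<longrightarrow> 2 \<in> P \<longrightarrow>
     (\<forall>p. prime p \<longrightarrow> int p dvd a * b \<longrightarrow> p \<in> P) \<longrightarrow> hinf a b * (\<Prod>p\<in>P. hilb p a b) = 1)"

lemma prodformI:
  assumes "finite T" "\<And>p. p \<in> T \<Longrightarrow> prime p \<and> (p = 2 \<or> int p dvd a * b)"
    "\<And>p. prime p \<Longrightarrow> p \<notin> T \<Longrightarrow> hilb p a b = 1" "hinf a b * (\<Prod>p\<in>T. hilb p a b) = 1"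
  shows "prodform a b"
  unfolding prodform_def
proof (intro allI impI)
  fix P assume P: "finite P" "\<forall>p\<in>P. prime p" "2 \<in> P" "\<forall>p. prime p \<longrightarrow> int p dvd a * b \<longrightarrow> p \<in> P"
  have "(\<Prod>p\<in>P. hilb p a b) = (\<Prod>p\<in>T. hilb p a b)"
    using assms P by (intro prod.mono_neutral_right) auto
  then show "hinf a b * (\<Prod>p\<in>P. hilb p a b) = 1" using assms(4) by simp
qed

lemma prodform_commute: "prodform a b = prodform b a"
  unfolding prodform_def by (simp add: hilb_commute[of _ a b] hinf_commute[of a b] mult.commute[of a b])

lemma prodform_mult:
  assumes "prodform a b" "prodform a' b" "a \<noteq> 0" "a' \<noteq> 0" "b \<noteq> 0"
  shows "prodform (a * a') b"
  unfolding prodform_def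
proof (intro allI impI)
  fix P assume P: "finite P" "\<forall>p\<in>P. prime p" "2 \<in> P" "\<forall>p. prime p \<longrightarrow> int p dvd a * a' * b \<longrightarrow> p \<in> P"
  have "(\<Prod>p\<in>P. hilb p (a * a') b) = (\<Prod>p\<in>P. hilb p a b) * (\<Prod>p\<in>P. hilb p a' b)"
    using P(2) assms(3-5) by (subst prod.distrib[symmetric], intro prod.cong) (auto simp: hilb_mult_left)
  moreover have "int p dvd a * a' * b" if "int p dvd a * b \<or> int p dvd a' * b" for p
  proof -
    have "a * a' * b = a' * (a * b)" "a * a' * b = a * (a' * b)" by simp_all
    then show ?thesis using that by (metis dvd_mult)
  qed
  then have d: "\<forall>p. prime p \<longrightarrow> int p dvd a * b \<longrightarrow> p \<in> P" "\<forall>p. prime p \<longrightarrow> int p dvd a' * b \<longrightarrow> p \<in> P"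
    using P(4) by simp_all
  have 1: "hinf a b * (\<Prod>p\<in>P. hilb p a b) = 1"
    using assms(1)[unfolded prodform_def, THEN spec[of _ P]] P(1-3) d(1) by simp
  have 2: "hinf a' b * (\<Prod>p\<in>P. hilb p a' b) = 1"
    using assms(2)[unfolded prodform_def, THEN spec[of _ P]] P(1-3) d(2) by simp
  have "x * y * (A * B) = (x * A) * (y * B)" for x y A B :: int
    by (metis mult.assoc mult.left_commute)
  from this[of "hinf a b" "hinf a' b" "\<Prod>p\<in>P. hilb p a b" "\<Prod>p\<in>P. hilb p a' b"] 1 2
  have "hinf a b * hinf a' b * ((\<Prod>p\<in>P. hilb p a b) * (\<Prod>p\<in>P. hilb p a' b)) = 1" by simp
  ultimately show "hinf (a * a') b * (\<Prod>p\<in>P. hilb p (a * a') b) = 1"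
    using hinf_mult_left[OF assms(3,4), of b] by simp
qed

lemma int_nonzero_induct:
  assumes "a \<noteq> 0" "P 1" "P (-1)" "\<And>p. prime p \<Longrightarrow> P (int p)"
    "\<And>a b. a \<noteq> 0 \<Longrightarrow> b \<noteq> 0 \<Longrightarrow> P a \<Longrightarrow> P b \<Longrightarrow> P (a * b)"
  shows "P a"
proof -
  have pos: "P (int n)" if "n > 0" for n
    using that
  proof (induction n rule: less_induct)
    case (less n)
    show ?case
    proof (cases "n = 1")
      case False
      then obtain p k where p: "prime p" "n = p * k" by (metis dvdE prime_factor_nat)
      then have "k < n" "k > 0" using less.prems prime_gt_1_nat[OF p(1)] by auto
      then show ?thesis using assms(4)[OF p(1)] less.IH[of k] assms(5)[of "int p" "int k"] p prime_gt_0_nat[OF p(1)]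
        by simp
    qed (use assms(2) in simp)
  qed
  show ?thesis
  proof (cases "a > 0")
    case True
    then show ?thesis using pos[of "nat a"] by simp
  next
    case False
    then show ?thesis using pos[of "nat (-a)"] assms(5)[of "-1" "-a"] assms(1,3) by simp
  qed
qed

lemma prime_not_dvd_1: "prime p \<Longrightarrow> \<not> int p dvd 1" "prime p \<Longrightarrow> \<not> int p dvd -1"
  using prime_gt_1_nat[of p] by auto

lemma prime_dvd_prime_int: "prime p \<Longrightarrow> prime q \<Longrightarrow> int p dvd int q \<longleftrightarrow> p = q"
  by (metis int_dvd_int_iff primes_dvd_imp_eq dvd_refl)

lemma prime_dvd_prime_iff: "prime (p::nat) \<Longrightarrow> prime q \<Longrightarrow> p dvd q \<longleftrightarrow> p = q"
  by (metis primes_dvd_imp_eq dvd_refl)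

lemma hilb_1: "prime p \<Longrightarrow> b \<noteq> 0 \<Longrightarrow> hilb p 1 b = 1"
  using hilb_square_left[of p 1 b] by simp

lemma prodform_1: "b \<noteq> 0 \<Longrightarrow> prodform 1 b"
  unfolding prodform_def by (auto simp: hilb_1 hinf_def intro!: prod.neutral)

lemma hilb_prime_2:
  assumes "prime q" "q > 2"
  shows "hilb q (int q) u = (if int q dvd u then hilb q (int q) u else Legendre u q)"
    "\<not> int q dvd u \<Longrightarrow> hilb q (int q) u = Legendre u q"
  using assms by (auto simp: hilb_def pval_self pval_unit)

lemma prodform_m1_m1: "prodform (-1) (-1)"
proof (rule prodformI[of "{2}"])
  show "hilb p (-1) (-1) = 1" if "prime p" "p \<notin> {2}" for p
    using that prime_not_dvd_1 by (intro hilb_unit) auto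
  show "hinf (-1) (-1) * (\<Prod>p\<in>{2}. hilb p (-1) (-1)) = 1"
    using pval_unit[of 2 "-1"] by (simp add: hilb_def hinf_def eps4_def)
qed auto

lemma prodform_m1_prime:
  assumes "prime q"
  shows "prodform (int q) (-1)"
proof (rule prodformI[of "{2, q}"])
  show "hilb p (int q) (-1) = 1" if "prime p" "p \<notin> {2, q}" for p
    using that prime_not_dvd_1 assms by (intro hilb_unit) (auto simp: prime_dvd_prime_iff)
  have m1: "pval 2 (-1) = 0" "punit 2 (-1) = -1" using pval_unit[of 2 "-1"] by auto
  show "hinf (int q) (-1) * (\<Prod>p\<in>{2, q}. hilb p (int q) (-1)) = 1"
  proof (cases "q = 2")
    case True
    then show ?thesis using m1 pval_self[of 2] by (simp add: hilb_def hinf_def eps4_def chi8_def)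
  next
    case False
    then have q: "q > 2" using assms prime_ge_2_nat[of q] by linarith
    have "odd q" using assms q prime_odd_nat by blast
    then have u: "pval 2 (int q) = 0" "punit 2 (int q) = int q" using pval_unit[of 2 "int q"] by auto
    have "hilb q (int q) (-1) = Legendre (-1) q"
      using hilb_prime_2(2)[OF assms q] prime_not_dvd_1[OF assms] by blast
    moreover have "hilb 2 (int q) (-1) = (if q mod 4 = 3 then -1 else 1)"
      using m1 u by (simp add: hilb_def eps4_def) (metis of_nat_eq_iff of_nat_numeral zmod_int)
    ultimately show ?thesis using False Legendre_minus_1[OF assms q] by (simp add: hinf_def)
  qed
qed (use assms in auto)

text \<open>As (q, -q) = 1 at every place, (q, q) equals (q, -1), and the case of -1
  applies.\<close>

lemma prodform_prime_self:
  assumes "prime q"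
  shows "prodform (int q) (int q)"
proof -
  have "hilb p (int q) (int q) = hilb p (int q) (-1)" if "prime p" for p
  proof -
    have "hilb p (int q) (- int q) = 1"
      using hilb_norm[of p "int q" "- int q" 0 1 1] that prime_gt_0_nat[OF assms] by simp
    moreover have "hilb p (int q) (- int q) = hilb p (int q) (-1) * hilb p (int q) (int q)"
      using hilb_mult_right[of p "int q" "-1" "int q"] that prime_gt_0_nat[OF assms] by simp
    ultimately show ?thesis
      using hilb_values[of p "int q" "-1"] hilb_values[of p "int q" "int q"] that prime_gt_0_nat[OF assms] by auto
  qed
  moreover have "hinf (int q) (int q) = hinf (int q) (-1)" by (simp add: hinf_def)
  ultimately show ?thesis
    using prodform_m1_prime[OF assms] assms unfolding prodform_def
    by (simp add: prime_dvd_mult_iff cong: prod.cong)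
qed

lemma prodform_2_prime:
  assumes "prime q" "q > 2"
  shows "prodform (int q) 2"
proof (rule prodformI[of "{2, q}"])
  show "hilb p (int q) 2 = 1" if "prime p" "p \<notin> {2, q}" for p
    using that assms prime_dvd_prime_int[of p 2] by (intro hilb_unit) (auto simp: prime_dvd_prime_iff)
  have "odd q" using assms prime_odd_nat by blast
  then have u: "pval 2 (int q) = 0" "punit 2 (int q) = int q" using pval_unit[of 2 "int q"] by auto
  have two: "pval 2 2 = 1" "punit 2 2 = 1" using pval_self[of 2] by auto
  have "hilb q (int q) 2 = Legendre 2 q"
    using hilb_prime_2(2)[OF assms, of 2] prime_dvd_prime_int[OF assms(1), of 2] assms(2) by auto
  moreover have "hilb 2 (int q) 2 = (if q mod 8 \<in> {1, 7} then 1 else -1)"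
  proof -
    have "int q mod 8 = int (q mod 8)" by (simp add: zmod_int)
    then show ?thesis using two u by (auto simp: hilb_def eps4_def chi8_def)
  qed
  ultimately show "hinf (int q) 2 * (\<Prod>p\<in>{2, q}. hilb p (int q) 2) = 1"
    using Legendre_2[OF assms] assms(2) by (simp add: hinf_def)
qed (use assms in auto)

text \<open>Quadratic reciprocity: the symbols at q and r are the two Legendre symbols, and the
  symbol at 2 is the sign that relates them.\<close>

lemma prodform_prime_prime:
  assumes "prime q" "q > 2" "prime r" "r > 2" "q \<noteq> r"
  shows "prodform (int q) (int r)"
proof (rule prodformI[of "{2, q, r}"])
  show "hilb p (int q) (int r) = 1" if "prime p" "p \<notin> {2, q, r}" for p
    using that assms by (intro hilb_unit) (auto simp: prime_dvd_prime_iff)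
  have o: "odd q" "odd r" using assms prime_odd_nat by blast+
  then have u: "pval 2 (int q) = 0" "punit 2 (int q) = int q" "pval 2 (int r) = 0" "punit 2 (int r) = int r"
    using pval_unit[of 2 "int q"] pval_unit[of 2 "int r"] by auto
  have "\<not> int q dvd int r" "\<not> int r dvd int q" using assms by (auto simp: prime_dvd_prime_iff)
  then have "hilb q (int q) (int r) = Legendre r q" "hilb r (int q) (int r) = Legendre q r"
    using hilb_prime_2(2)[OF assms(1,2)] hilb_prime_2(2)[OF assms(3,4)] hilb_commute[of r "int q" "int r"] by auto
  moreover have "hilb 2 (int q) (int r) = (-1) ^ ((q - 1) div 2 * ((r - 1) div 2))"
  proof -
    have "odd ((q - 1) div 2) \<longleftrightarrow> q mod 4 = 3" "odd ((r - 1) div 2) \<longleftrightarrow> r mod 4 = 3" using o by presburger+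
    then have "odd ((q - 1) div 2 * ((r - 1) div 2)) \<longleftrightarrow> q mod 4 = 3 \<and> r mod 4 = 3" by simp
    moreover have "int q mod 4 = int (q mod 4)" "int r mod 4 = int (r mod 4)" by (simp_all add: zmod_int)
    ultimately have "hilb 2 (int q) (int r) = (if odd ((q - 1) div 2 * ((r - 1) div 2)) then -1 else 1)"
      unfolding hilb_def eps4_def u by simp
    then show ?thesis by (metis neg_one_even_power neg_one_odd_power)
  qed
  moreover have "(\<Prod>p\<in>{2, q, r}. hilb p (int q) (int r)) =
      hilb 2 (int q) (int r) * (hilb q (int q) (int r) * hilb r (int q) (int r))"
    using assms(2,4,5) by simp
  ultimately have "(\<Prod>p\<in>{2, q, r}. hilb p (int q) (int r)) =
      (-1) ^ ((q - 1) div 2 * ((r - 1) div 2)) * (Legendre q r * Legendre r q)"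
    by (simp only: mult.commute)
  also have "\<dots> = (-1) ^ (2 * ((q - 1) div 2 * ((r - 1) div 2)))"
    unfolding Quadratic_Reciprocity[OF assms] mult_2 power_add by simp
  also have "\<dots> = 1" by simp
  finally show "hinf (int q) (int r) * (\<Prod>p\<in>{2, q, r}. hilb p (int q) (int r)) = 1"
    by (simp add: hinf_def)
qed (use assms in auto)

text \<open>By multiplicativity in both arguments it is enough to treat -1 and the primes. These
  cases are the quadratic reciprocity law and its two supplements.\<close>

theorem hilbert_product_formula:
  assumes "a \<noteq> 0" "b \<noteq> 0"
  shows "prodform a b"
  using assms(1)
proof (rule int_nonzero_induct[of a "\<lambda>a. prodform a b"])
  show "prodform 1 b" using assms(2) by (rule prodform_1)
  show "prodform (-1) b"
    using assms(2)
  proof (rule int_nonzero_induct)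
    show "prodform (-1) 1" by (subst prodform_commute) (simp add: prodform_1)
    show "prodform (-1) (-1)" by (rule prodform_m1_m1)
    show "prodform (-1) (int p)" if "prime p" for p
      using prodform_m1_prime[OF that] prodform_commute by blast
    show "prodform (-1) (a * b)" if "a \<noteq> 0" "b \<noteq> 0" "prodform (-1) a" "prodform (-1) b" for a b
      using prodform_mult[of a "-1" b] that
        prodform_commute[of "-1" a] prodform_commute[of "-1" b] prodform_commute[of "-1" "a * b"] by auto
  qed
  show "prodform (int p) b" if p: "prime p" for p
    using assms(2)
  proof (rule int_nonzero_induct)
    show "prodform (int p) 1" by (subst prodform_commute) (use p in \<open>auto intro: prodform_1\<close>)
    show "prodform (int p) (-1)" by (rule prodform_m1_prime[OF p])
    show "prodform (int p) (int q)" if q: "prime q" for q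
    proof -
      consider "p = q" | "p > 2" "q > 2" "p \<noteq> q" | "p > 2" "q = 2" | "p = 2" "q > 2"
        using prime_ge_2_nat[OF p] prime_ge_2_nat[OF q] by linarith
      then show ?thesis
        using p q prodform_prime_self prodform_prime_prime prodform_2_prime[OF p] prodform_2_prime[OF q]
        prodform_commute[of 2 "int q"] by cases auto
    qed
    show "prodform (int p) (a * b)" if "a \<noteq> 0" "b \<noteq> 0" "prodform (int p) a" "prodform (int p) b" for a b
      using prodform_mult[of a "int p" b] that p prime_gt_0_nat[OF p]
        prodform_commute[of "int p" a] prodform_commute[of "int p" b] prodform_commute[of "int p" "a * b"] by auto
  qed
  show "prodform (a * a') b" if "a \<noteq> 0" "a' \<noteq> 0" "prodform a b" "prodform a' b" for a a'
    using prodform_mult that assms(2) by blast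
qed

section \<open>Dirichlet series of real characters\<close>

text \<open>Summation by parts: the differences of the weights are nonnegative and telescope, so
  only the bound B on the sums of c enters.\<close>

lemma abel_bound:
  fixes a c :: "nat \<Rightarrow> real"
  assumes dec: "\<And>k. k \<ge> M \<Longrightarrow> a (Suc k) \<le> a k" and nn: "\<And>k. k \<ge> M \<Longrightarrow> 0 \<le> a k"
    and B: "\<And>n. \<bar>\<Sum>k\<in>{M..<n}. c k\<bar> \<le> B"
  shows "\<bar>\<Sum>k\<in>{M..<n}. c k * a k\<bar> \<le> B * a M"
proof (cases "n \<ge> M")
  case True
  define A where "A n = (\<Sum>k\<in>{M..<n}. c k)" for n
  have eq: "(\<Sum>k\<in>{M..<n}. c k * a k) = A n * a n + (\<Sum>k\<in>{M..<n}. A (Suc k) * (a k - a (Suc k)))"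
    using True
  proof (induction n rule: dec_induct)
    case (step n)
    have "A (Suc n) = A n + c n" using step.hyps by (simp add: A_def)
    then show ?case using step by (simp add: algebra_simps)
  qed (simp add: A_def)
  have tel: "(\<Sum>k\<in>{M..<n}. a k - a (Suc k)) = a M - a n"
    using True by (induction n rule: dec_induct) auto
  have "\<bar>\<Sum>k\<in>{M..<n}. c k * a k\<bar> \<le> \<bar>A n * a n\<bar> + (\<Sum>k\<in>{M..<n}. \<bar>A (Suc k) * (a k - a (Suc k))\<bar>)"
    unfolding eq by (rule order_trans[OF abs_triangle_ineq add_left_mono[OF sum_abs]])
  also have "\<dots> \<le> B * a n + (\<Sum>k\<in>{M..<n}. B * (a k - a (Suc k)))"
    using dec nn B True unfolding A_def[symmetric]
    by (intro add_mono sum_mono) (auto simp: abs_mult intro!: mult_mono order_trans[OF abs_ge_zero B])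
  also have "(\<Sum>k\<in>{M..<n}. B * (a k - a (Suc k))) = B * (a M - a n)"
    unfolding tel[symmetric] by (rule sum_distrib_left[symmetric])
  also have "B * a n + B * (a M - a n) = B * a M" by (simp add: algebra_simps)
  finally show ?thesis .
next
  case False
  then show ?thesis using B[of M] nn[of M] by simp
qed

text \<open>The value at 0 never matters, since \<open>0 powr s = 0\<close>.\<close>

definition cmult :: "(nat \<Rightarrow> real) \<Rightarrow> bool" where
  "cmult chi \<longleftrightarrow> chi 1 = 1 \<and> (\<forall>a b. chi (a * b) = chi a * chi b) \<and> (\<forall>a. \<bar>chi a\<bar> \<le> 1)"

definition dser :: "(nat \<Rightarrow> real) \<Rightarrow> real \<Rightarrow> nat \<Rightarrow> real" where
  "dser chi s n = chi n * real n powr (-s)"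

definition Lfun :: "(nat \<Rightarrow> real) \<Rightarrow> real \<Rightarrow> real" where
  "Lfun chi s = (\<Sum>n. dser chi s n)"

lemma powr_summable: "s > 1 \<Longrightarrow> summable (\<lambda>n. real n powr (-s))"
  by (simp add: summable_real_powr_iff)

lemma dser_le:
  assumes "cmult chi" shows "\<bar>dser chi s n\<bar> \<le> real n powr (-s)"
  using assms unfolding cmult_def dser_def by (auto simp: abs_mult intro!: mult_left_le_one_le)

lemma dser_summable:
  assumes "cmult chi" "s > 1"
  shows "summable (\<lambda>n. \<bar>dser chi s n\<bar>)" "summable (dser chi s)" "dser chi s summable_on A"
proof -
  show 1: "summable (\<lambda>n. \<bar>dser chi s n\<bar>)"
    using dser_le[OF assms(1)] by (intro summable_comparison_test'[OF powr_summable[OF assms(2)]]) auto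
  then show "summable (dser chi s)" by (rule summable_rabs_cancel)
  have "dser chi s summable_on UNIV"
    using 1 by (intro norm_summable_imp_summable_on) (simp add: real_norm_def[abs_def])
  then show "dser chi s summable_on A" by (rule summable_on_subset_banach) simp
qed

definition free_of :: "nat set \<Rightarrow> nat set" where "free_of T = {n. n > 0 \<and> (\<forall>p\<in>T. \<not> p dvd n)}"

lemma dser_mult: "cmult chi \<Longrightarrow> dser chi s (a * b) = dser chi s a * dser chi s b"
  by (simp add: cmult_def dser_def powr_mult)

text \<open>A sieve by one prime at a time: by complete multiplicativity the terms divisible by p
  sum to \<open>dser chi s p\<close> times the sum over all terms still present.\<close>

lemma euler_product_finite:
  assumes "cmult chi" "s > 1" "finite T" "\<forall>p\<in>T. prime p"
  shows "infsum (dser chi s) (free_of T) = (\<Prod>p\<in>T. 1 - dser chi s p) * Lfun chi s"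
  using assms(3,4)
proof (induction T rule: finite_induct)
  case empty
  have "infsum (dser chi s) (free_of {}) = infsum (dser chi s) UNIV"
    by (rule infsum_cong_neutral) (auto simp: free_of_def dser_def)
  also have "\<dots> = Lfun chi s"
    unfolding Lfun_def using dser_summable(1)[OF assms(1,2)]
    by (intro infsumI norm_summable_imp_has_sum) (auto intro: summable_sums dser_summable(2)[OF assms(1,2)])
  finally show ?case by simp
next
  case (insert p T)
  then have p: "prime p" and T: "\<forall>q\<in>T. prime q" by auto
  have im: "{n \<in> free_of T. p dvd n} = (\<lambda>m. p * m) ` free_of T"
  proof (intro equalityI subsetI)
    fix n assume n: "n \<in> {n \<in> free_of T. p dvd n}"
    then obtain m where "n = p * m" by (auto elim!: dvdE)
    with n have "m \<in> free_of T" by (auto simp: free_of_def)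
    with \<open>n = p * m\<close> show "n \<in> (\<lambda>m. p * m) ` free_of T" by blast
  next
    fix n assume "n \<in> (\<lambda>m. p * m) ` free_of T"
    then obtain m where m: "n = p * m" "m \<in> free_of T" by auto
    have "\<not> q dvd p * m" if "q \<in> T" for q
    proof
      assume "q dvd p * m"
      then have "q dvd p" using that T m by (auto simp: prime_dvd_mult_iff free_of_def)
      then have "q = p" using primes_dvd_imp_eq that T p by blast
      then show False using that insert.hyps by simp
    qed
    then show "n \<in> {n \<in> free_of T. p dvd n}" using m p prime_gt_0_nat by (auto simp: free_of_def)
  qed
  have "infsum (dser chi s) {n \<in> free_of T. p dvd n} = infsum (dser chi s \<circ> (\<lambda>m. p * m)) (free_of T)"
    unfolding im using prime_gt_0_nat[OF p] by (intro infsum_reindex) (auto simp: inj_on_def)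
  also have "\<dots> = dser chi s p * infsum (dser chi s) (free_of T)"
    by (simp add: o_def dser_mult[OF assms(1)] infsum_cmult_right' )
  finally have 1: "infsum (dser chi s) {n \<in> free_of T. p dvd n} = dser chi s p * infsum (dser chi s) (free_of T)" .
  have "free_of T = free_of (insert p T) \<union> {n \<in> free_of T. p dvd n}"
    "free_of (insert p T) \<inter> {n \<in> free_of T. p dvd n} = {}"
    by (auto simp: free_of_def)
  then have "infsum (dser chi s) (free_of T) =
      infsum (dser chi s) (free_of (insert p T)) + infsum (dser chi s) {n \<in> free_of T. p dvd n}"
    using infsum_Un_disjoint[OF dser_summable(3)[OF assms(1,2)] dser_summable(3)[OF assms(1,2)]] by metis
  then show ?case using insert 1 by (simp add: algebra_simps)
qed

definition primes_le :: "nat \<Rightarrow> nat set" where "primes_le N = {p. prime p \<and> p \<le> N}"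

lemma finite_primes_le [simp]: "finite (primes_le N)"
  unfolding primes_le_def by (rule finite_subset[of _ "{..N}"]) auto

lemma powr_tail_tendsto_0:
  assumes "s > 1"
  shows "(\<lambda>N. infsum (\<lambda>n. real n powr (-s)) {N<..}) \<longlonglongrightarrow> 0"
proof -
  let ?g = "\<lambda>n. real n powr (-s)"
  have su: "?g summable_on A" for A
    using norm_summable_imp_summable_on[of ?g] powr_summable[OF assms] summable_on_subset_banach[of ?g UNIV A] by simp
  have "infsum ?g {N<..} = infsum ?g UNIV - (\<Sum>n\<le>N. ?g n)" for N
  proof -
    have "infsum ?g UNIV = infsum ?g ({..N} \<union> {N<..})" by (rule arg_cong[of _ _ "infsum ?g"]) auto
    also have "\<dots> = infsum ?g {..N} + infsum ?g {N<..}"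
      by (intro infsum_Un_disjoint su) auto
    finally show ?thesis by simp
  qed
  moreover have "(\<lambda>N. \<Sum>n\<le>N. ?g n) \<longlonglongrightarrow> infsum ?g UNIV"
  proof -
    have "?g sums infsum ?g UNIV" by (rule has_sum_imp_sums[OF has_sum_infsum[OF su]])
    then show ?thesis by (simp add: sums_def_le)
  qed
  ultimately show ?thesis using tendsto_diff[OF tendsto_const[of "infsum ?g UNIV"]] by fastforce
qed

text \<open>After removing all multiples of primes up to N, the term 1 remains and every other term
  has index above N. The product is kept as a factor of L, so the positivity of L comes out as a
  consequence.\<close>

lemma euler_product_tendsto:
  assumes "cmult chi" "s > 1"
  shows "(\<lambda>N. (\<Prod>p\<in>primes_le N. 1 - dser chi s p) * Lfun chi s) \<longlonglongrightarrow> 1"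
proof -
  let ?f = "dser chi s" and ?g = "\<lambda>n. real n powr (-s)"
  have su: "?g summable_on A" for A
    using norm_summable_imp_summable_on[of ?g] powr_summable[OF assms(2)] summable_on_subset_banach[of ?g UNIV A] by simp
  have "\<bar>(\<Prod>p\<in>primes_le N. 1 - ?f p) * Lfun chi s - 1\<bar> \<le> infsum ?g {N<..}" for N
  proof -
    define T where "T = primes_le N"
    have 1: "1 \<in> free_of T" by (auto simp: free_of_def T_def primes_le_def)
    have "infsum ?f (free_of T) = infsum ?f ({1} \<union> (free_of T - {1}))"
      using 1 by (intro arg_cong[of _ _ "infsum ?f"]) auto
    also have "\<dots> = infsum ?f {1} + infsum ?f (free_of T - {1})"
      by (rule infsum_Un_disjoint[OF dser_summable(3)[OF assms] dser_summable(3)[OF assms]]) simp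
    also have "infsum ?f {1} = 1" using assms(1) by (simp add: dser_def cmult_def)
    finally have e0: "infsum ?f (free_of T) = 1 + infsum ?f (free_of T - {1})" .
    have e: "(\<Prod>p\<in>T. 1 - ?f p) * Lfun chi s - 1 = infsum ?f (free_of T - {1})"
    proof -
      have "finite T" "\<forall>p\<in>T. prime p" by (simp_all add: T_def) (simp add: primes_le_def)
      from euler_product_finite[OF assms this] show ?thesis using e0 by simp
    qed
    have sub: "free_of T - {1} \<subseteq> {N<..}"
    proof
      fix n assume n: "n \<in> free_of T - {1}"
      then obtain p where p: "prime p" "p dvd n" using prime_factor_nat[of n] by blast
      then have "p > N" using n by (force simp: free_of_def T_def primes_le_def)
      moreover have "p \<le> n" using p n by (intro dvd_imp_le) (auto simp: free_of_def)
      ultimately show "n \<in> {N<..}" by simp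
    qed
    have ab: "(\<lambda>n. \<bar>?f n\<bar>) summable_on (free_of T - {1})"
      using summable_on_iff_abs_summable_on_real[THEN iffD1, OF dser_summable(3)[OF assms]] unfolding real_norm_def .
    have "\<bar>infsum ?f (free_of T - {1})\<bar> \<le> infsum (\<lambda>n. \<bar>?f n\<bar>) (free_of T - {1})"
      using norm_infsum_bound[of ?f "free_of T - {1}"] ab unfolding real_norm_def by blast
    also have "\<dots> \<le> infsum ?g {N<..}"
      using sub dser_le[OF assms(1)] by (intro infsum_mono_neutral su ab) auto
    finally show ?thesis using e by (simp add: T_def)
  qed
  then have "(\<lambda>N. (\<Prod>p\<in>primes_le N. 1 - ?f p) * Lfun chi s - 1) \<longlonglongrightarrow> 0"
    by (intro Lim_null_comparison[OF _ powr_tail_tendsto_0[OF assms(2)]]) auto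
  then show ?thesis by (simp add: LIM_zero_iff)
qed

definition psum :: "(nat \<Rightarrow> real) \<Rightarrow> real \<Rightarrow> nat \<Rightarrow> real" where
  "psum chi s N = (\<Sum>p\<in>primes_le N. dser chi s p)"

text \<open>From |ln (1 + t) - t| \<le> 2 t^2 for |t| \<le> 1/2, with t^2 \<le> p^(-2); the extra 1
  absorbs the logarithm of the partial product times L. It depends neither on \<open>chi\<close> nor
  on s, so it survives the limit s to 1.\<close>

definition C0 :: real where "C0 = 2 * (\<Sum>n. real n powr (-2)) + 1"

lemma psum_ln_L:
  assumes "cmult chi" "s > 1"
  shows "Lfun chi s > 0" "\<forall>\<^sub>F N in sequentially. \<bar>psum chi s N - ln (Lfun chi s)\<bar> \<le> C0"
proof -
  let ?f = "dser chi s"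
  let ?P = "\<lambda>N. \<Prod>p\<in>primes_le N. 1 - ?f p"
  have half: "\<bar>?f p\<bar> \<le> 1 / 2" "(?f p)^2 \<le> real p powr (-2)" if "prime p" for p
  proof -
    have p: "real p \<ge> 2" using prime_ge_2_nat[OF that] by simp
    have "\<bar>?f p\<bar> \<le> real p powr (-s)" by (rule dser_le[OF assms(1)])
    also have "\<dots> \<le> real p powr (-1)" using p assms(2) by (intro powr_mono) auto
    finally have 1: "\<bar>?f p\<bar> \<le> real p powr (-1)" .
    also have "real p powr (-1) \<le> 1 / 2" using p by (simp add: powr_minus field_simps)
    finally show "\<bar>?f p\<bar> \<le> 1 / 2" .
    have "(?f p)^2 \<le> (real p powr (-1))\<^sup>2" using 1 by (rule abs_le_square_iff[THEN iffD1, OF order_trans]) simp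
    also have "\<dots> = real p powr (-2)" using p by (simp add: powr_minus powr_numeral power_one_over inverse_eq_divide)
    finally show "(?f p)^2 \<le> real p powr (-2)" .
  qed
  have fpos: "1 - ?f p > 0" if "p \<in> primes_le N" for p N
  proof -
    have "\<bar>?f p\<bar> \<le> 1 / 2" using half(1) that unfolding primes_le_def by blast
    then show ?thesis by linarith
  qed
  then have pos: "?P N > 0" for N by (intro prod_pos) blast
  note lim = euler_product_tendsto[OF assms]
  show L: "Lfun chi s > 0"
  proof (rule ccontr)
    assume "\<not> Lfun chi s > 0"
    then have "?P N * Lfun chi s \<le> 0" for N using pos[of N] by (simp add: mult_le_0_iff)
    then have "(1::real) \<le> 0" by (intro LIMSEQ_le_const2[OF lim]) auto
    then show False by simp
  qed
  have "(\<lambda>N. ln (?P N * Lfun chi s)) \<longlonglongrightarrow> ln 1" by (intro tendsto_ln lim) simp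
  then have "\<forall>\<^sub>F N in sequentially. \<bar>ln (?P N * Lfun chi s)\<bar> < 1"
    using tendstoD[of "\<lambda>N. ln (?P N * Lfun chi s)" 0 sequentially 1] by (simp add: dist_real_def)
  then show "\<forall>\<^sub>F N in sequentially. \<bar>psum chi s N - ln (Lfun chi s)\<bar> \<le> C0"
  proof eventually_elim
    case (elim N)
    have "ln (?P N * Lfun chi s) = (\<Sum>p\<in>primes_le N. ln (1 - ?f p)) + ln (Lfun chi s)"
    proof -
      have "ln (?P N) = (\<Sum>p\<in>primes_le N. ln (1 - ?f p))"
        by (intro ln_prod) (use fpos[of _ N] in force)+
      then show ?thesis using pos[of N] L by (simp add: ln_mult_pos)
    qed
    moreover have "\<bar>psum chi s N + (\<Sum>p\<in>primes_le N. ln (1 - ?f p))\<bar> \<le> C0 - 1"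
    proof -
      have "\<bar>psum chi s N + (\<Sum>p\<in>primes_le N. ln (1 - ?f p))\<bar> = \<bar>\<Sum>p\<in>primes_le N. ln (1 + (- ?f p)) - (- ?f p)\<bar>"
        by (simp add: psum_def sum.distrib[symmetric] add.commute)
      also have "\<dots> \<le> (\<Sum>p\<in>primes_le N. 2 * (- ?f p)^2)"
        using half(1) by (intro order_trans[OF sum_abs] sum_mono abs_ln_one_plus_x_minus_x_bound) (auto simp: primes_le_def)
      also have "\<dots> \<le> (\<Sum>p\<in>primes_le N. 2 * real p powr (-2))"
        using half(2) by (intro sum_mono) (auto simp: primes_le_def)
      also have "\<dots> = 2 * (\<Sum>p\<in>primes_le N. real p powr (-2))" by (simp add: sum_distrib_left)
      also have "\<dots> \<le> C0 - 1"
        unfolding C0_def using sum_le_suminf[OF powr_summable[of 2], of "primes_le N"] by simp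
      finally show ?thesis .
    qed
    ultimately show ?case using elim by linarith
  qed
qed

section \<open>Non-vanishing at 1\<close>

text \<open>A real nonprincipal character; that it is nonprincipal is expressed by the vanishing sum
  over a period, from which the bounded partial sums come.\<close>

definition npchar :: "nat \<Rightarrow> (nat \<Rightarrow> real) \<Rightarrow> bool" where
  "npchar m chi \<longleftrightarrow> m > 0 \<and> cmult chi \<and> (\<forall>a. chi (a + m) = chi a) \<and> (\<forall>a. chi a \<in> {-1, 0, 1}) \<and> (\<Sum>a<m. chi a) = 0"

text \<open>Sums over whole periods vanish, so an initial sum is at most m in absolute value, and a
  sum over an interval is a difference of two.\<close>

lemma npchar_sum_bound:
  assumes "npchar m chi"
  shows "\<bar>\<Sum>k\<in>{M..<n}. chi k\<bar> \<le> 2 * real m"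
proof -
  define S where "S n = (\<Sum>k<n. chi k)" for n
  have per: "S (n + m) = S n" for n
  proof (induction n)
    case 0
    then show ?case using assms by (simp add: S_def npchar_def)
  next
    case (Suc n)
    then show ?case using assms by (simp add: S_def npchar_def)
  qed
  have b: "\<bar>S n\<bar> \<le> real m" for n
  proof (induction n rule: less_induct)
    case (less n)
    show ?case
    proof (cases "n \<le> m")
      case True
      have "\<bar>S n\<bar> \<le> (\<Sum>k<n. \<bar>chi k\<bar>)" unfolding S_def by (rule sum_abs)
      also have "\<dots> \<le> (\<Sum>k<n. 1)" using assms by (intro sum_mono) (auto simp: npchar_def cmult_def)
      finally show ?thesis using True by simp
    next
      case False
      then have "S n = S (n - m)" using per[of "n - m"] by simp
      moreover have "n - m < n" using False assms by (auto simp: npchar_def)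
      ultimately show ?thesis using less.IH by simp
    qed
  qed
  show ?thesis
  proof (cases "M \<le> n")
    case True
    then have "(\<Sum>k\<in>{M..<n}. chi k) = S n - S M"
      unfolding S_def by (simp add: sum_diff_nat_ivl flip: atLeast0LessThan)
    then show ?thesis using b[of n] b[of M] by linarith
  qed simp
qed

lemma npchar_tail:
  assumes "npchar m chi" "s \<ge> 1" "M > 0"
  shows "\<bar>\<Sum>k\<in>{M..<n}. dser chi s k\<bar> \<le> 2 * real m / real M"
proof -
  have "\<bar>\<Sum>k\<in>{M..<n}. chi k * real k powr (-s)\<bar> \<le> 2 * real m * real M powr (-s)"
    using assms by (intro abel_bound npchar_sum_bound powr_mono2') auto
  also have "real M powr (-s) \<le> real M powr (-1)" using assms by (intro powr_mono) auto
  then have "2 * real m * real M powr (-s) \<le> 2 * real m * real M powr (-1)" by (intro mult_left_mono) auto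
  finally show ?thesis using assms(3) by (simp add: dser_def powr_minus field_simps)
qed

lemma npchar_summable:
  assumes "npchar m chi" "s \<ge> 1"
  shows "summable (dser chi s)"
  unfolding summable_Cauchy
proof (intro allI impI)
  fix e :: real assume e: "e > 0"
  obtain N :: nat where N: "2 * real m / e < real N" using reals_Archimedean2 by blast
  show "\<exists>N. \<forall>k\<ge>N. \<forall>n. norm (sum (dser chi s) {k..<n}) < e"
  proof (intro exI[of _ "Suc N"] allI impI)
    fix k n assume k: "k \<ge> Suc N"
    have "2 * real m < e * real N" using N e by (simp add: field_simps)
    also have "\<dots> \<le> e * real k" using k e by simp
    finally have "2 * real m / real k < e" using k by (simp add: field_simps)
    then show "norm (sum (dser chi s) {k..<n}) < e"
      using npchar_tail[OF assms, of k n] k by simp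
  qed
qed

lemma npchar_L_tail:
  assumes "npchar m chi" "s \<ge> 1" "M > 0"
  shows "\<bar>Lfun chi s - (\<Sum>k<M. dser chi s k)\<bar> \<le> 2 * real m / real M"
proof (rule LIMSEQ_le_const2)
  have "(\<lambda>n. \<Sum>k<n. dser chi s k) \<longlonglongrightarrow> Lfun chi s"
    unfolding Lfun_def by (rule summable_LIMSEQ[OF npchar_summable[OF assms(1,2)]])
  then show "(\<lambda>n. \<bar>(\<Sum>k<n. dser chi s k) - (\<Sum>k<M. dser chi s k)\<bar>) \<longlonglongrightarrow> \<bar>Lfun chi s - (\<Sum>k<M. dser chi s k)\<bar>"
    by (intro tendsto_intros)
  show "\<exists>N. \<forall>n\<ge>N. \<bar>(\<Sum>k<n. dser chi s k) - (\<Sum>k<M. dser chi s k)\<bar> \<le> 2 * real m / real M"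
  proof (intro exI[of _ M] allI impI)
    fix n assume "n \<ge> M"
    then have "(\<Sum>k<n. dser chi s k) - (\<Sum>k<M. dser chi s k) = (\<Sum>k\<in>{M..<n}. dser chi s k)"
      by (simp add: sum_diff_nat_ivl flip: atLeast0LessThan)
    then show "\<bar>(\<Sum>k<n. dser chi s k) - (\<Sum>k<M. dser chi s k)\<bar> \<le> 2 * real m / real M"
      using npchar_tail[OF assms] by simp
  qed
qed

text \<open>The tail bound is uniform in s \<ge> 1, so the limit is taken in a finite partial
  sum.\<close>

lemma npchar_L_tendsto:
  assumes "npchar m chi"
  shows "(Lfun chi \<longlongrightarrow> Lfun chi 1) (at_right 1)"
proof (rule tendstoI)
  fix e :: real assume e: "e > 0"
  obtain N :: nat where N: "6 * real m / e < real N" using reals_Archimedean2 by blast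
  define M where "M = Suc N"
  have M: "2 * real m / real M < e / 3" using N e by (simp add: M_def field_simps)
  have "((\<lambda>s. \<Sum>k<M. dser chi s k) \<longlongrightarrow> (\<Sum>k<M. dser chi 1 k)) (at_right 1)"
    unfolding dser_def
  proof (intro tendsto_sum tendsto_mult tendsto_const)
    fix k show "((\<lambda>s. real k powr - s) \<longlongrightarrow> real k powr - 1) (at_right 1)"
      by (cases "k = 0") (simp, intro tendsto_powr tendsto_intros, simp)
  qed
  then have "\<forall>\<^sub>F s in at_right 1. dist (\<Sum>k<M. dser chi s k) (\<Sum>k<M. dser chi 1 k) < e / 3"
    using e by (intro tendstoD) auto
  moreover have "\<forall>\<^sub>F s in at_right 1. (s::real) > 1" by (simp add: eventually_at_right_less)
  ultimately show "\<forall>\<^sub>F s in at_right 1. dist (Lfun chi s) (Lfun chi 1) < e"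
  proof eventually_elim
    case (elim s)
    have "\<bar>Lfun chi s - (\<Sum>k<M. dser chi s k)\<bar> < e / 3" "\<bar>Lfun chi 1 - (\<Sum>k<M. dser chi 1 k)\<bar> < e / 3"
      using npchar_L_tail[OF assms, of s M] npchar_L_tail[OF assms, of 1 M] elim M by (auto simp: M_def)
    then show ?case using elim(1) unfolding dist_real_def by linarith
  qed
qed

section \<open>Divisor sums and Lambert series of a real character\<close>

text \<open>The coefficients of the Dirichlet series zeta(s) L(s, chi).\<close>

definition dsum :: "(nat \<Rightarrow> real) \<Rightarrow> nat \<Rightarrow> real" where "dsum chi N = (\<Sum>d | d dvd N. chi d)"

lemma cmult_power: "cmult chi \<Longrightarrow> chi (p ^ i) = chi p ^ i"
  by (induction i) (auto simp: cmult_def)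

lemma prime_power_split:
  assumes "prime p" "n > (0::nat)"
  obtains a k where "n = p ^ a * k" "\<not> p dvd k" "k > 0"
proof -
  have "\<not> is_unit p" using assms(1) by (metis not_prime_unit)
  then obtain k where "n = p ^ multiplicity p n * k" "\<not> p dvd k"
    using multiplicity_decompose'[of n p] assms(2) by (metis neq0_conv)
  then show thesis using that[of "multiplicity p n" k] assms(2) by (metis mult_0_right neq0_conv)
qed

lemma prime_power_unique:
  assumes "prime p" "p ^ i * e = p ^ j * (f::nat)" "\<not> p dvd e" "\<not> p dvd f"
  shows "i = j" "e = f"
proof -
  have p0: "p \<noteq> 0" using assms(1) by auto
  have "multiplicity p (p ^ i * e) = i" if "\<not> p dvd e" for i and e :: nat
    using that p0 by (intro multiplicity_eqI) auto
  from this[OF assms(3), of i] this[OF assms(4), of j] show "i = j" using assms(2) by simp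
  then show "e = f" using assms(2) p0 by simp
qed

lemma dsum_prime_power:
  assumes "cmult chi" "prime p" "\<not> p dvd k" "k > 0"
  shows "dsum chi (p ^ a * k) = (\<Sum>i\<le>a. chi p ^ i) * dsum chi k"
proof -
  have co: "coprime (p ^ i) d" if "d dvd k" for i d
    using that assms(2,3) by (meson dvd_trans coprime_power_left_iff prime_imp_coprime)
  have nd: "\<not> p dvd d" if "d dvd k" for d using that assms(3) dvd_trans by blast
  have "bij_betw (\<lambda>(i, d). p ^ i * d) ({..a} \<times> {d. d dvd k}) {d. d dvd p ^ a * k}"
    unfolding bij_betw_def
  proof (intro conjI equalityI subsetI)
    show "inj_on (\<lambda>(i, d). p ^ i * d) ({..a} \<times> {d. d dvd k})"
    proof (rule inj_onI, clarify)
      fix i d j e assume "d dvd k" "e dvd k" "p ^ i * d = p ^ j * e"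
      then show "i = j \<and> d = e" using prime_power_unique[OF assms(2), of i d j e] nd by blast
    qed
    fix x assume "x \<in> (\<lambda>(i, d). p ^ i * d) ` ({..a} \<times> {d. d dvd k})"
    then show "x \<in> {d. d dvd p ^ a * k}" by (auto intro!: mult_dvd_mono le_imp_power_dvd)
  next
    fix x assume x: "x \<in> {d. d dvd p ^ a * k}"
    have "x > 0" using x dvd_pos_nat[of "p ^ a * k" x] assms(4) prime_gt_0_nat[OF assms(2)] by simp
    then obtain i d where d: "x = p ^ i * d" "\<not> p dvd d" using prime_power_split[OF assms(2)] by blast
    have "p ^ i dvd p ^ a * k" using x d(1) dvd_mult_left by blast
    then have "p ^ i dvd p ^ a" using co[of k i] by (simp add: coprime_dvd_mult_left_iff)
    then have "i \<le> a" using prime_gt_1_nat[OF assms(2)] by (simp add: power_dvd_imp_le)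
    moreover have "d dvd p ^ a * k" using x d(1) dvd_mult_right by blast
    moreover have "coprime d (p ^ a)" using prime_imp_coprime[OF assms(2) d(2)] by (subst coprime_commute) simp
    ultimately have "d dvd k" by (simp add: coprime_dvd_mult_right_iff)
    then show "x \<in> (\<lambda>(i, d). p ^ i * d) ` ({..a} \<times> {d. d dvd k})" using d(1) \<open>i \<le> a\<close> by auto
  qed
  from sum.reindex_bij_betw[OF this, of chi]
  have "dsum chi (p ^ a * k) = (\<Sum>(i, d)\<in>{..a} \<times> {d. d dvd k}. chi (p ^ i * d))"
    unfolding dsum_def by (simp add: case_prod_unfold)
  also have "\<dots> = (\<Sum>(i, d)\<in>{..a} \<times> {d. d dvd k}. chi p ^ i * chi d)"
    using assms(1) by (intro sum.cong) (auto simp: cmult_power cmult_def)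
  also have "\<dots> = (\<Sum>i\<le>a. chi p ^ i) * dsum chi k"
    unfolding dsum_def by (simp add: sum_product sum.cartesian_product)
  finally show ?thesis .
qed

lemma geometric_pm1:
  assumes "t \<in> {-1, 0, 1 :: real}"
  shows "(\<Sum>i\<le>a. t ^ i) \<ge> 0" "even a \<Longrightarrow> (\<Sum>i\<le>a. t ^ i) \<ge> 1"
proof -
  have m: "(\<Sum>i\<le>a. (-1::real) ^ i) = (if even a then 1 else 0)" for a by (induction a) auto
  have z: "(\<Sum>i\<le>a. (0::real) ^ i) = 1" for a by (induction a) auto
  show "(\<Sum>i\<le>a. t ^ i) \<ge> 0" "even a \<Longrightarrow> (\<Sum>i\<le>a. t ^ i) \<ge> 1" using assms m z by auto
qed

lemma dsum_nonneg:
  assumes "npchar m chi" "n > 0"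
  shows "dsum chi n \<ge> 0"
  using assms(2)
proof (induction n rule: less_induct)
  case (less n)
  have c: "cmult chi" using assms(1) by (simp add: npchar_def)
  show ?case
  proof (cases "n = 1")
    case True
    then show ?thesis using c by (simp add: dsum_def cmult_def)
  next
    case False
    then obtain p where p: "prime p" "p dvd n" using prime_factor_nat by blast
    obtain a k where k: "n = p ^ a * k" "\<not> p dvd k" "k > 0" using prime_power_split[OF p(1) less.prems] .
    have "a \<noteq> 0" using k p(2) by (metis mult_1 power_0)
    then have "p ^ a > 1" using prime_gt_1_nat[OF p(1)] by (intro one_less_power) auto
    then have "k < n" using k(1,3) by simp
    moreover have "chi p \<in> {-1, 0, 1}" using assms(1) by (simp add: npchar_def)
    moreover have "dsum chi n = (\<Sum>i\<le>a. chi p ^ i) * dsum chi k"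
      by (subst k(1)) (rule dsum_prime_power[OF c p(1) k(2,3)])
    ultimately show ?thesis using less.IH[of k] k(3) geometric_pm1(1)[of "chi p" a] by simp
  qed
qed

text \<open>All exponents in a square are even, so each local factor is a geometric sum with an odd
  number of terms in 1, 0 or -1 and is at least 1.\<close>

lemma dsum_square:
  assumes "npchar m chi" "n > 0"
  shows "dsum chi (n^2) \<ge> 1"
  using assms(2)
proof (induction n rule: less_induct)
  case (less n)
  have c: "cmult chi" using assms(1) by (simp add: npchar_def)
  show ?case
  proof (cases "n = 1")
    case True
    then show ?thesis using c by (simp add: dsum_def cmult_def)
  next
    case False
    then obtain p where p: "prime p" "p dvd n" using prime_factor_nat by blast
    obtain a k where k: "n = p ^ a * k" "\<not> p dvd k" "k > 0" using prime_power_split[OF p(1) less.prems] .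
    have "a \<noteq> 0" using k p(2) by (metis mult_1 power_0)
    then have "p ^ a > 1" using prime_gt_1_nat[OF p(1)] by (intro one_less_power) auto
    then have "k < n" using k(1,3) by simp
    moreover have "chi p \<in> {-1, 0, 1}" using assms(1) by (simp add: npchar_def)
    moreover have "n^2 = p ^ (2 * a) * k^2" unfolding k(1) by (simp add: power_mult_distrib power_mult[symmetric] mult.commute)
    moreover have "\<not> p dvd k^2" using k(2) p(1) by (simp add: prime_dvd_power_iff)
    ultimately show ?thesis
      using dsum_prime_power[OF c p(1), of "k^2" "2 * a"] less.IH[of k] k(3) geometric_pm1(2)[of "chi p" "2 * a"]
        mult_mono[of 1 "\<Sum>i\<le>2 * a. chi p ^ i" 1 "dsum chi (k^2)"] by auto
  qed
qed

text \<open>Terms of the Lambert series whose power series in x has the coefficients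
  \<open>dsum chi N\<close>.\<close>

definition lam :: "(nat \<Rightarrow> real) \<Rightarrow> real \<Rightarrow> nat \<Rightarrow> real" where
  "lam chi x n = chi n * (x ^ n / (1 - x ^ n))"

lemma lambert_geometric:
  assumes "0 < x" "x < (1::real)" "n > 0"
  shows "((\<lambda>j. x ^ (n * j)) has_sum (x ^ n / (1 - x ^ n))) {0<..}"
proof -
  define y where "y = x ^ n"
  have y: "0 < y" "y < 1" using assms by (auto simp: y_def power_less_one_iff)
  have "(\<lambda>j. y ^ j) sums (1 / (1 - y))" using geometric_sums[of y] y by simp
  then have "(\<lambda>j. y ^ Suc j) sums (1 / (1 - y) - 1)" by (subst sums_Suc_iff) simp
  moreover have "1 / (1 - y) - 1 = y / (1 - y)" using y by (simp add: field_simps)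
  ultimately have "(\<lambda>j. y ^ Suc j) sums (y / (1 - y))" by simp
  then have "((\<lambda>j. y ^ Suc j) has_sum (y / (1 - y))) UNIV"
    using y by (intro norm_summable_imp_has_sum) (auto simp: sums_iff)
  then have "((\<lambda>j. y ^ j) \<circ> Suc has_sum (y / (1 - y))) UNIV" by (simp add: o_def)
  then have "((\<lambda>j. y ^ j) has_sum (y / (1 - y))) (range Suc)" by (subst has_sum_reindex) auto
  moreover have "range Suc = {0<..}" by (auto simp: image_iff) (metis Suc_pred)
  ultimately show ?thesis by (simp add: y_def power_mult)
qed

lemma lambert_bound:
  assumes "0 < x" "x < (1::real)" "n > 0"
  shows "x ^ n / (1 - x ^ n) \<le> x ^ n / (1 - x)"
proof -
  have "x ^ n \<le> x ^ 1" using assms by (intro power_decreasing) auto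
  then show ?thesis using assms by (intro divide_left_mono mult_pos_pos) auto
qed

lemma lam_summable:
  assumes "cmult chi" "0 < x" "x < 1"
  shows "(\<lambda>n. x ^ n / (1 - x ^ n)) summable_on {0<..}" "lam chi x summable_on {0<..}"
proof -
  have "summable (\<lambda>n. x ^ n)" using assms by simp
  then have "(\<lambda>n. x ^ n) summable_on UNIV"
    using assms by (intro norm_summable_imp_summable_on) simp
  then have "(\<lambda>n. x ^ n * (1 / (1 - x))) summable_on UNIV" by (rule summable_on_cmult_left)
  then have 1: "(\<lambda>n. x ^ n / (1 - x)) summable_on {0<..}" using summable_on_subset_banach by fastforce
  show 2: "(\<lambda>n. x ^ n / (1 - x ^ n)) summable_on {0<..}"
    using assms by (intro summable_on_comparison_test[OF 1 lambert_bound]) (auto simp: power_le_one)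
  have "(\<lambda>n. norm (lam chi x n)) summable_on {0<..}"
  proof (rule summable_on_comparison_test[OF 2])
    fix n :: nat assume "n \<in> {0<..}"
    have "x ^ n / (1 - x ^ n) \<ge> 0" using assms by (simp add: power_le_one)
    moreover have "\<bar>chi n\<bar> \<le> 1" using assms(1) by (simp add: cmult_def)
    ultimately have "\<bar>chi n\<bar> * \<bar>x ^ n / (1 - x ^ n)\<bar> \<le> x ^ n / (1 - x ^ n)"
      using mult_right_mono[of "\<bar>chi n\<bar>" 1 "x ^ n / (1 - x ^ n)"] by (simp only: abs_of_nonneg mult_1)
    then show "norm (lam chi x n) \<le> x ^ n / (1 - x ^ n)"
      unfolding lam_def real_norm_def abs_mult .
  qed auto
  then show "lam chi x summable_on {0<..}" by (rule abs_summable_summable)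
qed

text \<open>Expanding each term as a geometric series and collecting powers of x gives the power
  series with coefficients \<open>dsum chi N\<close>. They are nonnegative, and at least 1 at
  squares.\<close>

lemma lambert_lower:
  assumes "npchar m chi" "0 < x" "x < 1"
  shows "(\<Sum>k=1..K. x ^ (k^2)) \<le> infsum (lam chi x) {0<..}"
proof -
  have c: "cmult chi" using assms(1) by (simp add: npchar_def)
  define h where "h = (\<lambda>(n, j). chi n * x ^ (n * j))"
  let ?P = "Sigma {0<..} (\<lambda>_::nat. {0<..}) :: (nat \<times> nat) set"
  let ?D = "Sigma {0<..} (\<lambda>N::nat. {d. d dvd N})"
  have pos: "(\<lambda>(n, j). x ^ (n * j)) summable_on ?P"
    using lambert_geometric[OF assms(2,3)] assms(2)
    by (intro summable_on_SigmaI[OF _ lam_summable(1)[OF c assms(2,3)]]) auto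
  have "(\<lambda>z. norm (h z)) summable_on ?P"
  proof (rule summable_on_comparison_test[OF pos])
    fix z assume "z \<in> ?P"
    have "\<bar>chi n\<bar> \<le> 1" for n using c by (simp add: cmult_def)
    then show "norm (h z) \<le> (case z of (n, j) \<Rightarrow> x ^ (n * j))"
      using assms(2) by (auto simp: h_def abs_mult split: prod.splits intro!: mult_left_le_one_le)
  qed auto
  then have hP: "h summable_on ?P" by (rule abs_summable_summable)
  \<comment> \<open>The exponent N = n j together with its divisor n replaces the pair (n,
    j).\<close>
  have bij: "bij_betw (\<lambda>(N, d). (d, N div d)) ?D ?P"
    by (rule bij_betwI[where g = "\<lambda>(n, j). (n * j, n)"]) (auto dest: dvd_pos_nat dvd_imp_le simp: div_greater_zero_iff)
  have hD: "(\<lambda>z. h ((\<lambda>(N, d). (d, N div d)) z)) summable_on ?D"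
    using hP summable_on_reindex_bij_betw[OF bij, of h] by simp
  have "infsum (lam chi x) {0<..} = infsum (\<lambda>n. infsum (\<lambda>j. h (n, j)) {0<..}) {0<..}"
  proof (rule infsum_cong)
    fix n :: nat assume "n \<in> {0<..}"
    then have "((\<lambda>j. chi n * x ^ (n * j)) has_sum lam chi x n) {0<..}"
      unfolding lam_def using lambert_geometric[OF assms(2,3), of n] by (intro has_sum_cmult_right) auto
    then show "lam chi x n = infsum (\<lambda>j. h (n, j)) {0<..}" by (simp add: h_def infsumI)
  qed
  also have "\<dots> = infsum h ?P" using infsum_Sigma'_banach[of "\<lambda>n j. h (n, j)"] hP by simp
  also have "\<dots> = infsum (\<lambda>z. h ((\<lambda>(N, d). (d, N div d)) z)) ?D"
    by (rule infsum_reindex_bij_betw[OF bij, symmetric])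
  also have "\<dots> = infsum (\<lambda>N. infsum (\<lambda>d. h (d, N div d)) {d. d dvd N}) {0<..}"
    using infsum_Sigma'_banach[of "\<lambda>N d. h (d, N div d)" "{0<..}" "\<lambda>N. {d. d dvd N}"] hD
    by (simp add: case_prod_unfold)
  also have "\<dots> = infsum (\<lambda>N. dsum chi N * x ^ N) {0<..}"
    by (intro infsum_cong) (auto simp: h_def dsum_def sum_distrib_right)
  finally have eq: "infsum (lam chi x) {0<..} = infsum (\<lambda>N. dsum chi N * x ^ N) {0<..}" .
  have sD: "(\<lambda>N. dsum chi N * x ^ N) summable_on {0<..}"
  proof -
    have "(\<lambda>N. infsum (\<lambda>d. h (d, N div d)) {d. d dvd N}) summable_on {0<..}"
      using summable_on_Sigma_banach[of "\<lambda>N d. h (d, N div d)" "{0<..}" "\<lambda>N. {d. d dvd N}"] hD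
      by (simp add: case_prod_unfold)
    then show ?thesis
      by (rule summable_on_cong[THEN iffD1, rotated]) (auto simp: h_def dsum_def sum_distrib_right)
  qed
  have "(\<Sum>k=1..K. x ^ (k^2)) \<le> (\<Sum>k=1..K. dsum chi (k^2) * x ^ (k^2))"
    using dsum_square[OF assms(1)] assms(2) by (intro sum_mono) (auto simp: mult_right_le_one_le intro!: mult_right_mono[of 1, simplified])
  also have "\<dots> = (\<Sum>N\<in>(\<lambda>k. k\<^sup>2) ` {1..K}. dsum chi N * x ^ N)"
    by (subst sum.reindex) (auto simp: inj_on_def)
  also have "\<dots> \<le> infsum (\<lambda>N. dsum chi N * x ^ N) {0<..}"
    using dsum_nonneg[OF assms(1)] assms(2) by (intro finite_sum_le_infsum sD) auto
  finally show ?thesis using eq by simp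
qed

text \<open>Monsky's comparison sequence; it decreases by the inequality of arithmetic and geometric means.\<close>

lemma geometric_amgm:
  assumes "0 \<le> y"
  shows "real n * y ^ (n - 1) \<le> (\<Sum>i<n. (y^2) ^ i)"
proof -
  have "(\<Sum>i<n. (y^2) ^ i) = (\<Sum>i<n. (y^2) ^ (n - Suc i))" by (rule sum.nat_diff_reindex[symmetric])
  then have "2 * (\<Sum>i<n. (y^2) ^ i) = (\<Sum>i<n. (y^2) ^ i + (y^2) ^ (n - Suc i))" by (simp add: sum.distrib)
  also have "\<dots> \<ge> (\<Sum>i<n. 2 * y ^ (n - 1))"
  proof (rule sum_mono)
    fix i assume "i \<in> {..<n}"
    then have "y ^ (n - 1) = y ^ i * y ^ (n - Suc i)" by (simp flip: power_add)
    moreover have "2 * (y ^ i * y ^ (n - Suc i)) \<le> (y ^ i)\<^sup>2 + (y ^ (n - Suc i))^2"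
      using sum_squares_bound[of "y ^ i" "y ^ (n - Suc i)"] by simp
    ultimately show "2 * y ^ (n - 1) \<le> (y^2) ^ i + (y^2) ^ (n - Suc i)" by (simp add: power_mult[symmetric] mult.commute)
  qed
  finally show ?thesis by simp
qed

definition monsky :: "real \<Rightarrow> nat \<Rightarrow> real" where
  "monsky x n = 1 / (real n * (1 - x)) - x ^ n / (1 - x ^ n)"

lemma monsky_decreasing:
  assumes "0 < x" "x < 1" "n > 0"
  shows "monsky x (Suc n) \<le> monsky x n" "0 \<le> monsky x n"
proof -
  define S where "S n = (\<Sum>i<n. x ^ i)" for n
  have S: "1 - x ^ n = (1 - x) * S n" for n
    unfolding S_def by (rule one_diff_power_eq)
  have Spos: "S n > 0" if "n > 0" for n
    unfolding S_def using assms that by (intro sum_pos) auto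
  \<comment> \<open>Multiplication by 1 - x removes the pole and leaves the geometric sums S n in
    the denominators.\<close>
  have form: "(1 - x) * monsky x n = 1 / real n - x ^ n / S n" if "n > 0" for n
    proof -
    have "(1 - x) * (1 / (real n * (1 - x))) = 1 / real n" "(1 - x) * (x ^ n / ((1 - x) * S n)) = x ^ n / S n"
      using Spos[OF that] that assms by simp_all
    then show ?thesis unfolding monsky_def S by (simp only: right_diff_distrib)
  qed
  \<comment> \<open>S n is a sum of even powers of y, so it is at least n y^(n - 1); the two bounds
    multiply to exponent 2 n - 1, just below that of x^n = y^(2 n).\<close>
  define y where "y = sqrt x"
  have y: "0 \<le> y" "y \<le> 1" "y^2 = x" using assms by (auto simp: y_def)
  have "real n * real (Suc n) * x ^ n \<le> S n * S (Suc n)"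
  proof -
    have "x ^ n = y ^ (n + n)" using y by (metis mult_2 power_mult)
    also have "\<dots> \<le> y ^ (n - 1 + n)" using y by (intro power_decreasing) auto
    finally have "real n * real (Suc n) * x ^ n \<le> (real n * y ^ (n - 1)) * (real (Suc n) * y ^ (Suc n - 1))"
      by (simp add: power_add mult_left_mono mult_ac)
    also have "\<dots> \<le> S n * S (Suc n)"
      unfolding S_def y(3)[symmetric] using y(1)
      by (intro mult_mono geometric_amgm) (auto intro!: sum_nonneg)
    finally show ?thesis .
  qed
  then have key: "x ^ n / (S n * S (Suc n)) \<le> 1 / (real n * real (Suc n))"
    using Spos[of n] Spos[of "Suc n"] assms(3) by (simp add: divide_simps mult_ac)
  have "x ^ n / S n - x ^ Suc n / S (Suc n) = x ^ n * (S (Suc n) - x * S n) / (S n * S (Suc n))"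
    using Spos[of n] Spos[of "Suc n"] assms(3) by (simp add: field_simps)
  also have "S (Suc n) - x * S n = 1"
    unfolding S_def by (simp only: sum.lessThan_Suc_shift sum_distrib_left) simp
  finally have "x ^ n / S n - x ^ Suc n / S (Suc n) \<le> 1 / (real n * real (Suc n))" using key by simp
  also have "\<dots> = 1 / real n - 1 / real (Suc n)" using assms(3) by (simp add: field_simps)
  finally have "(1 - x) * monsky x (Suc n) \<le> (1 - x) * monsky x n" using form assms(3) by simp
  then show "monsky x (Suc n) \<le> monsky x n" using assms by simp
  have "real n * x ^ n = (\<Sum>i<n. x ^ n)" by simp
  also have "\<dots> \<le> S n" unfolding S_def using assms by (intro sum_mono power_decreasing) auto
  finally have "x ^ n / S n \<le> 1 / real n" using Spos[OF assms(3)] assms(3) by (simp add: field_simps)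
  then have "0 \<le> (1 - x) * monsky x n" using form assms(3) by simp
  then show "0 \<le> monsky x n" using assms by (simp add: zero_le_mult_iff)
qed

text \<open>If L(1) = 0, the Lambert series equals minus the sum of
  \<open>chi n * monsky x n\<close>, which summation by parts bounds by 2 m for all x < 1. Its terms
  at squares alone exceed this bound as x tends to 1.\<close>

lemma npchar_L1_nonzero:
  assumes "npchar m chi"
  shows "Lfun chi 1 \<noteq> 0"
proof
  assume L: "Lfun chi 1 = 0"
  have c: "cmult chi" using assms by (simp add: npchar_def)
  have up: "infsum (lam chi x) {0<..} \<le> 2 * real m" if x: "0 < x" "x < 1" for x
  proof -
    \<comment> \<open>The first summand adds up to L(1) / (1 - x), which is 0 by assumption.\<close>
    have e: "lam chi x n = dser chi 1 n * (1 / (1 - x)) - chi n * (if n = 0 then 0 else monsky x n)" for n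
      using x by (simp add: lam_def dser_def monsky_def powr_minus field_simps)
    have "lam chi x sums infsum (lam chi x) UNIV"
    proof (rule has_sum_imp_sums, rule has_sum_infsum)
      show "lam chi x summable_on UNIV"
        using lam_summable(2)[OF c x] by (rule summable_on_cong_neutral[THEN iffD1, rotated -1]) (auto simp: lam_def)
    qed
    moreover have "infsum (lam chi x) UNIV = infsum (lam chi x) {0<..}"
      by (rule infsum_cong_neutral) (auto simp: lam_def)
    moreover have "(\<lambda>n. dser chi 1 n * (1 / (1 - x))) sums (0 * (1 / (1 - x)))"
      using summable_sums[OF npchar_summable[OF assms, of 1]] L unfolding Lfun_def by (intro sums_mult2) simp
    ultimately have "(\<lambda>n. dser chi 1 n * (1 / (1 - x)) - lam chi x n) sums (0 - infsum (lam chi x) {0<..})"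
      by (intro sums_diff) auto
    then have "(\<lambda>n. chi n * (if n = 0 then 0 else monsky x n)) sums (- infsum (lam chi x) {0<..})"
      unfolding e by simp
    then have lim: "(\<lambda>N. \<Sum>n<N. chi n * (if n = 0 then 0 else monsky x n)) \<longlonglongrightarrow> - infsum (lam chi x) {0<..}"
      by (simp add: sums_def)
    have "- (2 * real m) \<le> (\<Sum>n<N. chi n * (if n = 0 then 0 else monsky x n))" for N
    proof -
      have "(\<Sum>n<N. chi n * (if n = 0 then 0 else monsky x n)) = (\<Sum>n\<in>{1..<N}. chi n * monsky x n)"
        by (intro sum.mono_neutral_cong_right) auto
      moreover have "\<bar>\<Sum>n\<in>{1..<N}. chi n * monsky x n\<bar> \<le> 2 * real m * monsky x 1"
        using x by (intro abel_bound npchar_sum_bound[OF assms] monsky_decreasing) auto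
      moreover have "monsky x 1 = 1" using x by (simp add: monsky_def field_simps)
      ultimately have "\<bar>\<Sum>n<N. chi n * (if n = 0 then 0 else monsky x n)\<bar> \<le> 2 * real m" by (metis mult.right_neutral)
      then show ?thesis by (rule abs_le_D2[THEN le_imp_neg_le, simplified])
    qed
    then have "- (2 * real m) \<le> - infsum (lam chi x) {0<..}" by (intro LIMSEQ_le_const[OF lim]) auto
    then show ?thesis by simp
  qed
  \<comment> \<open>At x = 1 the first K square terms add up to K, one more than the bound 2
    m.\<close>
  define K where "K = 2 * m + 1"
  have "((\<lambda>x. \<Sum>k=1..K. x ^ (k^2)) \<longlongrightarrow> (\<Sum>k=1..K. 1 ^ (k^2))) (at_left (1::real))"
    by (intro tendsto_intros)
  then have "\<forall>\<^sub>F x in at_left (1::real). (\<Sum>k=1..K. x ^ (k^2)) > 2 * real m"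
    by (rule order_tendstoD) (simp add: K_def)
  moreover have "\<forall>\<^sub>F x in at_left (1::real). 0 < x"
    by (rule eventually_at_leftI[of 0]) auto
  moreover have "\<forall>\<^sub>F x in at_left (1::real). x < 1" by (rule eventually_at_leftI[of 0]) auto
  ultimately have "\<forall>\<^sub>F x in at_left (1::real). False"
  proof eventually_elim
    case (elim x)
    then show ?case using lambert_lower[OF assms, of x K] up[of x] by linarith
  qed
  then show False by simp
qed

section \<open>Character sums over primes\<close>

lemma npchar_psum_bounded:
  assumes "npchar m chi"
  shows "\<exists>B. \<forall>\<^sub>F s in at_right 1. \<forall>\<^sub>F N in sequentially. \<bar>psum chi s N\<bar> \<le> B"
proof -
  have c: "cmult chi" using assms by (simp add: npchar_def)
  have gt: "\<forall>\<^sub>F s in at_right 1. (s::real) > 1" by (simp add: eventually_at_right_less)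
  have "Lfun chi 1 \<ge> 0"
    by (rule tendsto_lowerbound[OF npchar_L_tendsto[OF assms]])
      (use gt psum_ln_L(1)[OF c] in \<open>auto elim!: eventually_mono intro: less_imp_le\<close>)
  then have "Lfun chi 1 > 0" using npchar_L1_nonzero[OF assms] by simp
  then have "((\<lambda>s. ln (Lfun chi s)) \<longlongrightarrow> ln (Lfun chi 1)) (at_right 1)"
    by (intro tendsto_ln npchar_L_tendsto[OF assms]) auto
  then have "\<forall>\<^sub>F s in at_right 1. dist (ln (Lfun chi s)) (ln (Lfun chi 1)) < 1" by (intro tendstoD) auto
  then have "\<forall>\<^sub>F s in at_right 1. \<forall>\<^sub>F N in sequentially. \<bar>psum chi s N\<bar> \<le> C0 + \<bar>ln (Lfun chi 1)\<bar> + 1"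
    using gt
  proof eventually_elim
    case (elim s)
    show ?case using psum_ln_L(2)[OF c elim(2)]
      by eventually_elim (use elim(1) in \<open>unfold dist_real_def; linarith\<close>)
  qed
  then show ?thesis by blast
qed

text \<open>The zeta function exceeds each partial sum of its series, and these tend to harmonic
  numbers as s tends to 1.\<close>

lemma psum_1_unbounded:
  "\<forall>\<^sub>F s in at_right 1. \<forall>\<^sub>F N in sequentially. psum (\<lambda>_. 1) s N \<ge> B"
proof -
  have c: "cmult (\<lambda>_. 1)" by (simp add: cmult_def)
  obtain K where K: "exp (B + C0) + 1 \<le> (harm K :: real)"
    using harm_at_top unfolding filterlim_at_top eventually_sequentially by blast
  have "((\<lambda>s. \<Sum>n=1..K. real n powr (-s)) \<longlongrightarrow> (\<Sum>n=1..K. real n powr (-1))) (at_right 1)"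
    by (intro tendsto_sum tendsto_powr tendsto_intros) auto
  moreover have "(\<Sum>n=1..K. real n powr (-1)) = harm K"
    unfolding harm_def by (intro sum.cong) (auto simp: powr_minus)
  ultimately have "\<forall>\<^sub>F s in at_right 1. (\<Sum>n=1..K. real n powr (-s)) > exp (B + C0)"
    using K by (intro order_tendstoD(1)) auto
  moreover have "\<forall>\<^sub>F s in at_right 1. (s::real) > 1" by (simp add: eventually_at_right_less)
  ultimately show ?thesis
  proof eventually_elim
    case (elim s)
    have "(\<Sum>n=1..K. real n powr (-s)) \<le> Lfun (\<lambda>_. 1) s"
      unfolding Lfun_def using sum_le_suminf[OF powr_summable[OF elim(2)], of "{1..K}"] by (simp add: dser_def[abs_def])
    then have "exp (B + C0) \<le> Lfun (\<lambda>_. 1) s" using elim(1) by linarith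
    then have "B + C0 \<le> ln (Lfun (\<lambda>_. 1) s)" using psum_ln_L(1)[OF c elim(2)] by (subst ln_ge_iff) auto
    then show ?case using psum_ln_L(2)[OF c elim(2)] by (auto elim!: eventually_mono)
  qed
qed

theorem sum_inverse_primes_diverges:
  "filterlim (\<lambda>N. \<Sum>p\<in>primes_le N. 1 / real p) at_top sequentially"
  unfolding filterlim_at_top
proof
  fix B :: real
  have "\<forall>\<^sub>F s in at_right 1. (s::real) > 1" by (simp add: eventually_at_right_less)
  with psum_1_unbounded[of B]
  have "\<forall>\<^sub>F s in at_right (1::real). s > 1 \<and> (\<forall>\<^sub>F N in sequentially. psum (\<lambda>_. 1) s N \<ge> B)"
    by eventually_elim auto
  from eventually_happens'[OF trivial_limit_at_right_real this]
  obtain s :: real where s: "s > 1" "\<forall>\<^sub>F N in sequentially. psum (\<lambda>_. 1) s N \<ge> B" by blast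
  show "\<forall>\<^sub>F N in sequentially. B \<le> (\<Sum>p\<in>primes_le N. 1 / real p)"
    using s(2)
  proof eventually_elim
    case (elim N)
    have "psum (\<lambda>_. 1) s N \<le> (\<Sum>p\<in>primes_le N. 1 / real p)"
      unfolding psum_def dser_def
    proof (rule sum_mono)
      fix p assume "p \<in> primes_le N"
      then have p: "real p \<ge> 1" by (auto simp: primes_le_def dest: prime_gt_0_nat)
      then have "real p powr (-s) \<le> real p powr (-1)" using s(1) by (intro powr_mono) auto
      then show "1 * real p powr - s \<le> 1 / real p" using p by (simp add: powr_minus field_simps)
    qed
    then show ?case using elim by linarith
  qed
qed

text \<open>The product of 1 + e i chi i(p) vanishes off the wanted primes and the divisors of m,
  and expands into a sum over subsets of I. By \<open>np\<close>, the independence of the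
  characters, only the empty subset gives an unbounded sum over primes; finitely many wanted primes
  could not account for it.\<close>

theorem primes_with_characters:
  fixes chi :: "'i \<Rightarrow> nat \<Rightarrow> real"
  assumes I: "finite I"
    and np: "\<And>T. T \<subseteq> I \<Longrightarrow> T \<noteq> {} \<Longrightarrow> npchar m (\<lambda>n. \<Prod>i\<in>T. chi i n)"
    and z: "\<And>i p. i \<in> I \<Longrightarrow> prime p \<Longrightarrow> chi i p = 0 \<Longrightarrow> p dvd m" and "m > 0"
    and e: "\<And>i. i \<in> I \<Longrightarrow> e i \<in> {-1, 1 :: real}"
  shows "infinite {p. prime p \<and> (\<forall>i\<in>I. chi i p = e i)}"
proof
  let ?Q = "{p. prime p \<and> (\<forall>i\<in>I. chi i p = e i)}"
  assume fin: "finite ?Q"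
  \<comment> \<open>The divisors of m are included because there a character may vanish without
    being -e i.\<close>
  define Z where "Z = ?Q \<union> {p. p dvd m}"
  have Z: "finite Z" using fin \<open>m > 0\<close> by (simp add: Z_def)
  define X where "X T = (\<lambda>n. \<Prod>i\<in>T. chi i n)" for T
  define w where "w p = (\<Prod>i\<in>I. e i * chi i p + 1)" for p
  have val: "chi i n \<in> {-1, 0, 1}" if "i \<in> I" for i n
    using np[of "{i}"] that by (simp add: npchar_def)
  have w_exp: "w p = (\<Sum>T\<in>Pow I. (\<Prod>i\<in>T. e i) * X T p)" for p
    unfolding w_def prod_add[OF I] X_def by (simp add: prod.distrib)
  have w0: "w p = 0" if "prime p" "p \<notin> Z" for p
  proof -
    have "p \<notin> ?Q" using that(2) unfolding Z_def by blast
    then have "\<exists>i\<in>I. chi i p \<noteq> e i" using that(1) by simp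
    then obtain i where i: "i \<in> I" "chi i p \<noteq> e i" by blast
    moreover have "chi i p \<noteq> 0" using z[OF i(1) that(1)] that(2) by (auto simp: Z_def)
    ultimately have "e i * chi i p + 1 = 0" using val[OF i(1), of p] e[OF i(1)] by auto
    then show ?thesis unfolding w_def using I i(1) by (subst prod_zero_iff) auto
  qed
  have w2: "0 \<le> w p \<and> w p \<le> 2 ^ card I" for p
  proof -
    have "0 \<le> e i * chi i p + 1 \<and> e i * chi i p + 1 \<le> 2" if "i \<in> I" for i using val[OF that, of p] e[OF that] by auto
    then show ?thesis unfolding w_def using prod_mono[of I "\<lambda>i. e i * chi i p + 1" "\<lambda>_. 2"]
        prod_nonneg[of I "\<lambda>i. e i * chi i p + 1"] by auto
  qed
  have up: "(\<Sum>p\<in>primes_le N. w p * real p powr (-s)) \<le> 2 ^ card I * real (card Z)" if "s > 1" for s N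
  proof -
    have "(\<Sum>p\<in>primes_le N. w p * real p powr (-s)) = (\<Sum>p\<in>primes_le N \<inter> Z. w p * real p powr (-s))"
      using w0 by (intro sum.mono_neutral_right) (auto simp: primes_le_def)
    also have "\<dots> \<le> (\<Sum>p\<in>primes_le N \<inter> Z. 2 ^ card I * 1)"
    proof (intro sum_mono mult_mono)
      fix p assume "p \<in> primes_le N \<inter> Z"
      then have p: "real p \<ge> 1" by (auto simp: primes_le_def dest: prime_gt_0_nat)
      then have "real p powr (-s) \<le> real p powr 0" using that by (intro powr_mono) auto
      then show "real p powr (-s) \<le> 1" using p by simp
    qed (use w2 in auto)
    also have "\<dots> = 2 ^ card I * real (card (primes_le N \<inter> Z))" by simp
    also have "\<dots> \<le> 2 ^ card I * real (card Z)" using Z by (intro mult_left_mono) (auto intro: card_mono)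
    finally show ?thesis .
  qed
  have "\<forall>T\<in>Pow I - {{}}. \<exists>B. \<forall>\<^sub>F s in at_right 1. \<forall>\<^sub>F N in sequentially. \<bar>psum (X T) s N\<bar> \<le> B"
    using npchar_psum_bounded[OF np] unfolding X_def by blast
  then obtain B where B: "\<And>T. T \<in> Pow I - {{}} \<Longrightarrow> \<forall>\<^sub>F s in at_right 1. \<forall>\<^sub>F N in sequentially. \<bar>psum (X T) s N\<bar> \<le> B T"
    by metis
  have "\<forall>\<^sub>F s in at_right 1. \<forall>T\<in>Pow I - {{}}. \<forall>\<^sub>F N in sequentially. \<bar>psum (X T) s N\<bar> \<le> B T"
    using B I by (intro eventually_ball_finite) auto
  moreover define b where "b = 2 ^ card I * real (card Z) + (\<Sum>T\<in>Pow I - {{}}. B T) + 1"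
  have "\<forall>\<^sub>F s in at_right 1. \<forall>\<^sub>F N in sequentially. psum (\<lambda>_. 1) s N \<ge> b" by (rule psum_1_unbounded)
  moreover have "\<forall>\<^sub>F s in at_right 1. (s::real) > 1" by (simp add: eventually_at_right_less)
  ultimately have "\<forall>\<^sub>F s in at_right (1::real). False"
  proof eventually_elim
    case (elim s)
    have "\<forall>\<^sub>F N in sequentially. \<forall>T\<in>Pow I - {{}}. \<bar>psum (X T) s N\<bar> \<le> B T"
      using elim(1) I by (intro eventually_ball_finite) auto
    with elim(2) have "\<forall>\<^sub>F N in sequentially. False"
    proof eventually_elim
      case (elim N)
      have "(\<Sum>p\<in>primes_le N. w p * real p powr (-s)) = (\<Sum>T\<in>Pow I. (\<Prod>i\<in>T. e i) * psum (X T) s N)"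
        unfolding w_exp psum_def dser_def sum_distrib_right sum_distrib_left
        by (subst sum.swap) (simp add: mult.assoc)
      also have "\<dots> = psum (\<lambda>_. 1) s N + (\<Sum>T\<in>Pow I - {{}}. (\<Prod>i\<in>T. e i) * psum (X T) s N)"
        using I by (subst sum.remove[of _ "{}"]) (auto simp: X_def)
      finally have 1: "psum (\<lambda>_. 1) s N + (\<Sum>T\<in>Pow I - {{}}. (\<Prod>i\<in>T. e i) * psum (X T) s N) \<le> 2 ^ card I * real (card Z)"
        using up[OF \<open>1 < s\<close>, of N] by simp
      have "\<bar>\<Sum>T\<in>Pow I - {{}}. (\<Prod>i\<in>T. e i) * psum (X T) s N\<bar> \<le> (\<Sum>T\<in>Pow I - {{}}. B T)"
      proof (intro order_trans[OF sum_abs] sum_mono)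
        fix T assume T: "T \<in> Pow I - {{}}"
        have "\<bar>e i\<bar> = 1" if "i \<in> T" for i
        proof -
          have "i \<in> I" using T that by blast
          from e[OF this] show ?thesis by auto
        qed
        then have "\<bar>\<Prod>i\<in>T. e i\<bar> = 1" unfolding abs_prod by (intro prod.neutral) blast
        then show "\<bar>(\<Prod>i\<in>T. e i) * psum (X T) s N\<bar> \<le> B T" using elim(2) T by (simp add: abs_mult)
      qed
      then show ?case using 1 elim(1) unfolding b_def by linarith
    qed
    then show ?case by simp
  qed
  then show False by simp
qed

section \<open>Primes with prescribed quadratic symbols\<close>

text \<open>Otherwise squaring would map the nonzero residues onto themselves, hence injectively;
  but 1 and -1 have the same square.\<close>

lemma exists_nonresidue:
  assumes "prime p" "p > 2"
  shows "\<exists>a. \<not> int p dvd a \<and> Legendre a (int p) = -1"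
proof (rule ccontr)
  assume "\<nexists>a. \<not> int p dvd a \<and> Legendre a (int p) = -1"
  then have L: "Legendre a p = 1" if "\<not> int p dvd a" for a using Legendre_values[OF that] that by blast
  define A where "A = {0<..<int p}"
  define f where "f x = x^2 mod int p" for x :: int
  have pp: "int p > 2" using assms(2) by simp
  have nd: "\<not> int p dvd x" if "x \<in> A" for x using that by (auto simp: A_def zdvd_not_zless)
  have "A \<subseteq> f ` A"
  proof
    fix a assume a: "a \<in> A"
    then have "QuadRes p a" using L[OF nd[OF a]] nd[OF a] by (auto simp: Legendre_def cong_0_iff split: if_splits)
    then obtain y where y: "[y\<^sup>2 = a] (mod int p)" by (auto simp: QuadRes_def)
    have "f (y mod p) = a" using y a by (simp add: f_def power_mod A_def unique_euclidean_semiring_class.cong_def)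
    moreover have "\<not> int p dvd y"
      using y nd[OF a] by (metis cong_dvd_iff dvd_power zero_less_numeral dvd_trans)
    then have "y mod p \<in> A"
      using pp pos_mod_bound[of "int p" y] pos_mod_sign[of "int p" y] unfolding A_def dvd_eq_mod_eq_0 greaterThanLessThan_iff by linarith
    ultimately show "a \<in> f ` A" by blast
  qed
  moreover have "finite A" by (simp add: A_def)
  ultimately have "inj_on f A" by (meson finite_surj_inj)
  moreover have "f 1 = f (int p - 1)"
  proof -
    have "(int p - 1)^2 = 1 + int p * (int p - 2)" by (simp add: power2_eq_square algebra_simps)
    then show ?thesis by (simp add: f_def)
  qed
  moreover have "1 \<in> A" "int p - 1 \<in> A" using pp by (auto simp: A_def)
  ultimately have "1 = int p - 1" by (rule inj_onD)
  then show False using pp by simp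
qed

lemma crt_primes:
  fixes f :: "nat \<Rightarrow> int"
  assumes "finite S" "\<And>p. p \<in> S \<Longrightarrow> prime p"
  shows "\<exists>x. \<forall>p\<in>S. [x = f p] (mod int p ^ K)"
  using assms
proof (induction S rule: finite_induct)
  case (insert p S)
  then obtain x where x: "\<forall>q\<in>S. [x = f q] (mod int q ^ K)" by auto
  have "coprime (int p) (int q)" if "q \<in> S" for q
  proof -
    have "p \<noteq> q" using that insert.hyps by auto
    then show ?thesis using insert.prems that by (simp add: primes_coprime)
  qed
  then have "coprime (int p ^ K) (\<Prod>q\<in>S. int q ^ K)" by (intro prod_coprime_right) simp
  from binary_chinese_remainder_int[OF this, of "f p" x]
  obtain y where y: "[y = f p] (mod int p ^ K)" "[y = x] (mod (\<Prod>q\<in>S. int q ^ K))" by auto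
  have "[y = f q] (mod int q ^ K)" if "q \<in> S" for q
  proof -
    have "int q ^ K dvd (\<Prod>q\<in>S. int q ^ K)" using that insert.hyps(1) by (intro dvd_prodI)
    then have "[y = x] (mod int q ^ K)" using y(2) cong_dvd_modulus by blast
    then show ?thesis using x that cong_trans by blast
  qed
  then show ?case using y(1) by (intro exI[of _ y]) auto
qed simp

text \<open>The indices 2 and 4 are free, since no odd prime has these values. They name the
  characters of -1 and of 2, which together determine an odd n modulo 8.\<close>

definition qchar :: "nat \<Rightarrow> nat \<Rightarrow> real" where
  "qchar i n = real_of_int
    (if i = 2 then (if even n then 0 else if n mod 4 = 3 then -1 else 1)
     else if i = 4 then (if even n then 0 else chi8 (int n))
     else Legendre (int n) (int i))"

lemma qchar_values: "qchar i n \<in> {-1, 0, 1}"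
  by (auto simp: qchar_def chi8_def Legendre_def)

lemma qchar_mult:
  assumes "i = 2 \<or> i = 4 \<or> (prime i \<and> i > 2)"
  shows "qchar i (a * b) = qchar i a * qchar i b"
proof -
  consider "i = 2" | "i = 4" | "i \<noteq> 2" "i \<noteq> 4" "prime i" "i > 2" using assms by auto
  then show ?thesis
  proof cases
    case 1
    have "(a * b) mod 4 = (a mod 4) * (b mod 4) mod 4" by (simp add: mod_mult_eq)
    moreover have "a mod 4 = 1 \<or> a mod 4 = 3 \<or> even a" "b mod 4 = 1 \<or> b mod 4 = 3 \<or> even b" by presburger+
    ultimately show ?thesis using 1 by (elim disjE) (simp_all add: qchar_def)
  next
    case 2
    then show ?thesis using chi8_mult[of "int a" "int b"] by (auto simp: qchar_def)
  qed (auto simp: qchar_def Legendre_mult)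
qed

lemma qchar_1:
  assumes "i = 2 \<or> i = 4 \<or> (prime i \<and> i > 2)" shows "qchar i 1 = 1"
  using assms Legendre_square[of i 1] prime_not_dvd_1[of i] by (auto simp: qchar_def chi8_def)

lemma qchar_period:
  assumes "i = 2 \<or> i = 4 \<or> (prime i \<and> i > 2)" "int i dvd int m" "8 dvd m"
  shows "qchar i (a + m) = qchar i a"
proof -
  obtain k where k: "m = 8 * k" using assms(3) by auto
  have "(a + m) mod 4 = a mod 4" unfolding k by presburger
  moreover have "even (a + m) = even a" unfolding k by simp
  moreover have "int (a + m) mod 8 = int a mod 8" unfolding k by (simp add: mod_add_right_eq[symmetric])
  moreover have "[int (a + m) = int a] (mod int i)" using assms(2) by (simp add: cong_iff_dvd_diff)
  then have "Legendre (int (a + m)) (int i) = Legendre (int a) (int i)" by (rule Legendre_cong_mod)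
  ultimately show ?thesis by (simp only: qchar_def chi8_def)
qed

lemma qchar_zero:
  assumes "i = 2 \<or> i = 4 \<or> (prime i \<and> i > 2)" "prime p" "qchar i p = 0"
  shows "p = 2 \<or> p = i"
proof -
  consider "i = 2 \<or> i = 4" | "i \<noteq> 2" "i \<noteq> 4" "prime i" using assms by auto
  then show ?thesis
  proof cases
    case 1
    then have "even p" using assms(3) by (auto simp: qchar_def chi8_def split: if_splits)
    then show ?thesis using assms(2) prime_dvd_prime_iff[of 2 p] by auto
  next
    case 2
    then have "int i dvd int p" using assms(3) by (auto simp: qchar_def Legendre_def cong_0_iff split: if_splits)
    then show ?thesis using 2 assms(2) prime_dvd_prime_int[of i p] by auto
  qed
qed

text \<open>Multiplication by a permutes the residues and reverses the sign of the sum.\<close>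

lemma sum_zero_of_twist:
  fixes chi :: "nat \<Rightarrow> real"
  assumes "m > 0" "\<And>a b. chi (a * b) = chi a * chi b" "\<And>a. chi (a + m) = chi a" "coprime a m" "chi a = -1"
  shows "(\<Sum>x<m. chi x) = 0"
proof -
  have per: "chi (x mod m) = chi x" for x
  proof (induction x rule: less_induct)
    case (less x)
    show ?case
    proof (cases "x < m")
      case False
      then have "chi ((x - m) mod m) = chi (x - m)" using less.IH[of "x - m"] assms(1) by simp
      then show ?thesis using False assms(3)[of "x - m"] by (simp add: mod_if[of x])
    qed simp
  qed
  have "bij_betw (\<lambda>x. a * x mod m) {..<m} {..<m}"
  proof (rule bij_betw_imageI)
    show inj: "inj_on (\<lambda>x. a * x mod m) {..<m}"
    proof (rule inj_onI)
      fix x y assume xy: "x \<in> {..<m}" "y \<in> {..<m}" "a * x mod m = a * y mod m"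
      then have "[a * x = a * y] (mod m)" by (simp add: unique_euclidean_semiring_class.cong_def)
      then have "[x = y] (mod m)" using assms(4) cong_mult_lcancel_nat by blast
      then show "x = y" using xy by (simp add: unique_euclidean_semiring_class.cong_def)
    qed
    have "(\<lambda>x. a * x mod m) ` {..<m} \<subseteq> {..<m}" using assms(1) by auto
    then show "(\<lambda>x. a * x mod m) ` {..<m} = {..<m}" using inj by (intro endo_inj_surj) auto
  qed
  from sum.reindex_bij_betw[OF this, of chi] have "(\<Sum>x<m. chi (a * x)) = (\<Sum>x<m. chi x)" by (simp add: per)
  then show ?thesis using assms(5) by (simp add: assms(2) sum_negf)
qed

text \<open>What has to be shown is independence: a product over any nonempty set of these
  characters takes the value -1 at some number coprime to m. The Chinese remainder theorem supplies
  that number, concentrated at one odd prime of the set or, if there is none, at 8.\<close>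

theorem primes_with_quadratic_symbols:
  assumes "finite P" "\<And>p. p \<in> P \<Longrightarrow> prime p \<and> p > 2" "\<And>p. p \<in> P \<Longrightarrow> e p \<in> {-1, 1 :: int}" "odd r"
  shows "infinite {q. prime q \<and> (\<forall>p\<in>P. Legendre (int q) (int p) = e p) \<and> int q mod 8 = r mod 8}"
proof -
  define I where "I = P \<union> {2, 4}"
  define m where "m = 8 * (\<Prod>p\<in>P. p)"
  have I: "i = 2 \<or> i = 4 \<or> (prime i \<and> i > 2)" if "i \<in> I" for i using that assms(2) by (auto simp: I_def)
  have P24: "2 \<notin> P" "4 \<notin> P" using assms(2)[of 2] assms(2)[of 4] by auto
  have m0: "m > 0" using assms(2) by (auto simp: m_def intro!: prod_pos dest: prime_gt_0_nat)
  have dm: "int i dvd int m" if "i \<in> I" for i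
  proof -
    have "i dvd m"
    proof (cases "i \<in> P")
      case True
      then show ?thesis using assms(1) unfolding m_def by (meson dvd_mult dvd_prodI)
    next
      case False
      then have "i = 2 \<or> i = 4" using that by (auto simp: I_def)
      then have "i dvd 8" by auto
      then show ?thesis unfolding m_def by (rule dvd_mult2)
    qed
    then show ?thesis by simp
  qed
  have d8: "8 dvd m" by (simp add: m_def)
  have "npchar m (\<lambda>n. \<Prod>i\<in>T. qchar i n)" if T: "T \<subseteq> I" "T \<noteq> {}" for T
  proof -
    let ?f = "\<lambda>n. \<Prod>i\<in>T. qchar i n"
    have fT: "finite T" using T assms(1) by (auto simp: I_def intro: finite_subset)
    have mult: "?f (a * b) = ?f a * ?f b" for a b
      using T I by (subst prod.distrib[symmetric]) (intro prod.cong qchar_mult; blast)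
    have per: "?f (a + m) = ?f a" for a
      using T I dm d8 by (intro prod.cong qchar_period; blast)
    have one: "?f 1 = 1" using T I by (intro prod.neutral ballI qchar_1) blast
    have val: "?f n \<in> {-1, 0, 1}" for n
      using fT by (induction T rule: finite_induct) (use qchar_values in \<open>force+\<close>)
    have "\<exists>a. coprime a m \<and> ?f a = -1"
    proof -
      have ex: "\<exists>a. coprime a m \<and> [a = b] (mod l) \<and> (\<forall>i\<in>I'. [a = 1] (mod i))"
        if H: "m = l * k" "coprime l k" "coprime b l" "\<forall>i\<in>I'. i dvd k" for b l k and I' :: "nat set"
      proof -
        obtain a where a: "[a = b] (mod l)" "[a = 1] (mod k)"
          using binary_chinese_remainder_nat[OF H(2), of b 1] by auto
        have "coprime a l" "coprime a k"
          using a H(3) by (auto simp: coprime_cong_cong_left[OF a(1)] coprime_cong_cong_left[OF a(2)])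
        then show ?thesis using a H by (intro exI[of _ a]) (auto intro: cong_dvd_modulus_nat)
      qed
      have c1: "qchar i a = 1" if "i \<in> P" "[a = 1] (mod i)" for i a
      proof -
        have "[int a = 1] (mod int i)" using that(2) by (metis cong_int_iff of_nat_1)
        then have "Legendre (int a) (int i) = Legendre 1 (int i)" by (rule Legendre_cong_mod)
        also have "\<dots> = 1" using Legendre_square[of i 1] assms(2)[OF that(1)] prime_not_dvd_1[of i] by simp
        finally show ?thesis using that(1) P24 by (auto simp: qchar_def)
      qed
      show ?thesis
      proof (cases "T \<inter> P = {}")
        case True
        \<comment> \<open>5 is 1 modulo 4 and has \<open>chi8\<close> equal to -1, which serves both
          sets containing 4; 3 serves the set {2}.\<close>
        define b where "b = (if 4 \<in> T then 5 else 3 :: nat)"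
        have "odd p" if "p \<in> P" for p using assms(2)[OF that] prime_odd_nat by auto
        then have "coprime (8::nat) (\<Prod>p\<in>P. p)"
          using assms(1) by (intro prod_coprime_right) (metis coprime_power_left_iff coprime_left_2_iff_odd numeral_eq_Suc power2_eq_square mult_2 coprime_commute odd_one coprime_mult_left_iff Num.numeral_Bit0 one_add_one)
        moreover have "coprime b 8" by (simp add: b_def coprime_iff_gcd_eq_1 gcd_nat.simps gcd_red_nat)
        ultimately obtain a where a: "coprime a m" "[a = b] (mod 8)"
          using ex[of 8 "\<Prod>p\<in>P. p" b "{}"] by (auto simp: m_def)
        have a8: "a mod 8 = b" using a(2) by (simp add: unique_euclidean_semiring_class.cong_def b_def split: if_splits)
        have T24: "T = {2} \<or> T = {4} \<or> T = {2, 4}" using True T by (auto simp: I_def)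
        have i8: "int a mod 8 = int b" using a8 by (metis of_nat_mod of_nat_numeral)
        have "odd a" "a mod 4 = b mod 4" using a8 unfolding b_def by (auto split: if_splits; presburger)+
        then have "?f a = -1"
          using T24 i8 by (elim disjE) (simp_all add: qchar_def b_def chi8_def)
        then show ?thesis using a(1) by blast
      next
        case False
        then obtain l where l: "l \<in> T" "l \<in> P" by auto
        have pl: "prime l" "l > 2" using assms(2)[OF l(2)] by auto
        obtain z where z: "\<not> int l dvd z" "Legendre z l = -1" using exists_nonresidue[OF pl] by auto
        \<comment> \<open>A nonresidue at l and 1 modulo 8 and modulo the other primes, so exactly
          one character of the set is -1.\<close>
        define b where "b = nat (z mod int l)"
        have b: "int b = z mod int l" using pl by (simp add: b_def)
        have "\<not> l dvd b"
        proof
          assume "l dvd b"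
          then have "int l dvd z mod int l" using b by (metis int_dvd_int_iff)
          then show False using z(1) by (simp add: dvd_mod_iff)
        qed
        then have "coprime b l" using pl(1) by (metis coprime_commute prime_imp_coprime)
        define k where "k = 8 * (\<Prod>p\<in>P - {l}. p)"
        have mk: "m = l * k" using assms(1) l by (simp add: m_def k_def prod.remove)
        have "coprime l k"
        proof -
          have "coprime l (\<Prod>p\<in>P - {l}. p)"
            using assms(2) pl by (intro prod_coprime_right primes_coprime) auto
          moreover have "odd l" using pl prime_odd_nat by auto
          then have "coprime l (2 ^ 3)" unfolding coprime_power_right_iff by (simp add: coprime_right_2_iff_odd)
          then have "coprime l 8" by simp
          ultimately show ?thesis unfolding k_def by simp
        qed
        moreover have "\<forall>i\<in>insert 8 (P - {l}). i dvd k"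
          using assms(1) by (auto simp: k_def intro!: dvd_mult dvd_prodI)
        ultimately obtain a where a: "coprime a m" "[a = b] (mod l)" "\<forall>i\<in>insert 8 (P - {l}). [a = 1] (mod i)"
          using ex[OF mk _ \<open>coprime b l\<close>] by blast
        have a8: "a mod 8 = 1" using a(3) by (simp add: unique_euclidean_semiring_class.cong_def)
        then have i8: "int a mod 8 = 1" by (metis of_nat_1 of_nat_mod of_nat_numeral)
        have "odd a" "a mod 4 = 1" using a8 by presburger+
        then have q24: "qchar 2 a = 1" "qchar 4 a = 1" using i8 by (simp_all add: qchar_def chi8_def)
        have "qchar i a = 1" if "i \<in> T - {l}" for i
          using that T q24 c1 a(3) by (auto simp: I_def)
        moreover have "qchar l a = -1"
        proof -
          have "[int a = z] (mod int l)" using a(2) b by (metis cong_int_iff cong_mod_right)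
          then show ?thesis using z(2) Legendre_cong_mod l(2) P24 by (auto simp: qchar_def)
        qed
        ultimately have "?f a = -1" using fT l(1) by (simp add: prod.remove)
        then show ?thesis using a(1) by blast
      qed
    qed
    then have "(\<Sum>x<m. ?f x) = 0" using sum_zero_of_twist[OF m0 mult per] by blast
    moreover have "\<bar>?f n\<bar> \<le> 1" for n using val[of n] by auto
    ultimately show ?thesis
      unfolding npchar_def cmult_def using m0 mult per val one by blast
  qed
  moreover have "p dvd m" if "i \<in> I" "prime p" "qchar i p = 0" for i p
  proof -
    have "p = 2 \<or> p = i" using qchar_zero I that by blast
    then show ?thesis using dm[OF that(1)] dm[of 2] by (auto simp: I_def)
  qed
  moreover define e' where "e' i = (if i = 2 then (if r mod 4 = 3 then -1 else 1) else if i = 4 then real_of_int (chi8 r) else real_of_int (e i))" for i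
  moreover have "e' i \<in> {-1, 1}" if "i \<in> I" for i
    using that assms(3)[of i] by (auto simp: e'_def I_def chi8_def)
  ultimately have inf: "infinite {p. prime p \<and> (\<forall>i\<in>I. qchar i p = e' i)}"
    using assms(1) m0 by (intro primes_with_characters[of I m]) (auto simp: I_def)
  have "{p. prime p \<and> (\<forall>i\<in>I. qchar i p = e' i)} \<subseteq>
      {q. prime q \<and> (\<forall>p\<in>P. Legendre (int q) (int p) = e p) \<and> int q mod 8 = r mod 8}"
  proof (intro subsetI CollectI conjI ballI; clarify?)
    fix q p assume q: "prime q" "\<forall>i\<in>I. qchar i q = e' i" and p: "p \<in> P"
    have "qchar p q = e' p" using q p by (auto simp: I_def)
    then show "Legendre (int q) (int p) = e p" using p P24 by (auto simp: qchar_def e'_def split: if_splits)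
  next
    fix q assume q: "prime q" "\<forall>i\<in>I. qchar i q = e' i"
    have 2: "qchar 2 q = e' 2" and 4: "qchar 4 q = e' 4" using q by (auto simp: I_def)
    have "odd q" using 2 by (auto simp: qchar_def e'_def split: if_splits)
    then have o: "odd (int q)" by simp
    have "chi8 (int q) = chi8 r" using 4 \<open>odd q\<close> by (simp add: qchar_def e'_def)
    moreover have "q mod 4 = 3 \<longleftrightarrow> r mod 4 = 3" using 2 \<open>odd q\<close> by (auto simp: qchar_def e'_def split: if_splits)
    then have "int q mod 4 = 3 \<longleftrightarrow> r mod 4 = 3" by (metis of_nat_eq_iff of_nat_mod of_nat_numeral)
    then have "int q mod 8 mod 4 = 3 \<longleftrightarrow> r mod 8 mod 4 = 3" by (simp add: mod_mod_cancel)
    moreover have "(int q mod 8 = 1 \<or> int q mod 8 = 7) = (r mod 8 = 1 \<or> r mod 8 = 7)"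
      using \<open>chi8 (int q) = chi8 r\<close> by (simp add: chi8_def split: if_splits)
    moreover have fin: "\<forall>a\<in>{1, 3, 5, 7}. \<forall>b\<in>{1, 3, 5, 7 :: int}. (a mod 4 = 3 \<longleftrightarrow> b mod 4 = 3) \<longrightarrow>
        (a = 1 \<or> a = 7) = (b = 1 \<or> b = 7) \<longrightarrow> a = b" by simp
    ultimately show "int q mod 8 = r mod 8"
      using fin[rule_format, OF odd_mod_8_mem[OF o] odd_mod_8_mem[OF assms(4)]] by blast
  qed
  then show ?thesis using inf finite_subset by blast
qed

section \<open>The Hasse principle for diagonal forms\<close>

lemma hilb_minus_self:
  assumes "prime p" "a \<noteq> 0" shows "hilb p a (- a) = 1"
  using hilb_norm[of p a "- a" 0 1 1] assms by simp

text \<open>That the symbol of a s and b s is 1 means that s is a value of a x^2 + b y^2. The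
  identity, a consequence of (s, s) = (s, -1), turns this into a condition on the single character s
  to (s, -a b).\<close>

lemma hilb_scale:
  assumes "prime p" "a \<noteq> 0" "b \<noteq> 0" "s \<noteq> 0"
  shows "hilb p (a * s) (b * s) = hilb p a b * hilb p s (- (a * b))"
proof -
  have 1: "hilb p s (- (a * b)) = hilb p s (-1) * (hilb p s a * hilb p s b)"
    using hilb_mult_right[of p s "-1" "a * b"] hilb_mult_right[of p s a b] assms by simp
  have "hilb p s (-1) * hilb p s s = 1"
    using hilb_mult_right[of p s "-1" s] hilb_minus_self[of p s] assms by simp
  then have 2: "hilb p s s = hilb p s (-1)"
    using hilb_values[of p s "-1"] hilb_values[of p s s] assms by auto
  have "hilb p (a * s) (b * s) = (hilb p a b * hilb p a s) * (hilb p s b * hilb p s s)"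
    using assms by (simp add: hilb_mult_left hilb_mult_right)
  then show ?thesis unfolding 1 2 hilb_commute[of p a s] by (simp add: mult_ac)
qed

text \<open>For nonzero c, the squares of the p-adic field.\<close>

definition isqr :: "nat \<Rightarrow> int \<Rightarrow> bool" where
  "isqr p c \<longleftrightarrow> even (pval p c) \<and> (if p = 2 then punit p c mod 8 = 1 else Legendre (punit p c) (int p) = 1)"

text \<open>Nondegeneracy of the symbol. For odd p the witness is a nonresidue or p, according to
  the parity of the valuation; for p = 2 it is 5 for odd valuation and otherwise -1 or 2, according
  to the unit part modulo 8.\<close>

lemma not_isqr:
  assumes "prime p" "c \<noteq> 0" "\<not> isqr p c"
  shows "\<exists>s. s \<noteq> 0 \<and> hilb p s c = -1"
proof (cases "p = 2")
  case True
  have "odd (punit 2 c)" using pval_punit(2)[OF assms(1,2)] True by simp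
  show ?thesis
  proof (cases "even (pval 2 c)")
    case False
    have "pval 2 5 = 0" "punit 2 5 = 5" using pval_unit[of 2 5] by auto
    then have "hilb 2 5 c = -1" using False by (simp add: hilb_def eps4_def chi8_def)
    then show ?thesis using True by (intro exI[of _ 5]) simp
  next
    case ev: True
    have ne: "punit 2 c mod 8 \<noteq> 1" using assms(3) True ev by (simp add: isqr_def)
    have 2: "pval 2 2 = 1" "punit 2 2 = 1" using pval_self[of 2] by auto
    have m1: "pval 2 (-1) = 0" "punit 2 (-1) = -1" using pval_unit[of 2 "-1"] by auto
    show ?thesis
    proof (cases "punit 2 c mod 8 = 7")
      case True
      then have "punit 2 c mod 8 mod 4 = 3" by simp
      then have "punit 2 c mod 4 = 3" by (simp add: mod_mod_cancel)
      then have "hilb 2 (-1) c = -1" using m1 ev by (simp add: hilb_def eps4_def chi8_def)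
      then show ?thesis using \<open>p = 2\<close> by (intro exI[of _ "-1"]) simp
    next
      case False
      then have "hilb 2 2 c = -1" using 2 ne by (simp add: hilb_def eps4_def chi8_def)
      then show ?thesis using \<open>p = 2\<close> by (intro exI[of _ 2]) simp
    qed
  qed
next
  case False
  then have p: "p > 2" using assms(1) prime_ge_2_nat[of p] by linarith
  note u = pval_punit(2)[OF assms(1,2)]
  show ?thesis
  proof (cases "even (pval p c)")
    case odd: False
    obtain z where z: "\<not> int p dvd z" "Legendre z p = -1" using exists_nonresidue[OF assms(1) p] by auto
    have "hilb p z c = -1" using z(2) odd False pval_unit[OF assms(1) z(1)] by (simp add: hilb_def)
    then show ?thesis using z(1) by (intro exI[of _ z]) auto
  next
    case True
    then have "Legendre (punit p c) p = -1" using assms(3) False Legendre_values[OF u] by (auto simp: isqr_def)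
    moreover have "Legendre (-1) (int p) ^ pval p c = 1"
      using True Legendre_values[of "int p" "-1"] prime_not_dvd_1(2)[OF assms(1)] by auto
    ultimately have "hilb p (int p) c = -1"
      using False pval_self[OF assms(1)] Legendre_square[OF assms(1) prime_not_dvd_1(1)[OF assms(1)]]
      by (simp add: hilb_def)
    then show ?thesis using assms(1) by (intro exI[of _ "int p"]) auto
  qed
qed

text \<open>
  The forms \<open>a x\<^sup>2 + b y\<^sup>2\<close> and \<open>- c z\<^sup>2 - d w\<^sup>2\<close> have a common value \<open>s\<close> over the \<open>p\<close>-adic field, that is, the
  diagonal form with coefficients \<open>a, b, c, d\<close> is isotropic there.
\<close>

definition good :: "nat \<Rightarrow> int \<Rightarrow> int \<Rightarrow> int \<Rightarrow> int \<Rightarrow> bool" where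
  "good p a b c d \<longleftrightarrow> (\<exists>s. s \<noteq> 0 \<and> hilb p (a * s) (b * s) = 1 \<and> hilb p (- c * s) (- d * s) = 1)"

lemma good_swap:
  assumes "good p a b c d" shows "good p c d a b"
proof -
  obtain s where "s \<noteq> 0" "hilb p (a * s) (b * s) = 1" "hilb p (- c * s) (- d * s) = 1"
    using assms by (auto simp: good_def)
  then show ?thesis unfolding good_def by (intro exI[of _ "- s"]) simp
qed

text \<open>The last assumption says that -a b is a square. Then a x^2 + b y^2 is a hyperbolic plane
  with every s as a value, and only the other half restricts s.\<close>

lemma good_of_square_side:
  assumes "prime p" "a \<noteq> 0" "b \<noteq> 0" "c \<noteq> 0" "d \<noteq> 0" "\<And>s. s \<noteq> 0 \<Longrightarrow> hilb p s (- (a * b)) = 1"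
  shows "good p a b c d"
proof -
  have "hilb p a b * hilb p a (- a) = hilb p a (- (a * b))"
    using hilb_mult_right[of p a "- a" b] assms by (simp add: mult.commute)
  then have ab: "hilb p a b = 1" using assms hilb_minus_self[of p a] by simp
  have 1: "hilb p (a * s) (b * s) = 1" if "s \<noteq> 0" for s
    using hilb_scale[OF assms(1-3) that] ab assms(6)[OF that] by simp
  have 2: "hilb p (- c * s) (- d * s) = hilb p (- c) (- d) * hilb p s (- (c * d))" if "s \<noteq> 0" for s
    using hilb_scale[of p "- c" "- d" s] assms that by simp
  show ?thesis
  proof (cases "hilb p (- c) (- d) = 1")
    case True
    have "hilb p 1 (- (c * d)) = 1" using assms by (intro hilb_1) auto
    then show ?thesis unfolding good_def using 1[of 1] 2[of 1] True by (intro exI[of _ 1]) simp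
  next
    case False
    then have m: "hilb p (- c) (- d) = -1" using hilb_values[of p "- c" "- d"] assms by auto
    \<comment> \<open>If -c d were a square too, the same computation as for a and b would make the
      symbol of -c and -d equal to 1.\<close>
    have "\<exists>s. s \<noteq> 0 \<and> hilb p s (- (c * d)) = -1"
    proof (rule ccontr)
      assume "\<not> (\<exists>s. s \<noteq> 0 \<and> hilb p s (- (c * d)) = -1)"
      then have t: "hilb p s (- (c * d)) = 1" if "s \<noteq> 0" for s
        using hilb_values[of p s "- (c * d)"] assms that by auto
      have "hilb p (- c) (- d) * hilb p (- c) (- (- c)) = hilb p (- c) (- (c * d))"
        using hilb_mult_right[of p "- c" c "- d"] assms by (simp add: mult.commute)
      then show False using m t[of "- c"] hilb_minus_self[of p "- c"] assms by simp
    qed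
    then obtain s where s: "s \<noteq> 0" "hilb p s (- (c * d)) = -1" by blast
    have "hilb p (- c * s) (- d * s) = 1" unfolding 2[OF s(1)] m s(2) by simp
    then show ?thesis unfolding good_def using 1[OF s(1)] s(1) by blast
  qed
qed

text \<open>The characters s to (s, -a b) and s to (s, -c d) differ at s0. If both are nontrivial
  they are therefore independent and attain every pair of signs, in particular the pair that the two
  halves ask for.\<close>

lemma good_of_nonsquare_disc:
  assumes "prime p" "a \<noteq> 0" "b \<noteq> 0" "c \<noteq> 0" "d \<noteq> 0" "s0 \<noteq> 0" "hilb p s0 (a * b * c * d) = -1"
  shows "good p a b c d"
proof (cases "\<forall>s. s \<noteq> 0 \<longrightarrow> hilb p s (- (a * b)) = 1")
  case True
  then show ?thesis using good_of_square_side assms by blast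
next
  case f1: False
  show ?thesis
  proof (cases "\<forall>s. s \<noteq> 0 \<longrightarrow> hilb p s (- (c * d)) = 1")
    case True
    then show ?thesis using good_of_square_side[of p c d a b] good_swap assms by blast
  next
    case f2: False
    define A where "A s = hilb p s (- (a * b))" for s
    define B where "B s = hilb p s (- (c * d))" for s
    have pm: "A s = 1 \<or> A s = -1" "B s = 1 \<or> B s = -1" if "s \<noteq> 0" for s
      using hilb_values[of p s "- (a * b)"] hilb_values[of p s "- (c * d)"] assms that by (auto simp: A_def B_def)
    have hom: "A (s * t) = A s * A t" "B (s * t) = B s * B t" if "s \<noteq> 0" "t \<noteq> 0" for s t
      using assms that by (auto simp: A_def B_def intro!: hilb_mult_left)
    obtain s1 where s1: "s1 \<noteq> 0" "A s1 = -1" using f1 pm by (auto simp: A_def)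
    obtain s2 where s2: "s2 \<noteq> 0" "B s2 = -1" using f2 pm by (auto simp: B_def)
    have "A s0 * B s0 = hilb p s0 ((- (a * b)) * (- (c * d)))"
      unfolding A_def B_def using assms by (intro hilb_mult_right[symmetric]) auto
    then have s0: "A s0 * B s0 = -1" using assms(7) by (simp add: mult.assoc)
    have one: "A 1 = 1" "B 1 = 1" using assms by (auto simp: A_def B_def intro!: hilb_1)
    \<comment> \<open>One character is -1 at s0 and the other is 1; multiplying by s0 changes
      exactly one of the two signs.\<close>
    have all: "\<exists>s. s \<noteq> 0 \<and> A s = x \<and> B s = y" if "x = 1 \<or> x = -1" "y = 1 \<or> y = -1" for x y
    proof -
      from pm[OF assms(6)] s0 consider "A s0 = -1" "B s0 = 1" | "A s0 = 1" "B s0 = -1" by auto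
      then show ?thesis
      proof cases
        case 1
        have "A (s0 * s2) = - A s2" "B (s0 * s2) = -1" using 1 s2 hom[OF assms(6) s2(1)] by simp_all
        moreover have "s0 * s2 \<noteq> 0" using s2 assms(6) by simp
        moreover have "x = A s2 \<or> x = - A s2" using pm(1)[OF s2(1)] that(1) by auto
        ultimately show ?thesis using that 1 one s2 assms(6) by (metis zero_neq_one)
      next
        case 2
        have "B (s0 * s1) = - B s1" "A (s0 * s1) = -1" using 2 s1 hom[OF assms(6) s1(1)] by simp_all
        moreover have "s0 * s1 \<noteq> 0" using s1 assms(6) by simp
        moreover have "y = B s1 \<or> y = - B s1" using pm(2)[OF s1(1)] that(2) by auto
        ultimately show ?thesis using that 2 one s1 assms(6) by (metis zero_neq_one)
      qed
    qed
    obtain s where s: "s \<noteq> 0" "A s = hilb p a b" "B s = hilb p (- c) (- d)"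
      using all[of "hilb p a b" "hilb p (- c) (- d)"] hilb_values[of p a b] hilb_values[of p "- c" "- d"] assms by auto
    have "hilb p (a * s) (b * s) = hilb p a b * hilb p a b"
      using hilb_scale[OF assms(1-3) s(1)] s(2) by (simp add: A_def)
    moreover have "hilb p (- c * s) (- d * s) = hilb p (- c) (- d) * hilb p (- c) (- d)"
      using hilb_scale[of p "- c" "- d" s] assms s(1,3) by (simp add: B_def)
    ultimately show ?thesis
      unfolding good_def using s(1) hilb_sq_self[of p a b] hilb_sq_self[of p "- c" "- d"] assms by auto
  qed
qed

lemma hilb_class_cong:
  assumes "prime p" "t' = int p ^ pval p t * u'" "\<not> int p dvd u'"
    "if p = 2 then u' mod 8 = punit p t mod 8 else Legendre u' (int p) = Legendre (punit p t) (int p)"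
  shows "hilb p x t' = hilb p x t"
proof -
  have v: "pval p t' = pval p t" "punit p t' = u'" using pval_eqI[OF assms(1-3)] by auto
  show ?thesis
  proof (cases "p = 2")
    case True
    then have m: "u' mod 8 = punit p t mod 8" using assms(4) by simp
    then have "u' mod 8 mod 4 = punit p t mod 8 mod 4" by simp
    then have "u' mod 4 = punit p t mod 4" by (simp add: mod_mod_cancel)
    then show ?thesis using True v m by (simp add: hilb_def eps4_def chi8_def)
  next
    case False
    then show ?thesis using assms(4) v by (simp add: hilb_def)
  qed
qed

text \<open>The margin 3 is what p = 2 requires: the unit parts then agree modulo 8.\<close>

lemma hilb_close:
  assumes "prime p" "t \<noteq> 0" "int p ^ k dvd t' - t" "pval p t + 3 \<le> k"
  shows "t' \<noteq> 0" "hilb p x t' = hilb p x t"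
proof -
  define v where "v = pval p t"
  note t = pval_punit[OF assms(1,2)]
  have "int p ^ (v + 3) dvd t' - t" using dvd_trans[OF le_imp_power_dvd assms(3), of "v + 3"] assms(4) by (simp add: v_def)
  then obtain r where "t' - t = int p ^ (v + 3) * r" by (auto elim!: dvdE)
  then have e: "t' = int p ^ v * (punit p t + int p ^ 3 * r)"
    using t(1) by (simp add: v_def power_add algebra_simps)
  have d: "int p dvd int p ^ 3 * r" by simp
  then have nd: "\<not> int p dvd punit p t + int p ^ 3 * r" using t(2) by (simp add: dvd_add_left_iff)
  then show "t' \<noteq> 0" using e assms(1) by auto
  show "hilb p x t' = hilb p x t"
  proof (rule hilb_class_cong[OF assms(1) e[unfolded v_def] nd])
    have "[punit p t + int p ^ 3 * r = punit p t] (mod int p)" using d by (simp add: cong_iff_dvd_diff)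
    then have "Legendre (punit p t + int p ^ 3 * r) p = Legendre (punit p t) p" by (rule Legendre_cong_mod)
    then show "if p = 2 then (punit p t + int p ^ 3 * r) mod 8 = punit p t mod 8
        else Legendre (punit p t + int p ^ 3 * r) (int p) = Legendre (punit p t) (int p)" by simp
  qed
qed

lemma pval_dvd_iff:
  assumes "prime p" "t \<noteq> 0" shows "int p ^ k dvd t \<longleftrightarrow> k \<le> pval p t"
  using assms unfolding pval_def by (intro power_dvd_iff_le_multiplicity) (auto dest: prime_gt_1_nat)

text \<open>If a x^2 + b y^2 is divisible by a much higher power of p than x or y, then (a x)^2 is
  p-adically close to -a b y^2, and -a b is a square. The exponent e bounds the valuation of x or of
  y.\<close>

lemma square_side_of_zero:
  assumes "prime p" "a \<noteq> 0" "b \<noteq> 0" "\<not> int p ^ e dvd x \<or> \<not> int p ^ e dvd y"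
    "int p ^ k dvd a * x^2 + b * y^2" "k \<ge> 2 * e + 2 * pval p a + pval p b + 3" "s \<noteq> 0"
  shows "hilb p s (- (a * b)) = 1"
proof -
  have half: "hilb p s (- (a * b)) = 1"
    if "\<not> int p ^ e dvd x" "a \<noteq> 0" "b \<noteq> 0" "int p ^ k dvd a * x^2 + b * y^2" "k \<ge> 2 * e + 2 * pval p a + 3" for a b x y
  proof -
    have x0: "x \<noteq> 0" using that(1) by auto
    have vx: "pval p x < e" using that(1) pval_dvd_iff[OF assms(1) x0] by simp
    define t where "t = (a * x)^2"
    have t0: "t \<noteq> 0" using x0 that(2) by (simp add: t_def)
    have "pval p t = 2 * pval p a + 2 * pval p x"
      using assms(1) that(2) x0 by (simp add: t_def power2_eq_square pval_mult)
    then have "pval p t + 3 \<le> k" using vx that(5) by linarith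
    moreover have "int p ^ k dvd (- (a * b)) * y^2 - t"
    proof -
      have "(- (a * b)) * y^2 - t = (- a) * (a * x^2 + b * y^2)" by (simp add: t_def power2_eq_square algebra_simps)
      then show ?thesis using that(4) by simp
    qed
    ultimately have n0: "(- (a * b)) * y^2 \<noteq> 0" and h: "hilb p s ((- (a * b)) * y^2) = hilb p s t"
      using hilb_close[OF assms(1) t0] by blast+
    have "hilb p s t = 1"
      using hilb_square_left[of p "a * x" s] assms(1,7) x0 that(2) by (simp add: t_def hilb_commute)
    moreover have "hilb p s ((- (a * b)) * y^2) = hilb p s (- (a * b)) * hilb p s (y^2)"
      using n0 assms(1,7) by (intro hilb_mult_right) auto
    moreover have "hilb p s (y^2) = 1"
      using hilb_square_left[of p y s] n0 assms(1,7) by (auto simp: hilb_commute)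
    ultimately show ?thesis using h by simp
  qed
  from assms(4) show ?thesis
  proof
    assume "\<not> int p ^ e dvd x"
    then show ?thesis using half[of x a b y] assms by simp
  next
    assume y: "\<not> int p ^ e dvd y"
    have y0: "y \<noteq> 0" using y by auto
    have vy: "pval p y < e" using y pval_dvd_iff[OF assms(1) y0] by simp
    define t where "t = (- (a * b)) * y^2"
    have t0: "t \<noteq> 0" using y0 assms by (simp add: t_def)
    have "pval p (- (a * b)) = pval p a + pval p b"
      using pval_mult(1)[of p "-1" "a * b"] pval_mult(1)[of p a b] pval_unit[of p "-1"] prime_not_dvd_1[OF assms(1)] assms(1-3) by simp
    then have "pval p t = pval p a + pval p b + 2 * pval p y"
      using assms(1-3) y0 pval_mult(1)[of p "- (a * b)" "y^2"] by (simp add: t_def power2_eq_square pval_mult(1)[of p y y])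
    then have "pval p t + 3 \<le> k" using vy assms(6) by linarith
    moreover have "int p ^ k dvd (a * x)^2 - t"
    proof -
      have "(a * x)^2 - t = a * (a * x^2 + b * y^2)" by (simp add: t_def power2_eq_square algebra_simps)
      then show ?thesis using assms(5) by simp
    qed
    ultimately have n0: "(a * x)^2 \<noteq> 0" and h: "hilb p s ((a * x)^2) = hilb p s t"
      using hilb_close[OF assms(1) t0] by blast+
    have "hilb p s ((a * x)^2) = 1"
      using hilb_square_left[of p "a * x" s] assms(1,7) n0 by (simp add: hilb_commute)
    moreover have "hilb p s t = hilb p s (- (a * b)) * hilb p s (y^2)"
      unfolding t_def using y0 assms by (intro hilb_mult_right) auto
    moreover have "hilb p s (y^2) = 1"
      using hilb_square_left[of p y s] y0 assms(1,7) by (auto simp: hilb_commute)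
    ultimately show ?thesis using h by simp
  qed
qed

text \<open>Let t be the value of the half a, b at an approximate zero. If t is not divisible by
  almost p^k, it is close to the negative of the other half and is a common value. Otherwise both
  halves nearly vanish, one of them at arguments of bounded valuation, so -a b or -c d is a
  square.\<close>

lemma good_of_local_zero:
  assumes "prime p" "a \<noteq> 0" "b \<noteq> 0" "c \<noteq> 0" "d \<noteq> 0"
    and zero: "\<And>k. \<exists>x y z w. int p ^ k dvd a * x^2 + b * y^2 + c * z^2 + d * w^2 \<and>
      \<not> (int p ^ e dvd x \<and> int p ^ e dvd y \<and> int p ^ e dvd z \<and> int p ^ e dvd w)"
  shows "good p a b c d"
proof -
  \<comment> \<open>Twice the constant 3: once for comparing the two halves, once for
    \<open>square_side_of_zero\<close>, which is applied at level k - 3.\<close>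
  define k where "k = 2 * e + 2 * (pval p a + pval p b + pval p c + pval p d) + 6"
  obtain x y z w where zw: "int p ^ k dvd a * x^2 + b * y^2 + c * z^2 + d * w^2"
    and e: "\<not> (int p ^ e dvd x \<and> int p ^ e dvd y \<and> int p ^ e dvd z \<and> int p ^ e dvd w)"
    using zero[of k] by blast
  define t where "t = a * x^2 + b * y^2"
  define t' where "t' = - c * z^2 + - d * w^2"
  have tt: "int p ^ k dvd t' - t"
  proof -
    have "t' - t = - (a * x^2 + b * y^2 + c * z^2 + d * w^2)" by (simp add: t_def t'_def)
    then show ?thesis using zw by (metis dvd_minus_iff)
  qed
  show ?thesis
  proof (cases "int p ^ (k - 3) dvd t")
    case False
    then have t0: "t \<noteq> 0" by auto
    then have "pval p t + 3 \<le> k" using False pval_dvd_iff[OF assms(1) t0, of "k - 3"] by linarith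
    then have t'0: "t' \<noteq> 0" and h: "hilb p s t' = hilb p s t" for s
      using hilb_close[OF assms(1) t0 tt] by blast+
    have "t^2 = (a * t) * x^2 + (b * t) * y^2" by (simp add: t_def power2_eq_square algebra_simps)
    then have 1: "hilb p (a * t) (b * t) = 1" using hilb_norm[of p "a * t" "b * t" t x y] assms t0 by auto
    have "t'^2 = (- c * t') * z^2 + (- d * t') * w^2" by (simp add: t'_def power2_eq_square algebra_simps)
    then have "hilb p (- c * t') (- d * t') = 1" using hilb_norm[of p "- c * t'" "- d * t'" t' z w] assms t'0 by auto
    then have "hilb p (- c * t) (- d * t) = 1"
      using hilb_scale[of p "- c" "- d" t] hilb_scale[of p "- c" "- d" t'] h[of "- (c * d)"] t0 t'0 assms
      by (simp add: hilb_commute[of p t] hilb_commute[of p t'])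
    then show ?thesis using 1 t0 by (auto simp: good_def)
  next
    case True
    have T0: "int p ^ (k - 3) dvd t' - t" using tt by (meson diff_le_self dvd_trans le_imp_power_dvd)
    then have T': "int p ^ (k - 3) dvd c * z^2 + d * w^2"
    proof -
      have "int p ^ (k - 3) dvd t'" using dvd_add[OF T0 True] by simp
      moreover have "c * z^2 + d * w^2 = - t'" by (simp add: t'_def)
      ultimately show ?thesis by (metis dvd_minus_iff)
    qed
    show ?thesis
    proof (cases "int p ^ e dvd x \<and> int p ^ e dvd y")
      case False
      then have "hilb p s (- (a * b)) = 1" if "s \<noteq> 0" for s
        using square_side_of_zero[OF assms(1-3) _ True[unfolded t_def] _ that, of e] by (auto simp: k_def)
      then show ?thesis using good_of_square_side[OF assms(1-5)] by blast
    next
      case False': True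
      then have "\<not> int p ^ e dvd z \<or> \<not> int p ^ e dvd w" using e by blast
      then have "hilb p s (- (c * d)) = 1" if "s \<noteq> 0" for s
        using square_side_of_zero[OF assms(1,4,5) _ T' _ that, of e] by (auto simp: k_def)
      then show ?thesis using good_of_square_side[OF assms(1,4,5,2,3)] good_swap by blast
    qed
  qed
qed

section \<open>Ternary forms\<close>

lemma square_mod_squarefree:
  assumes "m > 0" "squarefree (m::nat)" "\<And>p. prime p \<Longrightarrow> p dvd m \<Longrightarrow> \<exists>t. int p dvd t^2 - a"
  shows "\<exists>t. int m dvd t^2 - a"
  using assms
proof (induction m rule: less_induct)
  case (less m)
  show ?case
  proof (cases "m = 1")
    case False
    then obtain p where p: "prime p" "p dvd m" using prime_factor_nat by blast
    then obtain k where k: "m = p * k" by auto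
    have "k < m" "k > 0" using k less.prems(1) prime_gt_1_nat[OF p(1)] by auto
    moreover have "squarefree k" using less.prems(2) k squarefree_mono[of k m] by simp
    ultimately obtain t where t: "int k dvd t^2 - a" using less.IH[of k] less.prems(3) k by (metis dvd_mult)
    obtain t' where t': "int p dvd t'^2 - a" using less.prems(3)[OF p] by blast
    have "\<not> p dvd k"
    proof
      assume "p dvd k"
      then have "p^2 dvd m" using k by (auto simp: power2_eq_square)
      then show False using less.prems(2) p(1) squarefreeD[of m p] by auto
    qed
    then have co: "coprime (int k) (int p)" using p(1) prime_imp_coprime[of p k] by (simp add: coprime_commute)
    from binary_chinese_remainder_int[OF co, of t t'] obtain x where x: "[x = t] (mod int k)" "[x = t'] (mod int p)" by auto
    have "int k dvd x^2 - a" using t cong_diff[OF cong_pow[OF x(1), of 2] cong_refl[of a]] cong_dvd_iff by blast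
    moreover have "int p dvd x^2 - a" using t' cong_diff[OF cong_pow[OF x(2), of 2] cong_refl[of a]] cong_dvd_iff by blast
    ultimately have "int k * int p dvd x^2 - a" using co by (rule divides_mult)
    then show ?thesis by (intro exI[of _ x]) (simp add: k mult.commute)
  qed auto
qed

text \<open>Legendre's theorem by Serre's descent: \<open>t\<^sup>2 - a = b b'\<close> with \<open>\<bar>b'\<bar> < \<bar>b\<bar>\<close> replaces \<open>b\<close> by \<open>b'\<close>.\<close>

theorem conic_soluble:
  assumes "a \<noteq> 0" "b \<noteq> 0" "\<And>p. prime p \<Longrightarrow> hilb p a b = 1" "hinf a b = 1"
  shows "\<exists>x y z. (x \<noteq> 0 \<or> y \<noteq> 0 \<or> z \<noteq> 0) \<and> z\<^sup>2 = a * x^2 + b * (y::int)^2"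
  using assms
proof (induction "nat \<bar>a\<bar> + nat \<bar>b\<bar>" arbitrary: a b rule: less_induct)
  case less
  define sol where "sol a b \<longleftrightarrow> (\<exists>x y z. (x \<noteq> 0 \<or> y \<noteq> 0 \<or> z \<noteq> 0) \<and> z\<^sup>2 = a * x^2 + b * (y::int)^2)" for a b :: int
  have sol_commute: "sol a b = sol b a" for a b unfolding sol_def by (metis add.commute)
  \<comment> \<open>The descent step for |a| \<le> |b|. The induction hypothesis is passed as an
    assumption, so that the step also applies with a and b exchanged.\<close>
  have main: "sol a b"
    if ne: "a \<noteq> 0" "b \<noteq> 0" and h: "\<And>p. prime p \<Longrightarrow> hilb p a b = 1" "hinf a b = 1" and le: "\<bar>a\<bar> \<le> \<bar>b\<bar>"
      and IH: "\<And>a' b'. nat \<bar>a'\<bar> + nat \<bar>b'\<bar> < nat \<bar>a\<bar> + nat \<bar>b\<bar> \<Longrightarrow> a' \<noteq> 0 \<Longrightarrow> b' \<noteq> 0 \<Longrightarrow>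
        (\<And>p. prime p \<Longrightarrow> hilb p a' b' = 1) \<Longrightarrow> hinf a' b' = 1 \<Longrightarrow> sol a' b'" for a b
  proof (cases "squarefree b")
    case False
    \<comment> \<open>A square factor of b changes neither the symbols nor solubility.\<close>
    then obtain r where r: "r^2 dvd b" "\<not> is_unit r" using ne by (auto simp: squarefree_def)
    then obtain c where c: "b = r^2 * c" by (auto elim!: dvdE)
    have r0: "r \<noteq> 0" "c \<noteq> 0" using c ne by auto
    have "\<bar>r\<bar> > 1" using r(2) r0 by (auto simp: zdvd1_eq)
    then have "r^2 > 1" by (metis one_less_power power2_abs zero_less_numeral)
    then have "\<bar>c\<bar> < \<bar>b\<bar>" using c r0 by (simp add: abs_mult)
    moreover have "hilb p a c = 1" if "prime p" for p
    proof -
      have "hilb p a b = hilb p a (r^2) * hilb p a c" unfolding c using that r0 ne by (intro hilb_mult_right) auto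
      moreover have "hilb p a (r^2) = 1" using hilb_square_left[of p r a] that r0 ne by (simp add: hilb_commute)
      ultimately show ?thesis using h(1)[OF that] by simp
    qed
    moreover have "hinf a c = 1" using h(2) \<open>r\<^sup>2 > 1\<close> unfolding c by (auto simp: hinf_def mult_less_0_iff split: if_splits)
    ultimately have "sol a c" using IH[of a c] ne r0 by auto
    then obtain x y z where s: "x \<noteq> 0 \<or> y \<noteq> 0 \<or> z \<noteq> 0" "z^2 = a * x^2 + c * y^2" by (auto simp: sol_def)
    have "(r * z)^2 = a * (r * x)^2 + b * y^2" using s(2) by (simp add: c power_mult_distrib algebra_simps)
    moreover have "r * x \<noteq> 0 \<or> y \<noteq> 0 \<or> r * z \<noteq> 0" using s(1) r0 by auto
    ultimately show ?thesis unfolding sol_def by blast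
  next
    case sf: True
    show ?thesis
    proof (cases "\<bar>b\<bar> = 1")
      case True
      then have "\<bar>a\<bar> = 1" using le ne by linarith
      then have "a = 1 \<or> b = 1" using True h(2) by (auto simp: hinf_def abs_if split: if_splits)
      then have "(1::int)^2 = a * 1\<^sup>2 + b * 0\<^sup>2 \<or> (1::int)\<^sup>2 = a * 0\<^sup>2 + b * 1\<^sup>2" by auto
      then show ?thesis unfolding sol_def by (metis zero_neq_one)
    next
      case False
      then have b2: "\<bar>b\<bar> \<ge> 2" using ne by linarith
      \<comment> \<open>As b is squarefree, its valuation at p is 1, and for odd p not dividing a
        the symbol at p is the Legendre symbol of a.\<close>
      have "\<exists>t. int p dvd t^2 - a" if p: "prime p" "p dvd nat \<bar>b\<bar>" for p
      proof (cases "int p dvd a \<or> p = 2")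
        case True
        then consider "int p dvd a" | "p = 2" "odd a" by (cases "int p dvd a") auto
        then show ?thesis
        proof cases
          case 1
          then show ?thesis by (intro exI[of _ 0]) simp
        next
          case 2
          then show ?thesis by (intro exI[of _ 1]) simp
        qed
      next
        case False
        have "int p dvd b" using p(2) by (metis abs_of_nat dvd_abs_iff int_dvd_int_iff int_nat_eq abs_ge_zero)
        then obtain c where c: "b = int p * c" by auto
        have "\<not> int p dvd c"
        proof
          assume "int p dvd c"
          then have "(int p)^2 dvd b" using c by (auto simp: power2_eq_square)
          then show False using sf squarefreeD[of b "int p"] p(1) prime_gt_1_nat[of p] by auto
        qed
        then have v: "pval p b = 1" "pval p a = 0" "punit p a = a"
          using pval_eqI[OF p(1), of b 1 c] c pval_unit[OF p(1), of a] False by auto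
        have "Legendre a p = 1" using h(1)[OF p(1)] False v by (simp add: hilb_def)
        then obtain t where "[t\<^sup>2 = a] (mod int p)" by (auto simp: Legendre_def QuadRes_def split: if_splits)
        then show ?thesis by (auto simp: cong_iff_dvd_diff)
      qed
      moreover have "squarefree (nat \<bar>b\<bar>)"
      proof (rule squarefreeI)
        fix x assume "x^2 dvd nat \<bar>b\<bar>"
        then have "int (x^2) dvd int (nat \<bar>b\<bar>)" by (simp only: int_dvd_int_iff)
        then have "(int x)^2 dvd b" by simp
        then show "is_unit x" using squarefreeD[OF sf, of "int x"] by simp
      qed
      ultimately obtain t0 where t0: "b dvd t0\<^sup>2 - a" using square_mod_squarefree[of "nat \<bar>b\<bar>" a] ne by auto
      \<comment> \<open>The residue of least absolute value gives |t^2 - a| \<le> b^2 / 4 + |b|,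
        hence |b'| \<le> |b| / 4 + 1 < |b| for |b| \<ge> 2.\<close>
      have "\<exists>t. b dvd t^2 - a \<and> 2 * \<bar>t\<bar> \<le> \<bar>b\<bar>"
      proof -
        define r where "r = t0 mod \<bar>b\<bar>"
        define t where "t = (if 2 * r \<le> \<bar>b\<bar> then r else r - \<bar>b\<bar>)"
        have r: "0 \<le> r" "r < \<bar>b\<bar>" using ne by (auto simp: r_def)
        have "[t = t0] (mod b)"
        proof -
          have "b dvd r - t0" unfolding r_def by (metis abs_dvd_iff dvd_minus_mod dvd_diff_commute)
          moreover have "b dvd r - \<bar>b\<bar> - t0" if "b dvd r - t0"
          proof -
            have e: "r - \<bar>b\<bar> - t0 = (r - t0) - \<bar>b\<bar>" by simp
            show ?thesis unfolding e by (rule dvd_diff[OF that]) simp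
          qed
          ultimately show ?thesis by (auto simp: t_def cong_iff_dvd_diff)
        qed
        then have "[t\<^sup>2 - a = t0\<^sup>2 - a] (mod b)" by (intro cong_diff cong_pow) auto
        then have "b dvd t^2 - a" using t0 cong_dvd_iff by blast
        moreover have "2 * \<bar>t\<bar> \<le> \<bar>b\<bar>" using r by (auto simp: t_def)
        ultimately show ?thesis by blast
      qed
      then obtain t b' where t: "t^2 - a = b * b'" "2 * \<bar>t\<bar> \<le> \<bar>b\<bar>" by (auto elim!: dvdE)
      show ?thesis
      proof (cases "b' = 0")
        case True
        then have "t^2 = a * 1\<^sup>2 + b * 0\<^sup>2" using t(1) by simp
        then show ?thesis unfolding sol_def by (metis zero_neq_one)
      next
        case b': False
        have "\<bar>b'\<bar> < \<bar>b\<bar>"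
        proof -
          have "4 * (\<bar>b\<bar> * \<bar>b'\<bar>) = 4 * \<bar>t\<^sup>2 - a\<bar>" using t(1) by (simp add: abs_mult)
          also have "\<dots> \<le> (2 * \<bar>t\<bar>)\<^sup>2 + 4 * \<bar>b\<bar>" using le by (simp add: power_mult_distrib) (smt (verit) zero_le_power2)
          also have "\<dots> \<le> \<bar>b\<bar>\<^sup>2 + 4 * \<bar>b\<bar>" using t(2) by (intro add_right_mono power_mono) auto
          finally have "\<bar>b\<bar> * (4 * \<bar>b'\<bar>) \<le> \<bar>b\<bar> * (\<bar>b\<bar> + 4)" by (simp add: power2_eq_square algebra_simps)
          then have "4 * \<bar>b'\<bar> \<le> \<bar>b\<bar> + 4" using ne by simp
          then show ?thesis using b2 by linarith
        qed
        have prod1: "hilb p a (b * b') = 1" if "prime p" for p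
        proof -
          have "t^2 = a * 1\<^sup>2 + (b * b') * 1\<^sup>2" using t(1) by simp
          then show ?thesis using hilb_norm[of p a "b * b'" t 1 1] that ne b' by auto
        qed
        have "hilb p a b' = 1" if "prime p" for p
          using prod1[OF that] hilb_mult_right[OF that ne b'] h(1)[OF that] by simp
        moreover have "hinf a b' = 1"
        proof (rule ccontr)
          assume "hinf a b' \<noteq> 1"
          then have "a < 0" "b' < 0" by (auto simp: hinf_def split: if_splits)
          moreover from this have "b > 0" using h(2) ne by (auto simp: hinf_def split: if_splits)
          ultimately have "b * b' < 0" by (simp add: mult_pos_neg)
          then show False using t(1) \<open>a < 0\<close> by (smt (verit) zero_le_power2)
        qed
        ultimately have "sol a b'" using IH[of a b'] ne b' \<open>\<bar>b'\<bar> < \<bar>b\<bar>\<close> by auto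
        then obtain x y z where s: "x \<noteq> 0 \<or> y \<noteq> 0 \<or> z \<noteq> 0" "z^2 = a * x^2 + b' * y^2" by (auto simp: sol_def)
        show ?thesis
        proof (cases "y = 0")
          case True
          then have "z^2 = a * x^2 + b * 0\<^sup>2" "x \<noteq> 0 \<or> (0::int) \<noteq> 0 \<or> z \<noteq> 0" using s by auto
          then show ?thesis unfolding sol_def by blast
        next
          case False
          \<comment> \<open>Numbers z^2 - a x^2 are norms from the field of a square root of a. As b
            b' and b' y^2 are norms, so is their product b (b' y)^2.\<close>
          have 1: "b' * y^2 = z^2 - a * x^2" using s(2) by simp
          have "b * (b' * y)^2 = (b * b') * (b' * y^2)" by (simp add: power2_eq_square)
          also have "\<dots> = (t^2 - a) * (z^2 - a * x^2)" using t(1) 1 by simp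
          also have "\<dots> = (t * z + a * x)^2 - a * (t * x + z)^2" by (simp add: power2_eq_square algebra_simps)
          finally have "(t * z + a * x)^2 = a * (t * x + z)^2 + b * (b' * y)^2" by simp
          moreover have "b' * y \<noteq> 0" using False b' by simp
          ultimately show ?thesis unfolding sol_def by blast
        qed
      qed
    qed
  qed
  have "sol a b"
  proof (cases "\<bar>a\<bar> \<le> \<bar>b\<bar>")
    case True
    show ?thesis
    proof (rule main[OF less.prems True])
      fix a' b' :: int
      assume H: "nat \<bar>a'\<bar> + nat \<bar>b'\<bar> < nat \<bar>a\<bar> + nat \<bar>b\<bar>" "a' \<noteq> 0" "b' \<noteq> 0"
        "\<And>p. prime p \<Longrightarrow> hilb p a' b' = 1" "hinf a' b' = 1"
      show "sol a' b'" unfolding sol_def by (rule less.hyps[OF H])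
    qed
  next
    case False
    have "sol b a"
    proof (rule main)
      show "hilb p b a = 1" if "prime p" for p using less.prems(3)[OF that] by (simp add: hilb_commute)
      show "hinf b a = 1" using less.prems(4) by (simp add: hinf_commute)
      show "b \<noteq> 0" "a \<noteq> 0" by (rule less.prems)+
      show "\<bar>b\<bar> \<le> \<bar>a\<bar>" using False by linarith
      fix a' b' :: int
      assume H: "nat \<bar>a'\<bar> + nat \<bar>b'\<bar> < nat \<bar>b\<bar> + nat \<bar>a\<bar>" "a' \<noteq> 0" "b' \<noteq> 0"
        "\<And>p. prime p \<Longrightarrow> hilb p a' b' = 1" "hinf a' b' = 1"
      have H1: "nat \<bar>a'\<bar> + nat \<bar>b'\<bar> < nat \<bar>a\<bar> + nat \<bar>b\<bar>" using H(1) by simp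
      show "sol a' b'" unfolding sol_def by (rule less.hyps[OF H1 H(2-5)])
    qed
    then show ?thesis by (simp add: sol_commute)
  qed
  then show ?case by (simp add: sol_def)
qed

section \<open>Quaternary forms\<close>

lemma finite_bad_primes: "n \<noteq> 0 \<Longrightarrow> finite {p. prime p \<and> (p = 2 \<or> int p dvd n)}"
proof -
  assume "n \<noteq> 0"
  then have "finite {p. p dvd nat \<bar>n\<bar>}" by (intro finite_divisors_nat) simp
  moreover have "{p. prime p \<and> (p = 2 \<or> int p dvd n)} \<subseteq> insert 2 {p. p dvd nat \<bar>n\<bar>}"
    by auto
  ultimately show ?thesis by (meson finite_insert finite_subset)
qed

text \<open>Outside S and q both arguments are units, and the product formula forces the one symbol
  left, that at q.\<close>

lemma hilb_everywhere:
  assumes S: "finite S" "\<And>p. p \<in> S \<Longrightarrow> prime p" "2 \<in> S"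
    and nz: "A \<noteq> 0" "B \<noteq> 0" "t \<noteq> 0" and q: "prime q" "q \<notin> S"
    and AB: "\<And>p. prime p \<Longrightarrow> int p dvd A * B \<Longrightarrow> p \<in> S" and t: "\<And>p. prime p \<Longrightarrow> int p dvd t \<Longrightarrow> p \<in> insert q S"
    and h: "\<And>p. p \<in> S \<Longrightarrow> hilb p (A * t) (B * t) = 1" "hinf (A * t) (B * t) = 1" and p: "prime p"
  shows "hilb p (A * t) (B * t) = 1"
proof -
  have out: "p \<in> insert q S" if "prime p" "int p dvd (A * t) * (B * t)" for p
    using that AB t by (auto simp: prime_dvd_mult_iff)
  have "prodform (A * t) (B * t)" using nz by (intro hilbert_product_formula) auto
  then have "hinf (A * t) (B * t) * (\<Prod>p\<in>insert q S. hilb p (A * t) (B * t)) = 1"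
    unfolding prodform_def using S q out by (elim allE[of _ "insert q S"]) auto
  moreover have "(\<Prod>p\<in>insert q S. hilb p (A * t) (B * t)) = hilb q (A * t) (B * t)"
    using S q h(1) by (simp add: prod.neutral)
  ultimately have hq: "hilb q (A * t) (B * t) = 1" using h(2) by simp
  show ?thesis
  proof (cases "p \<in> insert q S")
    case True
    then show ?thesis using hq h(1) by auto
  next
    case False
    then have "\<not> int p dvd A * t" "\<not> int p dvd B * t" using out[OF p] by auto
    moreover have "p \<noteq> 2" using False S(3) by auto
    ultimately show ?thesis by (rule hilb_unit[OF p, rotated])
  qed
qed

text \<open>The local common values \<open>s p\<close> are replaced by one integer t in the same
  square class at every bad prime and with the right sign. Apart from bad primes it contains a
  single prime q, where the product formula takes care of both halves at once.\<close>

theorem quaternary_isotropic: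
  fixes a b c d :: int
  assumes nz: "a \<noteq> 0" "b \<noteq> 0" "c \<noteq> 0" "d \<noteq> 0"
    and loc: "\<And>p. prime p \<Longrightarrow> p = 2 \<or> int p dvd a * b * c * d \<Longrightarrow> good p a b c d"
    and real: "a < 0 \<or> b < 0 \<or> c < 0 \<or> d < 0" "a > 0 \<or> b > 0 \<or> c > 0 \<or> d > 0"
  shows "\<exists>x y z w. (x \<noteq> 0 \<or> y \<noteq> 0 \<or> z \<noteq> 0 \<or> w \<noteq> 0) \<and> a * x^2 + b * y^2 + c * z^2 + d * w^2 = 0"
proof -
  \<comment> \<open>The sign that t must have at the real place.\<close>
  have "\<exists>\<sigma>\<in>{1, -1}. hinf (a * \<sigma>) (b * \<sigma>) = 1 \<and> hinf (- c * \<sigma>) (- d * \<sigma>) = 1"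
    using nz real by (auto simp: hinf_def)
  then obtain \<sigma> where \<sigma>1: "\<sigma> \<in> {1, -1}"
    and \<sigma>2: "hinf (a * \<sigma>) (b * \<sigma>) = 1" "hinf (- c * \<sigma>) (- d * \<sigma>) = 1" by blast
  have \<sigma>: "\<sigma> = 1 \<or> \<sigma> = -1" "hinf (a * \<sigma>) (b * \<sigma>) = 1" "hinf (- c * \<sigma>) (- d * \<sigma>) = 1"
    using \<sigma>1 \<sigma>2 by blast+
  define S where "S = {p. prime p \<and> (p = 2 \<or> int p dvd a * b * c * d)}"
  have S: "finite S" "\<And>p. p \<in> S \<Longrightarrow> prime p" "2 \<in> S"
    using finite_bad_primes[of "a * b * c * d"] nz by (auto simp: S_def)
  have "\<forall>p\<in>S. \<exists>s. s \<noteq> 0 \<and> hilb p (a * s) (b * s) = 1 \<and> hilb p (- c * s) (- d * s) = 1"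
    using loc by (auto simp: S_def good_def)
  then obtain s where s: "\<And>p. p \<in> S \<Longrightarrow> s p \<noteq> 0" "\<And>p. p \<in> S \<Longrightarrow> hilb p (a * s p) (b * s p) = 1"
    "\<And>p. p \<in> S \<Longrightarrow> hilb p (- c * s p) (- d * s p) = 1" by metis
  define g where "g p = int p ^ pval p (s p)" for p
  \<comment> \<open>\<open>c0 p * q\<close> is going to be the unit part of t at p.\<close>
  define c0 where "c0 p = \<sigma> * (\<Prod>r\<in>S - {p}. g r)" for p
  have g0: "g p > 0" if "p \<in> S" for p using prime_gt_0_nat[OF S(2)[OF that]] by (simp add: g_def)
  have c0: "\<not> int p dvd c0 p" if pS: "p \<in> S" for p
  proof
    assume "int p dvd c0 p"
    then have "int p dvd (\<Prod>r\<in>S - {p}. g r)" using \<sigma>(1) by (auto simp: c0_def)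
    then obtain r where r: "r \<in> S - {p}" "int p dvd g r"
      using S(1) S(2)[OF pS] by (subst (asm) prime_dvd_prod_iff) auto
    then have "int p dvd int r" unfolding g_def using S(2)[OF that] prime_dvd_power[of "int p" "int r"] by auto
    then show False using r S(2) that prime_dvd_prime_int by auto
  qed
  have odd: "odd (c0 2 * punit 2 (s 2))"
    using c0[OF S(3)] pval_punit(2)[of 2 "s 2"] s(1)[OF S(3)] by simp
  \<comment> \<open>The symbols prescribed for q make \<open>c0 p * q\<close> agree with the unit
    part of \<open>s p\<close> up to squares; \<open>c0 p\<close> is its own inverse in this sense,
    since odd squares are 1 modulo 8.\<close>
  define Q where "Q = {q. prime q \<and> (\<forall>p\<in>S - {2}. Legendre (int q) (int p) = Legendre (c0 p) p * Legendre (punit p (s p)) p) \<and>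
      int q mod 8 = (c0 2 * punit 2 (s 2)) mod 8}"
  have "infinite Q" unfolding Q_def
  proof (rule primes_with_quadratic_symbols[OF _ _ _ odd])
    show "prime p \<and> p > 2" if "p \<in> S - {2}" for p using S(2)[of p] that prime_ge_2_nat[of p] by auto
    show "Legendre (c0 p) p * Legendre (punit p (s p)) p \<in> {-1, 1}" if "p \<in> S - {2}" for p
    proof -
      have pS: "p \<in> S" using that by simp
      show ?thesis
        using Legendre_values[OF c0[OF pS]] Legendre_values[OF pval_punit(2)[OF S(2)[OF pS] s(1)[OF pS]]] by auto
    qed
  qed (use S in auto)
  then have "\<not> Q \<subseteq> S" using S(1) finite_subset by blast
  then obtain q where "q \<in> Q" "q \<notin> S" by blast
  then have q: "prime q" "q \<notin> S" "\<forall>p\<in>S - {2}. Legendre (int q) (int p) = Legendre (c0 p) p * Legendre (punit p (s p)) p"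
    "int q mod 8 = (c0 2 * punit 2 (s 2)) mod 8"
    unfolding Q_def by blast+
  define t where "t = \<sigma> * (\<Prod>p\<in>S. g p) * int q"
  have m0: "(\<Prod>p\<in>S. g p) * int q > 0" using g0 prime_gt_0_nat[OF q(1)] by (intro mult_pos_pos prod_pos) auto
  have t0: "t \<noteq> 0" unfolding t_def mult.assoc
    by (metis m0 \<sigma>(1) less_irrefl mult_eq_0_iff zero_neq_neg_one zero_neq_one)
  have cls: "hilb p x t = hilb p x (s p)" if p: "p \<in> S" for p x
  proof (rule hilb_class_cong[OF S(2)[OF p], of _ _ "c0 p * int q"])
    have "(\<Prod>p\<in>S. g p) = g p * (\<Prod>r\<in>S - {p}. g r)" using S(1) p by (simp add: prod.remove)
    then show "t = int p ^ pval p (s p) * (c0 p * int q)" by (simp add: t_def c0_def g_def)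
    have "\<not> int p dvd int q" using q(1,2) S(2)[OF p] p prime_dvd_prime_int by auto
    then show "\<not> int p dvd c0 p * int q" using c0[OF p] S(2)[OF p] by (simp add: prime_dvd_mult_iff)
    show "if p = 2 then c0 p * int q mod 8 = punit p (s p) mod 8
        else Legendre (c0 p * int q) (int p) = Legendre (punit p (s p)) (int p)"
    proof (cases "p = 2")
      case True
      have "c0 2 * int q mod 8 = c0 2 * (int q mod 8) mod 8" by (simp add: mod_mult_right_eq)
      also have "\<dots> = c0 2 * (c0 2 * punit 2 (s 2)) mod 8" unfolding q(4) by (simp add: mod_mult_right_eq)
      also have "\<dots> = ((c0 2)^2 mod 8) * punit 2 (s 2) mod 8" by (simp add: power2_eq_square mod_mult_left_eq mult.assoc)
      also have "(c0 2)^2 mod 8 = 1" using c0[OF S(3)] by (simp add: square_mod_8)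
      finally show ?thesis using True by simp
    next
      case False
      then have p2: "p > 2" using S(2)[OF p] prime_ge_2_nat[of p] by linarith
      have "Legendre (c0 p * int q) p = Legendre (c0 p) p * (Legendre (c0 p) p * Legendre (punit p (s p)) p)"
        using q(3) False p by (simp add: Legendre_mult[OF S(2)[OF p] p2])
      then show ?thesis using False Legendre_values[OF c0[OF p]] by auto
    qed
  qed
  have hs: "hilb p (A * t) (B * t) = hilb p (A * s p) (B * s p)" if "p \<in> S" "A \<noteq> 0" "B \<noteq> 0" for p A B
    using hilb_scale[OF S(2)[OF that(1)] that(2,3) t0] hilb_scale[OF S(2)[OF that(1)] that(2,3) s(1)[OF that(1)]]
      cls[OF that(1), of "- (A * B)"] by (simp add: hilb_commute[of p t] hilb_commute[of p "s p"])
  have hi: "hinf (A * t) (B * t) = hinf (A * \<sigma>) (B * \<sigma>)" for A B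
  proof -
    have "A * t < 0 \<longleftrightarrow> A * \<sigma> < 0" for A
    proof -
      have "A * t = (A * \<sigma>) * ((\<Prod>p\<in>S. g p) * int q)" by (simp add: t_def mult_ac)
      moreover have "X * M < 0 \<longleftrightarrow> X < 0" if "M > 0" for X M :: int using that by (simp add: mult_less_0_iff)
      ultimately show ?thesis using m0 by presburger
    qed
    then show ?thesis by (simp add: hinf_def)
  qed
  have tq: "p \<in> insert q S" if pp: "prime p" "int p dvd t" for p
  proof -
    have "int p dvd (\<Prod>p\<in>S. g p) \<or> int p dvd int q"
      using that \<sigma>(1) by (auto simp: t_def prime_dvd_mult_iff)
    then show ?thesis
    proof
      assume "int p dvd (\<Prod>p\<in>S. g p)"
      then obtain r where r: "r \<in> S" "int p dvd g r" using S(1) pp(1) by (subst (asm) prime_dvd_prod_iff) auto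
      then have "int p dvd int r" unfolding g_def using that(1) prime_dvd_power[of "int p" "int r"] by auto
      then show ?thesis using r S(2) that prime_dvd_prime_int by auto
    qed (use that q prime_dvd_prime_int in auto)
  qed
  have solve: "\<exists>x y z. (x \<noteq> 0 \<or> y \<noteq> 0 \<or> z \<noteq> 0) \<and> z\<^sup>2 = (A * t) * x^2 + (B * t) * y^2"
    if "A \<noteq> 0" "B \<noteq> 0" "A * B dvd a * b * c * d" "\<And>p. p \<in> S \<Longrightarrow> hilb p (A * s p) (B * s p) = 1"
      "hinf (A * \<sigma>) (B * \<sigma>) = 1" for A B
  proof (rule conic_soluble)
    show "hilb p (A * t) (B * t) = 1" if "prime p" for p
    proof (rule hilb_everywhere[OF S _ _ t0 q(1,2) _ tq _ _ that])
      show "p \<in> S" if "prime p" "int p dvd A * B" for p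
        using that dvd_trans[OF that(2) \<open>A * B dvd a * b * c * d\<close>] by (simp add: S_def)
    qed (use \<open>A \<noteq> 0\<close> \<open>B \<noteq> 0\<close> hs hi \<open>\<And>p. p \<in> S \<Longrightarrow> hilb p (A * s p) (B * s p) = 1\<close> \<open>hinf (A * \<sigma>) (B * \<sigma>) = 1\<close> in auto)
  qed (use that hi t0 in auto)
  obtain x y z where 1: "x \<noteq> 0 \<or> y \<noteq> 0 \<or> z \<noteq> 0" "z^2 = (a * t) * x^2 + (b * t) * y^2"
    using solve[of a b] nz s(2) \<sigma>(2) by (metis dvd_triv_left mult.assoc)
  have "- c * - d dvd a * b * c * d" by (simp add: mult.assoc)
  then obtain x' y' z' where 2: "x' \<noteq> 0 \<or> y' \<noteq> 0 \<or> z' \<noteq> 0" "z'^2 = (- c * t) * x'^2 + (- d * t) * y'^2"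
    using solve[of "- c" "- d"] nz s(3) \<sigma>(3) by (metis neg_equal_0_iff_equal)
  show ?thesis
  \<comment> \<open>If z or z' is 0, one half of the form is already isotropic. Otherwise both
    conics are scaled to the square z^2 z'^2 and subtracted.\<close>
  proof (cases "z = 0")
    case True
    then have "t * (a * x^2 + b * y^2) = 0" using 1(2) by (simp add: algebra_simps)
    then have "a * x^2 + b * y^2 + c * 0\<^sup>2 + d * 0\<^sup>2 = 0" using t0 by simp
    then show ?thesis using 1(1) True by blast
  next
    case z: False
    show ?thesis
    proof (cases "z' = 0")
      case True
      then have "t * (c * x'^2 + d * y'^2) = 0" using 2(2) by (simp add: algebra_simps)
      then have "a * 0\<^sup>2 + b * 0\<^sup>2 + c * x'^2 + d * y'^2 = 0" using t0 by simp
      then show ?thesis using 2(1) True by blast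
    next
      case z': False
      have "t * (a * (x * z')^2 + b * (y * z')^2 + c * (x' * z)^2 + d * (y' * z)^2) =
          ((a * t) * x^2 + (b * t) * y^2) * z'^2 - ((- c * t) * x'^2 + (- d * t) * y'^2) * z^2"
        by (simp add: power2_eq_square algebra_simps)
      also have "\<dots> = 0" unfolding 1(2)[symmetric] 2(2)[symmetric] by simp
      finally have "a * (x * z')^2 + b * (y * z')^2 + c * (x' * z)^2 + d * (y' * z)^2 = 0" using t0 by simp
      moreover have "x \<noteq> 0 \<or> y \<noteq> 0" using 1(2) z by auto
      ultimately show ?thesis using z' by (metis mult_eq_0_iff)
    qed
  qed
qed

section \<open>Forms in five variables\<close>

text \<open>Otherwise the residues that are squares modulo p, 0 included, would be closed under
  adding 1, and every residue would be a square.\<close>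

lemma consecutive_nonresidue:
  assumes "prime p" "p > 2"
  shows "\<exists>z. Legendre (z^2 + 1) (int p) = -1"
proof (rule ccontr)
  assume n: "\<nexists>z. Legendre (z^2 + 1) (int p) = -1"
  have q: "QuadRes p (int k)" for k
  proof (induction k)
    case 0
    then show ?case unfolding QuadRes_def by (intro exI[of _ 0]) simp
  next
    case (Suc k)
    then obtain y where y: "[y\<^sup>2 = int k] (mod int p)" by (auto simp: QuadRes_def)
    have e: "[y\<^sup>2 + 1 = int (Suc k)] (mod int p)" using cong_add[OF y cong_refl[of 1]] by (simp add: add.commute)
    have "\<exists>w. [w\<^sup>2 = y^2 + 1] (mod int p)"
    proof (cases "[y\<^sup>2 + 1 = 0] (mod int p)")
      case True
      then show ?thesis by (intro exI[of _ 0]) (simp add: cong_sym)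
    next
      case False
      then show ?thesis using n by (auto simp: Legendre_def QuadRes_def split: if_splits)
    qed
    then show ?case unfolding QuadRes_def using e cong_trans by blast
  qed
  obtain a where a: "\<not> int p dvd a" "Legendre a p = -1" using exists_nonresidue[OF assms] by blast
  have "QuadRes p (a mod int p)" using q[of "nat (a mod int p)"] assms by simp
  then have "QuadRes p a" unfolding QuadRes_def by (metis cong_mod_right)
  then show False using a by (simp add: Legendre_def split: if_splits)
qed

text \<open>If a m or b m is not a p-adic square, (1, 0) or (0, 1) serves. If both are squares, the
  form is equivalent up to m to a sum of two squares, which takes the nonsquare unit 4 + 1 modulo 8
  for p = 2 and z^2 + 1 for odd p.\<close>

lemma binary_represents_nonsquare:
  assumes "prime p" "a \<noteq> 0" "b \<noteq> 0" "m \<noteq> 0"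
  shows "\<exists>x y s. a * x^2 + b * y^2 \<noteq> 0 \<and> s \<noteq> 0 \<and> hilb p s ((a * x^2 + b * y^2) * m) = -1"
proof -
  have *: ?thesis if "a * x^2 + b * y^2 \<noteq> 0" "\<not> isqr p ((a * x^2 + b * y^2) * m)" for x y
    using not_isqr[OF assms(1) _ that(2)] that(1) assms(4) by auto
  show ?thesis
  proof (cases "isqr p (a * m) \<and> isqr p (b * m)")
    case False
    then show ?thesis using *[of 1 0] *[of 0 1] assms by auto
  next
    case sq: True
    let ?i = "pval p (a * m) div 2" and ?j = "pval p (b * m) div 2" and ?u = "punit p (a * m)" and ?v = "punit p (b * m)"
    have ev: "pval p (a * m) = 2 * ?i" "pval p (b * m) = 2 * ?j" using sq by (auto simp: isqr_def)
    have am: "a * m = (int p ^ ?i)^2 * ?u" and bm: "b * m = (int p ^ ?j)^2 * ?v"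
      using pval_punit(1)[OF assms(1), of "a * m"] pval_punit(1)[OF assms(1), of "b * m"] ev assms
      by (metis mult_eq_0_iff power_mult mult.commute)+
    note nd = pval_punit(2)[OF assms(1), of "a * m"] pval_punit(2)[OF assms(1), of "b * m"]
    have "\<exists>x y. \<not> int p dvd ?u * x^2 + ?v * y^2 \<and>
        (if p = 2 then (?u * x^2 + ?v * y^2) mod 8 \<noteq> 1 else Legendre (?u * x^2 + ?v * y^2) p = -1)"
    proof (cases "p = 2")
      case True
      have "?u mod 8 = 1" "?v mod 8 = 1" using sq True by (auto simp: isqr_def)
      then have "(?u * 2\<^sup>2 + ?v * 1\<^sup>2) mod 8 = (1 * 4 + 1) mod 8"
        by (intro mod_add_cong mod_mult_cong) simp_all
      then have r: "(?u * 2\<^sup>2 + ?v * 1\<^sup>2) mod 8 = 5" by simp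
      have "odd k" if "k mod 8 = 5" for k :: int using that by presburger
      from this[OF r] have "odd (?u * 2\<^sup>2 + ?v * 1\<^sup>2)" .
      then show ?thesis using True r by (intro exI[of _ 2] exI[of _ 1]) simp
    next
      case False
      then have p: "p > 2" using assms(1) prime_ge_2_nat[of p] by linarith
      obtain z where z: "Legendre (z^2 + 1) p = -1" using consecutive_nonresidue[OF assms(1) p] by blast
      have lu: "Legendre ?u p = 1" "Legendre ?v p = 1" using sq False by (auto simp: isqr_def)
      then obtain r where r: "[r\<^sup>2 = ?u] (mod int p)" by (auto simp: Legendre_def QuadRes_def split: if_splits)
      from lu obtain w where w: "[w\<^sup>2 = ?v] (mod int p)" by (auto simp: Legendre_def QuadRes_def split: if_splits)
      have "[?u * (w * z)^2 + ?v * r^2 = ?u * (?v * z^2) + ?v * ?u] (mod int p)"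
        unfolding power_mult_distrib using w r by (intro cong_add cong_mult cong_refl)
      then have "Legendre (?u * (w * z)^2 + ?v * r^2) p = Legendre ((?u * ?v) * (z^2 + 1)) p"
        by (intro Legendre_cong_mod) (simp add: algebra_simps)
      also have "\<dots> = -1" using lu z by (simp add: Legendre_mult[OF assms(1) p])
      finally have L: "Legendre (?u * (w * z)^2 + ?v * r^2) p = -1" .
      then have "\<not> int p dvd ?u * (w * z)^2 + ?v * r^2" by (auto simp: Legendre_def cong_0_iff)
      then show ?thesis using L False by auto
    qed
    then obtain x y where xy: "\<not> int p dvd ?u * x^2 + ?v * y^2"
      "if p = 2 then (?u * x^2 + ?v * y^2) mod 8 \<noteq> 1 else Legendre (?u * x^2 + ?v * y^2) p = -1" by blast
    define X Y where "X = int p ^ ?j * x" and "Y = int p ^ ?i * y"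
    have e: "(a * X^2 + b * Y^2) * m = int p ^ (2 * (?i + ?j)) * (?u * x^2 + ?v * y^2)"
    proof -
      have gen: "A * X^2 + B * Y^2 = (int p ^ ?i * int p ^ ?j)^2 * (?u * x^2 + ?v * y^2)"
        if "A = (int p ^ ?i)^2 * ?u" "B = (int p ^ ?j)^2 * ?v" for A B
        unfolding that X_def Y_def by (simp add: power2_eq_square algebra_simps)
      have "(a * X^2 + b * Y^2) * m = (a * m) * X^2 + (b * m) * Y^2" by (simp add: algebra_simps)
      also have "\<dots> = (int p ^ ?i * int p ^ ?j)^2 * (?u * x^2 + ?v * y^2)"
        by (rule gen[OF am bm])
      also have "(int p ^ ?i * int p ^ ?j)^2 = int p ^ (2 * (?i + ?j))"
        by (simp only: power_add[symmetric] power_mult[symmetric] mult.commute)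
      finally show ?thesis .
    qed
    note v = pval_eqI[OF assms(1) e xy(1)]
    have "\<not> isqr p ((a * X^2 + b * Y^2) * m)" unfolding isqr_def v using xy(2) by auto
    moreover have "?u * x^2 + ?v * y^2 \<noteq> 0" using xy(1) by auto
    then have "(a * X^2 + b * Y^2) * m \<noteq> 0" unfolding e using assms(1) by auto
    ultimately show ?thesis using *[of X Y] by auto
  qed
qed

text \<open>The first two variables are merged into one value t = a X^2 + b Y^2, chosen by
  congruences so that t c d e is a nonsquare at every bad prime; there the quaternary form t, c, d,
  e is isotropic. Both signs occur among c, d, e, so the sign of t does not matter.\<close>

theorem quinary_isotropic:
  fixes a b c d e :: int
  assumes nz: "a \<noteq> 0" "b \<noteq> 0" "c \<noteq> 0" "d \<noteq> 0" "e \<noteq> 0"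
    and real: "c < 0 \<or> d < 0 \<or> e < 0" "c > 0 \<or> d > 0 \<or> e > 0"
  shows "\<exists>x y z w v. (x \<noteq> 0 \<or> y \<noteq> 0 \<or> z \<noteq> 0 \<or> w \<noteq> 0 \<or> v \<noteq> 0) \<and>
    a * x^2 + b * y^2 + c * z^2 + d * w^2 + e * v^2 = 0"
proof -
  define m where "m = c * d * e"
  have m0: "m \<noteq> 0" using nz by (simp add: m_def)
  define S where "S = {p. prime p \<and> (p = 2 \<or> int p dvd a * b * c * d * e)}"
  have S: "finite S" "\<And>p. p \<in> S \<Longrightarrow> prime p" "2 \<in> S"
    using finite_bad_primes[of "a * b * c * d * e"] nz by (auto simp: S_def)
  have "\<forall>p\<in>S. \<exists>x y s. a * x^2 + b * y^2 \<noteq> 0 \<and> s \<noteq> 0 \<and> hilb p s ((a * x^2 + b * y^2) * m) = -1"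
    using binary_represents_nonsquare[OF S(2) nz(1,2) m0] by blast
  then obtain x y s where xy: "\<And>p. p \<in> S \<Longrightarrow> a * (x p)^2 + b * (y p)^2 \<noteq> 0" "\<And>p. p \<in> S \<Longrightarrow> s p \<noteq> 0"
    "\<And>p. p \<in> S \<Longrightarrow> hilb p (s p) ((a * (x p)^2 + b * (y p)^2) * m) = -1" by metis
  define K where "K = (\<Sum>p\<in>S. pval p (a * (x p)^2 + b * (y p)^2)) + 3"
  have K: "pval p (a * (x p)^2 + b * (y p)^2) + 3 \<le> K" if "p \<in> S" for p
    unfolding K_def using S(1) that by (intro add_right_mono member_le_sum) auto
  obtain X where X: "\<forall>p\<in>S. [X = x p] (mod int p ^ K)" using crt_primes[OF S(1,2)] by blast
  obtain Y where Y: "\<forall>p\<in>S. [Y = y p] (mod int p ^ K)" using crt_primes[OF S(1,2)] by blast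
  define t where "t = a * X^2 + b * Y^2"
  have cl: "int p ^ K dvd t - (a * (x p)^2 + b * (y p)^2)" if "p \<in> S" for p
  proof -
    have "[t = a * (x p)^2 + b * (y p)^2] (mod int p ^ K)"
      unfolding t_def using X Y that by (intro cong_add cong_mult cong_pow cong_refl) auto
    then show ?thesis by (simp add: cong_iff_dvd_diff)
  qed
  \<comment> \<open>Closeness to a nonzero value at the single prime 2 already excludes t =
    0.\<close>
  have t0: "t \<noteq> 0" using hilb_close(1)[OF S(2) xy(1) cl K, OF S(3) S(3) S(3) S(3)] .
  have "\<exists>z w v u. (z \<noteq> 0 \<or> w \<noteq> 0 \<or> v \<noteq> 0 \<or> u \<noteq> 0) \<and> t * z^2 + c * w^2 + d * v^2 + e * u^2 = 0"
  proof (rule quaternary_isotropic[OF t0 nz(3-5)])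
    fix p :: nat assume p: "prime p" "p = 2 \<or> int p dvd t * c * d * e"
    show "good p t c d e"
    proof (cases "p \<in> S")
      case True
      have "hilb p (s p) (t * m) = hilb p (s p) t * hilb p (s p) m"
        using p(1) xy(2)[OF True] t0 m0 by (intro hilb_mult_right)
      also have "hilb p (s p) t = hilb p (s p) (a * (x p)^2 + b * (y p)^2)"
        by (rule hilb_close(2)[OF p(1) xy(1)[OF True] cl[OF True] K[OF True]])
      also have "\<dots> * hilb p (s p) m = hilb p (s p) ((a * (x p)^2 + b * (y p)^2) * m)"
        using p(1) xy(1,2)[OF True] m0 by (intro hilb_mult_right[symmetric])
      finally have "hilb p (s p) (t * c * d * e) = -1" using xy(3)[OF True] by (simp add: m_def mult.assoc)
      then show ?thesis using good_of_nonsquare_disc[OF p(1) t0 nz(3-5) xy(2)[OF True]] by blast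
    next
      \<comment> \<open>Outside S the coefficients c, d, e are units and s = c is a common value:
        the second half, scaled by c, has unit coefficients.\<close>
      case False
      then have n: "p \<noteq> 2" "\<not> int p dvd c" "\<not> int p dvd d" "\<not> int p dvd e"
        using p(1) by (auto simp: S_def prime_dvd_mult_iff)
      have "hilb p (t * c) (c * c) = 1"
        using hilb_square_left[of p c "t * c"] p(1) nz t0 by (simp add: hilb_commute power2_eq_square)
      moreover have "hilb p (- d * c) (- e * c) = 1"
        using n p(1) by (intro hilb_unit) (auto simp: prime_dvd_mult_iff)
      ultimately show ?thesis unfolding good_def using nz by blast
    qed
  qed (use real in auto)
  then obtain z w v u where 1: "z \<noteq> 0 \<or> w \<noteq> 0 \<or> v \<noteq> 0 \<or> u \<noteq> 0" "t * z^2 + c * w^2 + d * v^2 + e * u^2 = 0"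
    by blast
  have "a * (X * z)^2 + b * (Y * z)^2 + c * w^2 + d * v^2 + e * u^2 = 0"
    using 1(2) by (simp add: t_def power_mult_distrib algebra_simps)
  moreover have "X \<noteq> 0 \<or> Y \<noteq> 0" using t0 by (auto simp: t_def)
  ultimately show ?thesis using 1(1) by (metis mult_eq_0_iff)
qed

section \<open>Riemann sums over lattices\<close>

text \<open>A common majorant of all weights, stable under bounded shifts. The exponent exceeds the
  dimension by 2, so that a cover by balls of radius k + 1 bounds its integral by a sum of inverse
  squares.\<close>

definition wfun :: "real ^ 'm \<Rightarrow> real" where
  "wfun x = (1 / (1 + norm x)) ^ (CARD('m) + 2)"

lemma wfun_nonneg: "0 \<le> wfun x" by (simp add: wfun_def)

lemma wfun_shift:
  fixes x y :: "real ^ 'm"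
  assumes "norm (x - y) \<le> K"
  shows "wfun x \<le> (1 + K) ^ (CARD('m) + 2) * wfun y"
proof -
  have K: "K \<ge> 0" using assms norm_ge_zero order_trans by blast
  have "norm y \<le> norm x + K" using norm_triangle_ineq3[of x y] assms by linarith
  then have "1 + norm y \<le> (1 + K) * (1 + norm x)" proof -
    have "(1 + K) * (1 + norm x) = 1 + norm x + K + K * norm x" by (simp add: algebra_simps)
    moreover have "0 \<le> K * norm x" using K by simp
    ultimately show ?thesis using \<open>norm y \<le> norm x + K\<close> by linarith
  qed
  moreover have "1 + norm x > 0" "1 + norm y > 0" by (simp_all add: add_pos_nonneg)
  ultimately have "1 / (1 + norm x) \<le> (1 + K) / (1 + norm y)"
    by (simp add: pos_divide_le_eq pos_le_divide_eq)
  then have "wfun x \<le> ((1 + K) / (1 + norm y)) ^ (CARD('m) + 2)"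
    unfolding wfun_def by (intro power_mono) auto
  also have "\<dots> = (1 + K) ^ (CARD('m) + 2) * wfun y" by (simp add: wfun_def power_divide)
  finally show ?thesis .
qed

lemma wfun_measurable [measurable]: "wfun \<in> borel_measurable borel"
  unfolding wfun_def by measurable

lemma wfun_integrable: "integrable lborel (wfun :: real ^ 'm \<Rightarrow> real)"
proof (rule integrableI_bounded)
  let ?d = "CARD('m)"
  define a where "a k = (1 / (1 + real k)) ^ (?d + 2)" for k :: nat
  let ?B = "\<lambda>k. cball (0 :: real ^ 'm) (real k + 1)"
  have le: "ennreal (norm (wfun y)) \<le> (\<Sum>k. ennreal (a k) * indicator (?B k) y)" for y :: "real ^ 'm"
  proof -
    define k where "k = nat \<lfloor>norm y\<rfloor>"
    have "real k = real_of_int \<lfloor>norm y\<rfloor>" by (simp add: k_def)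
    then have k: "real k \<le> norm y" "norm y \<le> real k + 1" by linarith+
    have "wfun y \<le> a k" unfolding wfun_def a_def using k(1) by (intro power_mono divide_left_mono) (auto intro: mult_pos_pos add_pos_nonneg)
    then have "ennreal (norm (wfun y)) \<le> ennreal (a k) * indicator (?B k) y"
      using k(2) wfun_nonneg[of y] by (simp add: ennreal_leI)
    also have "\<dots> \<le> (\<Sum>k. ennreal (a k) * indicator (?B k) y)"
    proof -
      define g where "g k = ennreal (a k) * indicator (?B k) y" for k
      show ?thesis using sum_le_suminf[of g "{k}"] by (simp add: g_def[symmetric])
    qed
    finally show ?thesis .
  qed
  have "(\<integral>\<^sup>+ y. ennreal (norm (wfun (y :: real ^ 'm))) \<partial>lborel) \<le> (\<integral>\<^sup>+ y. (\<Sum>k. ennreal (a k) * indicator (?B k) y) \<partial>lborel)"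
    by (intro nn_integral_mono le)
  also have "\<dots> = (\<Sum>k. \<integral>\<^sup>+ y. ennreal (a k) * indicator (?B k) y \<partial>lborel)"
    by (intro nn_integral_suminf borel_measurable_times_ennreal borel_measurable_const borel_measurable_indicator) auto
  also have "\<dots> = (\<Sum>k. ennreal (a k) * emeasure lborel (?B k))"
    by (intro suminf_cong nn_integral_cmult_indicator) auto
  also have "\<dots> = (\<Sum>k. ennreal (unit_ball_vol (real ?d) * (1 / (real k + 1)\<^sup>2)))"
  proof (rule suminf_cong)
    fix k :: nat
    have "a k * (unit_ball_vol (real ?d) * (real k + 1) ^ ?d) = unit_ball_vol (real ?d) * (1 / (real k + 1)\<^sup>2)"
      unfolding a_def by (simp add: power_add power_divide add.commute power2_eq_square)
    then show "ennreal (a k) * emeasure lborel (?B k) = ennreal (unit_ball_vol (real ?d) * (1 / (real k + 1)\<^sup>2))"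
      by (simp add: emeasure_cball ennreal_mult''[symmetric] a_def)
  qed
  also have "\<dots> < \<infinity>"
  proof -
    have "summable (\<lambda>n. inverse ((real n)^2))" by (rule inverse_power_summable) simp
    then have "summable (\<lambda>k. inverse ((real (Suc k))^2))" by (subst summable_Suc_iff)
    then have "summable (\<lambda>k. 1 / (real k + 1)\<^sup>2)" by (simp add: inverse_eq_divide add.commute)
    then have "summable (\<lambda>k. unit_ball_vol (real ?d) * (1 / (real k + 1)\<^sup>2))" by (rule summable_mult)
    then show ?thesis
      unfolding infinity_ennreal_def less_top[symmetric] by (rule ennreal_suminf_neq_top) simp
  qed
  finally show "(\<integral>\<^sup>+ y. ennreal (norm (wfun (y :: real ^ 'm))) \<partial>lborel) < \<infinity>" .
qed simp

definition lat_point :: "int \<Rightarrow> int ^ 'm \<Rightarrow> real \<Rightarrow> int ^ 'm \<Rightarrow> real ^ 'm" where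
  "lat_point M a X v = (\<chi> u. real_of_int (M * v $ u + a $ u) / X)"

text \<open>The index of the cube of side M / X that contains y; \<open>lat_point\<close> sends it
  to a nearby point of the coset of a modulo M, scaled by 1 / X.\<close>

definition lat_cell :: "int \<Rightarrow> real \<Rightarrow> real ^ 'm \<Rightarrow> int ^ 'm" where
  "lat_cell M X y = (\<chi> u. \<lfloor>X * y $ u / real_of_int M\<rfloor>)"

lemma lat_close:
  fixes y :: "real ^ 'm"
  assumes "M > 0" "X > 0" "\<And>u. 0 \<le> a $ u \<and> a $ u < M"
  shows "norm (lat_point M a X (lat_cell M X y) - y) \<le> real CARD('m) * (real_of_int M / X)"
proof -
  have "\<bar>(lat_point M a X (lat_cell M X y) - y) $ u\<bar> \<le> real_of_int M / X" for u
  proof -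
    define t where "t = X * y $ u / real_of_int M"
    have Mr: "real_of_int M > 0" using assms(1) by simp
    have y: "y $ u = real_of_int M * t / X"
      using Mr assms(2) unfolding t_def by (simp add: nonzero_eq_divide_eq)
    have fl: "t - 1 \<le> real_of_int \<lfloor>t\<rfloor>" "real_of_int \<lfloor>t\<rfloor> \<le> t" by linarith+
    have b: "real_of_int M * (t - 1) \<le> real_of_int M * real_of_int \<lfloor>t\<rfloor>" "real_of_int M * real_of_int \<lfloor>t\<rfloor> \<le> real_of_int M * t"
      using fl assms(1) by (intro mult_left_mono; simp)+
    have a: "0 \<le> real_of_int (a $ u)" "real_of_int (a $ u) \<le> real_of_int M" using assms(3)[of u] by auto
    have "\<bar>real_of_int M * real_of_int \<lfloor>t\<rfloor> + real_of_int (a $ u) - real_of_int M * t\<bar> \<le> real_of_int M"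
      using b a by (simp add: right_diff_distrib abs_le_iff)
    then have "\<bar>real_of_int M * real_of_int \<lfloor>t\<rfloor> + real_of_int (a $ u) - real_of_int M * t\<bar> / X \<le> real_of_int M / X"
      using assms(2) by (intro divide_right_mono) auto
    moreover have "(lat_point M a X (lat_cell M X y) - y) $ u = (real_of_int M * real_of_int \<lfloor>t\<rfloor> + real_of_int (a $ u) - real_of_int M * t) / X"
      using y by (simp add: lat_point_def lat_cell_def t_def[symmetric] diff_divide_distrib)
    ultimately show ?thesis by (metis abs_divide abs_of_pos assms(2))
  qed
  note comp = this
  have "(\<Sum>u\<in>UNIV. \<bar>(lat_point M a X (lat_cell M X y) - y) $ u\<bar>) \<le> (\<Sum>u\<in>(UNIV :: 'm set). real_of_int M / X)"
    by (intro sum_mono comp)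
  then show ?thesis using norm_le_l1_cart[of "lat_point M a X (lat_cell M X y) - y"] by simp
qed

lemma lat_cell_measurable [measurable]: "(lat_cell M X :: real ^ 'm \<Rightarrow> int ^ 'm) \<in> measurable borel (count_space UNIV)"
proof -
  have "lat_cell M X -` {v} \<inter> space borel \<in> sets borel" for v :: "int ^ 'm"
  proof -
    have "lat_cell M X -` {v} \<inter> space borel = {y. \<forall>u. \<lfloor>X * y $ u / real_of_int M\<rfloor> = v $ u}"
      by (auto simp: lat_cell_def vec_eq_iff)
    also have "\<dots> = (\<Inter>u. {y. \<lfloor>X * y $ u / real_of_int M\<rfloor> = v $ u})" by auto
    also have "\<dots> \<in> sets borel"
    proof (intro sets.finite_INT)
      fix u
      have "(\<lambda>y :: real ^ 'm. X / real_of_int M * y $ u) \<in> borel_measurable borel"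
        by (intro borel_measurable_continuous_onI continuous_intros)
      then have "(\<lambda>y :: real ^ 'm. X * y $ u / real_of_int M) \<in> borel_measurable borel" by simp
      then have "(\<lambda>y. \<lfloor>X * y $ u / real_of_int M\<rfloor>) \<in> measurable borel (count_space UNIV)" by measurable
      from measurable_sets[OF this, of "{v $ u}"] show "{y. \<lfloor>X * y $ u / real_of_int M\<rfloor> = v $ u} \<in> sets borel"
        by (simp add: vimage_def)
    qed auto
    finally show ?thesis .
  qed
  then show ?thesis by (subst measurable_count_space_eq_countable) auto
qed

text \<open>All cells have the volume (M / X)^m. A sum over the lattice thus becomes the integral of
  a step function.\<close>

lemma lat_distr:
  assumes "M > 0" "X > 0"
  shows "distr lborel (count_space UNIV) (lat_cell M X :: real ^ 'm \<Rightarrow> int ^ 'm) =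
    density (count_space UNIV) (\<lambda>_. ennreal ((real_of_int M / X) ^ CARD('m)))"
proof (rule measure_eqI_countable[of _ UNIV])
  fix v :: "int ^ 'm"
  define l where "l = (\<chi> u. real_of_int M * real_of_int (v $ u) / X)"
  define r where "r = (\<chi> u. real_of_int M * (real_of_int (v $ u) + 1) / X)"
  let ?A = "lat_cell M X -` {v} :: (real ^ 'm) set"
  have A: "?A = {y. \<forall>u. l $ u \<le> y $ u \<and> y $ u < r $ u}"
  proof -
    have "\<lfloor>X * t / real_of_int M\<rfloor> = k \<longleftrightarrow> real_of_int M * real_of_int k / X \<le> t \<and> t < real_of_int M * (real_of_int k + 1) / X" for t k
    proof -
      have "real_of_int M > 0" using assms(1) by simp
      then show ?thesis unfolding floor_eq_iff using assms(2)
        by (simp add: pos_le_divide_eq pos_divide_le_eq pos_less_divide_eq pos_divide_less_eq mult.commute)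
    qed
    note fl = this
    have "?A = {y. \<forall>u. \<lfloor>X * y $ u / real_of_int M\<rfloor> = v $ u}" by (auto simp: lat_cell_def vec_eq_iff)
    then show ?thesis unfolding fl l_def r_def by simp
  qed
  have lr: "l \<bullet> b \<le> r \<bullet> b" "(r - l) \<bullet> b = real_of_int M / X" if "b \<in> Basis" for b
    using that assms by (auto simp: Basis_vec_def inner_axis l_def r_def divide_simps algebra_simps)
  have vol: "(\<Prod>b\<in>Basis. (r - l) \<bullet> b) = (real_of_int M / X) ^ CARD('m)" using lr(2) by simp
  have m: "?A \<in> sets lborel" using measurable_sets[OF lat_cell_measurable, of "{v}" M X] by simp
  have "emeasure lborel (box l r) \<le> emeasure lborel ?A" unfolding A by (intro emeasure_mono m[unfolded A]) (auto simp: mem_box_cart less_imp_le)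
  moreover have "emeasure lborel ?A \<le> emeasure lborel (cbox l r)" unfolding A by (intro emeasure_mono) (auto simp: mem_box_cart less_imp_le)
  ultimately have "emeasure lborel ?A = ennreal ((real_of_int M / X) ^ CARD('m))"
    using lr(1) by (simp add: vol antisym)
  then show "emeasure (distr lborel (count_space UNIV) (lat_cell M X)) {v} =
      emeasure (density (count_space UNIV) (\<lambda>_. ennreal ((real_of_int M / X) ^ CARD('m)))) {v}"
    by (simp add: emeasure_distr emeasure_density)
qed auto

text \<open>The hypotheses of dominated convergence for Riemann sums: continuity almost everywhere
  gives pointwise limits, the multiple of \<open>wfun\<close> the majorant.\<close>

definition adm :: "(real ^ 'm \<Rightarrow> real) \<Rightarrow> bool" where
  "adm f \<longleftrightarrow> f \<in> borel_measurable lebesgue \<and> (\<exists>C\<ge>0. \<forall>x. \<bar>f x\<bar> \<le> C * wfun x) \<and> negligible {x. \<not> isCont f x}"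

lemma lat_sum_integral:
  fixes f :: "real ^ 'm \<Rightarrow> real"
  assumes "adm f" "M > 0" "X > 0" "\<And>u. 0 \<le> a $ u \<and> a $ u < M"
  shows "(\<lambda>v. f (lat_point M a X v)) summable_on UNIV"
    "(real_of_int M / X) ^ CARD('m) * (\<Sum>\<^sub>\<infinity>v. f (lat_point M a X v)) = (\<integral>y. f (lat_point M a X (lat_cell M X y)) \<partial>lebesgue)"
proof -
  let ?F = "\<lambda>v. f (lat_point M a X v)" and ?G = "lat_cell M X :: real ^ 'm \<Rightarrow> int ^ 'm"
  let ?r = "(real_of_int M / X) ^ CARD('m)"
  have r: "?r > 0" using assms by simp
  have [measurable]: "?F \<in> borel_measurable (count_space UNIV)" by simp
  obtain C where C: "C \<ge> 0" "\<And>x. \<bar>f x\<bar> \<le> C * wfun x" using assms(1) by (auto simp: adm_def)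
  define K where "K = real CARD('m) * (real_of_int M / X)"
  have int: "integrable lborel (\<lambda>y. ?F (?G y))"
  proof (rule Bochner_Integration.integrable_bound)
    show "integrable lborel (\<lambda>y :: real ^ 'm. C * ((1 + K) ^ (CARD('m) + 2) * wfun y))"
      by (intro integrable_mult_right wfun_integrable)
    show "(\<lambda>y. ?F (?G y)) \<in> borel_measurable lborel"
      using measurable_compose[OF lat_cell_measurable, of ?F borel M X] by simp
    show "AE y in lborel. norm (?F (?G y)) \<le> norm (C * ((1 + K) ^ (CARD('m) + 2) * wfun y))"
    proof (rule AE_I2)
      fix y :: "real ^ 'm"
      have "\<bar>?F (?G y)\<bar> \<le> C * wfun (lat_point M a X (?G y))" by (rule C(2))
      also have "\<dots> \<le> C * ((1 + K) ^ (CARD('m) + 2) * wfun y)"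
        using lat_close[OF assms(2-4), of y] C(1) by (intro mult_left_mono wfun_shift) (auto simp: K_def)
      finally show "norm (?F (?G y)) \<le> norm (C * ((1 + K) ^ (CARD('m) + 2) * wfun y))" by simp
    qed
  qed
  have "integrable (distr lborel (count_space UNIV) ?G) ?F"
    using int by (subst integrable_distr_eq) auto
  then have "integrable (count_space UNIV) (\<lambda>v. ?r *\<^sub>R ?F v)"
    unfolding lat_distr[OF assms(2,3)] using r by (subst (asm) integrable_density) auto
  then have "integrable (count_space UNIV) (\<lambda>v. (1 / ?r) * (?r * ?F v))" by (intro integrable_mult_right) simp
  moreover have "(\<lambda>v. (1 / ?r) * (?r * ?F v)) = ?F" using assms(2,3) by (auto simp: fun_eq_iff)
  ultimately have "integrable (count_space UNIV) ?F" by (simp only:)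
  then have as: "Infinite_Set_Sum.abs_summable_on ?F UNIV" by (simp add: abs_summable_on_def)
  then have "Infinite_Sum.abs_summable_on ?F UNIV" by (rule abs_summable_equivalent[THEN iffD2])
  then show "?F summable_on UNIV" by (rule abs_summable_summable)
  have "(\<integral>y. ?F (?G y) \<partial>lebesgue) = (\<integral>y. ?F (?G y) \<partial>lborel)"
    using int by (intro integral_completion) auto
  also have "\<dots> = integral\<^sup>L (distr lborel (count_space UNIV) ?G) ?F" by (subst integral_distr) auto
  also have "\<dots> = integral\<^sup>L (count_space UNIV) (\<lambda>v. ?r *\<^sub>R ?F v)"
    unfolding lat_distr[OF assms(2,3)] using r by (subst integral_density) auto
  also have "\<dots> = ?r * infsetsum ?F UNIV" by (simp add: infsetsum_def)
  also have "infsetsum ?F UNIV = infsum ?F UNIV"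
    using as by (rule infsetsum_infsum)
  finally show "?r * (\<Sum>\<^sub>\<infinity>v. ?F v) = (\<integral>y. ?F (?G y) \<partial>lebesgue)" by simp
qed

lemma LIM_close:
  fixes y :: "'a::real_normed_vector"
  assumes "\<And>X. X > (0::real) \<Longrightarrow> norm (g X - y) \<le> K / X"
  shows "(g \<longlongrightarrow> y) at_top"
proof -
  have "((\<lambda>X::real. K / X) \<longlongrightarrow> 0) at_top" by real_asymp
  then have "((\<lambda>X. g X - y) \<longlongrightarrow> 0) at_top"
    by (rule Lim_null_comparison[rotated]) (rule eventually_mono[OF eventually_gt_at_top[of "0::real"] assms])
  then show ?thesis by (simp add: LIM_zero_iff)
qed

text \<open>Dominated convergence for the step functions: the lattice point assigned to y tends to
  y, and for X \<ge> 1 it stays within the fixed distance K, so a shifted \<open>wfun\<close> is a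
  majorant.\<close>

lemma lat_sum_limit:
  fixes f :: "real ^ 'm \<Rightarrow> real"
  assumes "adm f" "M > 0" "\<And>u. 0 \<le> a $ u \<and> a $ u < M"
  shows "((\<lambda>X. (\<Sum>\<^sub>\<infinity>v. f (lat_point M a X v)) / X ^ CARD('m)) \<longlongrightarrow> (integral\<^sup>L lebesgue f) / real_of_int M ^ CARD('m)) at_top"
proof -
  let ?h = "\<lambda>X y. f (lat_point M a X (lat_cell M X y))"
  obtain C where C: "C \<ge> 0" "\<And>x. \<bar>f x\<bar> \<le> C * wfun x" using assms(1) by (auto simp: adm_def)
  define K where "K = real CARD('m) * real_of_int M"
  have "((\<lambda>X. integral\<^sup>L lebesgue (?h X)) \<longlongrightarrow> integral\<^sup>L lebesgue f) at_top"
  proof (rule integral_dominated_convergence_at_top)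
    show "f \<in> borel_measurable lebesgue" using assms(1) by (simp add: adm_def)
    show "?h X \<in> borel_measurable lebesgue" for X
    proof (rule measurable_completion)
      show "?h X \<in> borel_measurable lborel"
        using measurable_compose[OF lat_cell_measurable, of "\<lambda>v. f (lat_point M a X v)" borel M X] by simp
    qed
    show "integrable lebesgue (\<lambda>y :: real ^ 'm. C * ((1 + K) ^ (CARD('m) + 2) * wfun y))"
      by (subst integrable_completion) (auto intro!: integrable_mult_right wfun_integrable)
    show "\<forall>\<^sub>F X in at_top. AE y in lebesgue. norm (?h X y) \<le> C * ((1 + K) ^ (CARD('m) + 2) * wfun y)"
      using eventually_ge_at_top[of "1::real"]
    proof eventually_elim
      case (elim X)
      show ?case
      proof (rule AE_I2)
        fix y :: "real ^ 'm"
        have "\<bar>?h X y\<bar> \<le> C * wfun (lat_point M a X (lat_cell M X y))" by (rule C(2))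
        also have "\<dots> \<le> C * ((1 + K) ^ (CARD('m) + 2) * wfun y)"
        proof (intro mult_left_mono wfun_shift C(1))
          have "norm (lat_point M a X (lat_cell M X y) - y) \<le> K / X"
            using lat_close[OF assms(2) _ assms(3), of X y] elim by (simp add: K_def)
          also have "\<dots> \<le> K / 1" using elim assms(2) by (intro divide_left_mono) (auto simp: K_def)
          finally show "norm (lat_point M a X (lat_cell M X y) - y) \<le> K" by simp
        qed
        finally show "norm (?h X y) \<le> C * ((1 + K) ^ (CARD('m) + 2) * wfun y)" by simp
      qed
    qed
    have "{x. \<not> isCont f x} \<in> null_sets lebesgue" using assms(1) by (simp add: adm_def negligible_iff_null_sets)
    then have "AE y in lebesgue. isCont f y" by (rule AE_I') auto
    then show "AE y in lebesgue. ((\<lambda>X. ?h X y) \<longlongrightarrow> f y) at_top"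
    proof (rule AE_mp, intro AE_I2 impI)
      fix y assume y: "isCont f y"
      have "((\<lambda>X. lat_point M a X (lat_cell M X y)) \<longlongrightarrow> y) at_top"
        using lat_close[OF assms(2) _ assms(3), of _ y] by (intro LIM_close[where K = K]) (simp add: K_def)
      then show "((\<lambda>X. ?h X y) \<longlongrightarrow> f y) at_top" using isCont_tendsto_compose[OF y] by blast
    qed
  qed
  then have "((\<lambda>X. integral\<^sup>L lebesgue (?h X) / real_of_int M ^ CARD('m)) \<longlongrightarrow> integral\<^sup>L lebesgue f / real_of_int M ^ CARD('m)) at_top"
    by (intro tendsto_divide tendsto_const) (use assms(2) in auto)
  then show ?thesis
  proof (rule Lim_transform_eventually)
    show "\<forall>\<^sub>F X in at_top. integral\<^sup>L lebesgue (?h X) / real_of_int M ^ CARD('m) = (\<Sum>\<^sub>\<infinity>v. f (lat_point M a X v)) / X ^ CARD('m)"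
      using eventually_gt_at_top[of "0::real"]
    proof eventually_elim
      case (elim X)
      show ?case
        unfolding lat_sum_integral(2)[OF assms(1,2) elim assms(3), symmetric] using assms(2) elim
        by (simp add: power_divide)
    qed
  qed
qed

section \<open>Densities of congruence conditions\<close>

definition qmod :: "int \<Rightarrow> int ^ 'm \<Rightarrow> int ^ 'm" where "qmod M Q = (\<chi> u. Q $ u mod M)"

definition res_vec :: "int \<Rightarrow> (int ^ 'm) set" where "res_vec M = {r. \<forall>u. 0 \<le> r $ u \<and> r $ u < M}"

definition periodic :: "int \<Rightarrow> (int ^ 'm) set \<Rightarrow> bool" where "periodic M A \<longleftrightarrow> (\<forall>Q. Q \<in> A \<longleftrightarrow> qmod M Q \<in> A)"

definition rdens :: "int \<Rightarrow> (int ^ 'm) set \<Rightarrow> real" where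
  "rdens M A = real (card (res_vec M \<inter> A)) / real_of_int M ^ CARD('m)"

text \<open>Divided by X^m, numerator and denominator of a probability converge separately, and
  limits can be added over residue classes.\<close>

definition wsum :: "(real ^ 'm \<Rightarrow> real) \<Rightarrow> (int ^ 'm) set \<Rightarrow> real \<Rightarrow> real" where
  "wsum f A X = (\<Sum>\<^sub>\<infinity>Q\<in>A. f (real_qform Q /\<^sub>R X)) / X ^ CARD('m)"

lemma finite_res_vec: "finite (res_vec M :: (int ^ 'm) set)"
proof -
  have "(res_vec M :: (int ^ 'm) set) \<subseteq> (\<lambda>f. (\<chi> u. f u)) ` (UNIV \<rightarrow>\<^sub>E {0..<M})"
  proof
    fix r :: "int ^ 'm" assume "r \<in> res_vec M"
    then show "r \<in> (\<lambda>f. (\<chi> u. f u)) ` (UNIV \<rightarrow>\<^sub>E {0..<M})"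
      by (intro image_eqI[of _ _ "\<lambda>u. r $ u"]) (auto simp: res_vec_def)
  qed
  then show ?thesis by (rule finite_subset) (intro finite_imageI finite_PiE; simp)
qed

lemma adm_summable:
  assumes "adm f" "X > 0"
  shows "(\<lambda>Q :: int ^ 'm. f (real_qform Q /\<^sub>R X)) summable_on A"
proof -
  have "(\<lambda>v. f (lat_point 1 0 X v)) summable_on UNIV"
    using lat_sum_integral(1)[OF assms(1) _ assms(2), of 1 0] by simp
  moreover have "lat_point 1 0 X v = real_qform v /\<^sub>R X" for v :: "int ^ 'm"
    by (simp add: lat_point_def vec_eq_iff divide_inverse mult.commute)
  ultimately have "(\<lambda>Q :: int ^ 'm. f (real_qform Q /\<^sub>R X)) summable_on UNIV" by simp
  then show ?thesis by (rule summable_on_subset_banach) simp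
qed

lemma wsum_residue:
  fixes f :: "real ^ 'm \<Rightarrow> real"
  assumes "adm f" "M > 0" "a \<in> res_vec M"
  shows "((\<lambda>X. wsum f {Q. qmod M Q = a} X) \<longlongrightarrow> (integral\<^sup>L lebesgue f) / real_of_int M ^ CARD('m)) at_top"
proof -
  have a: "0 \<le> a $ u \<and> a $ u < M" for u using assms(3) by (simp add: res_vec_def)
  have bij: "bij_betw (\<lambda>v. M *s v + a) UNIV {Q. qmod M Q = a}"
  proof (rule bij_betwI[where g = "\<lambda>Q. (\<chi> u. Q $ u div M)"])
    show "(\<lambda>v. M *s v + a) \<in> UNIV \<rightarrow> {Q. qmod M Q = a}"
      using a by (auto simp: qmod_def vec_eq_iff)
    show "(\<chi> u. (M *s v + a) $ u div M) = v" if "v \<in> UNIV" for v using a assms(2) by (simp add: vec_eq_iff)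
    show "M *s (\<chi> u. Q $ u div M) + a = Q" if "Q \<in> {Q. qmod M Q = a}" for Q
      using that by (auto simp: qmod_def vec_eq_iff) (metis mult_div_mod_eq)
  qed auto
  have "(\<Sum>\<^sub>\<infinity>v. f (lat_point M a X v)) = (\<Sum>\<^sub>\<infinity>Q\<in>{Q. qmod M Q = a}. f (real_qform Q /\<^sub>R X))" for X
  proof -
    have "lat_point M a X v = real_qform (M *s v + a) /\<^sub>R X" for v :: "int ^ 'm"
      by (simp add: lat_point_def vec_eq_iff divide_inverse mult.commute)
    then show ?thesis using infsum_reindex_bij_betw[OF bij, of "\<lambda>Q. f (real_qform Q /\<^sub>R X)"] by simp
  qed
  then show ?thesis using lat_sum_limit[OF assms(1,2) a] by (simp add: wsum_def)
qed

lemma wsum_union: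
  assumes "adm f" "X > 0" "A \<inter> B = {}"
  shows "wsum f (A \<union> B) X = wsum f A X + wsum f B X"
  unfolding wsum_def using infsum_Un_disjoint[OF adm_summable[OF assms(1,2)] adm_summable[OF assms(1,2)] assms(3)]
  by (simp add: add_divide_distrib)

lemma wsum_residues:
  fixes f :: "real ^ 'm \<Rightarrow> real"
  assumes "adm f" "M > 0" "finite R" "R \<subseteq> res_vec M"
  shows "((\<lambda>X. wsum f {Q. qmod M Q \<in> R} X) \<longlongrightarrow> real (card R) * ((integral\<^sup>L lebesgue f) / real_of_int M ^ CARD('m))) at_top"
  using assms(3,4)
proof (induction R rule: finite_induct)
  case empty
  then show ?case by (simp add: wsum_def)
next
  case (insert r R)
  let ?I = "(integral\<^sup>L lebesgue f) / real_of_int M ^ CARD('m)"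
  have "((\<lambda>X. wsum f {Q. qmod M Q = r} X + wsum f {Q. qmod M Q \<in> R} X) \<longlongrightarrow> ?I + real (card R) * ?I) at_top"
    using insert by (intro tendsto_add wsum_residue assms(1,2)) auto
  moreover have "\<forall>\<^sub>F X in at_top. wsum f {Q. qmod M Q = r} X + wsum f {Q. qmod M Q \<in> R} X = wsum f {Q. qmod M Q \<in> insert r R} X"
    using eventually_gt_at_top[of "0::real"]
  proof eventually_elim
    case (elim X)
    have "{Q. qmod M Q \<in> insert r R} = {Q. qmod M Q = r} \<union> {Q. qmod M Q \<in> R}" by auto
    moreover have "{Q. qmod M Q = r} \<inter> {Q. qmod M Q \<in> R} = {}" using insert.hyps by auto
    ultimately show ?case using wsum_union[OF assms(1) elim] by metis
  qed
  ultimately have "((\<lambda>X. wsum f {Q. qmod M Q \<in> insert r R} X) \<longlongrightarrow> ?I + real (card R) * ?I) at_top"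
    by (rule Lim_transform_eventually)
  then show ?case using insert.hyps by (simp add: algebra_simps add_divide_distrib)
qed

theorem wsum_periodic:
  fixes f :: "real ^ 'm \<Rightarrow> real"
  assumes "adm f" "M > 0" "periodic M A"
  shows "((\<lambda>X. wsum f A X) \<longlongrightarrow> rdens M A * integral\<^sup>L lebesgue f) at_top"
proof -
  have "qmod M Q \<in> res_vec M" for Q :: "int ^ 'm" using assms(2) by (simp add: qmod_def res_vec_def)
  then have A: "{Q. qmod M Q \<in> res_vec M \<inter> A} = A" using assms(3) by (auto simp: periodic_def)
  have "finite (res_vec M \<inter> A)" using finite_res_vec by blast
  from wsum_residues[OF assms(1,2) this] show ?thesis unfolding A rdens_def by simp
qed

section \<open>Quadratic forms and their Gram matrices\<close>

definition qev :: "'a::comm_ring_1 ^ ('n::{finite,linorder}) uprod \<Rightarrow> 'a ^ ('n::_) \<Rightarrow> 'a" where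
  "qev c x = (\<Sum>i\<in>UNIV. \<Sum>j\<in>{i..}. c $ Upair i j * x $ i * x $ j)"

text \<open>The matrix of the polar form Q(x + y) - Q(x) - Q(y). Doubling the diagonal keeps it
  integral, so the prime 2 needs no separate convention.\<close>

definition gram :: "'a::comm_ring_1 ^ ('n::{finite,linorder}) uprod \<Rightarrow> 'a ^ ('n::_) ^ ('n::_)" where
  "gram c = (\<chi> i j. if i = j then 2 * c $ Upair i i else c $ Upair i j)"

definition bil :: "'a::comm_ring_1 ^ ('n::{finite,linorder}) uprod \<Rightarrow> 'a ^ ('n::_) \<Rightarrow> 'a ^ ('n::_) \<Rightarrow> 'a" where
  "bil c x y = (\<Sum>i\<in>UNIV. x $ i * (gram c *v y) $ i)"

lemma isotropic_iff_qev: "isotropic ring_of_type c \<longleftrightarrow> (\<exists>k. k \<noteq> 0 \<and> qev c k = 0)"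
  by (simp add: isotropic_ring_of_type qev_def)

lemma bil_eq: "bil c x y = (\<Sum>i\<in>UNIV. \<Sum>j\<in>UNIV. gram c $ i $ j * x $ i * y $ j)"
  by (simp add: bil_def matrix_vector_mult_def sum_distrib_left mult_ac)

lemma qev_add: "qev c (x + y) = qev c x + qev c y + bil c x y"
proof -
  let ?A = "\<Sum>i\<in>UNIV. \<Sum>j\<in>{i..}. c $ Upair i j * x $ i * y $ j"
  let ?B = "\<Sum>i\<in>UNIV. \<Sum>j\<in>{..i}. c $ Upair i j * x $ i * y $ j"
  have "(\<Sum>i\<in>UNIV. \<Sum>j\<in>{i..}. c $ Upair i j * y $ i * x $ j) =
      (\<Sum>(i, j)\<in>(SIGMA i:UNIV. {i..}). c $ Upair i j * y $ i * x $ j)"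
    by (simp add: sum.Sigma)
  also have "\<dots> = (\<Sum>(i, j)\<in>(SIGMA i:UNIV. {..i}). c $ Upair i j * x $ i * y $ j)"
    by (rule sum.reindex_bij_witness[of _ prod.swap prod.swap]) (auto simp: Upair_inject mult_ac intro!: arg_cong2[of _ _ _ _ "(*)"] arg_cong[of _ _ "($) c"])
  also have "\<dots> = ?B" by (simp add: sum.Sigma)
  finally have B: "(\<Sum>i\<in>UNIV. \<Sum>j\<in>{i..}. c $ Upair i j * y $ i * x $ j) = ?B" .
  have "bil c x y = (\<Sum>i\<in>UNIV. (\<Sum>j\<in>{i..}. c $ Upair i j * x $ i * y $ j) + (\<Sum>j\<in>{..i}. c $ Upair i j * x $ i * y $ j))"
    unfolding bil_eq
  proof (rule sum.cong[OF refl])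
    fix i :: 'b
    let ?f = "\<lambda>j. c $ Upair i j * x $ i * y $ j"
    have "(\<Sum>j\<in>UNIV. gram c $ i $ j * x $ i * y $ j) = (\<Sum>j\<in>UNIV. ?f j + (if j = i then ?f j else 0))"
      by (intro sum.cong refl) (auto simp: gram_def algebra_simps)
    also have "\<dots> = (\<Sum>j\<in>UNIV. ?f j) + ?f i" by (simp add: sum.distrib)
    also have "(\<Sum>j\<in>UNIV. ?f j) = (\<Sum>j\<in>{i..}. ?f j) + (\<Sum>j\<in>{..<i}. ?f j)"
      by (subst sum.union_disjoint[symmetric]) (auto intro!: sum.cong)
    also have "\<dots> + ?f i = (\<Sum>j\<in>{i..}. ?f j) + (\<Sum>j\<in>{..i}. ?f j)"
    proof -
      have "{..i} = insert i {..<i}" by auto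
      then show ?thesis by (simp add: add_ac)
    qed
    finally show "(\<Sum>j\<in>UNIV. gram c $ i $ j * x $ i * y $ j) = (\<Sum>j\<in>{i..}. ?f j) + (\<Sum>j\<in>{..i}. ?f j)" .
  qed
  then have "bil c x y = ?A + ?B" by (simp add: sum.distrib)
  moreover have "qev c (x + y) = qev c x + qev c y + ?A + (\<Sum>i\<in>UNIV. \<Sum>j\<in>{i..}. c $ Upair i j * y $ i * x $ j)"
    unfolding qev_def sum.distrib[symmetric] by (intro sum.cong refl) (simp add: algebra_simps)
  ultimately show ?thesis using B by (simp add: add_ac)
qed

lemma qev_scale: "qev c (r *s x) = r^2 * qev c x"
  unfolding qev_def sum_distrib_left by (intro sum.cong refl) (simp add: power2_eq_square mult_ac)

lemma qev_0 [simp]: "qev c 0 = 0" by (simp add: qev_def)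

lemma bil_add_left: "bil c (x + y) z = bil c x z + bil c y z"
  by (simp add: bil_def distrib_right sum.distrib)
lemma bil_scale_left: "bil c (r *s x) z = r * bil c x z"
  by (simp add: bil_def sum_distrib_left mult.assoc)
lemma bil_0_left [simp]: "bil c 0 z = 0" by (simp add: bil_def)
lemma gram_sym: "gram c $ i $ j = gram c $ j $ i"
  by (auto simp: gram_def intro!: arg_cong[of _ _ "($) c"])
lemma bil_commute: "bil c x y = bil c y x"
  unfolding bil_eq by (subst sum.swap) (auto simp: gram_sym mult_ac intro!: sum.cong)
lemma bil_add_right: "bil c z (x + y) = bil c z x + bil c z y"
  by (simp add: bil_commute[of c z] bil_add_left)
lemma bil_scale_right: "bil c z (r *s x) = r * bil c z x"
  by (simp add: bil_commute[of c z] bil_scale_left)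
lemma bil_sum_left: "finite S \<Longrightarrow> bil c (\<Sum>i\<in>S. f i) z = (\<Sum>i\<in>S. bil c (f i) z)"
  by (induction S rule: finite_induct) (auto simp: bil_add_left)
lemma bil_diff_left: "bil c (x - y) z = bil c x z - bil c y z"
  by (simp add: bil_def left_diff_distrib sum_subtractf)

lemma qev_minus: "qev (- c) x = - qev c x"
  by (simp add: qev_def sum_negf)

lemma bil_self: "bil c x x = 2 * qev c x"
proof -
  have "qev c (2 *s x) = 4 * qev c x" by (simp add: qev_scale)
  moreover have "2 *s x = x + x" by (simp add: vec_eq_iff)
  ultimately have "4 * qev c x = qev c x + qev c x + bil c x x" using qev_add[of c x x] by metis
  then have "bil c x x = 4 * qev c x - 2 * qev c x" by (metis add_diff_cancel_left' mult_2)
  also have "\<dots> = (4 - 2) * qev c x" by (simp only: left_diff_distrib)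
  finally show ?thesis by simp
qed

lemma bil_axis: "bil c x (axis k 1) = (gram c *v x) $ k"
  by (subst bil_commute) (simp add: bil_def axis_def if_distrib[of "\<lambda>t. t * _"] cong: if_cong)

section \<open>Lifting zeros modulo prime powers\<close>

definition primitive :: "nat \<Rightarrow> int ^ 'n \<Rightarrow> bool" where
  "primitive p x \<longleftrightarrow> (\<exists>i. \<not> int p dvd x $ i)"

definition zero_mod :: "nat \<Rightarrow> nat \<Rightarrow> int ^ ('n::{finite,linorder}) uprod \<Rightarrow> bool" where
  "zero_mod p k c \<longleftrightarrow> (\<exists>x. primitive p x \<and> int p ^ k dvd qev c x)"

lemma zero_mod_mono: "zero_mod p k c \<Longrightarrow> j \<le> k \<Longrightarrow> zero_mod p j c"
  unfolding zero_mod_def by (meson dvd_trans le_imp_power_dvd)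

text \<open>Newton's method along the single direction y: the derivative of Q at x in this direction
  is \<open>bil c x y\<close>, of valuation v \<le> e, and changes of x modulo p^(e + 1) preserve
  that.\<close>

lemma hensel_lift:
  assumes p: "prime p" and Q: "int p ^ (2 * e + 1) dvd qev c x" and B: "\<not> int p ^ (e + 1) dvd bil c x y"
    and k: "k \<ge> 2 * e + 1"
  shows "\<exists>x'. int p ^ k dvd qev c x' \<and> (\<forall>i. int p ^ (e + 1) dvd x' $ i - x $ i)"
  using k
proof (induction k rule: dec_induct)
  case base
  then show ?case using Q by (intro exI[of _ x]) simp
next
  case (step k)
  then obtain x' where x': "int p ^ k dvd qev c x'" "\<forall>i. int p ^ (e + 1) dvd x' $ i - x $ i" by auto
  have "int p ^ (e + 1) dvd bil c (x' - x) y"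
    unfolding bil_def using x'(2) by (intro dvd_sum dvd_mult2) simp
  then have B': "\<not> int p ^ (e + 1) dvd bil c x' y"
    using B dvd_diff[of "int p ^ (e + 1)" "bil c x' y" "bil c (x' - x) y"] by (auto simp: bil_diff_left)
  then have b0: "bil c x' y \<noteq> 0" by auto
  define v where "v = multiplicity (int p) (bil c x' y)"
  have nu: "\<not> is_unit (int p)" using prime_gt_1_nat[OF p] by simp
  obtain u where u: "bil c x' y = int p ^ v * u" "\<not> int p dvd u"
    using multiplicity_decompose'[OF b0 nu] unfolding v_def by metis
  have ve: "v \<le> e"
  proof (rule ccontr)
    assume "\<not> v \<le> e"
    then have "int p ^ (e + 1) dvd int p ^ v" by (intro le_imp_power_dvd) simp
    then show False using B' u(1) by auto
  qed
  obtain q where q: "qev c x' = int p ^ k * q" using x'(1) by auto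
  have "coprime u (int p)" using prime_imp_coprime[of "int p" u] u(2) p by (simp add: coprime_commute)
  then obtain w where w: "[u * w = 1] (mod int p)" using cong_solve_coprime_int by blast
  define s where "s = - w * q"
  have sq: "int p dvd q + s * u"
  proof -
    have "q + s * u = - q * (u * w - 1)" by (simp add: s_def algebra_simps)
    then show ?thesis using w by (simp add: cong_iff_dvd_diff)
  qed
  define x'' where "x'' = x' + (int p ^ (k - v) * s) *s y"
  have "qev c x'' = int p ^ k * q + (int p ^ (k - v) * s)^2 * qev c y + int p ^ (k - v) * s * (int p ^ v * u)"
    unfolding x''_def qev_add qev_scale bil_scale_right q u(1) by simp
  also have "int p ^ (k - v) * s * (int p ^ v * u) = int p ^ k * (s * u)"
  proof -
    have "int p ^ k = int p ^ (k - v) * int p ^ v" using ve step.hyps by (simp flip: power_add)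
    then show ?thesis by simp
  qed
  finally have e1: "qev c x'' = int p ^ k * (q + s * u) + int p ^ (2 * (k - v)) * (s^2 * qev c y)"
    by (simp add: power_mult_distrib power_mult[symmetric] algebra_simps)
  have d1: "int p ^ Suc k dvd int p ^ k * (q + s * u)" using sq by (simp add: mult.commute mult_dvd_mono)
  \<comment> \<open>From k \<ge> 2 e + 1 and v \<le> e follows 2 (k - v) \<ge> k + 1, so the
    quadratic term of the step is harmless.\<close>
  have d2: "int p ^ Suc k dvd int p ^ (2 * (k - v))" using ve step.hyps by (intro le_imp_power_dvd) auto
  have "int p ^ Suc k dvd qev c x''" unfolding e1 by (rule dvd_add[OF d1 dvd_mult2[OF d2]])
  moreover have "int p ^ (e + 1) dvd x'' $ i - x $ i" for i
  proof -
    have "int p ^ (e + 1) dvd int p ^ (k - v)" using ve step.hyps by (intro le_imp_power_dvd) auto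
    then have "int p ^ (e + 1) dvd (x' $ i - x $ i) + int p ^ (k - v) * s * y $ i" using x'(2) by (intro dvd_add dvd_mult2) auto
    then show ?thesis by (simp add: x''_def algebra_simps)
  qed
  ultimately show ?case by blast
qed

definition locsol :: "nat \<Rightarrow> int ^ ('n::{finite,linorder}) uprod \<Rightarrow> bool" where
  "locsol p c \<longleftrightarrow> (\<forall>k. zero_mod p k c)"

lemma locsol_of_smooth_zero:
  assumes p: "prime p" and "primitive p x" "int p ^ (2 * e + 1) dvd qev c x" "\<not> int p ^ (e + 1) dvd bil c x y"
  shows "locsol p c"
  unfolding locsol_def
proof
  fix k
  obtain x' where x': "int p ^ max k (2 * e + 1) dvd qev c x'" "\<forall>i. int p ^ (e + 1) dvd x' $ i - x $ i"
    using hensel_lift[OF p assms(3,4), of "max k (2 * e + 1)"] by auto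
  obtain i where i: "\<not> int p dvd x $ i" using assms(2) by (auto simp: primitive_def)
  have "int p dvd x' $ i - x $ i" using x'(2) by (metis dvd_trans dvd_power zero_less_Suc Suc_eq_plus1)
  then have "\<not> int p dvd x' $ i" using i by (metis dvd_diff_right_iff dvd_diff_commute)
  then have "primitive p x'" by (auto simp: primitive_def)
  moreover have "int p ^ k dvd qev c x'" using x'(1) by (meson dvd_trans le_imp_power_dvd max.cobounded1)
  ultimately show "zero_mod p k c" by (auto simp: zero_mod_def)
qed

lemma det_of_int: "det (\<chi> i j. (of_int (A $ i $ j) :: 'b::comm_ring_1)) = of_int (det (A :: int ^ 'n ^ 'n))"
  by (simp add: det_def)

lemma cramer_int: "det ((\<chi> i j. if j = k then (A *v x) $ i else A $ i $ j) :: int ^ 'n ^ 'n) = x $ k * det A"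
proof -
  let ?r = "\<lambda>A :: int ^ 'n ^ 'n. (\<chi> i j. real_of_int (A $ i $ j)) :: real ^ 'n ^ 'n"
  let ?y = "\<chi> i. real_of_int (x $ i)"
  have "(?r A *v ?y) $ i = real_of_int ((A *v x) $ i)" for i by (simp add: matrix_vector_mult_def)
  then have "?r (\<chi> i j. if j = k then (A *v x) $ i else A $ i $ j) = (\<chi> i j. if j = k then (?r A *v ?y) $ i else ?r A $ i $ j)"
    by (simp add: vec_eq_iff)
  note eq = this
  let ?M = "(\<chi> i j. if j = k then (A *v x) $ i else A $ i $ j) :: int ^ 'n ^ 'n"
  have "real_of_int (det ?M) = det (?r ?M)" by (rule det_of_int[symmetric])
  also have "\<dots> = ?y $ k * det (?r A)" unfolding eq by (rule cramer_lemma)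
  also have "\<dots> = real_of_int (x $ k * det A)" by (simp add: det_of_int)
  finally have "real_of_int (det ?M) = real_of_int (x $ k * det A)" .
  then show ?thesis by (simp only: of_int_eq_iff)
qed

text \<open>Cramer's rule: x k times the determinant is the determinant with column k replaced by A
  x, from which d factors out.\<close>

lemma dvd_det:
  fixes A :: "int ^ 'n ^ 'n"
  assumes "\<And>i. d dvd (A *v x) $ i"
  shows "d dvd x $ k * det A"
proof -
  obtain w where w: "\<And>i. (A *v x) $ i = d * w i" using assms unfolding dvd_def by metis
  have "x $ k * det A = det (transpose ((\<chi> i j. if j = k then (A *v x) $ i else A $ i $ j) :: int ^ 'n ^ 'n))"
    by (simp only: cramer_int det_transpose)
  also have "transpose ((\<chi> i j. if j = k then (A *v x) $ i else A $ i $ j) :: int ^ 'n ^ 'n) =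
      (\<chi> j. if j = k then d *s (\<chi> i. w i) else (\<chi> i. A $ i $ j))"
    by (simp add: transpose_def vec_eq_iff w)
  also have "det \<dots> = d * det (\<chi> j. if j = k then (\<chi> i. w i) else (\<chi> i. A $ i $ j))"
    by (rule det_row_mul)
  finally show ?thesis by simp
qed

text \<open>A primitive x has a coordinate prime to p, so by Cramer's rule some partial derivative
  at x is not divisible by p^(e + 1), and the zero lifts. Solubility at all levels is thereby
  decided at one.\<close>

lemma locsol_of_det:
  assumes "prime p" "\<not> int p ^ (e + 1) dvd det (gram c)" "zero_mod p (2 * e + 1) c"
  shows "locsol p c"
proof -
  obtain x where x: "primitive p x" "int p ^ (2 * e + 1) dvd qev c x" using assms(3) by (auto simp: zero_mod_def)
  obtain k where k: "\<not> int p dvd x $ k" using x(1) by (auto simp: primitive_def)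
  have "\<exists>i. \<not> int p ^ (e + 1) dvd (gram c *v x) $ i"
  proof (rule ccontr)
    assume "\<nexists>i. \<not> int p ^ (e + 1) dvd (gram c *v x) $ i"
    then have "int p ^ (e + 1) dvd x $ k * det (gram c)" by (intro dvd_det) auto
    moreover have "coprime (int p) (x $ k)" using assms(1) k by (intro prime_imp_coprime) auto
    then have "coprime (int p ^ (e + 1)) (x $ k)" by simp
    ultimately show False using assms(2) by (simp add: coprime_dvd_mult_right_iff)
  qed
  then obtain i where "\<not> int p ^ (e + 1) dvd bil c x (axis i 1)" by (auto simp: bil_axis)
  then show ?thesis using locsol_of_smooth_zero[OF assms(1) x] by blast
qed

section \<open>Orthogonal systems\<close>

definition orth :: "int ^ ('n::{finite,linorder}) uprod \<Rightarrow> nat \<Rightarrow> (nat \<Rightarrow> int ^ ('n::_)) \<Rightarrow> bool" where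
  "orth c k v \<longleftrightarrow> (\<forall>i<k. qev c (v i) \<noteq> 0) \<and> (\<forall>i<k. \<forall>j<k. i \<noteq> j \<longrightarrow> bil c (v i) (v j) = 0)"

definition rvec :: "int ^ 'n \<Rightarrow> real ^ 'n" where "rvec x = (\<chi> i. real_of_int (x $ i))"

lemma rvec_simps: "rvec (x + y) = rvec x + rvec y" "rvec (r *s x) = real_of_int r *\<^sub>R rvec x" "rvec 0 = 0"
  by (simp_all add: rvec_def vec_eq_iff)

lemma gram_rvec: "gram (rvec c) = (\<chi> i j. real_of_int (gram c $ i $ j))"
  by (simp add: gram_def rvec_def vec_eq_iff)

lemma bil_rvec: "bil (rvec c) (rvec x) (rvec y) = real_of_int (bil c x y)"
  unfolding bil_eq gram_rvec by (simp add: rvec_def)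

lemma qev_rvec: "qev (rvec c) (rvec x) = real_of_int (qev c x)"
  by (simp add: qev_def rvec_def)

lemma orth_independent:
  assumes "orth c k v"
  shows "inj_on (\<lambda>i. rvec (v i)) {..<k}" "independent ((\<lambda>i. rvec (v i)) ` {..<k})"
proof -
  let ?w = "\<lambda>i. rvec (v i)"
  have b: "bil (rvec c) (?w i) (?w j) = (if i = j then 2 * real_of_int (qev c (v i)) else 0)" if "i < k" "j < k" for i j
    using assms that by (simp add: bil_rvec bil_self orth_def)
  show inj: "inj_on ?w {..<k}"
  proof (rule inj_onI)
    fix i j assume ij: "i \<in> {..<k}" "j \<in> {..<k}" "?w i = ?w j"
    have q: "qev c (v i) \<noteq> 0" using assms ij(1) by (simp add: orth_def)
    have "bil (rvec c) (?w i) (?w i) = bil (rvec c) (?w i) (?w j)" using ij(3) by simp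
    then show "i = j" using b[of i j] b[of i i] ij(1,2) q by (auto split: if_splits)
  qed
  show "independent (?w ` {..<k})"
  proof
    assume "dependent (?w ` {..<k})"
    then obtain u where u: "\<exists>x\<in>?w ` {..<k}. u x \<noteq> 0" "(\<Sum>x\<in>?w ` {..<k}. u x *\<^sub>R x) = 0"
      by (subst (asm) dependent_finite) auto
    then obtain j where j: "j < k" "u (?w j) \<noteq> 0" by auto
    have q: "qev c (v j) \<noteq> 0" using assms j(1) by (simp add: orth_def)
    have "(\<Sum>i<k. u (?w i) *s ?w i) = 0"
      using u(2) by (simp add: sum.reindex[OF inj] scalar_mult_eq_scaleR)
    then have "0 = bil (rvec c) (\<Sum>i<k. u (?w i) *s ?w i) (?w j)" by simp
    also have "\<dots> = (\<Sum>i<k. u (?w i) * bil (rvec c) (?w i) (?w j))" by (simp add: bil_sum_left bil_scale_left)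
    also have "\<dots> = (\<Sum>i<k. if i = j then u (?w i) * (2 * real_of_int (qev c (v i))) else 0)"
      using b j(1) by (intro sum.cong) auto
    also have "\<dots> = u (?w j) * (2 * real_of_int (qev c (v j)))" using j(1) by simp
    finally show False using j(2) q by simp
  qed
qed

lemma orth_le_card:
  assumes "orth (c :: int ^ ('n::{finite,linorder}) uprod) k v"
  shows "k \<le> CARD('n)"
  using independent_card_le[OF orth_independent(2)[OF assms]] card_image[OF orth_independent(1)[OF assms]] by simp

text \<open>Gram-Schmidt with denominators cleared: \<open>oproj\<close> is \<open>oden\<close>
  times the projection to the orthogonal complement, where \<open>oden\<close> is the product of the
  numbers 2 Q(v i).\<close>

definition oproj_coeff :: "int ^ ('n::{finite,linorder}) uprod \<Rightarrow> nat \<Rightarrow> (nat \<Rightarrow> int ^ ('n::_)) \<Rightarrow> int ^ ('n::_) \<Rightarrow> nat \<Rightarrow> int" where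
  "oproj_coeff c k v x i = (\<Prod>j\<in>{..<k} - {i}. 2 * qev c (v j)) * bil c x (v i)"

definition oden :: "int ^ ('n::{finite,linorder}) uprod \<Rightarrow> nat \<Rightarrow> (nat \<Rightarrow> int ^ ('n::_)) \<Rightarrow> int" where
  "oden c k v = (\<Prod>j<k. 2 * qev c (v j))"

definition oproj :: "int ^ ('n::{finite,linorder}) uprod \<Rightarrow> nat \<Rightarrow> (nat \<Rightarrow> int ^ ('n::_)) \<Rightarrow> int ^ ('n::_) \<Rightarrow> int ^ ('n::_)" where
  "oproj c k v x = oden c k v *s x - (\<Sum>i<k. oproj_coeff c k v x i *s v i)"

lemma oden_nonzero: "orth c k v \<Longrightarrow> oden c k v \<noteq> 0"
  by (simp add: orth_def oden_def)

lemma oproj_orth: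
  assumes "orth c k v" "i < k"
  shows "bil c (oproj c k v x) (v i) = 0"
proof -
  have "bil c (\<Sum>j<k. oproj_coeff c k v x j *s v j) (v i) = (\<Sum>j<k. oproj_coeff c k v x j * bil c (v j) (v i))"
    by (simp add: bil_sum_left bil_scale_left)
  also have "\<dots> = (\<Sum>j<k. if j = i then oproj_coeff c k v x i * (2 * qev c (v i)) else 0)"
    using assms by (intro sum.cong) (auto simp: orth_def bil_self)
  also have "\<dots> = oproj_coeff c k v x i * (2 * qev c (v i))" using assms(2) by simp
  also have "\<dots> = oden c k v * bil c x (v i)"
    unfolding oproj_coeff_def oden_def using assms(2) by (subst prod.remove[of "{..<k}" i]) auto
  finally show ?thesis by (simp add: oproj_def bil_diff_left bil_scale_left)
qed

lemma oproj_add: "oproj c k v (x + y) = oproj c k v x + oproj c k v y"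
proof -
  have "oproj_coeff c k v (x + y) i = oproj_coeff c k v x i + oproj_coeff c k v y i" for i
    by (simp add: oproj_coeff_def bil_add_left algebra_simps)
  then show ?thesis by (simp add: oproj_def vec_eq_iff algebra_simps sum.distrib)
qed

lemma nondegenerate:
  assumes "det (gram c) \<noteq> 0" "\<And>y. bil c x y = 0"
  shows "x = (0 :: int ^ ('n::{finite,linorder}))"
proof -
  have "(gram c *v x) $ i = 0" for i using assms(2)[of "axis i 1"] by (simp add: bil_axis)
  then have "x $ k * det (gram c) = 0" for k using dvd_det[of 0 "gram c" x k] by simp
  then show ?thesis using assms(1) by (simp add: vec_eq_iff)
qed

text \<open>If Q vanished on all projected vectors, so would the polar form between them. A nonzero
  projected vector is also orthogonal to the v i, so it would lie in the radical.\<close>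

lemma oproj_extend:
  assumes o: "orth c k v" and d: "det (gram c) \<noteq> 0" and x: "oproj c k v x \<noteq> 0"
  shows "\<exists>w. orth c (Suc k) (v(k := w))"
proof -
  have "\<exists>y. qev c (oproj c k v y) \<noteq> 0"
  proof (rule ccontr)
    assume "\<nexists>y. qev c (oproj c k v y) \<noteq> 0"
    then have z: "qev c (oproj c k v y) = 0" for y by blast
    have "bil c (oproj c k v x) y = 0" for y
    proof -
      have 1: "bil c (oproj c k v x) (oproj c k v y) = 0"
        using qev_add[of c "oproj c k v x" "oproj c k v y"] z by (simp flip: oproj_add)
      have "oden c k v *s y = oproj c k v y + (\<Sum>i<k. oproj_coeff c k v y i *s v i)" by (simp add: oproj_def)
      then have "oden c k v * bil c (oproj c k v x) y = bil c (oproj c k v y + (\<Sum>i<k. oproj_coeff c k v y i *s v i)) (oproj c k v x)"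
        by (metis bil_commute bil_scale_left)
      also have "\<dots> = (\<Sum>i<k. oproj_coeff c k v y i * bil c (v i) (oproj c k v x))"
        using 1 by (simp add: bil_add_left bil_sum_left bil_scale_left bil_commute[of c "oproj c k v y"])
      also have "\<dots> = 0" using oproj_orth[OF o] by (intro sum.neutral) (auto simp: bil_commute[of c _ "oproj c k v x"])
      finally show ?thesis using oden_nonzero[OF o] by simp
    qed
    then show False using nondegenerate[OF d] x by blast
  qed
  then obtain y where y: "qev c (oproj c k v y) \<noteq> 0" by blast
  define w where "w = oproj c k v y"
  have w: "bil c w (v i) = 0" "bil c (v i) w = 0" if "i < k" for i
    using oproj_orth[OF o that, of y] by (auto simp: w_def bil_commute)
  have "orth c (Suc k) (v(k := w))"
    using o y w by (auto simp: orth_def less_Suc_eq w_def[symmetric])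
  then show ?thesis by blast
qed

lemma oproj_nonzero:
  assumes "orth (c :: int ^ ('n::{finite,linorder}) uprod) k v" "k < CARD('n)"
  shows "\<exists>x. oproj c k v x \<noteq> 0"
proof (rule ccontr)
  assume "\<nexists>x. oproj c k v x \<noteq> 0"
  then have z: "oden c k v *s x = (\<Sum>i<k. oproj_coeff c k v x i *s v i)" for x by (simp add: oproj_def)
  let ?V = "(\<lambda>i. rvec (v i)) ` {..<k}"
  have "axis j (1::real) \<in> span ?V" for j :: "'n::_"
  proof -
    let ?x = "axis j 1 :: int ^ ('n::_)"
    have rs: "rvec (\<Sum>i<m. f i) = (\<Sum>i<m. rvec (f i))" for f :: "nat \<Rightarrow> int ^ ('n::_)" and m :: nat
      by (induction m) (auto simp: rvec_simps)
    have "real_of_int (oden c k v) *\<^sub>R rvec ?x = (\<Sum>i<k. real_of_int (oproj_coeff c k v ?x i) *\<^sub>R rvec (v i))"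
      using arg_cong[OF z[of ?x], of rvec] by (simp add: rvec_simps rs)
    also have "\<dots> \<in> span ?V" by (intro span_sum span_scale span_base) auto
    finally have "(1 / real_of_int (oden c k v)) *\<^sub>R (real_of_int (oden c k v) *\<^sub>R rvec ?x) \<in> span ?V" by (rule span_scale)
    moreover have "rvec ?x = axis j 1" by (simp add: rvec_def axis_def vec_eq_iff)
    ultimately show ?thesis using oden_nonzero[OF assms(1)] by simp
  qed
  then have "(Basis :: (real ^ ('n::_)) set) \<subseteq> span ?V" by (auto simp: Basis_vec_def)
  then have "span Basis \<subseteq> span ?V" by (metis span_mono span_span)
  then have "dim (UNIV :: (real ^ ('n::_)) set) \<le> dim ?V" by (metis dim_span dim_subset span_Basis)
  also have "\<dots> \<le> card ?V" by (intro dim_le_card') simp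
  also have "\<dots> \<le> k" using card_image_le[of "{..<k}" "\<lambda>i. rvec (v i)"] by simp
  finally show False using assms(2) by simp
qed

lemma orth_extend:
  assumes "orth (c :: int ^ ('n::{finite,linorder}) uprod) k v" "det (gram c) \<noteq> 0" "k \<le> m" "m \<le> CARD('n)"
  shows "\<exists>w. orth c m w \<and> (\<forall>i<k. w i = v i)"
  using assms(3,4)
proof (induction m rule: dec_induct)
  case base
  then show ?case using assms(1) by auto
next
  case (step m)
  then obtain w where w: "orth c m w" "\<forall>i<k. w i = v i" by auto
  obtain x where "oproj c m w x \<noteq> 0" using oproj_nonzero[OF w(1)] step.prems by auto
  from oproj_extend[OF w(1) assms(2) this] obtain u where "orth c (Suc m) (w(m := u))" by blast
  moreover have "\<forall>i<k. (w(m := u)) i = v i" using w(2) step.hyps by auto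
  ultimately show ?case by blast
qed

text \<open>A system of full length cannot be extended, so \<open>oden\<close> times any integer
  vector is an integral combination of the v i. This carries zeros modulo p^k to diagonal
  coordinates.\<close>

lemma oproj_full:
  assumes "orth (c :: int ^ ('n::{finite,linorder}) uprod) (CARD('n)) v" "det (gram c) \<noteq> 0"
  shows "oproj c (CARD('n)) v x = 0"
  using oproj_extend[OF assms] orth_le_card by (metis Suc_n_not_le_n)

section \<open>Admissible weights\<close>

lemma locally_finite_compact:
  fixes \<P> :: "'a::euclidean_space set set"
  assumes "locally_finite_in euclidean \<P>" "compact K"
  shows "finite {S \<in> \<P>. S \<inter> K \<noteq> {}}"
proof -
  have "\<forall>x. \<exists>V. open V \<and> x \<in> V \<and> finite {U \<in> \<P>. U \<inter> V \<noteq> {}}"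
    using assms(1) unfolding locally_finite_in_def by simp
  from choice[OF this] obtain V where V0: "\<forall>x. open (V x) \<and> x \<in> V x \<and> finite {U \<in> \<P>. U \<inter> V x \<noteq> {}}" ..
  then have V: "\<And>x. open (V x)" "\<And>x. x \<in> V x" "\<And>x. finite {U \<in> \<P>. U \<inter> V x \<noteq> {}}" by simp_all
  obtain T where T: "T \<subseteq> K" "finite T" "K \<subseteq> (\<Union>x\<in>T. V x)"
    by (rule compactE_image[OF assms(2), of K V]) (use V in auto)
  have "{S \<in> \<P>. S \<inter> K \<noteq> {}} \<subseteq> (\<Union>x\<in>T. {U \<in> \<P>. U \<inter> V x \<noteq> {}})" using T(3) by blast
  then show ?thesis using T(2) V(3) by (meson finite_UN finite_subset)
qed

lemma smooth_on_continuous: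
  assumes "smooth_on UNIV g" shows "continuous_on A g"
proof -
  have "iter_partial [] g differentiable (at x)" for x
    using assms by (auto simp: smooth_on_def dest!: spec[of _ "[]"])
  then have "isCont g x" for x using differentiable_imp_continuous_within by fastforce
  then show ?thesis by (simp add: continuous_at_imp_continuous_on)
qed

lemma piecewise_smooth_bounded:
  assumes "piecewise_smooth f" "compact K"
  shows "\<exists>B\<ge>0. \<forall>x\<in>K. \<bar>f x\<bar> \<le> B"
proof -
  obtain \<P> where \<P>: "locally_finite_in euclidean \<P>" "\<Union>\<P> = UNIV"
    and g: "\<forall>S\<in>\<P>. \<exists>g. smooth_on UNIV g \<and> (\<forall>x\<in>S. f x = g x)"
    using assms(1) by (auto simp: piecewise_smooth_def)
  from g obtain g where g: "\<And>S. S \<in> \<P> \<Longrightarrow> smooth_on UNIV (g S)" "\<And>S x. S \<in> \<P> \<Longrightarrow> x \<in> S \<Longrightarrow> f x = g S x" by metis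
  define F where "F = {S \<in> \<P>. S \<inter> K \<noteq> {}}"
  have F: "finite F" unfolding F_def by (rule locally_finite_compact[OF \<P>(1) assms(2)])
  have "\<exists>B\<ge>0. \<forall>x\<in>K. \<bar>g S x\<bar> \<le> B" if "S \<in> F" for S
  proof -
    have "bounded (g S ` K)" using that g(1) by (intro compact_imp_bounded compact_continuous_image smooth_on_continuous assms(2)) (auto simp: F_def)
    then obtain B where "\<forall>y\<in>g S ` K. norm y \<le> B" by (auto simp: bounded_iff)
    then show ?thesis by (intro exI[of _ "max B 0"]) auto
  qed
  then obtain B where B: "\<And>S. S \<in> F \<Longrightarrow> B S \<ge> 0" "\<And>S x. S \<in> F \<Longrightarrow> x \<in> K \<Longrightarrow> \<bar>g S x\<bar> \<le> B S" by metis
  show ?thesis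
  proof (intro exI[of _ "\<Sum>S\<in>F. B S"] conjI ballI)
    show "(\<Sum>S\<in>F. B S) \<ge> 0" using B(1) by (rule sum_nonneg)
    fix x assume x: "x \<in> K"
    obtain S where S: "S \<in> \<P>" "x \<in> S" using \<P>(2) by blast
    then have SF: "S \<in> F" using x by (auto simp: F_def)
    have "\<bar>f x\<bar> \<le> B S" using B(2)[OF SF x] g(2)[OF S] by simp
    also have "\<dots> \<le> (\<Sum>S\<in>F. B S)" using F SF B(1) by (intro member_le_sum) auto
    finally show "\<bar>f x\<bar> \<le> (\<Sum>S\<in>F. B S)" .
  qed
qed

text \<open>Discontinuities lie on frontiers of pieces. Each ball meets finitely many pieces, so the
  nonempty pieces are countably many.\<close>

lemma piecewise_smooth_ae_continuous:
  fixes f :: "'a::euclidean_space \<Rightarrow> real"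
  assumes "piecewise_smooth f"
  shows "negligible {x. \<not> isCont f x}"
proof -
  obtain \<P> where \<P>: "locally_finite_in euclidean \<P>" "\<Union>\<P> = UNIV"
    and neg: "\<And>S. S \<in> \<P> \<Longrightarrow> negligible (frontier S)"
    and g: "\<And>S. S \<in> \<P> \<Longrightarrow> \<exists>g. smooth_on UNIV g \<and> (\<forall>x\<in>S. f x = g x)"
    using assms by (auto simp: piecewise_smooth_def)
  have "\<P> - {{}} \<subseteq> (\<Union>n. {S \<in> \<P>. S \<inter> cball 0 (real n) \<noteq> {}})"
  proof
    fix S assume "S \<in> \<P> - {{}}"
    then obtain x where x: "S \<in> \<P>" "x \<in> S" by blast
    obtain n where "norm x \<le> real n" using real_arch_simple by blast
    then have "x \<in> S \<inter> cball 0 (real n)" using x by simp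
    then show "S \<in> (\<Union>n. {S \<in> \<P>. S \<inter> cball 0 (real n) \<noteq> {}})" using x(1) by blast
  qed
  moreover have "finite {S \<in> \<P>. S \<inter> cball 0 (real n) \<noteq> {}}" for n
    by (rule locally_finite_compact[OF \<P>(1)]) simp
  then have "countable (\<Union>n. {S \<in> \<P>. S \<inter> cball 0 (real n) \<noteq> {}})"
    using countable_finite by (intro countable_UN) auto
  ultimately have c: "countable (\<P> - {{}})" by (rule countable_subset)
  have "{x. \<not> isCont f x} \<subseteq> (\<Union>S\<in>\<P> - {{}}. frontier S)"
  proof
    fix x assume x: "x \<in> {x. \<not> isCont f x}"
    obtain S where S: "S \<in> \<P>" "x \<in> S" using \<P>(2) by blast
    obtain g where g': "smooth_on UNIV g" "\<forall>x\<in>S. f x = g x" using g[OF S(1)] by blast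
    have "x \<notin> interior S"
    proof
      assume i: "x \<in> interior S"
      have "isCont g x" using smooth_on_continuous[OF g'(1), of UNIV] by (simp add: continuous_on_eq_continuous_at)
      moreover have "\<forall>\<^sub>F y in nhds x. f y = g y"
        using i g'(2) by (auto simp: eventually_nhds intro!: exI[of _ "interior S"] dest: interior_subset[THEN subsetD])
      ultimately have "isCont f x" by (simp add: isCont_cong)
      then show False using x by simp
    qed
    then have "x \<in> frontier S" using S(2) by (simp add: frontier_def closure_subset[THEN subsetD])
    then show "x \<in> (\<Union>S\<in>\<P> - {{}}. frontier S)" using S by auto
  qed
  moreover have "negligible (\<Union>S\<in>\<P> - {{}}. frontier S)"
    using c neg by (intro negligible_countable_Union[of "frontier ` (\<P> - {{}})"]) auto
  ultimately show ?thesis by (rule negligible_subset[rotated])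
qed

lemma nice_adm:
  fixes D :: "real ^ 'm \<Rightarrow> real"
  assumes "nice_distribution D"
  shows "adm D"
  unfolding adm_def
proof (intro conjI)
  have ps: "piecewise_smooth D" and rd: "rapidly_decaying D" and int: "integrable lebesgue D"
    using assms by (auto simp: nice_distribution_def)
  show "D \<in> borel_measurable lebesgue" using int by auto
  show "negligible {x. \<not> isCont D x}" using ps by (rule piecewise_smooth_ae_continuous)
  let ?d = "CARD('m) + 2"
  have "D \<in> o[at_infinity](\<lambda>x. norm x powr - real ?d)" using rd unfolding rapidly_decaying_def by (metis of_nat_0_less_iff add_gr_0 zero_less_numeral)
  from landau_o.smallD[OF this, of 1] obtain b where b: "\<And>x. norm x \<ge> b \<Longrightarrow> \<bar>D x\<bar> \<le> norm x powr - real ?d"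
    by (auto simp: eventually_at_infinity)
  define r where "r = max b 1"
  obtain B where B: "B \<ge> 0" "\<And>x. x \<in> cball 0 r \<Longrightarrow> \<bar>D x\<bar> \<le> B"
    using piecewise_smooth_bounded[OF ps, of "cball 0 r"] by auto
  \<comment> \<open>One summand for each region: decay outside the ball of radius r, boundedness
    inside.\<close>
  define C where "C = 2 ^ ?d + B * (1 + r) ^ ?d"
  have "\<bar>D x\<bar> \<le> C * wfun x" for x
  proof (cases "norm x \<le> r")
    case True
    have "1 = (1 + r) ^ ?d * (1 / (1 + r)) ^ ?d" by (simp add: power_mult_distrib[symmetric] r_def max_def)
    also have "\<dots> \<le> (1 + r) ^ ?d * wfun x"
      unfolding wfun_def using True by (intro mult_left_mono power_mono divide_left_mono) (auto simp: r_def intro!: mult_pos_pos add_pos_nonneg)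
    finally have "B * 1 \<le> B * ((1 + r) ^ ?d * wfun x)" using B(1) by (intro mult_left_mono)
    also have "\<dots> \<le> C * wfun x" using wfun_nonneg[of x] by (simp add: C_def distrib_right mult.assoc)
    finally show ?thesis using B(2)[of x] True by simp
  next
    case False
    then have x: "norm x \<ge> 1" "norm x \<ge> b" by (auto simp: r_def)
    have "norm x powr - real ?d = (1 / norm x) ^ ?d"
      using x(1) by (simp only: powr_minus powr_realpow[of "norm x"] power_one_over inverse_eq_divide)
    also have "\<dots> \<le> (2 / (1 + norm x)) ^ ?d"
    proof (intro power_mono)
      have "norm x > 0" using x(1) by linarith
      then show "1 / norm x \<le> 2 / (1 + norm x)" using x(1) by (subst frac_le_eq) (auto simp: divide_nonpos_pos)
    qed simp
    also have "\<dots> = 2 ^ ?d * wfun x" by (simp add: wfun_def power_divide)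
    also have "\<dots> \<le> C * wfun x" using B(1) wfun_nonneg[of x] by (intro mult_right_mono) (auto simp: C_def r_def)
    finally show ?thesis using b[OF x(2)] by linarith
  qed
  moreover have "C \<ge> 0" using B(1) by (simp add: C_def r_def)
  ultimately show "\<exists>C\<ge>0. \<forall>x. \<bar>D x\<bar> \<le> C * wfun x" by blast
qed

lemma adm_abs:
  assumes "adm f" shows "adm (\<lambda>x. \<bar>f x\<bar>)"
proof -
  have "{x. \<not> isCont (\<lambda>x. \<bar>f x\<bar>) x} \<subseteq> {x. \<not> isCont f x}" by (auto intro: continuous_intros)
  then show ?thesis using assms negligible_subset by (auto simp: adm_def)
qed

lemma lebesgue_of_frontier:
  fixes A :: "'a::euclidean_space set"
  assumes "negligible (frontier A)" shows "A \<in> sets lebesgue"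
proof -
  have "A = interior A \<union> (A \<inter> frontier A)" using interior_subset closure_subset by (auto simp: frontier_def)
  moreover have "interior A \<in> sets lebesgue" using lborelD by (simp add: borel_open)
  moreover have "A \<inter> frontier A \<in> sets lebesgue"
    using assms negligible_subset[of "frontier A" "A \<inter> frontier A"] negligible_imp_sets by blast
  ultimately show ?thesis by (metis sets.Un)
qed

lemma adm_indicator:
  assumes "adm f" "negligible (frontier A)"
  shows "adm (\<lambda>x. f x * indicator A x)"
  unfolding adm_def
proof (intro conjI)
  have A: "A \<in> sets lebesgue" by (rule lebesgue_of_frontier[OF assms(2)])
  then show "(\<lambda>x. f x * indicator A x) \<in> borel_measurable lebesgue"
    using assms(1) by (intro borel_measurable_times) (auto simp: adm_def)
  obtain C where C: "C \<ge> 0" "\<forall>x. \<bar>f x\<bar> \<le> C * wfun x" using assms(1) by (auto simp: adm_def)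
  have "\<bar>f x * indicator A x\<bar> \<le> C * wfun x" for x
    using C wfun_nonneg[of x] by (cases "x \<in> A") auto
  then show "\<exists>C\<ge>0. \<forall>x. \<bar>f x * indicator A x\<bar> \<le> C * wfun x" using C(1) by blast
  have "{x. \<not> isCont (\<lambda>x. f x * indicator A x) x} \<subseteq> {x. \<not> isCont f x} \<union> frontier A"
  proof
    fix x assume x: "x \<in> {x. \<not> isCont (\<lambda>x. f x * indicator A x) x}"
    show "x \<in> {x. \<not> isCont f x} \<union> frontier A"
    proof (rule ccontr)
      assume n: "x \<notin> {x. \<not> isCont f x} \<union> frontier A"
      then have "x \<in> interior A \<or> x \<in> interior (- A)"
        by (auto simp: frontier_def interior_complement)
      then have "\<exists>c. \<forall>\<^sub>F y in nhds x. indicator A y = (c :: real)"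
      proof
        assume "x \<in> interior A"
        then have "\<forall>\<^sub>F y in nhds x. indicator A y = (1 :: real)"
          by (auto simp: eventually_nhds intro!: exI[of _ "interior A"] dest: interior_subset[THEN subsetD])
        then show ?thesis by blast
      next
        assume "x \<in> interior (- A)"
        then have "\<forall>\<^sub>F y in nhds x. indicator A y = (0 :: real)"
          unfolding eventually_nhds using interior_subset[of "- A"] by (intro exI[of _ "interior (- A)"]) (auto simp: indicator_def)
        then show ?thesis by blast
      qed
      then obtain c :: real where c: "\<forall>\<^sub>F y in nhds x. indicator A y = c" by blast
      then have "\<forall>\<^sub>F y in nhds x. f y * indicator A y = f y * c" by (rule eventually_mono) simp
      moreover have "isCont (\<lambda>y. f y * c) x" using n by (intro continuous_intros) auto
      ultimately have "isCont (\<lambda>x. f x * indicator A x) x" using isCont_cong by fastforce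
      then show False using x by simp
    qed
  qed
  moreover have "negligible ({x. \<not> isCont f x} \<union> frontier A)"
    using assms by (simp add: adm_def negligible_Un)
  ultimately show "negligible {x. \<not> isCont (\<lambda>x. f x * indicator A x) x}" by (rule negligible_subset[rotated])
qed

lemma adm_integrable:
  fixes f :: "real ^ 'm \<Rightarrow> real"
  assumes "adm f" shows "integrable lebesgue f"
proof -
  obtain C where C: "C \<ge> 0" "\<And>x. \<bar>f x\<bar> \<le> C * wfun x" using assms by (auto simp: adm_def)
  have "integrable lebesgue (\<lambda>y :: real ^ 'm. C * wfun y)"
    by (subst integrable_completion) (auto intro!: integrable_mult_right wfun_integrable)
  then show ?thesis
  proof (rule Bochner_Integration.integrable_bound)
    show "f \<in> borel_measurable lebesgue" using assms by (simp add: adm_def)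
    have "norm (f x) \<le> norm (C * wfun x)" for x
      using order_trans[OF C(2) abs_ge_self] by simp
    then show "AE x in lebesgue. norm (f x) \<le> norm (C * wfun x)" by simp
  qed
qed

section \<open>The boundary of the real isotropic locus\<close>

definition real_iso :: "(real ^ ('n::{finite,linorder}) uprod) set" where
  "real_iso = {c. isotropic ring_of_type c}"

definition psd :: "(real ^ ('n::{finite,linorder}) uprod) set" where
  "psd = {c. \<forall>k. qev c k \<ge> 0}"

lemma qev_linear: "qev (a *\<^sub>R c + b *\<^sub>R d) k = a * qev c k + b * qev (d :: real ^ ('n::{finite,linorder}) uprod) k"
  by (simp add: qev_def sum.distrib sum_distrib_left algebra_simps)

lemma convex_psd: "convex psd"
  unfolding convex_def by (auto simp: psd_def qev_linear)

lemma continuous_qev_coeff: "continuous_on A (\<lambda>c. qev c k)" for k :: "real ^ ('n::{finite,linorder})"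
  unfolding qev_def by (intro continuous_intros)

lemma isotropic_of_indefinite:
  fixes c :: "real ^ ('n::{finite,linorder}) uprod"
  assumes "qev c u > 0" "qev c w < 0"
  shows "isotropic ring_of_type c"
proof -
  define g where "g t = (1 - t) *\<^sub>R u + t *\<^sub>R w" for t :: real
  have "continuous_on {0..1} (\<lambda>t. qev c (g t))" unfolding qev_def g_def by (intro continuous_intros)
  then obtain t where t: "0 \<le> t" "t \<le> 1" "qev c (g t) = 0"
    using IVT2'[of "\<lambda>t. qev c (g t)" 1 0 0] assms by (auto simp: g_def)
  \<comment> \<open>If the segment met the origin, u and w would be proportional, and their values
    could not have opposite signs.\<close>
  have "g t \<noteq> 0"
  proof
    assume z: "g t = 0"
    have "t \<noteq> 1" using z assms(2) by (auto simp: g_def)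
    have "(1 - t) *s u = (- t) *s w" using z by (simp add: g_def vec_eq_iff algebra_simps)
    then have "(1 - t)^2 * qev c u = t^2 * qev c w" by (metis qev_scale power2_minus)
    moreover have "(1 - t)^2 * qev c u > 0" using \<open>t \<noteq> 1\<close> assms(1) by simp
    moreover have "t^2 * qev c w \<le> 0" using assms(2) by (simp add: mult_le_0_iff)
    ultimately show False by linarith
  qed
  then show ?thesis using t(3) unfolding isotropic_iff_qev by blast
qed

text \<open>An interior form stays semidefinite after subtraction of a small multiple of the sum of
  squares I.\<close>

lemma psd_interior_definite:
  assumes "c \<in> interior psd" "k \<noteq> 0"
  shows "qev c k > 0"
proof -
  define I :: "real ^ 'a uprod" where "I = (\<chi> u. if \<exists>i. u = Upair i i then 1 else 0)"
  have I: "qev I k = (\<Sum>i\<in>UNIV. (k $ i)\<^sup>2)"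
  proof -
    have "(\<exists>l. Upair i j = Upair l l) \<longleftrightarrow> i = j" for i j :: 'a by auto
    then have "(\<Sum>j\<in>{i..}. I $ Upair i j * k $ i * k $ j) = (\<Sum>j\<in>{i..}. if j = i then (k $ i)\<^sup>2 else 0)" for i
      by (intro sum.cong refl) (auto simp: I_def power2_eq_square)
    then show ?thesis unfolding qev_def by simp
  qed
  have "(\<Sum>i\<in>UNIV. (k $ i)\<^sup>2) > 0"
  proof -
    obtain i where "k $ i \<noteq> 0" using assms(2) by (auto simp: vec_eq_iff)
    then show ?thesis by (intro sum_pos2[of _ i]) auto
  qed
  then have Ipos: "qev I k > 0" using I by simp
  obtain e where e: "e > 0" "ball c e \<subseteq> psd" using assms(1) by (auto simp: mem_interior)
  define s where "s = e / (2 * (norm I + 1))"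
  have "norm I + 1 > 0" by (simp add: add_nonneg_pos)
  then have s: "s > 0" "s * norm I < e" using e(1) by (auto simp: s_def divide_simps add_nonneg_pos intro!: mult_strict_left_mono)
  have "1 *\<^sub>R c + (- s) *\<^sub>R I \<in> ball c e" using s by (simp add: dist_norm)
  then have "1 *\<^sub>R c + (- s) *\<^sub>R I \<in> psd" using e(2) by blast
  then have "qev (1 *\<^sub>R c + (- s) *\<^sub>R I) k \<ge> 0" unfolding psd_def by blast
  then have "qev c k \<ge> s * qev I k" unfolding qev_linear by simp
  then show ?thesis using s(1) Ipos by (smt (verit) mult_pos_pos)
qed

text \<open>Outside the cones of positive and negative semidefinite forms every form is isotropic,
  and in their interiors none is. The frontier thus lies in the frontiers of two convex
  sets.\<close>

lemma negligible_frontier_real_iso: "negligible (frontier (real_iso :: (real ^ ('n::{finite,linorder}) uprod) set))"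
proof -
  let ?N = "uminus ` psd :: (real ^ ('n::_) uprod) set"
  have N: "c \<in> ?N \<longleftrightarrow> - c \<in> psd" for c by (metis image_iff minus_minus)
  have "convex ?N" using convex_negations[OF convex_psd] .
  have "frontier real_iso \<subseteq> frontier psd \<union> frontier ?N"
  proof
    fix c :: "real ^ ('n::_) uprod" assume c: "c \<in> frontier real_iso"
    have half: False if "d \<in> interior psd" "d = c \<or> d = - c" for d
    proof -
      have "interior psd \<subseteq> - real_iso" "uminus ` interior psd \<subseteq> - real_iso"
        using psd_interior_definite by (force simp: real_iso_def isotropic_iff_qev qev_minus)+
      moreover have "open (uminus ` interior psd)" by (simp add: open_negations)
      ultimately have "interior psd \<union> uminus ` interior psd \<subseteq> interior (- real_iso)"
        by (intro interior_maximal) auto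
      moreover have "c \<in> interior psd \<union> uminus ` interior psd" using that by (auto simp: image_iff) (metis minus_minus)
      ultimately show False using c by (auto simp: frontier_def interior_complement)
    qed
    have "c \<in> psd \<or> c \<in> ?N"
    proof (rule ccontr)
      assume "\<not> (c \<in> psd \<or> c \<in> ?N)"
      then have "c \<notin> psd" "- c \<notin> psd" using N by blast+
      then obtain u w where uw: "qev c w < 0" "qev c u > 0" by (auto simp: psd_def qev_minus not_le)
      define U0 where "U0 = {d. qev d w < 0} \<inter> {d. qev d u > 0}"
      have "open U0" unfolding U0_def
        by (intro open_Int open_Collect_less continuous_on_const continuous_qev_coeff)
      moreover have "U0 \<subseteq> real_iso" using isotropic_of_indefinite by (auto simp: U0_def real_iso_def)
      ultimately have "c \<in> interior real_iso" using uw by (auto simp: U0_def intro!: interiorI[of U0])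
      then show False using c by (simp add: frontier_def)
    qed
    then show "c \<in> frontier psd \<union> frontier ?N"
    proof
      assume "c \<in> psd"
      moreover have "c \<notin> interior psd" using half by blast
      ultimately show ?thesis using closure_subset by (auto simp: frontier_def)
    next
      assume cN: "c \<in> ?N"
      have "interior ?N = uminus ` interior psd" by (rule interior_negations)
      then have "c \<notin> interior ?N" using half[of "- c"] by auto
      moreover have "c \<in> closure ?N" using closure_subset[of ?N] cN by (rule subsetD)
      ultimately show ?thesis unfolding frontier_def by blast
    qed
  qed
  moreover have "negligible (frontier psd \<union> frontier ?N)"
    by (intro negligible_Un negligible_convex_frontier convex_psd \<open>convex ?N\<close>)
  ultimately show ?thesis by (rule negligible_subset[rotated])
qed

lemma real_iso_scale:
  assumes "X > 0"
  shows "c /\<^sub>R X \<in> real_iso \<longleftrightarrow> c \<in> real_iso"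
proof -
  have "qev (c /\<^sub>R X) k = qev c k / X" for k
    using qev_linear[of "inverse X" c 0 0 k] by (simp add: divide_inverse mult.commute)
  then show ?thesis using assms by (simp add: real_iso_def isotropic_iff_qev)
qed

section \<open>The Hasse principle for general forms\<close>

lemma qev_tendsto:
  fixes c :: "real ^ ('n::{finite,linorder}) uprod"
  assumes "(f \<longlongrightarrow> z) F" shows "((\<lambda>t. qev c (f t)) \<longlongrightarrow> qev c z) F"
  unfolding qev_def by (intro tendsto_sum tendsto_mult tendsto_const tendsto_vec_nth assms)

text \<open>Positivity is an open and homogeneous condition, so rational approximations with common
  denominator n reach it.\<close>

lemma int_vector_positive:
  fixes c :: "int ^ ('n::{finite,linorder}) uprod"
  assumes "qev (rvec c) z > 0"
  shows "\<exists>x. qev c x > 0"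
proof -
  define g where "g n = (\<chi> i. \<lfloor>real n * z $ i\<rfloor>)" for n :: nat
  have "(\<lambda>n. (1 / real n) *s rvec (g n)) \<longlonglongrightarrow> z"
  proof (rule vec_tendstoI)
    fix i
    have "(\<lambda>n. real_of_int \<lfloor>real n * z $ i\<rfloor> / real n) \<longlonglongrightarrow> z $ i" by real_asymp
    then show "(\<lambda>n. ((1 / real n) *s rvec (g n)) $ i) \<longlonglongrightarrow> z $ i" by (simp add: g_def rvec_def)
  qed
  from qev_tendsto[OF this, of "rvec c"] have "\<forall>\<^sub>F n in sequentially. qev (rvec c) ((1 / real n) *s rvec (g n)) > 0"
    using assms by (rule order_tendstoD)
  then obtain n where "qev (rvec c) ((1 / real n) *s rvec (g n)) > 0"
    using eventually_happens'[OF sequentially_bot] by blast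
  then have "(1 / real n)^2 * real_of_int (qev c (g n)) > 0" by (simp only: qev_scale qev_rvec)
  then have "real_of_int (qev c (g n)) > 0" by (simp add: zero_less_mult_iff)
  then show ?thesis by auto
qed

lemma rvec_uminus: "rvec (- c) = - rvec c" by (simp add: rvec_def vec_eq_iff)

lemma gram_kernel_real:
  fixes c :: "real ^ ('n::{finite,linorder}) uprod"
  assumes "det (gram c) \<noteq> 0" "x \<noteq> 0"
  shows "\<exists>i. (gram c *v x) $ i \<noteq> 0"
proof (rule ccontr)
  assume "\<nexists>i. (gram c *v x) $ i \<noteq> 0"
  then have z: "gram c *v x = 0" by (simp add: vec_eq_iff)
  have "invertible (gram c)" using assms(1) by (simp add: invertible_det_nz)
  then show False using z assms(2) by (metis invertible_def matrix_left_invertible_ker)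
qed

text \<open>For a nonzero isotropic x outside the radical some y is not orthogonal to x, and the
  value at t x + y is linear in t with nonzero slope.\<close>

lemma indefinite_values:
  fixes c :: "real ^ ('n::{finite,linorder}) uprod"
  assumes "det (gram c) \<noteq> 0" "x \<noteq> 0" "qev c x = 0"
  shows "\<exists>u. qev c u = r"
proof -
  obtain i where i: "(gram c *v x) $ i \<noteq> 0" using gram_kernel_real[OF assms(1,2)] by blast
  define y where "y = axis i (1::real)"
  define \<beta> where "\<beta> = bil c x y"
  have \<beta>: "\<beta> \<noteq> 0" using i by (simp add: \<beta>_def y_def bil_axis)
  have "qev c (((r - qev c y) / \<beta>) *s x + y) = r"
    unfolding qev_add qev_scale bil_scale_left \<beta>_def[symmetric] assms(3) using \<beta> by simp
  then show ?thesis by blast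
qed

lemma indefinite_int:
  fixes c :: "int ^ ('n::{finite,linorder}) uprod"
  assumes "det (gram c) \<noteq> 0" "isotropic ring_of_type (rvec c)"
  shows "\<exists>u w. qev c u > 0 \<and> qev c w < 0"
proof -
  have d: "det (gram (rvec c)) \<noteq> 0" using assms(1) by (simp add: gram_rvec det_of_int)
  obtain x where x: "x \<noteq> 0" "qev (rvec c) x = 0" using assms(2) by (auto simp: isotropic_iff_qev)
  obtain u where u: "qev (rvec c) u = 1" using indefinite_values[OF d x] by blast
  obtain w where w: "qev (rvec c) w = -1" using indefinite_values[OF d x] by blast
  have "qev (rvec (- c)) w > 0" using w by (simp add: rvec_uminus qev_minus)
  then obtain w' where "qev (- c) w' > 0" using int_vector_positive by blast
  moreover have "qev (rvec c) u > 0" using u by simp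
  then obtain u' where "qev c u' > 0" using int_vector_positive by blast
  ultimately show ?thesis by (auto simp: qev_minus)
qed

lemma orth_mixed:
  fixes c :: "int ^ ('n::{finite,linorder}) uprod"
  assumes "det (gram c) \<noteq> 0" "isotropic ring_of_type (rvec c)" "2 \<le> m" "m \<le> CARD('n)"
  shows "\<exists>v. orth c m v \<and> qev c (v 0) > 0 \<and> qev c (v 1) < 0"
proof -
  obtain u w where uw: "qev c u > 0" "qev c w < 0" using indefinite_int[OF assms(1,2)] by blast
  \<comment> \<open>A multiple of the projection of w orthogonal to u; the computation below shows
    that the sign of its value stays negative.\<close>
  define w' where "w' = (2 * qev c u) *s w + (- bil c w u) *s u"
  have "bil c w' u = 0" by (simp add: w'_def bil_add_left bil_scale_left bil_self)
  then have b: "bil c w' u = 0" "bil c u w' = 0" by (simp_all add: bil_commute[of c u w'])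
  have "qev c w' = (2 * qev c u)^2 * qev c w - qev c u * (bil c w u)^2"
    using bil_commute[of c u w] by (simp add: w'_def qev_add qev_scale bil_scale_left bil_scale_right bil_self power2_eq_square algebra_simps)
  moreover have "(2 * qev c u)^2 * qev c w < 0" using uw by (intro mult_pos_neg) auto
  moreover have "qev c u * (bil c w u)^2 \<ge> 0" using uw by simp
  ultimately have q: "qev c w' < 0" by linarith
  have "orth c 2 (\<lambda>i. if i = 0 then u else w')"
    using uw q b by (auto simp: orth_def less_2_cases_iff)
  from orth_extend[OF this assms(1,3,4)] obtain v where v: "orth c m v" "\<forall>i<2. v i = (if i = 0 then u else w')" by blast
  then show ?thesis using uw q by (intro exI[of _ v]) auto
qed

lemma orth_sum:
  assumes "orth c k v" "m \<le> k"
  shows "qev c (\<Sum>i<m. z i *s v i) = (\<Sum>i<m. (z i)\<^sup>2 * qev c (v i))"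
  using assms(2)
proof (induction m)
  case (Suc m)
  have "bil c (\<Sum>i<m. z i *s v i) (z m *s v m) = 0"
    using assms(1) Suc.prems by (simp add: bil_scale_right bil_sum_left bil_scale_left orth_def)
  then show ?case using Suc by (simp add: qev_add qev_scale)
qed simp

lemma orth_sum_nonzero:
  assumes "orth c k v" "j < k" "z j \<noteq> 0"
  shows "(\<Sum>i<k. z i *s v i) \<noteq> 0"
proof
  assume "(\<Sum>i<k. z i *s v i) = 0"
  then have "0 = bil c (\<Sum>i<k. z i *s v i) (v j)" by simp
  also have "\<dots> = (\<Sum>i<k. z i * bil c (v i) (v j))" by (simp add: bil_sum_left bil_scale_left)
  also have "\<dots> = (\<Sum>i<k. if i = j then z j * (2 * qev c (v j)) else 0)"
    using assms(1,2) by (intro sum.cong) (auto simp: orth_def bil_self)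
  also have "\<dots> = z j * (2 * qev c (v j))" using assms(2) by simp
  finally show False using assms by (simp add: orth_def)
qed

theorem isotropic_quinary:
  fixes c :: "int ^ ('n::{finite,linorder}) uprod"
  assumes "det (gram c) \<noteq> 0" "isotropic ring_of_type (rvec c)" "CARD('n) \<ge> 5"
  shows "isotropic ring_of_type c"
proof -
  obtain v where v: "orth c 5 v" "qev c (v 0) > 0" "qev c (v 1) < 0"
    using orth_mixed[OF assms(1,2), of 5] assms(3) by auto
  have nz: "qev c (v i) \<noteq> 0" if "i < 5" for i using v(1) that by (simp add: orth_def)
  \<comment> \<open>The values at v 0 and v 1, of opposite sign, take two of the last three places,
    where \<open>quinary_isotropic\<close> asks for both signs.\<close>
  obtain x y z w u where s: "x \<noteq> 0 \<or> y \<noteq> 0 \<or> z \<noteq> 0 \<or> w \<noteq> 0 \<or> u \<noteq> 0"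
    "qev c (v 2) * x^2 + qev c (v 3) * y^2 + qev c (v 4) * z^2 + qev c (v 0) * w^2 + qev c (v 1) * u^2 = 0"
  proof -
    have "\<exists>x y z w u. (x \<noteq> 0 \<or> y \<noteq> 0 \<or> z \<noteq> 0 \<or> w \<noteq> 0 \<or> u \<noteq> 0) \<and>
        qev c (v 2) * x^2 + qev c (v 3) * y^2 + qev c (v 4) * z^2 + qev c (v 0) * w^2 + qev c (v 1) * u^2 = 0"
      using v(2,3) by (intro quinary_isotropic nz) auto
    then show thesis using that by blast
  qed
  define f where "f i = (if i = 0 then w else if i = 1 then u else if i = 2 then x else if i = 3 then y else z)" for i :: nat
  have "qev c (\<Sum>i<5. f i *s v i) = 0"
    unfolding orth_sum[OF v(1) order.refl] using s(2) by (simp add: eval_nat_numeral f_def algebra_simps)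
  moreover have "\<exists>j<5. f j \<noteq> 0"
  proof (rule ccontr)
    assume "\<not> (\<exists>j<5. f j \<noteq> 0)"
    then have "f 0 = 0" "f 1 = 0" "f 2 = 0" "f 3 = 0" "f 4 = 0" by auto
    then show False using s(1) by (simp add: f_def)
  qed
  then have "(\<Sum>i<5. f i *s v i) \<noteq> 0" using orth_sum_nonzero[OF v(1)] by blast
  ultimately show ?thesis unfolding isotropic_iff_qev by blast
qed

text \<open>Passing to an orthogonal system multiplies a zero modulo p^k by \<open>oden\<close>. The
  primitivity lost in this way is bounded independently of k, which is the form of local zero that
  \<open>good_of_local_zero\<close> accepts.\<close>

theorem isotropic_quaternary:
  fixes c :: "int ^ ('n::{finite,linorder}) uprod"
  assumes d: "det (gram c) \<noteq> 0" and "isotropic ring_of_type (rvec c)" and n: "CARD('n) = 4"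
    and loc: "\<And>p. prime p \<Longrightarrow> locsol p c"
  shows "isotropic ring_of_type c"
proof -
  obtain v where v: "orth c 4 v" "qev c (v 0) > 0" "qev c (v 1) < 0"
    using orth_mixed[OF assms(1,2), of 4] n by auto
  have nz: "qev c (v i) \<noteq> 0" if "i < 4" for i using v(1) that by (simp add: orth_def)
  have good: "good p (qev c (v 0)) (qev c (v 1)) (qev c (v 2)) (qev c (v 3))" if p: "prime p" for p
  proof -
    define P where "P = oden c 4 v"
    have P0: "P \<noteq> 0" using oden_nonzero[OF v(1)] by (simp add: P_def)
    \<comment> \<open>If all diagonal coordinates were divisible by p^e, so would be P times a
      coordinate of x prime to p, hence P.\<close>
    define e where "e = Suc (pval p P)"
    have eP: "\<not> int p ^ e dvd P" using pval_dvd_iff[OF p P0, of e] by (simp add: e_def)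
    show ?thesis
    proof (rule good_of_local_zero[OF p nz nz nz nz])
      fix k
      obtain x where x: "primitive p x" "int p ^ k dvd qev c x" using loc[OF p] by (auto simp: locsol_def zero_mod_def)
      obtain i where i: "\<not> int p dvd x $ i" using x(1) by (auto simp: primitive_def)
      define f where "f = oproj_coeff c 4 v x"
      have e1: "P *s x = (\<Sum>i<4. f i *s v i)"
        using oproj_full[of c v x] v(1) d n by (simp add: oproj_def P_def f_def)
      have "P^2 * qev c x = (\<Sum>i<4. (f i)\<^sup>2 * qev c (v i))"
        using arg_cong[OF e1, of "qev c"] unfolding orth_sum[OF v(1) order.refl] by (simp add: qev_scale)
      then have "int p ^ k dvd (\<Sum>i<4. (f i)\<^sup>2 * qev c (v i))" using x(2) by (metis dvd_mult)
      then have 1: "int p ^ k dvd qev c (v 0) * (f 0)^2 + qev c (v 1) * (f 1)^2 + qev c (v 2) * (f 2)^2 + qev c (v 3) * (f 3)^2"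
        by (simp add: eval_nat_numeral algebra_simps)
      have 2: "\<not> (int p ^ e dvd f 0 \<and> int p ^ e dvd f 1 \<and> int p ^ e dvd f 2 \<and> int p ^ e dvd f 3)"
      proof
        assume "int p ^ e dvd f 0 \<and> int p ^ e dvd f 1 \<and> int p ^ e dvd f 2 \<and> int p ^ e dvd f 3"
        then have "int p ^ e dvd f j" if "j < 4" for j using that by (auto simp: eval_nat_numeral less_Suc_eq)
        then have "int p ^ e dvd (\<Sum>j<4. f j * v j $ i)" by (intro dvd_sum dvd_mult2) auto
        moreover have "(\<Sum>j<4. f j * v j $ i) = P * x $ i" using arg_cong[OF e1, of "\<lambda>t. t $ i"] by simp
        ultimately have "int p ^ e dvd P * x $ i" by simp
        moreover have "coprime (int p ^ e) (x $ i)" using p i prime_imp_coprime[of "int p" "x $ i"] by simp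
        ultimately show False using eP by (simp add: coprime_dvd_mult_left_iff)
      qed
      show "\<exists>x y z w. int p ^ k dvd qev c (v 0) * x^2 + qev c (v 1) * y^2 + qev c (v 2) * z^2 + qev c (v 3) * w^2 \<and>
          \<not> (int p ^ e dvd x \<and> int p ^ e dvd y \<and> int p ^ e dvd z \<and> int p ^ e dvd w)"
        using 1 2 by blast
    qed auto
  qed
  obtain x y z w where s: "x \<noteq> 0 \<or> y \<noteq> 0 \<or> z \<noteq> 0 \<or> w \<noteq> 0"
    "qev c (v 0) * x^2 + qev c (v 1) * y^2 + qev c (v 2) * z^2 + qev c (v 3) * w^2 = 0"
  proof -
    have "\<exists>x y z w. (x \<noteq> 0 \<or> y \<noteq> 0 \<or> z \<noteq> 0 \<or> w \<noteq> 0) \<and>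
        qev c (v 0) * x^2 + qev c (v 1) * y^2 + qev c (v 2) * z^2 + qev c (v 3) * w^2 = 0"
      using v(2,3) by (intro quaternary_isotropic nz good) auto
    then show thesis using that by blast
  qed
  define f where "f i = (if i = 0 then x else if i = 1 then y else if i = 2 then z else w)" for i :: nat
  have "qev c (\<Sum>i<4. f i *s v i) = 0"
    unfolding orth_sum[OF v(1) order.refl] using s(2) by (simp add: eval_nat_numeral f_def algebra_simps)
  moreover have "\<exists>j<4. f j \<noteq> 0"
  proof (rule ccontr)
    assume "\<not> (\<exists>j<4. f j \<noteq> 0)"
    then have "f 0 = 0" "f 1 = 0" "f 2 = 0" "f 3 = 0" by auto
    then show False using s(1) by (simp add: f_def)
  qed
  then have "(\<Sum>i<4. f i *s v i) \<noteq> 0" using orth_sum_nonzero[OF v(1)] by blast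
  ultimately show ?thesis unfolding isotropic_iff_qev by blast
qed

section \<open>The \<open>p\<close>-adic densities\<close>

lemma qev_cong:
  assumes "\<And>u. [c $ u = d $ u] (mod M)" "\<And>i. [x $ i = y $ i] (mod M)"
  shows "[qev c x = qev d y] (mod M)"
  unfolding qev_def by (intro cong_sum cong_mult assms)

lemma zero_mod_cong:
  assumes "\<And>u. [c $ u = d $ u] (mod int p ^ k)" "zero_mod p k c"
  shows "zero_mod p k d"
proof -
  obtain x where x: "primitive p x" "int p ^ k dvd qev c x" using assms(2) by (auto simp: zero_mod_def)
  have "[qev c x = qev d x] (mod int p ^ k)" by (intro qev_cong assms(1) cong_refl)
  then have "int p ^ k dvd qev d x" using x(2) cong_dvd_iff by blast
  then show ?thesis using x(1) by (auto simp: zero_mod_def)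
qed

lemma qmod_cong: "[qmod M Q $ u = Q $ u] (mod M)" by (simp add: qmod_def Cong.cong_def)

lemma periodic_zero_mod: "periodic (int p ^ k) {c. zero_mod p k c}"
  unfolding periodic_def using zero_mod_cong qmod_cong cong_sym by (metis mem_Collect_eq)

lemma card_res_vec:
  assumes "M \<ge> 0"
  shows "card (res_vec M :: (int ^ 'm) set) = nat M ^ CARD('m)"
proof -
  have "bij_betw (\<lambda>x. \<lambda>u. x $ u) (res_vec M :: (int ^ 'm) set) (UNIV \<rightarrow>\<^sub>E {0..<M})"
    by (rule bij_betw_byWitness[where f' = "\<lambda>f. \<chi> u. f u"])
      (auto simp: res_vec_def PiE_iff extensional_def)
  then have "card (res_vec M :: (int ^ 'm) set) = card ((UNIV :: 'm set) \<rightarrow>\<^sub>E {0..<M})"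
    by (rule bij_betw_same_card)
  then show ?thesis by (simp add: card_PiE)
qed

text \<open>Koenig's lemma for an inverse system of finite nonempty sets. \<open>good k x\<close>
  says that x has preimages at all higher levels; the pigeonhole principle extends such an x by one
  level.\<close>

lemma koenig:
  assumes fin: "\<And>k. finite (Z k)" and ne: "\<And>k. Z k \<noteq> {}"
    and r: "\<And>j k z. j \<le> k \<Longrightarrow> z \<in> Z k \<Longrightarrow> r j z \<in> Z j"
    and rr: "\<And>j k z. j \<le> k \<Longrightarrow> r j (r k z) = r j z"
  shows "\<exists>f. \<forall>k. f k \<in> Z k \<and> r k (f (Suc k)) = f k"
proof -
  define good where "good k x \<longleftrightarrow> x \<in> Z k \<and> (\<forall>m\<ge>k. \<exists>z\<in>Z m. r k z = x)" for k :: nat and x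
  have pick: "\<exists>y. good k y \<and> (\<forall>j\<le>k. r j y = r j y) \<and> (\<exists>m\<ge>k. y = r k (w m))"
    if w: "\<And>m. m \<ge> k \<Longrightarrow> w m \<in> Z m" for k w
  proof -
    have "(\<lambda>m. r k (w m)) ` {k..} \<subseteq> Z k" using w r by auto
    then have "finite ((\<lambda>m. r k (w m)) ` {k..})" using fin finite_subset by blast
    then obtain m0 where m0: "m0 \<in> {k..}" "infinite {m \<in> {k..}. r k (w m) = r k (w m0)}"
      using pigeonhole_infinite[of "{k..}" "\<lambda>m. r k (w m)"] infinite_Ici by blast
    have "good k (r k (w m0))"
      unfolding good_def
    proof (intro conjI allI impI)
      show "r k (w m0) \<in> Z k" using m0(1) w r by simp
      fix m assume m: "m \<ge> k"
      obtain n where n: "n > m" "n \<ge> k" "r k (w n) = r k (w m0)"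
        using m0(2) unfolding infinite_nat_iff_unbounded by blast
      have "w n \<in> Z n" using n w by simp
      then have "r m (w n) \<in> Z m" using r[of m n] n(1) by simp
      moreover have "r k (r m (w n)) = r k (w m0)" using rr[OF m] n by simp
      ultimately show "\<exists>z\<in>Z m. r k z = r k (w m0)" by blast
    qed
    then show ?thesis using m0(1) by auto
  qed
  have "\<exists>x. good 0 x"
  proof -
    have "\<forall>m. \<exists>z. z \<in> Z m" using ne by blast
    from choice[OF this] obtain w where "\<forall>m. w m \<in> Z m" ..
    then show ?thesis using pick[of 0 w] by blast
  qed
  moreover have "\<exists>y. good (Suc k) y \<and> r k y = x" if "good k x" for k x
  proof -
    have "\<forall>m. \<exists>z. m \<ge> k \<longrightarrow> z \<in> Z m \<and> r k z = x" using that unfolding good_def by blast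
    from choice[OF this] obtain w where w: "\<forall>m. m \<ge> k \<longrightarrow> w m \<in> Z m \<and> r k (w m) = x" ..
    obtain y m where y: "good (Suc k) y" "m \<ge> Suc k" "y = r (Suc k) (w m)" using pick[of "Suc k" w] w by auto
    have "r k y = x" using y w rr[of k "Suc k"] by simp
    then show ?thesis using y by blast
  qed
  ultimately obtain f where "\<And>k. good k (f k)" "\<And>k. r k (f (Suc k)) = f k"
    using dependent_nat_choice[of good "\<lambda>k x y. r k y = x"] by blast
  then show ?thesis by (auto simp: good_def)
qed

definition lvl :: "nat \<Rightarrow> (nat \<Rightarrow> int) ^ 'm \<Rightarrow> int ^ 'm" where "lvl k c = (\<chi> u. (c $ u) k)"

lemma padic_simps:
  "(x \<oplus>\<^bsub>padic_int p\<^esub> y) k = (x k + y k) mod int p ^ k" "(x \<otimes>\<^bsub>padic_int p\<^esub> y) k = (x k * y k) mod int p ^ k"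
  "\<zero>\<^bsub>padic_int p\<^esub> = (\<lambda>k. 0)"
  by (simp_all add: padic_int_def)

lemma finsum_padic:
  assumes "p > 0" "finite A" "f \<in> A \<rightarrow> carrier (padic_int p)"
  shows "finsum (padic_int p) f A k = (\<Sum>i\<in>A. f i k) mod int p ^ k"
  using assms(2,3)
proof induction
  case empty
  interpret cring "padic_int p" by (rule cring_padic_int) fact
  show ?case by (simp add: padic_simps)
next
  case (insert a A)
  interpret cring "padic_int p" by (rule cring_padic_int) fact
  show ?case using insert by (simp add: finsum_insert padic_simps mod_simps)
qed

lemma qform_eval_padic:
  assumes "p > 0" "c \<in> padic_space p" "x \<in> padic_space p"
  shows "qform_eval (padic_int p) c x k = qev (lvl k c) (lvl k x) mod int p ^ k"
proof -
  interpret cring "padic_int p" by (rule cring_padic_int) fact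
  have c: "c $ u \<in> carrier (padic_int p)" and x: "x $ i \<in> carrier (padic_int p)" for u i
    using assms by (auto simp: padic_space_def)
  have in1: "(\<lambda>j. c $ Upair i j \<otimes>\<^bsub>padic_int p\<^esub> x $ i \<otimes>\<^bsub>padic_int p\<^esub> x $ j) \<in> A \<rightarrow> carrier (padic_int p)" for i A
    using c x by simp
  have in2: "(\<lambda>i. \<Oplus>\<^bsub>padic_int p\<^esub>j\<in>{i..}. c $ Upair i j \<otimes>\<^bsub>padic_int p\<^esub> x $ i \<otimes>\<^bsub>padic_int p\<^esub> x $ j) \<in> UNIV \<rightarrow> carrier (padic_int p)"
    using in1 by (auto intro!: finsum_closed)
  have "qform_eval (padic_int p) c x k =
    (\<Sum>i\<in>UNIV. (\<Sum>j\<in>{i..}. ((c $ Upair i j) k * (x $ i) k mod int p ^ k * (x $ j) k) mod int p ^ k) mod int p ^ k) mod int p ^ k"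
    unfolding qform_eval_def
    by (simp add: finsum_padic[OF assms(1) _ in2] finsum_padic[OF assms(1) _ in1] padic_simps)
  also have "\<dots> = qev (lvl k c) (lvl k x) mod int p ^ k"
    by (simp add: qev_def lvl_def mod_simps)
  finally show ?thesis .
qed

lemma lvl_cong:
  assumes "c \<in> padic_space p" "j \<le> k"
  shows "[lvl k c $ u = lvl j c $ u] (mod int p ^ j)"
  using padic_int_level[of "c $ u" p j k] padic_int_level[of "c $ u" p j j] assms
  by (auto simp: lvl_def Cong.cong_def padic_space_def)

lemma lvl_residues: "c \<in> padic_space p \<Longrightarrow> lvl k c \<in> res_vec (int p ^ k)"
  by (auto simp: lvl_def res_vec_def padic_space_def padic_int_def)

text \<open>Division by the highest power p^e that divides the zero makes it primitive but costs
  p^(2 e) in the value, so the computation runs at the higher level K and is reduced at the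
  end.\<close>

lemma isotropic_padic_zero_mod:
  fixes c :: "(nat \<Rightarrow> int) ^ ('n::{finite,linorder}) uprod"
  assumes p: "prime p" and c: "c \<in> padic_space p" and iso: "isotropic (padic_int p) c"
  shows "zero_mod p k (lvl k c)"
proof -
  have p0: "p > 0" using p by (simp add: prime_gt_0_nat)
  obtain x where x: "x \<in> padic_space p" "\<exists>i. x $ i \<noteq> \<zero>\<^bsub>padic_int p\<^esub>" "qform_eval (padic_int p) c x = \<zero>\<^bsub>padic_int p\<^esub>"
    using iso by (auto simp: isotropic_def padic_space_def)
  obtain l where l: "lvl l x \<noteq> 0" using x(2) by (fastforce simp: lvl_def vec_eq_iff padic_simps)
  have "0 \<le> lvl 0 x $ i \<and> lvl 0 x $ i < 1" for i using lvl_residues[OF x(1), of 0] by (simp add: res_vec_def)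
  then have l0: "lvl 0 x = 0" by (simp add: vec_eq_iff) (smt (verit))
  obtain e where e: "lvl e x = 0" "lvl (Suc e) x \<noteq> 0"
  proof -
    define m where "m = (LEAST m. lvl m x \<noteq> 0)"
    have m: "lvl m x \<noteq> 0" unfolding m_def using l by (rule LeastI)
    then obtain e where "m = Suc e" using l0 by (cases m) auto
    then have "lvl e x = 0" using not_less_Least[of e "\<lambda>m. lvl m x \<noteq> 0"] m_def by auto
    then show thesis using that m \<open>m = Suc e\<close> by blast
  qed
  define K where "K = k + 2 * e + 1"
  have "int p ^ e dvd lvl K x $ i" for i
    using lvl_cong[OF x(1), of e K i] e(1) by (simp add: K_def cong_0_iff)
  then have "\<forall>i. \<exists>y. lvl K x $ i = int p ^ e * y" by (auto simp: dvd_def)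
  from choice[OF this] obtain y' where y': "\<forall>i. lvl K x $ i = int p ^ e * y' i" ..
  define y :: "int ^ ('n::_)" where "y = (\<chi> i. y' i)"
  have y: "lvl K x = int p ^ e *s y" using y' by (simp add: vec_eq_iff y_def)
  have "primitive p y"
  proof -
    obtain i where i: "lvl (Suc e) x $ i \<noteq> 0" using e(2) by (auto simp: vec_eq_iff)
    have "\<not> int p dvd y $ i"
    proof
      assume "int p dvd y $ i"
      then have "int p ^ Suc e dvd lvl K x $ i" unfolding y by (simp add: mult.commute mult_dvd_mono)
      then have "int p ^ Suc e dvd lvl (Suc e) x $ i"
        using lvl_cong[OF x(1), of "Suc e" K i] cong_dvd_iff by (auto simp: K_def)
      moreover have "0 \<le> lvl (Suc e) x $ i" "lvl (Suc e) x $ i < int p ^ Suc e"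
        using lvl_residues[OF x(1), of "Suc e"] unfolding res_vec_def by blast+
      ultimately show False using i zdvd_not_zless[of "lvl (Suc e) x $ i" "int p ^ Suc e"] by auto
    qed
    then show ?thesis by (auto simp: primitive_def)
  qed
  moreover have "int p ^ k dvd qev (lvl k c) y"
  proof -
    have "int p ^ K dvd qev (lvl K c) (lvl K x)"
      using qform_eval_padic[OF p0 c x(1), of K] x(3) by (simp add: padic_simps dvd_eq_mod_eq_0)
    moreover have "int p ^ K = int p ^ (2 * e) * int p ^ (k + 1)" by (simp add: K_def power_add)
    moreover have "qev (lvl K c) (lvl K x) = int p ^ (2 * e) * qev (lvl K c) y"
      unfolding y qev_scale by (simp add: power_mult[symmetric] mult.commute)
    ultimately have "int p ^ (2 * e) * int p ^ (k + 1) dvd int p ^ (2 * e) * qev (lvl K c) y" by simp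
    then have "int p ^ (k + 1) dvd qev (lvl K c) y" using p0 by simp
    then have "int p ^ k dvd qev (lvl K c) y" by (meson dvd_trans le_add1 le_imp_power_dvd)
    moreover have "[qev (lvl K c) y = qev (lvl k c) y] (mod int p ^ k)"
      by (intro qev_cong cong_refl lvl_cong[OF c]) (simp add: K_def)
    ultimately show ?thesis using cong_dvd_iff by blast
  qed
  ultimately show ?thesis by (auto simp: zero_mod_def)
qed

text \<open>Compactness: primitive zeros modulo powers of p form an inverse system of finite
  nonempty sets, and a compatible sequence is a p-adic zero.\<close>

lemma zero_mod_isotropic_padic:
  fixes c :: "(nat \<Rightarrow> int) ^ ('n::{finite,linorder}) uprod"
  assumes p: "prime p" and c: "c \<in> padic_space p" and z: "\<And>k. zero_mod p k (lvl k c)"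
  shows "isotropic (padic_int p) c"
proof -
  have p0: "p > 0" using p by (simp add: prime_gt_0_nat)
  \<comment> \<open>The set at k is taken modulo p^(k + 1): reduction modulo p^0 would not keep
    vectors primitive.\<close>
  define Z where "Z k = {x \<in> res_vec (int p ^ Suc k). primitive p x \<and> int p ^ Suc k dvd qev (lvl (Suc k) c) x}" for k
  have red: "qmod (int p ^ Suc k) x \<in> Z k" if "primitive p x" "int p ^ Suc k dvd qev (lvl m c) x" "m \<ge> Suc k" for k m x
  proof -
    have "qmod (int p ^ Suc k) x \<in> res_vec (int p ^ Suc k)" using p0 by (simp add: qmod_def res_vec_def)
    moreover have "primitive p (qmod (int p ^ Suc k) x)"
      using that(1) by (auto simp: primitive_def qmod_def dvd_mod_iff)
    moreover have "[qev (lvl m c) x = qev (lvl (Suc k) c) (qmod (int p ^ Suc k) x)] (mod int p ^ Suc k)"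
      using that(3) by (intro qev_cong lvl_cong[OF c] cong_sym[OF qmod_cong])
    ultimately show ?thesis using that(2) cong_dvd_iff unfolding Z_def by blast
  qed
  have "\<exists>f. \<forall>k. f k \<in> Z k \<and> qmod (int p ^ Suc k) (f (Suc k)) = f k"
  proof (rule koenig)
    show "finite (Z k)" for k unfolding Z_def by (rule finite_subset[OF _ finite_res_vec[of "int p ^ Suc k"]]) blast
    show "Z k \<noteq> {}" for k using z[of "Suc k"] red by (auto simp: zero_mod_def)
    show "qmod (int p ^ Suc j) x \<in> Z j" if "j \<le> k" "x \<in> Z k" for j k x
    proof (rule red)
      show "primitive p x" using that by (simp add: Z_def)
      have "int p ^ Suc j dvd int p ^ Suc k" using that(1) by (intro le_imp_power_dvd) simp
      then show "int p ^ Suc j dvd qev (lvl (Suc k) c) x" using that(2) dvd_trans unfolding Z_def by blast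
    qed (use that in simp)
    show "qmod (int p ^ Suc j) (qmod (int p ^ Suc k) x) = qmod (int p ^ Suc j) x" if "j \<le> k" for j k x
    proof -
      have "int p ^ Suc j dvd int p ^ Suc k" using that by (intro le_imp_power_dvd) simp
      then show ?thesis by (simp add: qmod_def vec_eq_iff mod_mod_cancel del: power_Suc)
    qed
  qed
  then obtain f where f: "\<And>k. f k \<in> Z k" "\<And>k. qmod (int p ^ Suc k) (f (Suc k)) = f k" by blast
  have fc: "[f (Suc k) $ i = f k $ i] (mod int p ^ Suc k)" for k i
    using qmod_cong[of "int p ^ Suc k" "f (Suc k)" i] f(2)[of k] cong_sym by metis
  define x :: "(nat \<Rightarrow> int) ^ ('n::_)" where "x = (\<chi> i. (\<lambda>k. f k $ i mod int p ^ k))"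
  have "f (Suc k) $ i mod int p ^ k = f k $ i mod int p ^ k" for k i
    using cong_dvd_modulus[OF fc[of k i], of "int p ^ k"] by (simp add: Cong.cong_def)
  then have x: "x \<in> padic_space p"
    unfolding padic_space_def x_def using padic_int_closed[OF p0, of "\<lambda>k. f k $ i" for i] by simp
  have "int p ^ k dvd qev (lvl k c) (lvl k x)" for k
  proof -
    have "int p ^ Suc k dvd qev (lvl (Suc k) c) (f k)" using f(1)[of k] by (simp add: Z_def)
    then have "int p ^ k dvd qev (lvl (Suc k) c) (f k)" by (meson dvd_trans le_imp_power_dvd le_SucI order_refl)
    moreover have "[qev (lvl (Suc k) c) (f k) = qev (lvl k c) (lvl k x)] (mod int p ^ k)"
      by (intro qev_cong lvl_cong[OF c]) (simp_all add: lvl_def x_def Cong.cong_def)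
    ultimately show ?thesis using cong_dvd_iff by blast
  qed
  then have "qform_eval (padic_int p) c x = \<zero>\<^bsub>padic_int p\<^esub>"
    using qform_eval_padic[OF p0 c x] by (auto simp: padic_simps fun_eq_iff)
  moreover have "\<exists>i. x $ i \<noteq> \<zero>\<^bsub>padic_int p\<^esub>"
  proof -
    obtain i where i: "\<not> int p dvd f 1 $ i" using f(1)[of 1] by (auto simp: Z_def primitive_def)
    then have "(x $ i) 1 \<noteq> 0" by (simp add: x_def dvd_eq_mod_eq_0)
    then show ?thesis by (auto simp: padic_simps intro!: exI[of _ i])
  qed
  ultimately show ?thesis using x unfolding isotropic_def padic_space_def by blast
qed

text \<open>Reduction at level k splits the space into p^(k m) cylinders of equal Haar measure,
  where m is the number of coordinates.\<close>

lemma padic_density: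
  fixes A :: "(int ^ 'm) set"
  assumes "p > 0"
  shows "{c \<in> padic_space p. lvl k c \<in> A} \<in> sets (padic_haar p)"
    "measure (padic_haar p) {c \<in> padic_space p. lvl k c \<in> A} = rdens (int p ^ k) A"
proof -
  let ?V = "padic_space p :: ((nat \<Rightarrow> int) ^ 'm) set"
  let ?M = "padic_haar p :: ((nat \<Rightarrow> int) ^ 'm) measure"
  define emb :: "int ^ 'm \<Rightarrow> (nat \<Rightarrow> int) ^ 'm" where "emb r = (\<chi> u. (\<lambda>j. r $ u mod int p ^ j))" for r
  have haar: "is_padic_haar p ?M" by (rule is_padic_haar_padic_haar) fact
  interpret prob_space ?M using haar unfolding is_padic_haar_def by blast
  have M: "sets ?M = sets (restrict_space borel ?V)" using haar by (simp add: is_padic_haar_def)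
  have emb: "emb r \<in> ?V" for r
    unfolding emb_def padic_space_def using padic_int_closed[OF assms(1), of "\<lambda>k. r $ u" for u] by simp
  have cyl: "padic_cylinder p k (emb r) = {c \<in> ?V. lvl k c = r}" if "r \<in> res_vec (int p ^ k)" for r
    using that by (auto simp: padic_cylinder_def emb_def lvl_def res_vec_def vec_eq_iff)
  have sets: "padic_cylinder p k b \<in> sets ?M" if "b \<in> ?V" for b
    using that unfolding M sets_padic_space by (auto intro!: sigma_sets.Basic)
  have lvl_emb: "lvl k (emb r) = r" if "r \<in> res_vec (int p ^ k)" for r
    using that by (auto simp: emb_def lvl_def res_vec_def vec_eq_iff)
  have "padic_cylinder p k ` ?V = (\<lambda>r. {c \<in> ?V. lvl k c = r}) ` res_vec (int p ^ k)"
  proof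
    show "padic_cylinder p k ` ?V \<subseteq> (\<lambda>r. {c \<in> ?V. lvl k c = r}) ` res_vec (int p ^ k)"
    proof
      fix C assume "C \<in> padic_cylinder p k ` ?V"
      then obtain b where b: "b \<in> ?V" "C = padic_cylinder p k b" by blast
      have "C = {c \<in> ?V. lvl k c = lvl k b}" unfolding b(2) by (auto simp: padic_cylinder_def lvl_def vec_eq_iff)
      then show "C \<in> (\<lambda>r. {c \<in> ?V. lvl k c = r}) ` res_vec (int p ^ k)" using lvl_residues[OF b(1)] by blast
    qed
    show "(\<lambda>r. {c \<in> ?V. lvl k c = r}) ` res_vec (int p ^ k) \<subseteq> padic_cylinder p k ` ?V"
    proof (rule image_subsetI)
      fix r :: "int ^ 'm" assume r: "r \<in> res_vec (int p ^ k)"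
      have "padic_cylinder p k (emb r) \<in> padic_cylinder p k ` ?V" using emb by blast
      then show "{c \<in> ?V. lvl k c = r} \<in> padic_cylinder p k ` ?V" unfolding cyl[OF r] .
    qed
  qed
  moreover have "inj_on (\<lambda>r. {c \<in> ?V. lvl k c = r}) (res_vec (int p ^ k))"
  proof (rule inj_onI)
    fix r s assume rs: "r \<in> res_vec (int p ^ k)" "{c \<in> ?V. lvl k c = r} = {c \<in> ?V. lvl k c = s}"
    have "emb r \<in> {c \<in> ?V. lvl k c = r}" using emb lvl_emb[OF rs(1)] by simp
    then show "r = s" using lvl_emb[OF rs(1)] unfolding rs(2) by simp
  qed
  ultimately have "card (padic_cylinder p k ` ?V) = card (res_vec (int p ^ k) :: (int ^ 'm) set)"
    by (simp add: card_image)
  then have card: "card (padic_cylinder p k ` ?V) = (p ^ k) ^ CARD('m)"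
    by (simp add: card_res_vec nat_power_eq)
  have one: "measure ?M {c \<in> ?V. lvl k c = r} = 1 / real_of_int (int p ^ k) ^ CARD('m)" "{c \<in> ?V. lvl k c = r} \<in> sets ?M"
    if r: "r \<in> res_vec (int p ^ k)" for r
  proof -
    have "emeasure ?M {c \<in> ?V. lvl k c = r} = 1 / of_nat ((p ^ k) ^ CARD('m))"
      using is_padic_haar_cylinder[OF assms(1) haar emb[of r], of k] card cyl[OF r]
      by (simp add: card_res_vec nat_power_eq)
    also have "\<dots> = ennreal (1 / real ((p ^ k) ^ CARD('m)))"
      using assms(1) by (simp add: ennreal_of_nat_eq_real_of_nat divide_ennreal flip: ennreal_1)
    finally show "measure ?M {c \<in> ?V. lvl k c = r} = 1 / real_of_int (int p ^ k) ^ CARD('m)"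
      unfolding measure_def by simp
    show "{c \<in> ?V. lvl k c = r} \<in> sets ?M" using sets[OF emb[of r]] cyl[OF r] by simp
  qed
  let ?R = "res_vec (int p ^ k) \<inter> A"
  have eq: "{c \<in> ?V. lvl k c \<in> A} = (\<Union>r\<in>?R. {c \<in> ?V. lvl k c = r})"
    using lvl_residues by blast
  have fin: "finite ?R" using finite_res_vec by blast
  show "{c \<in> ?V. lvl k c \<in> A} \<in> sets ?M"
    unfolding eq using fin one(2) by (intro sets.finite_UN) auto
  have "measure ?M {c \<in> ?V. lvl k c \<in> A} = (\<Sum>r\<in>?R. measure ?M {c \<in> ?V. lvl k c = r})"
    unfolding eq using fin one(2)
    by (intro finite_measure_finite_Union) (auto simp: disjoint_family_on_def)
  also have "\<dots> = (\<Sum>r\<in>?R. 1 / real_of_int (int p ^ k) ^ CARD('m))"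
    by (intro sum.cong refl one(1)) simp
  also have "\<dots> = rdens (int p ^ k) A" by (simp add: rdens_def)
  finally show "measure ?M {c \<in> ?V. lvl k c \<in> A} = rdens (int p ^ k) A" .
qed

text \<open>The isotropic forms are the intersection of the decreasing sets of forms with a
  primitive zero modulo p^k.\<close>

theorem padic_isotropy_limit:
  assumes p: "prime p"
  shows "(\<lambda>k. rdens (int p ^ k) {c :: int ^ ('n::{finite,linorder}) uprod. zero_mod p k c})
      \<longlonglongrightarrow> padic_isotropy_prob TYPE('n) p"
    "decseq (\<lambda>k. rdens (int p ^ k) {c :: int ^ 'n uprod. zero_mod p k c})"
proof -
  have p0: "p > 0" using p by (simp add: prime_gt_0_nat)
  let ?V = "padic_space p :: ((nat \<Rightarrow> int) ^ ('n::_) uprod) set"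
  let ?M = "padic_haar p :: ((nat \<Rightarrow> int) ^ ('n::_) uprod) measure"
  define I where "I k = {c \<in> ?V. lvl k c \<in> {c. zero_mod p k c}}" for k
  interpret prob_space ?M using is_padic_haar_padic_haar[OF p0] unfolding is_padic_haar_def by blast
  have I: "I k \<in> sets ?M" "measure ?M (I k) = rdens (int p ^ k) {c :: int ^ ('n::_) uprod. zero_mod p k c}" for k
    unfolding I_def using padic_density[OF p0, of k "{c :: int ^ ('n::_) uprod. zero_mod p k c}"] by simp_all
  have dec: "decseq I"
    unfolding decseq_Suc_iff
  proof (intro allI subsetI)
    fix k c assume c: "c \<in> I (Suc k)"
    then have "zero_mod p k (lvl (Suc k) c)" unfolding I_def using zero_mod_mono[of p "Suc k" _ k] by auto
    then have "zero_mod p k (lvl k c)"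
      using zero_mod_cong[OF lvl_cong[of c p k "Suc k"]] c by (auto simp: I_def)
    then show "c \<in> I k" using c by (simp add: I_def)
  qed
  have "{c \<in> ?V. isotropic (padic_int p) c} = (\<Inter>k. I k)"
    using isotropic_padic_zero_mod[OF p] zero_mod_isotropic_padic[OF p] unfolding I_def by blast
  then have "(\<lambda>k. measure ?M (I k)) \<longlonglongrightarrow> padic_isotropy_prob TYPE('n) p"
    unfolding padic_isotropy_prob_def using finite_Lim_measure_decseq[of I] I(1) dec by auto
  then show "(\<lambda>k. rdens (int p ^ k) {c :: int ^ ('n::_) uprod. zero_mod p k c})
      \<longlonglongrightarrow> padic_isotropy_prob TYPE('n) p" unfolding I(2) .
  have "measure ?M (I n) \<le> measure ?M (I m)" if "m \<le> n" for m n
    using decseqD[OF dec that] I(1) by (intro finite_measure_mono) auto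
  then show "decseq (\<lambda>k. rdens (int p ^ k) {c :: int ^ ('n::_) uprod. zero_mod p k c})"
    unfolding I(2) by (simp add: decseq_def)
qed

lemma padic_isotropy_prob_bounds:
  assumes p: "prime p"
  shows "0 \<le> padic_isotropy_prob TYPE('n::{finite,linorder}) p" "padic_isotropy_prob TYPE('n) p \<le> 1"
proof -
  have p0: "p > 0" using p by (simp add: prime_gt_0_nat)
  interpret prob_space "padic_haar p :: ((nat \<Rightarrow> int) ^ ('n::_) uprod) measure"
    using is_padic_haar_padic_haar[OF p0] unfolding is_padic_haar_def by blast
  show "0 \<le> padic_isotropy_prob TYPE('n) p" "padic_isotropy_prob TYPE('n) p \<le> 1"
    unfolding padic_isotropy_prob_def by simp_all
qed

section \<open>Calculus of residue densities\<close>

lemma rdens_nonneg: "M > 0 \<Longrightarrow> 0 \<le> rdens M A" by (simp add: rdens_def)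

lemma rdens_mono: "M > 0 \<Longrightarrow> A \<subseteq> B \<Longrightarrow> rdens M A \<le> rdens M B"
  unfolding rdens_def using finite_res_vec[of M]
  by (intro divide_right_mono of_nat_mono card_mono) auto

lemma rdens_UNIV: "M > 0 \<Longrightarrow> rdens M (UNIV :: (int ^ 'm) set) = 1"
  by (simp add: rdens_def card_res_vec)

lemma rdens_Compl:
  fixes A :: "(int ^ 'm) set"
  assumes M: "M > 0"
  shows "rdens M (- A) = 1 - rdens M A"
proof -
  have "card (res_vec M \<inter> A \<union> res_vec M \<inter> - A) = card (res_vec M \<inter> A) + card (res_vec M \<inter> - A)"
    using finite_res_vec[of M, where 'm = 'm] by (intro card_Un_disjoint) auto
  moreover have "res_vec M \<inter> A \<union> res_vec M \<inter> - A = res_vec M" by blast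
  ultimately have "rdens M A + rdens M (- A) = rdens M (UNIV :: (int ^ 'm) set)"
    by (simp add: rdens_def add_divide_distrib[symmetric])
  then show ?thesis using rdens_UNIV[OF M, where 'm = 'm] by simp
qed

lemma qmod_residues: "M > 0 \<Longrightarrow> qmod M Q \<in> res_vec M"
  by (simp add: qmod_def res_vec_def)

lemma qmod_id: "Q \<in> res_vec M \<Longrightarrow> qmod M Q = Q"
  by (simp add: qmod_def res_vec_def vec_eq_iff)

lemma periodic_congD:
  assumes "periodic M A" "\<And>u. [c $ u = d $ u] (mod M)"
  shows "c \<in> A \<longleftrightarrow> d \<in> A"
proof -
  have "qmod M c = qmod M d" using assms(2) unfolding Cong.cong_def by (simp add: qmod_def vec_eq_iff)
  then show ?thesis using assms(1) unfolding periodic_def by metis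
qed

lemma periodicI:
  assumes "\<And>c d. (\<And>u. [c $ u = d $ u] (mod M)) \<Longrightarrow> c \<in> A \<Longrightarrow> d \<in> A"
  shows "periodic M A"
proof -
  have "c \<in> A \<longleftrightarrow> qmod M c \<in> A" for c
    using assms[of c "qmod M c"] assms[of "qmod M c" c] qmod_cong[of M c] cong_sym by blast
  then show ?thesis by (simp add: periodic_def)
qed

lemma periodic_Int: "periodic M A \<Longrightarrow> periodic M B \<Longrightarrow> periodic M (A \<inter> B)"
  by (auto simp: periodic_def)

lemma periodic_dvd:
  assumes "periodic M A" "M dvd N"
  shows "periodic N A"
proof (rule periodicI)
  fix c d assume "\<And>u. [c $ u = d $ u] (mod N)" "c \<in> A"
  then show "d \<in> A" using periodic_congD[OF assms(1), of c d] cong_dvd_modulus[OF _ assms(2)] by blast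
qed

lemma card_translate:
  assumes M: "M > 0" and A: "periodic M A"
  shows "card (res_vec M \<inter> {c. c + v \<in> A}) = card (res_vec M \<inter> A)"
proof (rule bij_betw_same_card)
  show "bij_betw (\<lambda>c. qmod M (c + v)) (res_vec M \<inter> {c. c + v \<in> A}) (res_vec M \<inter> A)"
  proof (rule bij_betw_byWitness[where f' = "\<lambda>c. qmod M (c - v)"])
    show "\<forall>c\<in>res_vec M \<inter> {c. c + v \<in> A}. qmod M (qmod M (c + v) - v) = c"
    proof
      fix c assume "c \<in> res_vec M \<inter> {c. c + v \<in> A}"
      then have "qmod M c = c" by (simp add: qmod_id)
      then show "qmod M (qmod M (c + v) - v) = c" by (simp add: qmod_def vec_eq_iff mod_simps)
    qed
    show "\<forall>c\<in>res_vec M \<inter> A. qmod M (qmod M (c - v) + v) = c"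
    proof
      fix c assume "c \<in> res_vec M \<inter> A"
      then have "qmod M c = c" by (simp add: qmod_id)
      then show "qmod M (qmod M (c - v) + v) = c" by (simp add: qmod_def vec_eq_iff mod_simps)
    qed
    show "(\<lambda>c. qmod M (c + v)) ` (res_vec M \<inter> {c. c + v \<in> A}) \<subseteq> res_vec M \<inter> A"
      using qmod_residues[OF M] A by (auto simp: periodic_def)
    show "(\<lambda>c. qmod M (c - v)) ` (res_vec M \<inter> A) \<subseteq> res_vec M \<inter> {c. c + v \<in> A}"
    proof (rule image_subsetI)
      fix c assume c: "c \<in> res_vec M \<inter> A"
      have "[(qmod M (c - v) + v) $ u = c $ u] (mod M)" for u
        by (simp add: qmod_def Cong.cong_def mod_add_left_eq)
      then have "qmod M (c - v) + v \<in> A" using periodic_congD[OF A] c by blast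
      then show "qmod M (c - v) \<in> res_vec M \<inter> {c. c + v \<in> A}" using qmod_residues[OF M, of "c - v"] by blast
    qed
  qed
qed

text \<open>Double counting of the pairs (c, v). A density can thus be estimated by counting along a
  fixed finite set V of translates, uniformly in the starting point c.\<close>

lemma sum_translates:
  assumes M: "M > 0" and A: "periodic M A" and V: "finite V"
  shows "(\<Sum>c\<in>res_vec M. card {v \<in> V. c + v \<in> A}) = card V * card (res_vec M \<inter> A)"
proof -
  have "(\<Sum>c\<in>res_vec M. card {v \<in> V. c + v \<in> A}) = (\<Sum>c\<in>res_vec M. \<Sum>v\<in>V. if c + v \<in> A then 1 else 0)"
    using V by (intro sum.cong refl) (simp add: sum.If_cases Int_def)
  also have "\<dots> = (\<Sum>v\<in>V. \<Sum>c\<in>res_vec M. if c + v \<in> A then 1 else 0)" by (rule sum.swap)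
  also have "\<dots> = (\<Sum>v\<in>V. card (res_vec M \<inter> {c. c + v \<in> A}))"
    by (intro sum.cong refl) (simp add: sum.If_cases finite_res_vec)
  also have "\<dots> = card V * card (res_vec M \<inter> A)" by (simp add: card_translate[OF M A])
  finally show ?thesis .
qed

lemma rdens_le_average:
  fixes A :: "(int ^ 'm) set"
  assumes M: "M > 0" and A: "periodic M A" and V: "finite V" and K: "\<And>c. card {v \<in> V. c + v \<in> A} \<le> K"
  shows "real (card V) * rdens M A \<le> real K"
proof -
  have "card V * card (res_vec M \<inter> A) \<le> (\<Sum>c\<in>(res_vec M :: (int ^ 'm) set). K)"
    unfolding sum_translates[OF M A V, symmetric] by (intro sum_mono K)
  then have "real (card V * card (res_vec M \<inter> A)) \<le> real (nat M ^ CARD('m) * K)"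
    unfolding of_nat_le_iff using M by (simp add: card_res_vec)
  then show ?thesis using M by (simp add: rdens_def pos_divide_le_eq mult.commute)
qed

lemma rdens_ge_average:
  assumes M: "M > 0" and A: "periodic M A" and V: "finite V" and K: "\<And>c. c \<in> G \<Longrightarrow> K \<le> card {v \<in> V. c + v \<in> A}"
  shows "real K * rdens M G \<le> real (card V) * rdens M A"
proof -
  have "(\<Sum>c\<in>res_vec M \<inter> G. K) \<le> (\<Sum>c\<in>res_vec M \<inter> G. card {v \<in> V. c + v \<in> A})"
    by (intro sum_mono K) simp
  also have "\<dots> \<le> (\<Sum>c\<in>res_vec M. card {v \<in> V. c + v \<in> A})"
    by (intro sum_mono2 finite_res_vec) auto
  finally have "K * card (res_vec M \<inter> G) \<le> card V * card (res_vec M \<inter> A)"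
    unfolding sum_translates[OF M A V] by (simp add: mult.commute)
  then have "real (K * card (res_vec M \<inter> G)) \<le> real (card V * card (res_vec M \<inter> A))"
    unfolding of_nat_le_iff .
  then show ?thesis using M by (simp add: rdens_def divide_right_mono)
qed

text \<open>Chinese remainder theorem: the pair of reductions is injective, hence bijective because
  the cardinalities agree.\<close>

lemma rdens_coprime:
  fixes A B :: "(int ^ 'm) set"
  assumes "coprime M N" "M > 0" "N > 0" "periodic M A" "periodic N B"
  shows "rdens (M * N) (A \<inter> B) = rdens M A * rdens N B"
proof -
  define h :: "int ^ 'm \<Rightarrow> _" where "h r = (qmod M r, qmod N r)" for r
  have MN: "M * N > 0" using assms by simp
  have inj: "inj_on h (res_vec (M * N))"
  proof (rule inj_onI)
    fix r s assume rs: "r \<in> res_vec (M * N)" "s \<in> res_vec (M * N)" "h r = h s"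
    have "[r $ u = s $ u] (mod M * N)" for u
      using rs(3) assms(1) by (intro coprime_cong_mult) (simp_all add: h_def qmod_def vec_eq_iff Cong.cong_def)
    then have "qmod (M * N) r = qmod (M * N) s" unfolding Cong.cong_def by (simp add: qmod_def vec_eq_iff)
    then show "r = s" using rs by (simp add: qmod_id)
  qed
  have sub: "h ` res_vec (M * N) \<subseteq> res_vec M \<times> res_vec N"
    using qmod_residues assms by (auto simp: h_def)
  have "card (h ` res_vec (M * N)) = card ((res_vec M :: (int ^ 'm) set) \<times> (res_vec N :: (int ^ 'm) set))"
    using assms(2,3) MN by (simp add: card_image[OF inj] card_cartesian_product card_res_vec nat_mult_distrib power_mult_distrib)
  then have surj: "h ` res_vec (M * N) = res_vec M \<times> res_vec N"
    using sub by (intro card_subset_eq) (auto intro: finite_res_vec)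
  have mem: "r \<in> A \<inter> B \<longleftrightarrow> h r \<in> A \<times> B" for r
    using assms(4,5) by (simp add: h_def periodic_def)
  have "h ` (res_vec (M * N) \<inter> (A \<inter> B)) = (res_vec M \<inter> A) \<times> (res_vec N \<inter> B)"
  proof (intro equalityI subsetI)
    fix y assume "y \<in> h ` (res_vec (M * N) \<inter> (A \<inter> B))"
    then obtain r where r: "r \<in> res_vec (M * N)" "r \<in> A \<inter> B" "y = h r" by blast
    have "y \<in> res_vec M \<times> res_vec N" using r(1,3) sub by blast
    moreover have "y \<in> A \<times> B" using r(2) mem[of r] unfolding r(3) by simp
    ultimately show "y \<in> (res_vec M \<inter> A) \<times> (res_vec N \<inter> B)" by auto
  next
    fix y assume y: "y \<in> (res_vec M \<inter> A) \<times> (res_vec N \<inter> B)"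
    then have "y \<in> h ` res_vec (M * N)" unfolding surj by auto
    then obtain r where r: "r \<in> res_vec (M * N)" "y = h r" by blast
    have "r \<in> A \<inter> B" using y mem[of r] r(2) by auto
    then show "y \<in> h ` (res_vec (M * N) \<inter> (A \<inter> B))" using r by blast
  qed
  moreover have "inj_on h (res_vec (M * N) \<inter> (A \<inter> B))" using inj by (rule inj_on_subset) blast
  ultimately have "card (res_vec (M * N) \<inter> (A \<inter> B)) = card ((res_vec M \<inter> A) \<times> (res_vec N \<inter> B))"
    by (metis card_image)
  then show ?thesis by (simp add: rdens_def card_cartesian_product power_mult_distrib)
qed

lemma rdens_prime_powers:
  fixes A :: "nat \<Rightarrow> (int ^ 'm) set"
  assumes "finite S" "\<And>p. p \<in> S \<Longrightarrow> prime p" "\<And>p. p \<in> S \<Longrightarrow> periodic (int p ^ k) (A p)"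
  shows "periodic (\<Prod>p\<in>S. int p ^ k) (\<Inter>p\<in>S. A p) \<and>
    rdens (\<Prod>p\<in>S. int p ^ k) (\<Inter>p\<in>S. A p) = (\<Prod>p\<in>S. rdens (int p ^ k) (A p))"
  using assms
proof (induction S)
  case empty
  show ?case by (simp add: periodic_def rdens_UNIV)
next
  case (insert p S)
  have p: "prime p" using insert by simp
  have IH: "periodic (\<Prod>p\<in>S. int p ^ k) (\<Inter>p\<in>S. A p)"
    "rdens (\<Prod>p\<in>S. int p ^ k) (\<Inter>p\<in>S. A p) = (\<Prod>p\<in>S. rdens (int p ^ k) (A p))"
    using insert by auto
  have cop: "coprime (int p ^ k) (\<Prod>p\<in>S. int p ^ k)"
  proof (intro prod_coprime_right)
    fix q assume "q \<in> S"
    then have "coprime p q" using insert by (intro primes_coprime) auto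
    then show "coprime (int p ^ k) (int q ^ k)" by simp
  qed
  have pos: "int p ^ k > 0" "(\<Prod>p\<in>S. int p ^ k) > 0"
    using p insert by (auto intro!: prod_pos simp: prime_gt_0_nat)
  have pp: "periodic (int p ^ k) (A p)" using insert by simp
  have "rdens (int p ^ k * (\<Prod>p\<in>S. int p ^ k)) (A p \<inter> (\<Inter>p\<in>S. A p)) = rdens (int p ^ k) (A p) * (\<Prod>p\<in>S. rdens (int p ^ k) (A p))"
    using rdens_coprime[OF cop pos pp IH(1)] IH(2) by simp
  moreover have "periodic (int p ^ k * (\<Prod>p\<in>S. int p ^ k)) (A p \<inter> (\<Inter>p\<in>S. A p))"
    by (intro periodic_Int periodic_dvd[OF pp] periodic_dvd[OF IH(1)]) auto
  ultimately show ?case using insert by simp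
qed

section \<open>Forms of highly divisible determinant\<close>

text \<open>Synthetic division at t0 lowers the degree, and the differences t - t0 are collected in
  K. As K depends on T alone, no d larger than |K| times the leading coefficient can divide all
  values, unless that coefficient is 0.\<close>

lemma roots_dvd:
  assumes "finite T" "card T = Suc n"
  shows "\<exists>K::int. K \<noteq> 0 \<and> (\<forall>f d. degree f \<le> n \<longrightarrow> (\<forall>t\<in>T. d dvd poly f t) \<longrightarrow> d dvd K * Polynomial.coeff f n)"
  using assms
proof (induction n arbitrary: T)
  case 0
  then obtain t where t: "T = {t}" by (auto simp: card_1_singleton_iff)
  have "\<forall>f d. degree f \<le> 0 \<longrightarrow> (\<forall>t\<in>T. d dvd poly f t) \<longrightarrow> d dvd 1 * Polynomial.coeff f 0"
  proof (intro allI impI)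
    fix f :: "int poly" and d assume f: "degree f \<le> 0" "\<forall>t\<in>T. d dvd poly f t"
    obtain a where "f = [:a:]" using f(1) degree_eq_zeroE by blast
    then show "d dvd 1 * Polynomial.coeff f 0" using f(2) t by simp
  qed
  then show ?case by (intro exI[of _ 1]) simp
next
  case (Suc n)
  then obtain t0 where t0: "t0 \<in> T" by (metis card_eq_0_iff ex_in_conv nat.distinct(1))
  have "card (T - {t0}) = Suc n" using Suc t0 by simp
  then obtain K where K: "K \<noteq> 0" "\<And>f d. degree f \<le> n \<Longrightarrow> (\<forall>t\<in>T - {t0}. d dvd poly f t) \<Longrightarrow> d dvd K * Polynomial.coeff f n"
    using Suc.IH[of "T - {t0}"] Suc.prems by auto
  define P where "P = (\<Prod>t\<in>T - {t0}. t - t0)"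
  have P: "P \<noteq> 0" using Suc.prems by (auto simp: P_def)
  have "d dvd (K * P) * Polynomial.coeff f (Suc n)" if f: "degree f \<le> Suc n" "\<forall>t\<in>T. d dvd poly f t" for f d
  proof -
    define g where "g = synthetic_div f t0"
    have fg: "f + Polynomial.smult t0 g = pCons (poly f t0) g" unfolding g_def by (rule synthetic_div_correct)
    have g: "degree g \<le> n" using f(1) by (simp add: g_def degree_synthetic_div)
    have "Polynomial.coeff f (Suc n) + t0 * Polynomial.coeff g (Suc n) = Polynomial.coeff g n"
      using arg_cong[OF fg, of "\<lambda>q. Polynomial.coeff q (Suc n)"] by simp
    then have cg: "Polynomial.coeff f (Suc n) = Polynomial.coeff g n" using g coeff_eq_0[of g "Suc n"] by simp
    have pf: "poly f t - poly f t0 = (t - t0) * poly g t" for t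
      using arg_cong[OF fg, of "\<lambda>q. poly q t"] by (simp add: algebra_simps)
    have "d dvd poly (Polynomial.smult P g) t" if t: "t \<in> T - {t0}" for t
    proof -
      have "d dvd (t - t0) * poly g t" unfolding pf[symmetric] using f(2) t t0 by (intro dvd_diff) auto
      moreover have "(t - t0) dvd P" unfolding P_def using Suc.prems t by (intro dvd_prodI) auto
      ultimately show ?thesis by simp (meson dvd_refl dvd_trans mult_dvd_mono)
    qed
    then have "d dvd K * Polynomial.coeff (Polynomial.smult P g) n" using g by (intro K(2)) auto
    then show ?thesis using cg by (simp add: mult.assoc)
  qed
  then show ?case using K(1) P by (intro exI[of _ "K * P"]) auto
qed

lemma prod_linear_poly:
  fixes a b :: "'i \<Rightarrow> 'a::comm_ring_1"
  assumes "finite S"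
  shows "degree (\<Prod>i\<in>S. [:a i, b i:]) \<le> card S \<and> Polynomial.coeff (\<Prod>i\<in>S. [:a i, b i:]) (card S) = (\<Prod>i\<in>S. b i)"
  using assms
proof induction
  case (insert i S)
  let ?q = "\<Prod>i\<in>S. [:a i, b i:]"
  have e: "[:a i, b i:] * ?q = Polynomial.smult (a i) ?q + pCons 0 (Polynomial.smult (b i) ?q)" by simp
  have "Polynomial.coeff ?q (Suc (card S)) = 0" using insert.IH by (intro coeff_eq_0) simp
  then have "Polynomial.coeff ([:a i, b i:] * ?q) (Suc (card S)) = b i * Polynomial.coeff ?q (card S)" unfolding e by simp
  moreover have "degree ([:a i, b i:] * ?q) \<le> Suc (card S)"
    unfolding e using insert.IH
    by (intro degree_add_le) (auto intro: order.trans[OF degree_smult_le] order.trans[OF degree_pCons_le])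
  ultimately show ?case using insert by simp
qed simp

definition idform :: "int ^ ('n::{finite,linorder}) uprod" where
  "idform = (\<chi> u. if (\<exists>i. u = Upair i i) then 1 else 0)"

lemma gram_idform: "gram (c + t *s idform) $ i $ j = gram c $ i $ j + t * (if i = j then 2 else 0)"
  by (auto simp: gram_def idform_def)

lemma det_poly:
  fixes c :: "int ^ ('n::{finite,linorder}) uprod"
  shows "\<exists>f. degree f \<le> CARD('n) \<and> Polynomial.coeff f (CARD('n)) = 2 ^ CARD('n) \<and> (\<forall>t. poly f t = det (gram (c + t *s idform)))"
proof -
  let ?U = "UNIV :: 'n set"
  define b where "b \<sigma> i = (if i = \<sigma> i then 2 else 0 :: int)" for \<sigma> :: "'n \<Rightarrow> 'n" and i
  define f where "f = (\<Sum>\<sigma> | \<sigma> permutes ?U. Polynomial.smult (of_int (sign \<sigma>)) (\<Prod>i\<in>?U. [:gram c $ i $ \<sigma> i, b \<sigma> i:]))"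
  have fin: "finite {\<sigma>. \<sigma> permutes ?U}" by (simp add: finite_permutations)
  have "degree f \<le> CARD('n)"
    unfolding f_def
  proof (intro degree_sum_le fin)
    fix \<sigma> :: "'n \<Rightarrow> 'n"
    show "degree (Polynomial.smult (of_int (sign \<sigma>)) (\<Prod>i\<in>?U. [:gram c $ i $ \<sigma> i, b \<sigma> i:])) \<le> CARD('n)"
      by (rule order.trans[OF degree_smult_le]) (simp add: prod_linear_poly)
  qed
  moreover have "Polynomial.coeff f (CARD('n)) = (\<Sum>\<sigma> | \<sigma> permutes ?U. of_int (sign \<sigma>) * (\<Prod>i\<in>?U. b \<sigma> i))"
    unfolding f_def coeff_sum
  proof (intro sum.cong refl)
    fix \<sigma> :: "'n \<Rightarrow> 'n"
    show "Polynomial.coeff (Polynomial.smult (of_int (sign \<sigma>)) (\<Prod>i\<in>?U. [:gram c $ i $ \<sigma> i, b \<sigma> i:])) (CARD('n)) = of_int (sign \<sigma>) * (\<Prod>i\<in>?U. b \<sigma> i)"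
      using prod_linear_poly[of ?U "\<lambda>i. gram c $ i $ \<sigma> i" "b \<sigma>"] by simp
  qed
  moreover have "\<dots> = (\<Sum>\<sigma> | \<sigma> permutes ?U. if \<sigma> = id then 2 ^ CARD('n) else 0)"
  proof (intro sum.cong refl)
    fix \<sigma> :: "'n \<Rightarrow> 'n"
    show "of_int (sign \<sigma>) * (\<Prod>i\<in>?U. b \<sigma> i) = (if \<sigma> = id then 2 ^ CARD('n) else 0)"
    proof (cases "\<sigma> = id")
      case True
      then show ?thesis by (simp add: b_def)
    next
      case False
      then obtain i where "\<sigma> i \<noteq> i" by (auto simp: fun_eq_iff)
          then have "b \<sigma> i = 0" by (simp add: b_def)
      then have "(\<Prod>i\<in>?U. b \<sigma> i) = 0" by (intro prod_zero bexI[of _ i]) simp_all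
      then show ?thesis using False by simp
    qed
  qed
  moreover have "\<dots> = 2 ^ CARD('n)"
    using fin by (simp add: sum.delta permutes_id)
  moreover have "poly f t = det (gram (c + t *s idform))" for t
    unfolding f_def det_def by (simp add: poly_sum poly_prod gram_idform b_def)
  ultimately show ?thesis by (intro exI[of _ f]) simp
qed

lemma det_dvd_cong:
  assumes "\<And>u. [c $ u = d $ u] (mod M)"
  shows "[det (gram c) = det (gram d)] (mod M)"
  unfolding det_def gram_def
  using assms by (intro cong_sum cong_mult cong_prod cong_refl) (auto intro: cong_mult)

text \<open>
  The polynomial \<open>det (gram (c + t *s idform))\<close> in \<open>t\<close> has degree \<open>n\<close> and leading coefficient \<open>2 ^ n\<close>, so
  for large \<open>j\<close> it cannot be divisible by \<open>p ^ j\<close> at more than \<open>n\<close> points of a fixed finite set.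
\<close>

lemma det_density:
  assumes p: "prime p" and e: "eps > 0"
  shows "\<exists>j. rdens (int p ^ j) {c :: int ^ ('n::{finite,linorder}) uprod. int p ^ j dvd det (gram c)} < eps"
proof -
  let ?n = "CARD('n)"
  obtain m where m: "real ?n < real m * eps" using reals_Archimedean3[OF e] by blast
  define V where "V = (\<lambda>t. int t *s (idform :: int ^ ('n::_) uprod)) ` {..<m}"
  have id0: "(idform :: int ^ ('n::_) uprod) $ Upair undefined undefined = 1" by (auto simp: idform_def)
  have inj: "inj (\<lambda>t. int t *s (idform :: int ^ ('n::_) uprod))"
  proof (rule injI)
    fix s t assume "int s *s (idform :: int ^ ('n::_) uprod) = int t *s idform"
    from arg_cong[OF this, of "\<lambda>x. x $ Upair undefined undefined"] show "s = t" using id0 by simp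
  qed
  have cardV: "card V = m" unfolding V_def using inj by (simp add: card_image inj_on_subset)
  define \<T> where "\<T> = {T \<in> Pow (int ` {..<m}). card T = Suc ?n}"
  have fT: "finite \<T>" by (simp add: \<T>_def)
  have "\<forall>T. \<exists>K::int. T \<in> \<T> \<longrightarrow> K \<noteq> 0 \<and> (\<forall>f d. degree f \<le> ?n \<longrightarrow> (\<forall>t\<in>T. d dvd poly f t) \<longrightarrow> d dvd K * Polynomial.coeff f ?n)"
  proof
    fix T
    show "\<exists>K::int. T \<in> \<T> \<longrightarrow> K \<noteq> 0 \<and> (\<forall>f d. degree f \<le> ?n \<longrightarrow> (\<forall>t\<in>T. d dvd poly f t) \<longrightarrow> d dvd K * Polynomial.coeff f ?n)"
    proof (cases "T \<in> \<T>")
      case True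
      then have "finite T" "card T = Suc ?n" by (auto simp: \<T>_def intro: finite_subset)
      then show ?thesis using roots_dvd by blast
    qed simp
  qed
  from choice[OF this] obtain K :: "int set \<Rightarrow> int" where K: "\<And>T. T \<in> \<T> \<Longrightarrow> K T \<noteq> 0"
    "\<And>T f d. T \<in> \<T> \<Longrightarrow> degree f \<le> ?n \<Longrightarrow> (\<forall>t\<in>T. d dvd poly f t) \<Longrightarrow> d dvd K T * Polynomial.coeff f ?n" by blast
  define B where "B = (\<Sum>T\<in>\<T>. \<bar>K T * 2 ^ ?n\<bar>)"
  have B0: "B \<ge> 0" by (simp add: B_def sum_nonneg)
  \<comment> \<open>Makes p^j larger than every nonzero number \<open>K T * 2 ^ n\<close> that it
    would have to divide.\<close>
  define j where "j = nat B"
  have pj: "B < int p ^ j"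
  proof -
    have "j < 2 ^ j" by simp
    also have "(2::nat) ^ j \<le> p ^ j" using prime_ge_2_nat[OF p] by (intro power_mono) auto
    finally show ?thesis using B0 unfolding j_def by (metis nat_0_le of_nat_less_iff of_nat_power)
  qed
  let ?A = "{c :: int ^ ('n::_) uprod. int p ^ j dvd det (gram c)}"
  have pos: "int p ^ j > 0" using p by (simp add: prime_gt_0_nat)
  have per: "periodic (int p ^ j) ?A"
  proof (rule periodicI)
    fix c d :: "int ^ ('n::_) uprod"
    assume "\<And>u. [c $ u = d $ u] (mod int p ^ j)" "c \<in> ?A"
    then show "d \<in> ?A" using cong_dvd_iff[OF det_dvd_cong, of c d "int p ^ j"] by simp
  qed
  have "card {v \<in> V. c + v \<in> ?A} \<le> ?n" for c
  proof (rule ccontr)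
    assume "\<not> card {v \<in> V. c + v \<in> ?A} \<le> ?n"
    define S where "S = {t \<in> {..<m}. int p ^ j dvd det (gram (c + int t *s idform))}"
    have "{v \<in> V. c + v \<in> ?A} = (\<lambda>t. int t *s idform) ` S" by (auto simp: V_def S_def)
    then have "card {v \<in> V. c + v \<in> ?A} = card S" using inj by (simp add: card_image inj_on_subset)
    then have "Suc ?n \<le> card (int ` S)" using \<open>\<not> _\<close> by (simp add: card_image)
    then obtain T where T: "T \<subseteq> int ` S" "card T = Suc ?n" by (meson obtain_subset_with_card_n)
    then have TT: "T \<in> \<T>" by (auto simp: \<T>_def S_def)
    obtain f where f: "degree f \<le> ?n" "Polynomial.coeff f ?n = 2 ^ ?n" "\<And>t. poly f t = det (gram (c + t *s idform))"
      using det_poly[of c] by blast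
    have "\<forall>t\<in>T. int p ^ j dvd poly f t" using T(1) by (auto simp: f(3) S_def)
    then have d: "int p ^ j dvd K T * 2 ^ ?n" using K(2)[OF TT f(1)] f(2) by simp
    have "\<bar>K T * 2 ^ ?n\<bar> \<le> B" unfolding B_def using TT fT by (intro member_le_sum) auto
    moreover have "K T * 2 ^ ?n \<noteq> 0" using K(1)[OF TT] by simp
    ultimately show False using dvd_imp_le_int[OF _ d] pj by simp
  qed
  from rdens_le_average[OF pos per _ this] have "real m * rdens (int p ^ j) ?A \<le> real ?n"
    using cardV by (simp add: V_def)
  then have "real m * rdens (int p ^ j) ?A < real m * eps" using m by linarith
  then show ?thesis by (intro exI[of _ j]) (simp add: mult_less_cancel_left)
qed

section \<open>Ternary subforms at odd primes\<close>

lemma square_inj: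
  assumes p: "prime p" and s: "0 \<le> s" "2 * s < int p" "0 \<le> t" "2 * t < int p" and d: "int p dvd s^2 - t^2"
  shows "s = t"
proof (rule ccontr)
  assume ne: "s \<noteq> t"
  have "s^2 - t^2 = (s - t) * (s + t)" by (simp add: power2_eq_square algebra_simps)
  then have "int p dvd s - t \<or> int p dvd s + t" using d p by (simp add: prime_dvd_mult_iff)
  then show False
  proof
    assume "int p dvd s - t"
    then have "int p \<le> \<bar>s - t\<bar>" using ne dvd_imp_le_int[of "s - t" "int p"] by simp
    then show False using s by linarith
  next
    assume "int p dvd s + t"
    moreover have "s + t \<noteq> 0" using ne s by linarith
    ultimately have "int p \<le> \<bar>s + t\<bar>" using dvd_imp_le_int[of "s + t" "int p"] by simp
    then show False using s by linarith
  qed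
qed

text \<open>Pigeonhole: the residues A x^2 and \<gamma> - y^2 take (p + 1) / 2 values each, too many
  to be disjoint.\<close>

lemma diagonal_represents:
  assumes p: "prime p" "p > 2" and A: "\<not> int p dvd A"
  shows "\<exists>x y. int p dvd A * x^2 + y^2 - \<gamma>"
proof -
  define h where "h = (int p - 1) div 2"
  have odd: "odd p" using p prime_odd_nat by blast
  then have h: "2 * h = int p - 1" by (simp add: h_def)
  define f where "f s = (A * s^2) mod int p" for s
  define g where "g s = (\<gamma> - s\<^sup>2) mod int p" for s
  have p0: "int p > 0" using p by simp
  have fi: "inj_on f {0..h}"
  proof (rule inj_onI)
    fix s t assume st: "s \<in> {0..h}" "t \<in> {0..h}" "f s = f t"
    have "int p dvd A * s^2 - A * t^2" using st(3) by (simp add: f_def mod_eq_dvd_iff)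
    then have "int p dvd A * (s^2 - t^2)" by (simp add: algebra_simps)
    then have "int p dvd s^2 - t^2" using A p by (simp add: prime_dvd_mult_iff)
    then show "s = t" using square_inj[OF p(1), of s t] st h by simp
  qed
  have gi: "inj_on g {0..h}"
  proof (rule inj_onI)
    fix s t assume st: "s \<in> {0..h}" "t \<in> {0..h}" "g s = g t"
    have "int p dvd (\<gamma> - t\<^sup>2) - (\<gamma> - s\<^sup>2)" using st(3) unfolding g_def mod_eq_dvd_iff[symmetric] by (rule sym)
    then have "int p dvd s^2 - t^2" by simp
    then show "s = t" using square_inj[OF p(1), of s t] st h by simp
  qed
  have "f ` {0..h} \<inter> g ` {0..h} \<noteq> {}"
  proof
    assume e: "f ` {0..h} \<inter> g ` {0..h} = {}"
    have "f ` {0..h} \<union> g ` {0..h} \<subseteq> {0..<int p}" using p0 by (auto simp: f_def g_def)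
    then have "card (f ` {0..h} \<union> g ` {0..h}) \<le> card {0..<int p}" by (intro card_mono) auto
    then have "nat (h + 1) + nat (h + 1) \<le> p"
      using e by (subst (asm) card_Un_disjoint) (simp_all add: card_image fi gi)
    then show False using h p by linarith
  qed
  then obtain s t where "f s = g t" by blast
  then have "int p dvd A * s^2 - (\<gamma> - t\<^sup>2)" by (simp add: f_def g_def mod_eq_dvd_iff)
  then show ?thesis by (intro exI[of _ s] exI[of _ t]) (simp add: algebra_simps)
qed

lemma matrix_axis: "((A :: int ^ 'n ^ 'n) *v axis i 1) $ k = A $ k $ i"
  by (simp add: matrix_vector_mult_def axis_def if_distrib[of "\<lambda>x. _ * x"] sum.delta cong: if_cong)

lemma qev_axis: "qev (c :: int ^ ('n::{finite,linorder}) uprod) (axis i 1) = c $ Upair i i"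
proof -
  have "bil c (axis i 1) (axis i 1) = 2 * c $ Upair i i"
    unfolding bil_axis matrix_axis by (simp add: gram_def)
  then show ?thesis using bil_self[of c "axis i 1"] by simp
qed

lemma bil_axis_axis: "i \<noteq> j \<Longrightarrow> bil (c :: int ^ ('n::{finite,linorder}) uprod) (axis i 1) (axis j 1) = c $ Upair i j"
  unfolding bil_axis matrix_axis gram_sym[of c j i] by (simp add: gram_def)

definition vec3 :: "'n \<Rightarrow> 'n \<Rightarrow> 'n \<Rightarrow> int \<Rightarrow> int \<Rightarrow> int \<Rightarrow> int ^ 'n" where
  "vec3 i j k x y z = x *s axis i 1 + y *s axis j 1 + z *s axis k 1"

definition disc2 :: "int ^ ('n::{finite,linorder}) uprod \<Rightarrow> 'n \<Rightarrow> 'n \<Rightarrow> int" where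
  "disc2 c i j = (c $ Upair i j)^2 - 4 * c $ Upair i i * c $ Upair j j"

text \<open>Half the Gram determinant of the ternary subform, arranged to show that it is linear in
  the coefficient of k with slope \<open>- disc2 c i j\<close>.\<close>

definition disc3 :: "int ^ ('n::{finite,linorder}) uprod \<Rightarrow> 'n \<Rightarrow> 'n \<Rightarrow> 'n \<Rightarrow> int" where
  "disc3 c i j k = c $ Upair i j * c $ Upair i k * c $ Upair j k - c $ Upair i i * (c $ Upair j k)^2
     - c $ Upair j j * (c $ Upair i k)^2 - c $ Upair k k * disc2 c i j"

lemma qev_vec3:
  fixes c :: "int ^ ('n::{finite,linorder}) uprod"
  assumes "i \<noteq> j" "i \<noteq> k" "j \<noteq> k"
  shows "qev c (vec3 i j k x y z) = c $ Upair i i * x^2 + c $ Upair j j * y^2 + c $ Upair k k * z^2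
     + c $ Upair i j * x * y + c $ Upair i k * x * z + c $ Upair j k * y * z"
  using assms
  by (simp add: vec3_def qev_add qev_scale qev_axis bil_add_left bil_add_right bil_scale_left bil_scale_right bil_axis_axis algebra_simps)

lemma qev_vec2:
  fixes c :: "int ^ ('n::{finite,linorder}) uprod"
  assumes "i \<noteq> j"
  shows "qev c (x *s axis i 1 + y *s axis j 1) = c $ Upair i i * x^2 + c $ Upair j j * y^2 + c $ Upair i j * x * y"
  using assms
  by (simp add: qev_add qev_scale qev_axis bil_scale_left bil_scale_right bil_axis_axis algebra_simps)

lemma vec3_nth:
  assumes "i \<noteq> j" "i \<noteq> k" "j \<noteq> k"
  shows "vec3 i j k x y z $ i = x" "vec3 i j k x y z $ j = y" "vec3 i j k x y z $ k = z"
  using assms by (simp_all add: vec3_def axis_def)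

text \<open>Completing the square twice, with denominators cleared.\<close>

lemma ternary_identity:
  fixes a b c d e f x y z :: int
  shows "4 * a * (4 * a * c - b^2) * (a * x^2 + c * y^2 + f * z^2 + b * x * y + d * x * z + e * y * z)
    = (4 * a * c - b^2) * (2 * a * x + b * y + d * z)^2 + ((4 * a * c - b^2) * y + (2 * a * e - b * d) * z)^2
      + 4 * a * (b * d * e - a * e^2 - c * d^2 - f * (b^2 - 4 * a * c)) * z^2"
  by (simp add: power2_eq_square algebra_simps)

text \<open>If p divides a or the binary discriminant, a zero is visible in two variables. Otherwise
  z = 1, the substitution of X and Y for x and y is invertible modulo p, and X, Y are provided by
  \<open>diagonal_represents\<close>.\<close>

lemma ternary_zero_mod:
  fixes a b c d e f :: int
  assumes p: "prime p" "p > 2"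
  shows "\<exists>x y z. (\<not> int p dvd x \<or> \<not> int p dvd y \<or> \<not> int p dvd z) \<and>
    int p dvd a * x^2 + c * y^2 + f * z^2 + b * x * y + d * x * z + e * y * z"
proof -
  have pi: "prime (int p)" using p by simp
  have p1: "\<not> int p dvd 1" using p by (simp add: zdvd_not_zless)
  have p2: "\<not> int p dvd 2" using p by (simp add: zdvd_not_zless)
  let ?m = "4 * a * c - b^2"
  consider "int p dvd a" | "\<not> int p dvd a" "int p dvd ?m" | "\<not> int p dvd a" "\<not> int p dvd ?m" by blast
  then show ?thesis
  proof cases
    case 1
    then show ?thesis using p1 by (intro exI[of _ 1] exI[of _ 0]) simp
  next
    case 2
    \<comment> \<open>The vector (b, -2 a) lies in the radical of the degenerate binary form modulo
      p.\<close>
    have "\<not> int p dvd - 2 * a" using 2 p2 pi by (simp add: prime_dvd_mult_iff)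
    moreover have "a * b^2 + c * (- 2 * a)^2 + b * b * (- 2 * a) = a * ?m"
      by (simp add: power2_eq_square algebra_simps)
    ultimately show ?thesis using 2 by (intro exI[of _ b] exI[of _ "- 2 * a"] exI[of _ 0]) simp
  next
    case 3
    let ?D = "b * d * e - a * e^2 - c * d^2 - f * (b^2 - 4 * a * c)"
    obtain X Y where XY: "int p dvd ?m * X^2 + Y^2 - (- 4 * a * ?D)"
      using diagonal_represents[OF p 3(2)] by blast
    have inv: "\<exists>t. int p dvd m * t - r" if "\<not> int p dvd m" for m r
    proof -
      have "coprime m (int p)" using prime_imp_coprime[OF pi that] by (simp add: coprime_commute)
      then obtain t where "[m * t = 1] (mod int p)" using cong_solve_coprime_int by blast
      then have "[m * t * r = 1 * r] (mod int p)" by (intro cong_scalar_right)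
      then have "int p dvd m * (t * r) - r" by (simp add: cong_iff_dvd_diff mult.assoc)
      then show ?thesis by blast
    qed
    obtain y where y: "int p dvd ?m * y - (Y - (2 * a * e - b * d))" using inv[OF 3(2)] by blast
    have "\<not> int p dvd 2 * a" using 3 p2 pi by (simp add: prime_dvd_mult_iff)
    then obtain x where x: "int p dvd 2 * a * x - (X - (b * y + d))" using inv by blast
    have cX: "[2 * a * x + b * y + d * 1 = X] (mod int p)" "[?m * y + (2 * a * e - b * d) * 1 = Y] (mod int p)"
      using x y by (simp_all add: cong_iff_dvd_diff algebra_simps)
    have "[?m * (2 * a * x + b * y + d * 1)^2 + (?m * y + (2 * a * e - b * d) * 1)^2 + 4 * a * ?D * 1\<^sup>2
      = ?m * X^2 + Y^2 + 4 * a * ?D * 1\<^sup>2] (mod int p)"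
      by (intro cong_add cong_mult cong_pow cong_refl cX)
    moreover have "int p dvd ?m * X^2 + Y^2 + 4 * a * ?D * 1\<^sup>2" using XY by (simp add: algebra_simps)
    ultimately have "int p dvd 4 * a * ?m * (a * x^2 + c * y^2 + f * 1\<^sup>2 + b * x * y + d * x * 1 + e * y * 1)"
      unfolding ternary_identity using cong_dvd_iff by blast
    moreover have "\<not> int p dvd 4" using p2 pi prime_dvd_mult_iff[of "int p" 2 2] by simp
    ultimately have "int p dvd a * x^2 + c * y^2 + f * 1\<^sup>2 + b * x * y + d * x * 1 + e * y * 1"
      using 3 pi by (simp add: prime_dvd_mult_iff)
    then show ?thesis using p1 by (intro exI[of _ x] exI[of _ y] exI[of _ 1]) simp
  qed
qed

text \<open>A zero of a ternary subform exists modulo p. It is nonsingular because the Gram matrix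
  of the subform is invertible modulo p, so it lifts.\<close>

lemma locsol_of_disc3:
  fixes c :: "int ^ ('n::{finite,linorder}) uprod"
  assumes p: "prime p" "p > 2" and ij: "i \<noteq> j" "i \<noteq> k" "j \<noteq> k" and D: "\<not> int p dvd disc3 c i j k"
  shows "locsol p c"
proof -
  have pi: "prime (int p)" using p by simp
  have p2: "\<not> int p dvd 2" using p by (simp add: zdvd_not_zless)
  define a where "a = c $ Upair i i"
  define b where "b = c $ Upair i j"
  define c' where "c' = c $ Upair j j"
  define d where "d = c $ Upair i k"
  define e where "e = c $ Upair j k"
  define f where "f = c $ Upair k k"
  note defs = a_def b_def c'_def d_def e_def f_def
  obtain x y z where xyz: "\<not> int p dvd x \<or> \<not> int p dvd y \<or> \<not> int p dvd z"
    "int p dvd a * x^2 + c' * y^2 + f * z^2 + b * x * y + d * x * z + e * y * z"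
    using ternary_zero_mod[OF p] by blast
  define v where "v = vec3 i j k x y z"
  have 1: "primitive p v" using xyz(1) vec3_nth[OF ij, of x y z] unfolding primitive_def v_def by metis
  have 2: "int p ^ (2 * 0 + 1) dvd qev c v"
    using xyz(2) by (simp add: v_def qev_vec3[OF ij] defs)
  define r where "r l = bil c v (axis l 1)" for l
  have self: "bil c (axis l 1) (axis l 1) = 2 * c $ Upair l l" for l
    by (simp add: bil_self qev_axis)
  have comm: "Upair j i = Upair i j" "Upair k i = Upair i k" "Upair k j = Upair j k" by auto
  have r: "r i = 2 * a * x + b * y + d * z" "r j = b * x + 2 * c' * y + e * z" "r k = d * x + e * y + 2 * f * z"
    using ij unfolding r_def v_def vec3_def bil_add_left bil_scale_left defs
    by (simp_all add: self bil_axis_axis comm)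
  let ?D = "b * d * e - a * e^2 - c' * d^2 - f * (b^2 - 4 * a * c')"
  have De: "disc3 c i j k = ?D" by (simp add: disc3_def disc2_def defs)
  \<comment> \<open>The rows of the adjugate of the ternary Gram matrix, whose determinant is twice
    \<open>disc3 c i j k\<close>.\<close>
  have adj: "2 * ?D * x = (4 * c' * f - e^2) * r i + (d * e - 2 * b * f) * r j + (b * e - 2 * c' * d) * r k"
    "2 * ?D * y = (d * e - 2 * b * f) * r i + (4 * a * f - d^2) * r j + (b * d - 2 * a * e) * r k"
    "2 * ?D * z = (b * e - 2 * c' * d) * r i + (b * d - 2 * a * e) * r j + (4 * a * c' - b\<^sup>2) * r k"
    unfolding r by (simp_all add: power2_eq_square algebra_simps)
  have "\<exists>l. \<not> int p dvd r l"
  proof (rule ccontr)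
    assume "\<nexists>l. \<not> int p dvd r l"
    then have rl: "int p dvd r l" for l by blast
    define \<Delta> where "\<Delta> = ?D"
    have "int p dvd 2 * \<Delta> * x" "int p dvd 2 * \<Delta> * y" "int p dvd 2 * \<Delta> * z"
      unfolding \<Delta>_def adj using rl by (intro dvd_add dvd_mult; simp)+
    then show False using xyz(1) D p2 pi unfolding De \<Delta>_def[symmetric] by (simp add: prime_dvd_mult_iff)
  qed
  then obtain l where "\<not> int p ^ (0 + 1) dvd bil c v (axis l 1)" by (auto simp: r_def)
  then show ?thesis by (rule locsol_of_smooth_zero[OF p(1) 1 2])
qed

section \<open>Forms in at most three variables\<close>

lemma affine_count:
  assumes M: "M > 0" and \<alpha>: "coprime \<alpha> (int M)" and S: "S \<subseteq> {0..<int M}"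
  shows "card S \<le> card {t \<in> {..<M}. (\<beta> + \<alpha> * int t) mod int M \<in> S}"
proof -
  obtain \<gamma> where \<gamma>: "[\<alpha> * \<gamma> = 1] (mod int M)" using cong_solve_coprime_int[OF \<alpha>] by blast
  define h where "h s = nat ((\<gamma> * (s - \<beta>)) mod int M)" for s
  have hs: "(\<beta> + \<alpha> * int (h s)) mod int M = s" if "s \<in> S" for s
  proof -
    have "int (h s) = (\<gamma> * (s - \<beta>)) mod int M" using M by (simp add: h_def)
    then have "[\<beta> + \<alpha> * int (h s) = \<beta> + \<alpha> * (\<gamma> * (s - \<beta>))] (mod int M)"
      by (intro cong_add cong_mult cong_refl) (simp add: Cong.cong_def)
    also have "\<beta> + \<alpha> * (\<gamma> * (s - \<beta>)) = \<beta> + (\<alpha> * \<gamma>) * (s - \<beta>)" by (simp add: mult.assoc)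
    also have "[\<dots> = \<beta> + 1 * (s - \<beta>)] (mod int M)" by (intro cong_add cong_mult cong_refl \<gamma>)
    finally show ?thesis using S that by (auto simp: Cong.cong_def)
  qed
  have "inj_on h S" using hs by (metis inj_onI)
  moreover have "h ` S \<subseteq> {t \<in> {..<M}. (\<beta> + \<alpha> * int t) mod int M \<in> S}"
    using hs M by (auto simp: h_def nat_less_iff)
  ultimately show ?thesis by (intro card_inj_on_le) auto
qed

text \<open>Conditioning on one coefficient: if from every point of G at least K of m consecutive
  steps in direction u land in A, then A has at least K / m of the density of G. Repeated use treats
  coefficients one after the other.\<close>

lemma rdens_axis_step:
  fixes A G :: "(int ^ 'm) set"
  assumes M: "M > 0" and A: "periodic M A" and m: "m > 0"
    and K: "\<And>c. c \<in> G \<Longrightarrow> K \<le> card {t \<in> {..<m}. c + int t *s axis u 1 \<in> A}"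
  shows "real K / real m * rdens M G \<le> rdens M A"
proof -
  define V where "V = (\<lambda>t. int t *s (axis u 1 :: int ^ 'm)) ` {..<m}"
  have inj: "inj (\<lambda>t. int t *s (axis u 1 :: int ^ 'm))"
  proof (rule injI)
    fix s t assume "int s *s (axis u 1 :: int ^ 'm) = int t *s axis u 1"
    from arg_cong[OF this, of "\<lambda>x. x $ u"] show "s = t" by (simp add: axis_def)
  qed
  have "card {v \<in> V. c + v \<in> A} = card {t \<in> {..<m}. c + int t *s axis u 1 \<in> A}" for c
  proof -
    have "{v \<in> V. c + v \<in> A} = (\<lambda>t. int t *s axis u 1) ` {t \<in> {..<m}. c + int t *s axis u 1 \<in> A}"
      by (auto simp: V_def)
    then show ?thesis using inj by (simp add: card_image inj_on_subset)
  qed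
  moreover have "card V = m" unfolding V_def using inj by (simp add: card_image inj_on_subset)
  moreover have "finite V" by (simp add: V_def)
  ultimately have "real K * rdens M G \<le> real m * rdens M A"
    using rdens_ge_average[OF M A, of V G K] K by simp
  then show ?thesis using m by (simp add: divide_le_eq mult.commute)
qed

lemma rdens_unit_ge:
  fixes u :: "'m::finite"
  assumes p: "prime p"
  shows "(real p - 1) / real p \<le> rdens (int p ^ 2) {c :: int ^ 'm. \<not> int p dvd c $ u}"
proof -
  have p0: "p > 0" using p by (simp add: prime_gt_0_nat)
  have p2: "int p ^ 2 > 0" using p0 by simp
  have "p - 1 \<le> card {t \<in> {..<p}. c + int t *s axis u 1 \<in> {c :: int ^ 'm. \<not> int p dvd c $ u}}" for c
  proof -
    have "card {1..<int p} \<le> card {t \<in> {..<p}. (c $ u + 1 * int t) mod int p \<in> {1..<int p}}"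
      using p0 by (intro affine_count) auto
    also have "\<dots> \<le> card {t \<in> {..<p}. c + int t *s axis u 1 \<in> {c :: int ^ 'm. \<not> int p dvd c $ u}}"
      by (intro card_mono) (auto simp: axis_def dvd_eq_mod_eq_0)
    finally show ?thesis by simp
  qed
  moreover have "periodic (int p ^ 2) {c :: int ^ 'm. \<not> int p dvd c $ u}"
  proof (rule periodicI)
    fix c d :: "int ^ 'm" assume cd: "\<And>u. [c $ u = d $ u] (mod int p ^ 2)" "c \<in> {c. \<not> int p dvd c $ u}"
    have "[c $ u = d $ u] (mod int p)" using cong_dvd_modulus[OF cd(1)] by simp
    then show "d \<in> {c. \<not> int p dvd c $ u}" using cd(2) cong_dvd_iff by blast
  qed
  ultimately have "real (p - 1) / real p * rdens (int p ^ 2) (UNIV :: (int ^ 'm) set) \<le> rdens (int p ^ 2) {c :: int ^ 'm. \<not> int p dvd c $ u}"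
    by (rule rdens_axis_step[OF p2 _ p0, rotated])
  then show ?thesis using p0 rdens_UNIV[OF p2, where 'm = 'm] by (simp add: of_nat_diff)
qed

text \<open>The residues a s^2 with 1 \<le> s \<le> (p - 1) / 2 are distinct nonresidues, and an
  affine map with unit slope permutes the residues.\<close>

lemma nonresidue_count:
  assumes p: "prime p" "p > 2" and \<alpha>: "\<not> int p dvd \<alpha>"
  shows "(p - 1) div 2 \<le> card {t \<in> {..<p}. Legendre (\<beta> + \<alpha> * int t) (int p) = -1}"
proof -
  obtain a where a: "\<not> int p dvd a" "Legendre a (int p) = -1" using exists_nonresidue[OF p] by blast
  have p0: "int p > 0" using p by simp
  define h where "h = (int p - 1) div 2"
  have odd: "odd p" using p prime_odd_nat by blast
  then have h: "2 * h = int p - 1" by (simp add: h_def)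
  define g where "g s = (a * s^2) mod int p" for s
  have inj: "inj_on g {1..h}"
  proof (rule inj_onI)
    fix s t assume st: "s \<in> {1..h}" "t \<in> {1..h}" "g s = g t"
    have "int p dvd a * s^2 - a * t^2" using st(3) by (simp add: g_def mod_eq_dvd_iff)
    then have "int p dvd a * (s^2 - t^2)" by (simp add: algebra_simps)
    then have "int p dvd s^2 - t^2" using a p by (simp add: prime_dvd_mult_iff)
    then show "s = t" using square_inj[OF p(1), of s t] st h by simp
  qed
  have L: "Legendre (g s) (int p) = -1" if "s \<in> {1..h}" for s
  proof -
    have s: "\<not> int p dvd s" using that h by (intro zdvd_not_zless) auto
    have "Legendre (g s) (int p) = Legendre (a * s^2) (int p)"
      by (intro Legendre_cong_mod) (simp add: g_def Cong.cong_def)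
    then show ?thesis using Legendre_mult[OF p, of a "s^2"] Legendre_square[OF p(1) s] a by simp
  qed
  have "int ((p - 1) div 2) = h" using p by (simp add: h_def zdiv_int of_nat_diff)
  then have "(p - 1) div 2 = card (g ` {1..h})" by (simp add: card_image[OF inj])
  also have "\<dots> \<le> card {t \<in> {..<p}. (\<beta> + \<alpha> * int t) mod int p \<in> g ` {1..h}}"
  proof (rule affine_count)
    show "coprime \<alpha> (int p)" using prime_imp_coprime[of "int p" \<alpha>] \<alpha> p by (simp add: coprime_commute)
  qed (use p0 in \<open>auto simp: g_def\<close>)
  also have "\<dots> \<le> card {t \<in> {..<p}. Legendre (\<beta> + \<alpha> * int t) (int p) = -1}"
  proof (intro card_mono subsetI)
    fix t assume t: "t \<in> {t \<in> {..<p}. (\<beta> + \<alpha> * int t) mod int p \<in> g ` {1..h}}"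
    have "Legendre (\<beta> + \<alpha> * int t) (int p) = Legendre ((\<beta> + \<alpha> * int t) mod int p) (int p)"
      by (intro Legendre_cong_mod) (simp add: Cong.cong_def)
    then show "t \<in> {t \<in> {..<p}. Legendre (\<beta> + \<alpha> * int t) (int p) = -1}" using t L by auto
  qed simp
  finally show ?thesis .
qed

lemma cong_p2:
  assumes "[a = b] (mod int p ^ 2)"
  shows "[a = b] (mod int p)"
  using cong_dvd_modulus[OF assms] by simp

lemma disc2_cong:
  assumes "\<And>u. [c $ u = d $ u] (mod M)"
  shows "[disc2 c i j = disc2 d i j] (mod M)"
  unfolding disc2_def by (intro cong_diff cong_mult cong_pow cong_refl assms)

lemma disc3_cong:
  assumes "\<And>u. [c $ u = d $ u] (mod M)"
  shows "[disc3 c i j k = disc3 d i j k] (mod M)"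
  unfolding disc3_def by (intro cong_diff cong_mult cong_pow cong_refl assms disc2_cong)

text \<open>The binary subform in i and j is anisotropic modulo p, a multiple of a norm form of the
  unramified quadratic extension.\<close>

definition nonsplit :: "nat \<Rightarrow> 'n \<Rightarrow> 'n \<Rightarrow> (int ^ ('n::{finite,linorder}) uprod) set" where
  "nonsplit p i j = {c. \<not> int p dvd c $ Upair i i \<and> Legendre (disc2 c i j) (int p) = -1}"

lemma periodic_nonsplit: "periodic (int p ^ 2) (nonsplit p i j)"
proof (rule periodicI)
  fix c d assume cd: "\<And>u. [c $ u = d $ u] (mod int p ^ 2)" "c \<in> nonsplit p i j"
  have cp: "[c $ u = d $ u] (mod int p)" for u by (rule cong_p2[OF cd(1)])
  have "Legendre (disc2 c i j) (int p) = Legendre (disc2 d i j) (int p)"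
    by (intro Legendre_cong_mod disc2_cong cp)
  then show "d \<in> nonsplit p i j" using cd(2) cong_dvd_iff[OF cp] by (auto simp: nonsplit_def)
qed

text \<open>The coefficient of i is a unit with density at least (p - 1) / p. Then
  \<open>disc2\<close> is affine in the coefficient of j with unit slope, hence a nonresidue at
  least (p - 1) / 2 times out of p. For p \<ge> 3 this gives 2/3 times 1/3.\<close>

lemma rdens_nonsplit_ge:
  assumes p: "prime p" "p > 2" and ij: "i \<noteq> (j :: 'n::{finite,linorder})"
  shows "2 / 9 \<le> rdens (int p ^ 2) (nonsplit p i j)"
proof -
  have p2: "int p ^ 2 > 0" and p0: "p > 0" using p by simp_all
  have pi: "prime (int p)" using p by simp
  let ?G = "{c :: int ^ 'n uprod. \<not> int p dvd c $ Upair i i}"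
  have "(p - 1) div 2 \<le> card {t \<in> {..<p}. c + int t *s axis (Upair j j) 1 \<in> nonsplit p i j}" if c: "c \<in> ?G" for c
  proof -
    have "\<not> int p dvd 2" using p by (simp add: zdvd_not_zless)
    then have "\<not> int p dvd 4" using prime_dvd_mult_iff[of "int p" 2 2] pi by simp
    then have u: "\<not> int p dvd - 4 * c $ Upair i i" using c pi by (simp add: prime_dvd_mult_iff)
    have "{t \<in> {..<p}. c + int t *s axis (Upair j j) 1 \<in> nonsplit p i j} =
      {t \<in> {..<p}. Legendre (disc2 c i j + (- 4 * c $ Upair i i) * int t) (int p) = -1}"
      using c ij by (auto simp: nonsplit_def disc2_def axis_def algebra_simps)
    then show ?thesis using nonresidue_count[OF p u] by simp
  qed
  then have 1: "real ((p - 1) div 2) / real p * rdens (int p ^ 2) ?G \<le> rdens (int p ^ 2) (nonsplit p i j)"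
    by (rule rdens_axis_step[OF p2 periodic_nonsplit p0])
  have p3: "real p \<ge> 3" using p by simp
  have "odd p" using p prime_odd_nat by blast
  then have h: "real ((p - 1) div 2) / real p = ((real p - 1) / real p) / 2"
    using p by (simp add: real_of_nat_div of_nat_diff)
  have q: "2 / 3 \<le> (real p - 1) / real p" using p3 by (simp add: field_simps)
  have "2 / 3 \<le> rdens (int p ^ 2) ?G" using q rdens_unit_ge[OF p(1), of "Upair i i"] by linarith
  moreover have "1 / 3 \<le> real ((p - 1) div 2) / real p" unfolding h using p3 by (simp add: field_simps)
  ultimately have "(1 / 3) * (2 / 3) \<le> real ((p - 1) div 2) / real p * rdens (int p ^ 2) ?G"
    by (intro mult_mono) auto
  then show ?thesis using 1 by linarith
qed

text \<open>For a fixed nonsplit plane \<open>disc3\<close> is affine in the coefficient of k with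
  unit slope, so it runs through all classes modulo p^2, and p - 1 of them have valuation exactly 1.
  The constant is 2/9 times 2/3.\<close>

lemma rdens_ramified_ge:
  assumes p: "prime p" "p > 2" and ij: "i \<noteq> j" "i \<noteq> k" "j \<noteq> (k :: 'n::{finite,linorder})"
  shows "4 / (27 * real p) \<le> rdens (int p ^ 2)
    {c \<in> nonsplit p i j. int p dvd disc3 c i j k \<and> \<not> int p ^ 2 dvd disc3 c i j k}" (is "_ \<le> rdens _ ?A")
proof -
  have p2: "int p ^ 2 > 0" and p0: "p > 0" and pp: "p ^ 2 > 0" using p by simp_all
  have pi: "prime (int p)" using p by simp
  have "p - 1 \<le> card {t \<in> {..<p ^ 2}. c + int t *s axis (Upair k k) 1 \<in> ?A}" if c: "c \<in> nonsplit p i j" for c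
  proof -
    have "\<not> int p dvd disc2 c i j" using c by (auto simp: nonsplit_def Legendre_def cong_0_iff split: if_splits)
    then have u: "coprime (- disc2 c i j) (int (p ^ 2))"
      using pi by (simp add: coprime_commute prime_imp_coprime)
    define S where "S = (\<lambda>w. int p * w) ` {1..<int p}"
    have "inj_on (\<lambda>w. int p * w) {1..<int p}" using p0 by (auto intro: inj_onI)
    then have cS: "card S = p - 1" by (simp add: S_def card_image)
    have SM: "S \<subseteq> {0..<int (p ^ 2)}" using p0 by (auto simp: S_def power2_eq_square)
    have "card S \<le> card {t \<in> {..<p ^ 2}. (disc3 c i j k + (- disc2 c i j) * int t) mod int (p ^ 2) \<in> S}"
      by (rule affine_count[OF pp u SM])
    also have "\<dots> \<le> card {t \<in> {..<p ^ 2}. c + int t *s axis (Upair k k) 1 \<in> ?A}"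
    proof (intro card_mono subsetI)
      fix t assume "t \<in> {t \<in> {..<p ^ 2}. (disc3 c i j k + (- disc2 c i j) * int t) mod int (p ^ 2) \<in> S}"
      then obtain w where t: "t < p ^ 2" and w: "1 \<le> w" "w < int p"
        "(disc3 c i j k + (- disc2 c i j) * int t) mod int (p ^ 2) = int p * w" by (auto simp: S_def)
      define d where "d = c + int t *s axis (Upair k k) 1"
      have d2: "disc2 d i j = disc2 c i j" using ij by (simp add: d_def disc2_def axis_def)
      have d3: "disc3 d i j k = disc3 c i j k + (- disc2 c i j) * int t"
        unfolding disc3_def d2 using ij by (simp add: d_def axis_def algebra_simps)
      have w': "\<not> int p dvd w" using w by (intro zdvd_not_zless) auto
      have m: "[disc3 d i j k = int p * w] (mod int p ^ 2)"
        unfolding d3 using w(3) by (metis cong_mod_left cong_refl of_nat_power)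
      have "int p dvd disc3 d i j k" using cong_dvd_iff[OF cong_p2[OF m]] by simp
      moreover have "\<not> int p ^ 2 dvd disc3 d i j k"
        unfolding cong_dvd_iff[OF m] using w' p0 by (simp add: power2_eq_square)
      moreover have "d \<in> nonsplit p i j"
        using c ij d2 by (simp add: nonsplit_def) (simp add: d_def axis_def)
      ultimately show "t \<in> {t \<in> {..<p ^ 2}. c + int t *s axis (Upair k k) 1 \<in> ?A}" using t by (simp add: d_def)
    qed simp
    finally show ?thesis using cS by simp
  qed
  moreover have "periodic (int p ^ 2) ?A"
  proof (rule periodicI)
    fix c d assume cd: "\<And>u. [c $ u = d $ u] (mod int p ^ 2)" "c \<in> ?A"
    have m: "[disc3 c i j k = disc3 d i j k] (mod int p ^ 2)" by (rule disc3_cong[OF cd(1)])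
    have "d \<in> nonsplit p i j" using periodic_congD[OF periodic_nonsplit cd(1)] cd(2) by simp
    then show "d \<in> ?A" using cd(2) cong_dvd_iff[OF m] cong_dvd_iff[OF cong_p2[OF m]] by simp
  qed
  ultimately have 1: "real (p - 1) / real (p ^ 2) * rdens (int p ^ 2) (nonsplit p i j) \<le> rdens (int p ^ 2) ?A"
    by (rule rdens_axis_step[OF p2 _ pp, rotated])
  have p3: "real p \<ge> 3" using p by simp
  have "2 / (3 * real p) \<le> real (p - 1) / real (p ^ 2)"
    using p3 p0 by (simp add: of_nat_diff divide_simps power2_eq_square)
  then have "2 / (3 * real p) * (2 / 9) \<le> real (p - 1) / real (p ^ 2) * rdens (int p ^ 2) (nonsplit p i j)"
    using rdens_nonsplit_ge[OF p ij(1)] by (intro mult_mono) auto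
  then show ?thesis using 1 by simp
qed

lemma nonsplit_anisotropic:
  assumes p: "prime p" "p > 2" and D: "Legendre D (int p) = -1" and d: "int p dvd y^2 - D * x^2"
  shows "int p dvd x" "int p dvd y"
proof -
  have nD: "\<not> int p dvd D" using D by (auto simp: Legendre_def cong_0_iff split: if_splits)
  show x: "int p dvd x"
  proof (rule ccontr)
    assume "\<not> int p dvd x"
    then have "Legendre D (int p) = 1"
      using Legendre_eq_1I[OF p nD, of x y] d by (simp add: cong_iff_dvd_diff)
    then show False using D by simp
  qed
  have "int p dvd D * x^2" using x by (simp add: power2_eq_square)
  then have "int p dvd (y^2 - D * x^2) + D * x^2" using d by (rule dvd_add[rotated])
  then have "int p dvd y^2" by simp
  then show "int p dvd y" using p by (meson prime_dvd_power prime_int_nat_transfer prime_nat_int_transfer)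
qed

text \<open>After completing squares, the nonsplit part forces X and Y to vanish modulo p, so its
  value is divisible by p^2. The last term has a coefficient of valuation 1, which then forces p to
  divide z, and back substitution gives y and x.\<close>

lemma anisotropic_3:
  assumes p: "prime p" "p > 2" and U: "UNIV = {i, j, k :: 'n::{finite,linorder}}" and ij: "i \<noteq> j" "i \<noteq> k" "j \<noteq> k"
    and c: "c \<in> nonsplit p i j" "int p dvd disc3 c i j k" "\<not> int p ^ 2 dvd disc3 c i j k"
  shows "\<not> zero_mod p 2 c"
proof
  assume "zero_mod p 2 c"
  then obtain v where v: "primitive p v" "int p ^ 2 dvd qev c v" by (auto simp: zero_mod_def)
  have pi: "prime (int p)" using p by simp
  define x where "x = v $ i"
  define y where "y = v $ j"
  define z where "z = v $ k"
  have "v = vec3 i j k x y z"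
    unfolding vec_eq_iff
  proof
    fix l
    have "l \<in> {i, j, k}" using U by blast
    then show "v $ l = vec3 i j k x y z $ l" using vec3_nth[OF ij] by (auto simp: x_def y_def z_def)
  qed
  then have Q: "int p ^ 2 dvd qev c (vec3 i j k x y z)" using v(2) by simp
  define a where "a = c $ Upair i i"
  define b where "b = c $ Upair i j"
  define c' where "c' = c $ Upair j j"
  define d where "d = c $ Upair i k"
  define e where "e = c $ Upair j k"
  define f where "f = c $ Upair k k"
  note defs = a_def b_def c'_def d_def e_def f_def
  let ?D = "b * d * e - a * e^2 - c' * d^2 - f * (b^2 - 4 * a * c')"
  let ?m = "4 * a * c' - b\<^sup>2"
  have De: "disc3 c i j k = ?D" "disc2 c i j = - ?m" by (simp_all add: disc3_def disc2_def defs)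
  have L: "Legendre (- ?m) (int p) = -1" and a: "\<not> int p dvd a" using c(1) De by (auto simp: nonsplit_def defs)
  have "\<not> int p dvd - ?m" using L by (auto simp: Legendre_def cong_0_iff split: if_splits)
  then have nm: "\<not> int p dvd ?m" unfolding dvd_minus_iff .
  define X where "X = 2 * a * x + b * y + d * z"
  define Y where "Y = ?m * y + (2 * a * e - b * d) * z"
  have S: "int p ^ 2 dvd ?m * X^2 + Y^2 + 4 * a * ?D * z^2"
    using Q unfolding X_def Y_def ternary_identity[symmetric] qev_vec3[OF ij] defs[symmetric] by simp
  have "int p dvd int p ^ 2" by simp
  then have "int p dvd ?m * X^2 + Y^2 + 4 * a * ?D * z^2" using S dvd_trans by blast
  moreover have "int p dvd 4 * a * ?D * z^2" using c(2) unfolding De by simp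
  ultimately have "int p dvd ?m * X^2 + Y^2" by (simp add: dvd_add_left_iff)
  then have "int p dvd Y^2 - (- ?m) * X^2" by (simp add: algebra_simps)
  then have XY: "int p dvd X" "int p dvd Y" using nonsplit_anisotropic[OF p L] by blast+
  have "int p ^ 2 dvd ?m * X^2 + Y^2" using XY by (intro dvd_add dvd_mult dvd_power_same)
  then have "int p ^ 2 dvd 4 * a * ?D * z^2" using S by (simp add: dvd_add_right_iff)
  moreover obtain D' where D': "?D = int p * D'" using c(2) unfolding De dvd_def by blast
  ultimately have "int p * int p dvd int p * (4 * a * D' * z^2)" unfolding D' by (simp add: power2_eq_square ac_simps)
  then have "int p dvd 4 * a * D' * z^2" using p by simp
  moreover have "\<not> int p dvd D'" using c(3) p unfolding De D' by (simp add: power2_eq_square)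
  moreover have p2: "\<not> int p dvd 2" using p by (simp add: zdvd_not_zless)
  moreover have "\<not> int p dvd 4" using p2 pi prime_dvd_mult_iff[of "int p" 2 2] by simp
  ultimately have z: "int p dvd z" using a pi by (auto simp: prime_dvd_mult_iff prime_dvd_power_iff)
  then have "int p dvd ?m * y" using XY(2) unfolding Y_def by (simp add: dvd_add_left_iff)
  then have y: "int p dvd y" using nm pi by (simp add: prime_dvd_mult_iff)
  have "int p dvd 2 * a * x" using XY(1) z y unfolding X_def by (simp add: dvd_add_left_iff)
  then have x: "int p dvd x" using a p2 pi by (simp add: prime_dvd_mult_iff)
  have "int p dvd v $ l" for l
  proof -
    have "l \<in> {i, j, k}" using U by blast
    then show ?thesis using x y z by (auto simp: x_def y_def z_def)
  qed
  then show False using v(1) by (simp add: primitive_def)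
qed

lemma anisotropic_2:
  assumes p: "prime p" "p > 2" and U: "UNIV = {i, j :: 'n::{finite,linorder}}" and ij: "i \<noteq> j"
    and c: "c \<in> nonsplit p i j"
  shows "\<not> zero_mod p 2 c"
proof
  assume "zero_mod p 2 c"
  then obtain v where v: "primitive p v" "int p ^ 2 dvd qev c v" by (auto simp: zero_mod_def)
  have pi: "prime (int p)" using p by simp
  define x where "x = v $ i"
  define y where "y = v $ j"
  have "v = x *s axis i 1 + y *s axis j 1"
    unfolding vec_eq_iff
  proof
    fix l
    have "l \<in> {i, j}" using U by blast
    then show "v $ l = (x *s axis i 1 + y *s axis j 1) $ l" using ij by (auto simp: x_def y_def axis_def)
  qed
  moreover have "int p dvd int p ^ 2" by simp
  ultimately have Q: "int p dvd qev c (x *s axis i 1 + y *s axis j 1)" using v(2) dvd_trans by metis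
  define a where "a = c $ Upair i i"
  define b where "b = c $ Upair i j"
  define c' where "c' = c $ Upair j j"
  note defs = a_def b_def c'_def
  have L: "Legendre (b^2 - 4 * a * c') (int p) = -1" and a: "\<not> int p dvd a" using c by (auto simp: nonsplit_def disc2_def defs)
  have "int p dvd 4 * a * (a * x^2 + c' * y^2 + b * x * y)"
    using Q unfolding qev_vec2[OF ij] defs by (rule dvd_mult)
  also have "4 * a * (a * x^2 + c' * y^2 + b * x * y) = (2 * a * x + b * y)^2 - (b^2 - 4 * a * c') * y^2"
    by (simp add: power2_eq_square algebra_simps)
  finally have XY: "int p dvd y" "int p dvd 2 * a * x + b * y" using nonsplit_anisotropic[OF p L] by blast+
  moreover have "\<not> int p dvd 2" using p by (simp add: zdvd_not_zless)
  ultimately have x: "int p dvd x" using a pi by (simp add: dvd_add_left_iff prime_dvd_mult_iff)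
  have "int p dvd v $ l" for l
  proof -
    have "l \<in> {i, j}" using U by blast
    then show ?thesis using x XY(1) by (auto simp: x_def y_def)
  qed
  then show False using v(1) by (simp add: primitive_def)
qed

lemma anisotropic_1:
  assumes p: "prime p" and U: "UNIV = {i :: 'n::{finite,linorder}}"
    and c: "\<not> int p dvd c $ Upair i i"
  shows "\<not> zero_mod p 2 c"
proof
  assume "zero_mod p 2 c"
  then obtain v where v: "primitive p v" "int p ^ 2 dvd qev c v" by (auto simp: zero_mod_def)
  have pi: "prime (int p)" using p by simp
  have v1: "v = v $ i *s axis i 1" using U by (auto simp: vec_eq_iff axis_def)
  have "int p dvd int p ^ 2" by simp
  then have "int p dvd qev c (v $ i *s axis i 1)" using v(2) v1 dvd_trans by metis
  then have "int p dvd v $ i" using c pi unfolding qev_scale qev_axis by (simp add: prime_dvd_mult_iff prime_dvd_power_iff)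
  then have "int p dvd v $ l" for l using U by (metis UNIV_I singletonD)
  then show False using v(1) by (simp add: primitive_def)
qed

lemma anisotropic_density:
  assumes p: "prime p" "p > 2" and n: "CARD('n::{finite,linorder}) \<le> 3"
  shows "4 / (27 * real p) \<le> 1 - rdens (int p ^ 2) {c :: int ^ 'n uprod. zero_mod p 2 c}"
proof -
  have p2: "int p ^ 2 > 0" and p0: "p > 0" using p by simp_all
  have p3: "real p \<ge> 3" using p by simp
  have le: "4 / (27 * real p) \<le> 2 / 9" "4 / (27 * real p) \<le> 2 / 3" using p3 by (simp_all add: divide_simps)
  have q: "2 / 3 \<le> (real p - 1) / real p" using p3 by (simp add: field_simps)
  have fin: "4 / (27 * real p) \<le> 1 - rdens (int p ^ 2) {c :: int ^ 'n uprod. zero_mod p 2 c}"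
    if "4 / (27 * real p) \<le> rdens (int p ^ 2) A" "\<And>c. c \<in> A \<Longrightarrow> \<not> zero_mod p 2 c" for A :: "(int ^ 'n uprod) set"
  proof -
    have "rdens (int p ^ 2) A \<le> rdens (int p ^ 2) (- {c :: int ^ 'n uprod. zero_mod p 2 c})"
      using that(2) by (intro rdens_mono[OF p2]) auto
    then show ?thesis using that(1) rdens_Compl[OF p2, of "{c :: int ^ 'n uprod. zero_mod p 2 c}"] by linarith
  qed
  have "CARD('n) \<noteq> 0" by simp
  then consider "CARD('n) = 1" | "CARD('n) = 2" | "CARD('n) = 3" using n by linarith
  then show ?thesis
  proof cases
    case 1
    then obtain i :: 'n where U: "UNIV = {i}" by (auto simp: card_1_singleton_iff)
    have "2 / 3 \<le> rdens (int p ^ 2) {c :: int ^ 'n uprod. \<not> int p dvd c $ Upair i i}"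
      using rdens_unit_ge[OF p(1), of "Upair i i"] q by linarith
    then show ?thesis using fin anisotropic_1[OF p(1) U] le(2) by (metis (mono_tags, lifting) mem_Collect_eq order_trans)
  next
    case 2
    then obtain i j :: 'n where U: "UNIV = {i, j}" "i \<noteq> j" by (auto simp: card_2_iff)
    show ?thesis using fin[OF order.trans[OF le(1) rdens_nonsplit_ge[OF p U(2)]]] anisotropic_2[OF p U] by blast
  next
    case 3
    then obtain i j k :: 'n where U: "UNIV = {i, j, k}" "i \<noteq> j" "i \<noteq> k" "j \<noteq> k" by (auto simp: card_3_iff)
    show ?thesis using fin[OF rdens_ramified_ge[OF p U(2-4)]] anisotropic_3[OF p U] by blast
  qed
qed

section \<open>Counting integral forms in boxes\<close>

text \<open>Setting the coordinates in W to 0 stands for forgetting them, so projections of a box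
  stay in the same type.\<close>

definition box_zero :: "nat \<Rightarrow> 'm set \<Rightarrow> (int ^ 'm) set" where
  "box_zero Y W = {Q. (\<forall>u. \<bar>Q $ u\<bar> \<le> int Y) \<and> (\<forall>w\<in>W. Q $ w = 0)}"

definition vset :: "int ^ 'm \<Rightarrow> 'm \<Rightarrow> int \<Rightarrow> int ^ 'm" where
  "vset Q u t = (\<chi> w. if w = u then t else Q $ w)"

lemma vset_nth [simp]: "vset Q u t $ w = (if w = u then t else Q $ w)" by (simp add: vset_def)

lemma box_zero_card:
  fixes W :: "'m::finite set"
  shows "finite (box_zero Y W)" "card (box_zero Y W) = (2 * Y + 1) ^ (CARD('m) - card W)"
proof -
  let ?F = "\<lambda>w. if w \<in> W then {0} else {- int Y..int Y}"
  have bij: "bij_betw (\<lambda>Q. \<lambda>u. Q $ u) (box_zero Y W) (Pi\<^sub>E UNIV ?F)"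
    by (rule bij_betw_byWitness[where f' = "\<lambda>f. \<chi> u. f u"])
      (auto simp: box_zero_def PiE_iff extensional_def abs_le_iff minus_le_iff split: if_splits, (smt (verit) of_nat_0_le_iff)+)
  have "finite (Pi\<^sub>E UNIV ?F)" by (intro finite_PiE) auto
  then show "finite (box_zero Y W)" using bij_betw_finite[OF bij] by simp
  have "card (box_zero Y W) = card (Pi\<^sub>E UNIV ?F)" using bij by (rule bij_betw_same_card)
  also have "\<dots> = (\<Prod>w\<in>UNIV. if w \<in> W then 1 else 2 * Y + 1)"
    by (subst card_PiE) (auto intro!: prod.cong)
  also have "\<dots> = (2 * Y + 1) ^ card (- W)"
    by (simp add: prod.If_cases Compl_eq_Diff_UNIV)
  also have "card (- W) = CARD('m) - card W" by (simp add: Compl_eq_Diff_UNIV card_Diff_subset)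
  finally show "card (box_zero Y W) = (2 * Y + 1) ^ (CARD('m) - card W)" .
qed

definition tcard :: "nat \<Rightarrow> (int \<Rightarrow> bool) \<Rightarrow> nat" where
  "tcard Y P = card {t. - int Y \<le> t \<and> t \<le> int Y \<and> P t}"

lemma tcard_finite [simp]: "finite {t. - int Y \<le> t \<and> t \<le> int Y \<and> P t}"
  by (rule finite_subset[of _ "{- int Y..int Y}"]) auto

lemma tcard_mono: "(\<And>t. P t \<Longrightarrow> Q t) \<Longrightarrow> tcard Y P \<le> tcard Y Q"
  unfolding tcard_def by (intro card_mono) auto

text \<open>Counts along the fibres of the map that forgets coordinate u; \<open>P'\<close> is what
  \<open>P\<close> says about the other coordinates, and K bounds each fibre.\<close>

lemma box_step:
  assumes u: "u \<notin> W"
    and P: "\<And>Q. Q \<in> box_zero Y W \<Longrightarrow> P Q \<Longrightarrow> P' (vset Q u 0)"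
    and K: "\<And>q. q \<in> box_zero Y (insert u W) \<Longrightarrow> P' q \<Longrightarrow> tcard Y (\<lambda>t. P (vset q u t)) \<le> K"
  shows "card {Q \<in> box_zero Y W. P Q} \<le> K * card {q \<in> box_zero Y (insert u W). P' q}"
proof -
  let ?A = "{Q \<in> box_zero Y W. P Q}" and ?G = "{q \<in> box_zero Y (insert u W). P' q}"
  let ?T = "\<lambda>q. {t. - int Y \<le> t \<and> t \<le> int Y \<and> P (vset q u t)}"
  have "?A \<subseteq> (\<Union>q\<in>?G. vset q u ` ?T q)"
  proof
    fix Q assume Q: "Q \<in> ?A"
    have b: "\<bar>Q $ w\<bar> \<le> int Y" for w using Q by (simp add: box_zero_def)
    have 1: "vset Q u 0 \<in> ?G" using Q P[of Q] by (auto simp: box_zero_def)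
    have 2: "vset (vset Q u 0) u (Q $ u) = Q" by (simp add: vec_eq_iff)
    have "Q $ u \<in> ?T (vset Q u 0)" using Q 2 b[of u] by (auto simp: abs_le_iff)
    then have "Q \<in> vset (vset Q u 0) u ` ?T (vset Q u 0)" by (rule image_eqI[rotated]) (simp add: 2)
    then show "Q \<in> (\<Union>q\<in>?G. vset q u ` ?T q)" using 1 by blast
  qed
  moreover have fG: "finite ?G" using box_zero_card(1)[of Y "insert u W"] by simp
  moreover have "finite (\<Union>q\<in>?G. vset q u ` ?T q)"
    using fG by (intro finite_UN_I finite_imageI tcard_finite)
  ultimately have "card ?A \<le> card (\<Union>q\<in>?G. vset q u ` ?T q)" by (intro card_mono)
  also have "\<dots> \<le> (\<Sum>q\<in>?G. card (vset q u ` ?T q))" by (rule card_UN_le[OF fG])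
  also have "\<dots> \<le> (\<Sum>q\<in>?G. K)"
  proof (intro sum_mono)
    fix q assume "q \<in> ?G"
    then have "card (?T q) \<le> K" using K[of q] unfolding tcard_def by simp
    moreover have "card (vset q u ` ?T q) \<le> card (?T q)" by (intro card_image_le tcard_finite)
    ultimately show "card (vset q u ` ?T q) \<le> K" by linarith
  qed
  finally show ?thesis by (simp add: mult.commute)
qed

lemma box_step_last:
  fixes W :: "'m::finite set"
  assumes u: "u \<notin> W"
    and P: "\<And>Q. Q \<in> box_zero Y W \<Longrightarrow> P Q \<Longrightarrow> P' (vset Q u 0)"
    and K: "\<And>q. q \<in> box_zero Y (insert u W) \<Longrightarrow> P' q \<Longrightarrow> tcard Y (\<lambda>t. P (vset q u t)) \<le> K"
  shows "card {Q \<in> box_zero Y W. P Q} \<le> K * (2 * Y + 1) ^ (CARD('m) - Suc (card W))"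
proof -
  have "card {q \<in> box_zero Y (insert u W). P' q} \<le> card (box_zero Y (insert u W))"
    using box_zero_card(1)[of Y "insert u W"] by (intro card_mono) auto
  also have "\<dots> = (2 * Y + 1) ^ (CARD('m) - Suc (card W))"
    using u by (simp add: box_zero_card(2))
  finally have "K * card {q \<in> box_zero Y (insert u W). P' q} \<le> K * (2 * Y + 1) ^ (CARD('m) - Suc (card W))"
    by (rule mult_left_mono) simp
  moreover have "card {Q \<in> box_zero Y W. P Q} \<le> K * card {q \<in> box_zero Y (insert u W). P' q}"
    by (rule box_step[where P = P and P' = P' and u = u]) (use u P K in auto)
  ultimately show ?thesis by linarith
qed

lemma class_card:
  assumes p: "p > (0::nat)" and T: "T \<subseteq> {- int Y..int Y}" and c: "\<And>s t. s \<in> T \<Longrightarrow> t \<in> T \<Longrightarrow> int p dvd s - t"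
  shows "card T \<le> 2 * Y div p + 1"
proof -
  have inj: "inj_on (\<lambda>t. (t + int Y) div int p) T"
  proof (rule inj_onI)
    fix s t assume st: "s \<in> T" "t \<in> T" "(s + int Y) div int p = (t + int Y) div int p"
    have "int p dvd (s + int Y) - (t + int Y)" using c[OF st(1,2)] by simp
    then have "(s + int Y) mod int p = (t + int Y) mod int p" by (simp only: mod_eq_dvd_iff)
    then have "s + int Y = t + int Y" using st(3) by (metis mult_div_mod_eq)
    then show "s = t" by simp
  qed
  have "(\<lambda>t. (t + int Y) div int p) ` T \<subseteq> {0..int (2 * Y div p)}"
  proof (rule image_subsetI)
    fix t assume "t \<in> T"
    then have t: "0 \<le> t + int Y" "t + int Y \<le> int (2 * Y)" using T by auto
    have "(t + int Y) div int p \<le> int (2 * Y) div int p" using t p by (intro zdiv_mono1) auto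
    then show "(t + int Y) div int p \<in> {0..int (2 * Y div p)}"
      using t p by (simp add: zdiv_int pos_imp_zdiv_nonneg_iff)
  qed
  then have "card T \<le> card {0..int (2 * Y div p)}" using inj by (intro card_inj_on_le) auto
  then show ?thesis by simp
qed

lemma linear_card:
  assumes p: "prime p" and \<alpha>: "\<not> int p dvd \<alpha>"
  shows "tcard Y (\<lambda>t. int p dvd \<alpha> * t + \<beta>) \<le> 2 * Y div p + 1"
  unfolding tcard_def
proof (rule class_card)
  show "p > 0" using p by (simp add: prime_gt_0_nat)
  fix s t assume st: "s \<in> {t. - int Y \<le> t \<and> t \<le> int Y \<and> int p dvd \<alpha> * t + \<beta>}" "t \<in> {t. - int Y \<le> t \<and> t \<le> int Y \<and> int p dvd \<alpha> * t + \<beta>}"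
  have "int p dvd (\<alpha> * s + \<beta>) - (\<alpha> * t + \<beta>)" using st by (intro dvd_diff) auto
  also have "(\<alpha> * s + \<beta>) - (\<alpha> * t + \<beta>) = \<alpha> * (s - t)" by (simp add: algebra_simps)
  finally show "int p dvd s - t" using \<alpha> p by (simp add: prime_dvd_mult_iff)
qed auto

lemma tcard_Un: "tcard Y (\<lambda>t. P t \<or> Q t) \<le> tcard Y P + tcard Y Q"
proof -
  have "{t. - int Y \<le> t \<and> t \<le> int Y \<and> (P t \<or> Q t)} =
    {t. - int Y \<le> t \<and> t \<le> int Y \<and> P t} \<union> {t. - int Y \<le> t \<and> t \<le> int Y \<and> Q t}" by blast
  then show ?thesis unfolding tcard_def using card_Un_le[of "{t. - int Y \<le> t \<and> t \<le> int Y \<and> P t}" "{t. - int Y \<le> t \<and> t \<le> int Y \<and> Q t}"] by simp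
qed

lemma quadratic_card:
  assumes p: "prime p" and \<alpha>: "\<not> int p dvd \<alpha>"
  shows "tcard Y (\<lambda>t. int p dvd \<alpha> * t^2 + \<beta> * t + \<gamma>) \<le> 2 * (2 * Y div p + 1)"
proof (cases "\<exists>s. int p dvd \<alpha> * s^2 + \<beta> * s + \<gamma>")
  case True
  then obtain s where s: "int p dvd \<alpha> * s^2 + \<beta> * s + \<gamma>" by blast
  have n1: "\<not> int p dvd 1" using prime_gt_1_nat[OF p] by (simp add: zdvd_not_zless)
  have "tcard Y (\<lambda>t. int p dvd \<alpha> * t^2 + \<beta> * t + \<gamma>) \<le>
    tcard Y (\<lambda>t. int p dvd 1 * t + (- s) \<or> int p dvd \<alpha> * t + (\<alpha> * s + \<beta>))"
  proof (rule tcard_mono)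
    fix t assume t: "int p dvd \<alpha> * t^2 + \<beta> * t + \<gamma>"
    have "int p dvd (\<alpha> * t^2 + \<beta> * t + \<gamma>) - (\<alpha> * s^2 + \<beta> * s + \<gamma>)" using s t by (intro dvd_diff) auto
    also have "(\<alpha> * t^2 + \<beta> * t + \<gamma>) - (\<alpha> * s^2 + \<beta> * s + \<gamma>) = (1 * t + (- s)) * (\<alpha> * t + (\<alpha> * s + \<beta>))"
      by (simp add: power2_eq_square algebra_simps)
    finally show "int p dvd 1 * t + (- s) \<or> int p dvd \<alpha> * t + (\<alpha> * s + \<beta>)"
      using p prime_dvd_mult_iff[of "int p"] by simp
  qed
  also have "\<dots> \<le> tcard Y (\<lambda>t. int p dvd 1 * t + (- s)) + tcard Y (\<lambda>t. int p dvd \<alpha> * t + (\<alpha> * s + \<beta>))"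
    by (rule tcard_Un)
  also have "\<dots> \<le> (2 * Y div p + 1) + (2 * Y div p + 1)"
    by (intro add_mono linear_card[OF p n1] linear_card[OF p \<alpha>])
  finally show ?thesis by simp
next
  case False
  then show ?thesis by (simp add: tcard_def)
qed

section \<open>Forms with two ternary subforms degenerate at one prime\<close>

locale four_indices =
  fixes i j k l :: "'n::{finite,linorder}"
  assumes ne [simp]: "i \<noteq> j" "i \<noteq> k" "j \<noteq> k" "i \<noteq> l" "j \<noteq> l" "k \<noteq> l"
begin

lemma ne' [simp]: "j \<noteq> i" "k \<noteq> i" "k \<noteq> j" "l \<noteq> i" "l \<noteq> j" "l \<noteq> k"
  using ne by blast+

text \<open>The part of \<open>disc3 c i j k\<close> that remains when p divides
  \<open>disc2 c i j\<close>.\<close>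

abbreviation degen :: "int ^ 'n uprod \<Rightarrow> int" where
  "degen c \<equiv> c $ Upair i j * c $ Upair i k * c $ Upair j k - c $ Upair i i * (c $ Upair j k)^2 - c $ Upair j j * (c $ Upair i k)^2"

lemma disc2_vset_other: "u \<noteq> Upair i i \<Longrightarrow> u \<noteq> Upair i j \<Longrightarrow> u \<noteq> Upair j j \<Longrightarrow> disc2 (vset c u t) i j = disc2 c i j"
  by (simp add: disc2_def)

lemma disc3_vset_l: "disc3 (vset c (Upair l l) t) i j k = disc3 c i j k"
  by (simp add: disc3_def disc2_def)

lemma disc3_linear_l: "disc3 (vset c (Upair l l) t) i j l = (- disc2 c i j) * t + disc3 (vset c (Upair l l) 0) i j l"
  by (simp add: disc3_def disc2_def algebra_simps)

lemma disc3_linear_k: "disc3 (vset c (Upair k k) t) i j k = (- disc2 c i j) * t + disc3 (vset c (Upair k k) 0) i j k"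
  by (simp add: disc3_def disc2_def algebra_simps)

lemma degen_quadratic: "degen (vset c (Upair i k) t) = (- c $ Upair j j) * t^2 + (c $ Upair i j * c $ Upair j k) * t + (- (c $ Upair i i * (c $ Upair j k)^2))"
  by (simp add: algebra_simps)

lemma disc2_linear: "disc2 (vset c (Upair i i) t) i j = (- 4 * c $ Upair j j) * t + (c $ Upair i j)^2"
  by (simp add: disc2_def)

lemma disc3_degen: "disc3 c i j k = degen c - c $ Upair k k * disc2 c i j"
  by (simp add: disc3_def)

lemma degen_dvd: "int p dvd disc3 c i j k \<Longrightarrow> int p dvd disc2 c i j \<Longrightarrow> int p dvd degen c"
  unfolding disc3_degen by (metis dvd_diffD1 dvd_mult dvd_diff diff_add_cancel dvd_add)

lemma two_coordinates:
  fixes K :: nat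
  assumes "card {Q \<in> box_zero Y {}. P Q} \<le> K1 * card {q \<in> box_zero Y {u}. P' q}"
    "card {q \<in> box_zero Y {u}. P' q} \<le> K2 * (2 * Y + 1) ^ (CARD('n uprod) - Suc (card {u}))"
  shows "card {Q \<in> box_zero Y {}. P Q} \<le> K1 * K2 * (2 * Y + 1) ^ (CARD('n uprod) - 2)"
proof -
  have "K1 * card {q \<in> box_zero Y {u}. P' q} \<le> K1 * (K2 * (2 * Y + 1) ^ (CARD('n uprod) - 2))"
    using assms(2) by (intro mult_left_mono) (simp_all add: numeral_2_eq_2 del: mult_Suc)
  with assms(1) show ?thesis unfolding mult.assoc by (rule order.trans)
qed

text \<open>
  As \<open>disc3\<close> is linear in its last diagonal coefficient with slope \<open>- disc2\<close>, two coefficients of \<open>c\<close> are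
  determined modulo \<open>p\<close> up to boundedly many choices.
\<close>

lemma bad_prime_card:
  assumes p: "prime p" "p > 2"
  shows "card {c \<in> box_zero Y {}. int p dvd disc3 c i j k \<and> int p dvd disc3 c i j l}
    \<le> 4 * (2 * Y div p + 1)^2 * (2 * Y + 1) ^ (CARD('n uprod) - 2)"
proof -
  define K where "K = 2 * Y div p + 1"
  have pi: "prime (int p)" using p by simp
  have n1: "\<not> int p dvd 1" using p by (simp add: zdvd_not_zless)
  have p2: "\<not> int p dvd 2" using p by (simp add: zdvd_not_zless)
  have p4: "\<not> int p dvd 4" using p2 pi prime_dvd_mult_iff[of "int p" 2 2] by simp
  \<comment> \<open>If p does not divide \<open>disc2\<close>, the coefficients at l l and k k are
    determined modulo p. If it does, it divides \<open>degen\<close> too; then either the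
    coefficients at i k and i i are confined by the quadratic \<open>degen\<close> and the linear
    \<open>disc2\<close>, or p divides those at i j and j j.\<close>
  let ?P1 = "\<lambda>c. \<not> int p dvd disc2 c i j \<and> int p dvd disc3 c i j k \<and> int p dvd disc3 c i j l"
  let ?P2 = "\<lambda>c. \<not> int p dvd c $ Upair j j \<and> int p dvd disc2 c i j \<and> int p dvd degen c"
  let ?P3 = "\<lambda>c :: int ^ 'n uprod. int p dvd c $ Upair i j \<and> int p dvd c $ Upair j j"
  have sub: "{c \<in> box_zero Y {}. int p dvd disc3 c i j k \<and> int p dvd disc3 c i j l}
    \<subseteq> {c \<in> box_zero Y {}. ?P1 c} \<union> {c \<in> box_zero Y {}. ?P2 c} \<union> {c \<in> box_zero Y {}. ?P3 c}"
  proof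
    fix c assume c: "c \<in> {c \<in> box_zero Y {}. int p dvd disc3 c i j k \<and> int p dvd disc3 c i j l}"
    have "?P3 c" if "int p dvd disc2 c i j" "int p dvd c $ Upair j j"
    proof -
      have "int p dvd disc2 c i j + 4 * c $ Upair i i * c $ Upair j j" using that by (intro dvd_add dvd_mult)
      then have "int p dvd (c $ Upair i j)^2" by (simp add: disc2_def)
      then show ?thesis using that(2) pi by (simp add: prime_dvd_power_iff)
    qed
    moreover have "?P2 c" if "int p dvd disc2 c i j" "\<not> int p dvd c $ Upair j j"
      using that c degen_dvd[of p c] by blast
    ultimately show "c \<in> {c \<in> box_zero Y {}. ?P1 c} \<union> {c \<in> box_zero Y {}. ?P2 c} \<union> {c \<in> box_zero Y {}. ?P3 c}"
      using c by blast
  qed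
  have 1: "card {c \<in> box_zero Y {}. ?P1 c} \<le> K * K * (2 * Y + 1) ^ (CARD('n uprod) - 2)"
  proof (rule two_coordinates)
    let ?P' = "\<lambda>c. \<not> int p dvd disc2 c i j \<and> int p dvd disc3 c i j k"
    show "card {c \<in> box_zero Y {}. ?P1 c} \<le> K * card {c \<in> box_zero Y {Upair l l}. ?P' c}"
    proof (rule box_step)
      fix q :: "int ^ 'n uprod" assume "?P' q"
      then have q: "\<not> int p dvd - disc2 q i j" by simp
      have "tcard Y (\<lambda>t. ?P1 (vset q (Upair l l) t)) \<le>
        tcard Y (\<lambda>t. int p dvd (- disc2 q i j) * t + disc3 (vset q (Upair l l) 0) i j l)"
        by (rule tcard_mono) (subst (asm) disc3_linear_l, blast)
      also have "\<dots> \<le> K" unfolding K_def by (rule linear_card[OF p(1) q])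
      finally show "tcard Y (\<lambda>t. ?P1 (vset q (Upair l l) t)) \<le> K" .
    qed (simp_all add: disc2_vset_other disc3_vset_l)
    show "card {c \<in> box_zero Y {Upair l l}. ?P' c} \<le> K * (2 * Y + 1) ^ (CARD('n uprod) - Suc (card {Upair l l}))"
    proof (rule box_step_last[where u = "Upair k k" and P' = "\<lambda>c. \<not> int p dvd disc2 c i j"])
      fix q :: "int ^ 'n uprod" assume "\<not> int p dvd disc2 q i j"
      then have q: "\<not> int p dvd - disc2 q i j" by simp
      have "tcard Y (\<lambda>t. ?P' (vset q (Upair k k) t)) \<le>
        tcard Y (\<lambda>t. int p dvd (- disc2 q i j) * t + disc3 (vset q (Upair k k) 0) i j k)"
        by (rule tcard_mono) (subst (asm) disc3_linear_k, blast)
      also have "\<dots> \<le> K" unfolding K_def by (rule linear_card[OF p(1) q])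
      finally show "tcard Y (\<lambda>t. ?P' (vset q (Upair k k) t)) \<le> K" .
    qed (simp_all add: disc2_vset_other)
  qed
  have 2: "card {c \<in> box_zero Y {}. ?P2 c} \<le> (2 * K) * K * (2 * Y + 1) ^ (CARD('n uprod) - 2)"
  proof (rule two_coordinates)
    let ?P' = "\<lambda>c. \<not> int p dvd c $ Upair j j \<and> int p dvd disc2 c i j"
    show "card {c \<in> box_zero Y {}. ?P2 c} \<le> 2 * K * card {c \<in> box_zero Y {Upair i k}. ?P' c}"
    proof (rule box_step)
      fix q :: "int ^ 'n uprod" assume "?P' q"
      then have q: "\<not> int p dvd - q $ Upair j j" by simp
      have "tcard Y (\<lambda>t. ?P2 (vset q (Upair i k) t)) \<le>
        tcard Y (\<lambda>t. int p dvd (- q $ Upair j j) * t^2 + (q $ Upair i j * q $ Upair j k) * t + (- (q $ Upair i i * (q $ Upair j k)^2)))"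
        by (rule tcard_mono) (simp only: degen_quadratic)
      also have "\<dots> \<le> 2 * K" unfolding K_def by (rule quadratic_card[OF p(1) q])
      finally show "tcard Y (\<lambda>t. ?P2 (vset q (Upair i k) t)) \<le> 2 * K" .
    qed (simp_all add: disc2_vset_other)
    show "card {c \<in> box_zero Y {Upair i k}. ?P' c} \<le> K * (2 * Y + 1) ^ (CARD('n uprod) - Suc (card {Upair i k}))"
    proof (rule box_step_last[where u = "Upair i i" and P' = "\<lambda>c. \<not> int p dvd c $ Upair j j"])
      fix q :: "int ^ 'n uprod" assume "\<not> int p dvd q $ Upair j j"
      then have q: "\<not> int p dvd - 4 * q $ Upair j j" using p4 pi by (simp add: prime_dvd_mult_iff)
      have "tcard Y (\<lambda>t. ?P' (vset q (Upair i i) t)) \<le>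
        tcard Y (\<lambda>t. int p dvd (- 4 * q $ Upair j j) * t + (q $ Upair i j)^2)"
        by (rule tcard_mono) (simp only: disc2_linear)
      also have "\<dots> \<le> K" unfolding K_def by (rule linear_card[OF p(1) q])
      finally show "tcard Y (\<lambda>t. ?P' (vset q (Upair i i) t)) \<le> K" .
    qed simp_all
  qed
  have 3: "card {c \<in> box_zero Y {}. ?P3 c} \<le> K * K * (2 * Y + 1) ^ (CARD('n uprod) - 2)"
  proof (rule two_coordinates)
    let ?P' = "\<lambda>c :: int ^ 'n uprod. int p dvd c $ Upair j j"
    have lin: "tcard Y (\<lambda>t. int p dvd t) \<le> K"
      using linear_card[OF p(1) n1, of Y 0] by (simp add: K_def)
    have lin': "tcard Y (\<lambda>t. int p dvd t \<and> X) \<le> K" for X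
      using lin by (rule order.trans[rotated]) (rule tcard_mono, simp)
    show "card {c \<in> box_zero Y {}. ?P3 c} \<le> K * card {c \<in> box_zero Y {Upair i j}. ?P' c}"
      by (rule box_step) (auto simp: lin' lin)
    show "card {c \<in> box_zero Y {Upair i j}. ?P' c} \<le> K * (2 * Y + 1) ^ (CARD('n uprod) - Suc (card {Upair i j}))"
      by (rule box_step_last[where u = "Upair j j" and P' = "\<lambda>_. True"]) (simp_all add: lin)
  qed
  have "card {c \<in> box_zero Y {}. int p dvd disc3 c i j k \<and> int p dvd disc3 c i j l}
    \<le> card ({c \<in> box_zero Y {}. ?P1 c} \<union> {c \<in> box_zero Y {}. ?P2 c} \<union> {c \<in> box_zero Y {}. ?P3 c})"
    by (rule card_mono[OF _ sub]) (use box_zero_card(1)[of Y "{}"] in auto)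
  also have "\<dots> \<le> card {c \<in> box_zero Y {}. ?P1 c} + card {c \<in> box_zero Y {}. ?P2 c} + card {c \<in> box_zero Y {}. ?P3 c}"
    by (rule order.trans[OF card_Un_le]) (intro add_right_mono card_Un_le)
  also have "\<dots> \<le> K * K * (2 * Y + 1) ^ (CARD('n uprod) - 2) + (2 * K) * K * (2 * Y + 1) ^ (CARD('n uprod) - 2) + K * K * (2 * Y + 1) ^ (CARD('n uprod) - 2)"
    by (intro add_mono 1 2 3)
  also have "\<dots> = 4 * K^2 * (2 * Y + 1) ^ (CARD('n uprod) - 2)" by (simp add: power2_eq_square algebra_simps)
  finally show ?thesis by (simp add: K_def)
qed

definition big_primes :: "nat \<Rightarrow> int \<Rightarrow> nat set" where
  "big_primes Y n = {p. prime p \<and> p > Y \<and> int p dvd n}"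

text \<open>Five primes above Y would have a product of at least (Y + 1)^5.\<close>

lemma big_primes_card:
  assumes n: "n \<noteq> 0" "\<bar>n\<bar> < (int Y + 1) ^ 5" and Y: "Y > 0"
  shows "finite (big_primes Y n)" "card (big_primes Y n) \<le> 4"
proof -
  have "big_primes Y n \<subseteq> {..nat \<bar>n\<bar>}"
  proof
    fix p assume "p \<in> big_primes Y n"
    then have "int p dvd n" by (simp add: big_primes_def)
    then have "int p \<le> \<bar>n\<bar>" using n(1) dvd_imp_le_int[of n "int p"] by simp
    then show "p \<in> {..nat \<bar>n\<bar>}" by simp
  qed
  then show fin: "finite (big_primes Y n)" using finite_subset by blast
  show "card (big_primes Y n) \<le> 4"
  proof (rule ccontr)
    assume c: "\<not> card (big_primes Y n) \<le> 4"
    have "(\<Prod>p\<in>S. int p) dvd n" if "finite S" "S \<subseteq> big_primes Y n" for S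
      using that
    proof (induction S)
      case (insert q S)
      have "coprime (int q) (\<Prod>p\<in>S. int p)"
      proof (intro prod_coprime_right)
        fix r assume "r \<in> S"
        then have "coprime q r" using insert by (intro primes_coprime) (auto simp: big_primes_def)
        then show "coprime (int q) (int r)" by simp
      qed
      then show ?case using insert by (simp add: divides_mult big_primes_def)
    qed simp
    from this[OF fin order.refl] have "(\<Prod>p\<in>big_primes Y n. int p) dvd n" .
    then have "(\<Prod>p\<in>big_primes Y n. int p) \<le> \<bar>n\<bar>"
      using dvd_imp_le_int[OF n(1), of "\<Prod>p\<in>big_primes Y n. int p"] by linarith
    moreover have "(\<Prod>p\<in>big_primes Y n. int Y + 1) \<le> (\<Prod>p\<in>big_primes Y n. int p)"
      by (intro prod_mono) (auto simp: big_primes_def)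
    moreover have "(int Y + 1) ^ 5 \<le> (int Y + 1) ^ card (big_primes Y n)"
      using c by (intro power_increasing) auto
    ultimately show False using n(2) by simp
  qed
qed

lemma big_primes_UN_card:
  assumes "n \<noteq> 0" "\<bar>n\<bar> < (int Y + 1) ^ 5" "Y > 0"
    and K: "\<And>p. p \<in> big_primes Y n \<Longrightarrow> tcard Y (\<lambda>t. R p t) \<le> K"
  shows "tcard Y (\<lambda>t. \<exists>p\<in>big_primes Y n. R p t) \<le> 4 * K"
proof -
  note L = big_primes_card[OF assms(1-3)]
  have "{t. - int Y \<le> t \<and> t \<le> int Y \<and> (\<exists>p\<in>big_primes Y n. R p t)} =
    (\<Union>p\<in>big_primes Y n. {t. - int Y \<le> t \<and> t \<le> int Y \<and> R p t})" by blast
  then have "tcard Y (\<lambda>t. \<exists>p\<in>big_primes Y n. R p t) \<le> (\<Sum>p\<in>big_primes Y n. tcard Y (\<lambda>t. R p t))"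
    unfolding tcard_def using card_UN_le[OF L(1), of "\<lambda>p. {t. - int Y \<le> t \<and> t \<le> int Y \<and> R p t}"] by simp
  also have "\<dots> \<le> (\<Sum>p\<in>big_primes Y n. K)" by (intro sum_mono K)
  also have "\<dots> \<le> 4 * K" using L(2) by simp
  finally show ?thesis .
qed

lemma abs_mult3: "\<bar>x\<bar> \<le> Z \<Longrightarrow> \<bar>y\<bar> \<le> Z \<Longrightarrow> \<bar>z\<bar> \<le> Z \<Longrightarrow> \<bar>x * y * z\<bar> \<le> Z ^ 3" for x y z Z :: int
proof -
  assume a: "\<bar>x\<bar> \<le> Z" "\<bar>y\<bar> \<le> Z" "\<bar>z\<bar> \<le> Z"
  have "\<bar>x\<bar> * \<bar>y\<bar> * \<bar>z\<bar> \<le> Z * Z * Z" using a by (intro mult_mono) auto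
  then show "\<bar>x * y * z\<bar> \<le> Z ^ 3" by (simp add: abs_mult power3_eq_cube)
qed

lemma disc_bounds:
  assumes "c \<in> box_zero Y {}" "Y \<ge> 8"
  shows "\<bar>disc2 c i j\<bar> < (int Y + 1) ^ 5" "\<bar>disc3 c i j k\<bar> < (int Y + 1) ^ 5"
proof -
  define y where "y = int Y"
  have y: "y \<ge> 8" using assms(2) by (simp add: y_def)
  have b: "\<bar>c $ u\<bar> \<le> y" for u using assms(1) by (simp add: box_zero_def y_def)
  have b2: "\<bar>c $ u * c $ v\<bar> \<le> y\<^sup>2" for u v
    unfolding abs_mult power2_eq_square using b[of u] b[of v] by (intro mult_mono) auto
  note b3 = abs_mult3[OF b b b]
  \<comment> \<open>Counted with their coefficients, the discriminants have 5 monomials of degree 2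
    and 8 of degree 3; Y \<ge> 8 turns the constant into a power.\<close>
  have "8 * y ^ 3 \<le> y * y ^ 3" using y by (intro mult_right_mono) auto
  also have "\<dots> = y ^ 4" by (simp add: eval_nat_numeral)
  also have "\<dots> \<le> (y + 1) ^ 4" using y by (intro power_mono) auto
  also have "\<dots> < (y + 1) ^ 5" using y by (intro power_strict_increasing) auto
  finally have Y5: "8 * y ^ 3 < (y + 1) ^ 5" .
  have y23: "y^2 \<le> y ^ 3" using y by (intro power_increasing) auto
  have "disc2 c i j = c $ Upair i j * c $ Upair i j - 4 * (c $ Upair i i * c $ Upair j j)"
    by (simp add: disc2_def power2_eq_square)
  then have "\<bar>disc2 c i j\<bar> \<le> 5 * y^2" using b2[of "Upair i j" "Upair i j"] b2[of "Upair i i" "Upair j j"] by linarith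
  then have "\<bar>disc2 c i j\<bar> \<le> 8 * y ^ 3" using y23 by (smt (verit) zero_le_power2)
  then show "\<bar>disc2 c i j\<bar> < (int Y + 1) ^ 5" using Y5 by (simp add: y_def)
  have "disc3 c i j k = c $ Upair i j * c $ Upair i k * c $ Upair j k - c $ Upair i i * c $ Upair j k * c $ Upair j k
     - c $ Upair j j * c $ Upair i k * c $ Upair i k - c $ Upair k k * c $ Upair i j * c $ Upair i j
     + 4 * (c $ Upair k k * c $ Upair i i * c $ Upair j j)"
    by (simp add: disc3_def disc2_def power2_eq_square algebra_simps)
  then have "\<bar>disc3 c i j k\<bar> \<le> 8 * y ^ 3"
    using b3[of "Upair i j" "Upair i k" "Upair j k"] b3[of "Upair i i" "Upair j k" "Upair j k"]
      b3[of "Upair j j" "Upair i k" "Upair i k"] b3[of "Upair k k" "Upair i j" "Upair i j"]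
      b3[of "Upair k k" "Upair i i" "Upair j j"] by linarith
  then show "\<bar>disc3 c i j k\<bar> < (int Y + 1) ^ 5" using Y5 by (simp add: y_def)
qed

lemma single_card: "(\<And>s t :: int. P s \<Longrightarrow> P t \<Longrightarrow> s = t) \<Longrightarrow> tcard Y (\<lambda>t. P t) \<le> 1"
  unfolding tcard_def One_nat_def by (subst card_le_Suc0_iff_eq) auto

text \<open>
  For \<open>p > Y\<close> only one coefficient can be gained, but then \<open>p\<close> is one of the boundedly many large
  prime factors of a nonzero integer that does not involve this coefficient.
\<close>

lemma large_bad_prime_card:
  assumes Y: "Y \<ge> 8"
  shows "card {c \<in> box_zero Y {}. \<exists>p. prime p \<and> p > Y \<and> int p dvd disc3 c i j k \<and> int p dvd disc3 c i j l}
    \<le> 27 * (2 * Y + 1) ^ (CARD('n uprod) - 1)"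
proof -
  let ?B = "box_zero Y {} :: (int ^ 'n uprod) set"
  \<comment> \<open>The first three cases are equations over the integers, each of which fixes one
    coefficient. In the last two, p is a large prime divisor of a nonzero \<open>disc3\<close> or
    \<open>disc2\<close>, and the gained coefficient is that at l l or i k.\<close>
  let ?P1 = "\<lambda>c :: int ^ 'n uprod. c $ Upair j j = 0"
  let ?P2 = "\<lambda>c :: int ^ 'n uprod. c $ Upair j j \<noteq> 0 \<and> disc2 c i j = 0"
  let ?P3 = "\<lambda>c. disc2 c i j \<noteq> 0 \<and> disc3 c i j k = 0"
  let ?P4 = "\<lambda>c. disc3 c i j k \<noteq> 0 \<and> (\<exists>p\<in>big_primes Y (disc3 c i j k). \<not> int p dvd disc2 c i j \<and> int p dvd disc3 c i j l)"
  let ?P5 = "\<lambda>c :: int ^ 'n uprod. c $ Upair j j \<noteq> 0 \<and> disc2 c i j \<noteq> 0 \<and> (\<exists>p\<in>big_primes Y (disc2 c i j). int p dvd degen c)"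
  have Y0: "Y > 0" using Y by simp
  \<comment> \<open>A residue class modulo p > Y meets the interval from -Y to Y in at most two
    points.\<close>
  have Kp: "2 * Y div p + 1 \<le> 2" if "p > Y" for p
  proof -
    have "2 * Y div p < 2" using that by (subst div_less_iff_less_mult) auto
    then show ?thesis by simp
  qed
  have sub: "{c \<in> ?B. \<exists>p. prime p \<and> p > Y \<and> int p dvd disc3 c i j k \<and> int p dvd disc3 c i j l}
    \<subseteq> {c \<in> ?B. ?P1 c} \<union> ({c \<in> ?B. ?P2 c} \<union> ({c \<in> ?B. ?P3 c} \<union> ({c \<in> ?B. ?P4 c} \<union> {c \<in> ?B. ?P5 c})))"
  proof
    fix c assume "c \<in> {c \<in> ?B. \<exists>p. prime p \<and> p > Y \<and> int p dvd disc3 c i j k \<and> int p dvd disc3 c i j l}"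
    then obtain p where c: "c \<in> ?B" "prime p" "p > Y" "int p dvd disc3 c i j k" "int p dvd disc3 c i j l" by blast
    show "c \<in> {c \<in> ?B. ?P1 c} \<union> ({c \<in> ?B. ?P2 c} \<union> ({c \<in> ?B. ?P3 c} \<union> ({c \<in> ?B. ?P4 c} \<union> {c \<in> ?B. ?P5 c})))"
    proof (cases "int p dvd disc2 c i j")
      case True
      have "int p dvd degen c" using degen_dvd c True by blast
      moreover have "p \<in> big_primes Y (disc2 c i j)" using c True by (simp add: big_primes_def)
      ultimately show ?thesis using c(1) by blast
    next
      case False
      then have "disc2 c i j \<noteq> 0" by auto
      moreover have "p \<in> big_primes Y (disc3 c i j k)" using c by (simp add: big_primes_def)
      ultimately show ?thesis using c False by blast
    qed
  qed
  have c1: "card {c \<in> ?B. ?P1 c} \<le> 1 * (2 * Y + 1) ^ (CARD('n uprod) - Suc (card ({} :: 'n uprod set)))"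
    by (rule box_step_last[where u = "Upair j j" and P' = "\<lambda>_. True"]) (simp_all add: single_card[of "\<lambda>t. t = 0", simplified])
  have c2: "card {c \<in> ?B. ?P2 c} \<le> 1 * (2 * Y + 1) ^ (CARD('n uprod) - Suc (card ({} :: 'n uprod set)))"
  proof (rule box_step_last[where u = "Upair i i" and P' = "\<lambda>c. c $ Upair j j \<noteq> 0"])
    fix q :: "int ^ 'n uprod" assume "q $ Upair j j \<noteq> 0"
    then show "tcard Y (\<lambda>t. ?P2 (vset q (Upair i i) t)) \<le> 1"
      by (intro single_card) (auto simp: disc2_linear)
  qed simp_all
  have c3: "card {c \<in> ?B. ?P3 c} \<le> 1 * (2 * Y + 1) ^ (CARD('n uprod) - Suc (card ({} :: 'n uprod set)))"
  proof (rule box_step_last[where u = "Upair k k" and P' = "\<lambda>c. disc2 c i j \<noteq> 0"])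
    fix q :: "int ^ 'n uprod" assume q: "disc2 q i j \<noteq> 0"
    have "s = t" if "disc3 (vset q (Upair k k) s) i j k = 0" "disc3 (vset q (Upair k k) t) i j k = 0" for s t
      using that q disc3_linear_k[of q s] disc3_linear_k[of q t] by simp
    then show "tcard Y (\<lambda>t. ?P3 (vset q (Upair k k) t)) \<le> 1"
      by (intro single_card) blast
  qed (simp_all add: disc2_vset_other)
  have c4: "card {c \<in> ?B. ?P4 c} \<le> 8 * (2 * Y + 1) ^ (CARD('n uprod) - Suc (card ({} :: 'n uprod set)))"
  proof (rule box_step_last[where u = "Upair l l" and P' = "\<lambda>c. disc3 c i j k \<noteq> 0"])
    fix q :: "int ^ 'n uprod" assume q: "disc3 q i j k \<noteq> 0" and qB: "q \<in> box_zero Y (insert (Upair l l) {})"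
    have qB': "q \<in> box_zero Y {}" using qB by (simp add: box_zero_def)
    let ?R = "\<lambda>p t. \<not> int p dvd disc2 q i j \<and> int p dvd disc3 (vset q (Upair l l) t) i j l"
    have "tcard Y (\<lambda>t. ?R p t) \<le> 2" if p: "p \<in> big_primes Y (disc3 q i j k)" for p
    proof (cases "int p dvd disc2 q i j")
      case False
      then have d: "\<not> int p dvd - disc2 q i j" by simp
      have pp: "prime p" "p > Y" using p by (simp_all add: big_primes_def)
      have "tcard Y (?R p) \<le> tcard Y (\<lambda>t. int p dvd (- disc2 q i j) * t + disc3 (vset q (Upair l l) 0) i j l)"
        by (rule tcard_mono) (subst (asm) disc3_linear_l, blast)
      then show ?thesis
        using linear_card[OF pp(1) d, of Y "disc3 (vset q (Upair l l) 0) i j l"] Kp[OF pp(2)] by linarith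
    qed (simp add: tcard_def)
    then have "tcard Y (\<lambda>t. \<exists>p\<in>big_primes Y (disc3 q i j k). ?R p t) \<le> 4 * 2"
      by (rule big_primes_UN_card[OF q disc_bounds(2)[OF qB' Y] Y0])
    then show "tcard Y (\<lambda>t. ?P4 (vset q (Upair l l) t)) \<le> 8"
      using q by (simp add: disc3_vset_l disc2_vset_other)
  qed (simp_all add: disc3_vset_l)
  have c5: "card {c \<in> ?B. ?P5 c} \<le> 16 * (2 * Y + 1) ^ (CARD('n uprod) - Suc (card ({} :: 'n uprod set)))"
  proof (rule box_step_last[where u = "Upair i k" and P' = "\<lambda>c. c $ Upair j j \<noteq> 0 \<and> disc2 c i j \<noteq> 0"])
    fix q :: "int ^ 'n uprod" assume q: "q $ Upair j j \<noteq> 0 \<and> disc2 q i j \<noteq> 0" and qB: "q \<in> box_zero Y (insert (Upair i k) {})"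
    have qB': "q \<in> box_zero Y {}" using qB by (simp add: box_zero_def)
    let ?R = "\<lambda>p t. int p dvd degen (vset q (Upair i k) t)"
    have "tcard Y (\<lambda>t. ?R p t) \<le> 4" if p: "p \<in> big_primes Y (disc2 q i j)" for p
    proof -
      have pp: "prime p" "p > Y" using p by (simp_all add: big_primes_def)
      have "\<bar>q $ Upair j j\<bar> < int p" using qB' pp(2) by (auto simp: box_zero_def intro: le_less_trans)
      then have "\<not> int p dvd q $ Upair j j" using q dvd_imp_le_int[of "q $ Upair j j" "int p"] by auto
      then have d: "\<not> int p dvd - q $ Upair j j" by simp
      have "tcard Y (?R p) \<le> 2 * (2 * Y div p + 1)"
        unfolding degen_quadratic by (rule quadratic_card[OF pp(1) d])
      also have "\<dots> \<le> 2 * 2" by (intro mult_left_mono Kp[OF pp(2)]) simp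
      finally show ?thesis by simp
    qed
    then have "tcard Y (\<lambda>t. \<exists>p\<in>big_primes Y (disc2 q i j). ?R p t) \<le> 4 * 4"
      by (rule big_primes_UN_card[OF conjunct2[OF q] disc_bounds(1)[OF qB' Y] Y0])
    then show "tcard Y (\<lambda>t. ?P5 (vset q (Upair i k) t)) \<le> 16"
      using q by (simp add: disc2_vset_other)
  qed (simp_all add: disc2_vset_other)
  have fB: "finite ?B" by (rule box_zero_card(1))
  have "card {c \<in> ?B. \<exists>p. prime p \<and> p > Y \<and> int p dvd disc3 c i j k \<and> int p dvd disc3 c i j l}
    \<le> card ({c \<in> ?B. ?P1 c} \<union> ({c \<in> ?B. ?P2 c} \<union> ({c \<in> ?B. ?P3 c} \<union> ({c \<in> ?B. ?P4 c} \<union> {c \<in> ?B. ?P5 c}))))"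
    by (rule card_mono[OF _ sub]) (use fB in auto)
  also have "\<dots> \<le> card {c \<in> ?B. ?P1 c} + (card {c \<in> ?B. ?P2 c} + (card {c \<in> ?B. ?P3 c} + (card {c \<in> ?B. ?P4 c} + card {c \<in> ?B. ?P5 c})))"
    by (intro order.trans[OF card_Un_le] add_left_mono card_Un_le)
  \<comment> \<open>27 = 1 + 1 + 1 + 8 + 16; the last two are four primes times 2 solutions of a
    linear and 4 of a quadratic congruence.\<close>
  also have "\<dots> \<le> 27 * (2 * Y + 1) ^ (CARD('n uprod) - 1)" using c1 c2 c3 c4 c5 by simp
  finally show ?thesis .
qed

lemma sum_inverse_squares: "N > 0 \<Longrightarrow> (\<Sum>p\<in>{N<..N + M}. 1 / (real p)\<^sup>2) \<le> 1 / real N - 1 / real (N + M)"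
proof (induction M)
  case (Suc M)
  have "{N<..N + Suc M} = insert (N + Suc M) {N<..N + M}" by auto
  then have "(\<Sum>p\<in>{N<..N + Suc M}. 1 / (real p)\<^sup>2) = 1 / (real (N + Suc M))\<^sup>2 + (\<Sum>p\<in>{N<..N + M}. 1 / (real p)\<^sup>2)"
    by simp
  moreover have "1 / (x + 1)\<^sup>2 \<le> 1 / x - 1 / (x + 1)" if "x > 0" for x :: real
  proof -
    have "1 / x - 1 / (x + 1) = 1 / (x * (x + 1))" using that by (simp add: field_simps)
    moreover have "x * (x + 1) \<le> (x + 1)\<^sup>2" using that by (simp add: power2_eq_square algebra_simps)
    ultimately show ?thesis using that by (simp add: frac_le)
  qed
  from this[of "real (N + M)"] have "1 / (real (N + Suc M))\<^sup>2 \<le> 1 / real (N + M) - 1 / real (N + Suc M)"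
    using Suc.prems by (simp add: add_ac)
  ultimately show ?case using Suc.IH Suc.prems by linarith
qed simp

text \<open>Primes up to Y contribute a multiple of the sum of 1 / p^2 over p > N, hence of 1 / N.
  All primes above Y together save one power of 2 Y + 1.\<close>

lemma tail_card:
  assumes Y: "Y \<ge> 8" and N: "N \<ge> 2"
  shows "real (card {c \<in> box_zero Y {}. \<exists>p. prime p \<and> p > N \<and> int p dvd disc3 c i j k \<and> int p dvd disc3 c i j l})
    \<le> 9 * (2 * real Y + 1) ^ CARD('n uprod) / real N + 27 * (2 * real Y + 1) ^ (CARD('n uprod) - 1)"
proof -
  let ?B = "box_zero Y {} :: (int ^ 'n uprod) set"
  let ?bad = "\<lambda>p c. int p dvd disc3 c i j k \<and> int p dvd disc3 c i j l"
  define S where "S = {p \<in> {N<..N + Y}. prime p \<and> p \<le> Y}"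
  have fS: "finite S" by (simp add: S_def)
  have fB: "finite ?B" by (rule box_zero_card(1))
  have m2: "CARD('n uprod) \<ge> 2"
  proof -
    have "card {Upair i i, Upair j j} \<le> CARD('n uprod)" by (rule card_mono) auto
    then show ?thesis by simp
  qed
  define y where "y = 2 * real Y + 1"
  have y: "y > 0" by (simp add: y_def)
  have one: "real (card {c \<in> ?B. ?bad p c}) \<le> 9 * y ^ CARD('n uprod) * (1 / (real p)\<^sup>2)" if p: "p \<in> S" for p
  proof -
    have pp: "prime p" "p > 2" "p \<le> Y" using p N by (auto simp: S_def)
    have "real (2 * Y div p) \<le> 2 * real Y / real p" using of_nat_div_le_of_nat[of "2 * Y" p, where 'a = real] by simp
    moreover have "1 \<le> real Y / real p" using pp by simp
    ultimately have K: "real (2 * Y div p + 1) \<le> 3 / 2 * y / real p"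
      using pp by (simp add: y_def field_simps)
    have "real (card {c \<in> ?B. ?bad p c}) \<le> real (4 * (2 * Y div p + 1)^2 * (2 * Y + 1) ^ (CARD('n uprod) - 2))"
      using bad_prime_card[OF pp(1,2), of Y] of_nat_le_iff by blast
    also have "\<dots> = 4 * (real (2 * Y div p + 1))^2 * y ^ (CARD('n uprod) - 2)" by (simp add: y_def add.commute)
    also have "\<dots> \<le> 4 * (3 / 2 * y / real p)^2 * y ^ (CARD('n uprod) - 2)"
      using K y by (intro mult_right_mono mult_left_mono power_mono) auto
    also have "\<dots> = 9 * (y ^ 2 * y ^ (CARD('n uprod) - 2)) * (1 / (real p)\<^sup>2)" by (simp add: power_mult_distrib power_divide)
    also have "y ^ 2 * y ^ (CARD('n uprod) - 2) = y ^ CARD('n uprod)" using m2 by (simp only: power_add[symmetric] le_add_diff_inverse)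
    finally show ?thesis .
  qed
  have "{c \<in> ?B. \<exists>p. prime p \<and> p > N \<and> ?bad p c} \<subseteq>
    (\<Union>p\<in>S. {c \<in> ?B. ?bad p c}) \<union> {c \<in> ?B. \<exists>p. prime p \<and> p > Y \<and> ?bad p c}"
  proof
    fix c assume "c \<in> {c \<in> ?B. \<exists>p. prime p \<and> p > N \<and> ?bad p c}"
    then obtain p where c: "c \<in> ?B" "prime p" "p > N" "?bad p c" by blast
    show "c \<in> (\<Union>p\<in>S. {c \<in> ?B. ?bad p c}) \<union> {c \<in> ?B. \<exists>p. prime p \<and> p > Y \<and> ?bad p c}"
    proof (cases "p \<le> Y")
      case True
      then have "p \<in> S" using c by (simp add: S_def)
      then show ?thesis using c by blast
    next
      case False
      then show ?thesis using c not_le by blast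
    qed
  qed
  then have "card {c \<in> ?B. \<exists>p. prime p \<and> p > N \<and> ?bad p c} \<le>
    card ((\<Union>p\<in>S. {c \<in> ?B. ?bad p c}) \<union> {c \<in> ?B. \<exists>p. prime p \<and> p > Y \<and> ?bad p c})"
    using fB fS by (intro card_mono) auto
  also have "\<dots> \<le> card (\<Union>p\<in>S. {c \<in> ?B. ?bad p c}) + card {c \<in> ?B. \<exists>p. prime p \<and> p > Y \<and> ?bad p c}"
    by (rule card_Un_le)
  also have "\<dots> \<le> (\<Sum>p\<in>S. card {c \<in> ?B. ?bad p c}) + 27 * (2 * Y + 1) ^ (CARD('n uprod) - 1)"
    by (intro add_mono card_UN_le[OF fS] large_bad_prime_card[OF Y])
  finally have "real (card {c \<in> ?B. \<exists>p. prime p \<and> p > N \<and> ?bad p c}) \<le>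
    real ((\<Sum>p\<in>S. card {c \<in> ?B. ?bad p c}) + 27 * (2 * Y + 1) ^ (CARD('n uprod) - 1))" by (simp only: of_nat_le_iff)
  also have "\<dots> = (\<Sum>p\<in>S. real (card {c \<in> ?B. ?bad p c})) + 27 * y ^ (CARD('n uprod) - 1)" by (simp add: y_def add.commute)
  also have "\<dots> \<le> (\<Sum>p\<in>S. 9 * y ^ CARD('n uprod) * (1 / (real p)\<^sup>2)) + 27 * y ^ (CARD('n uprod) - 1)"
    by (intro add_mono sum_mono one) auto
  also have "\<dots> \<le> 9 * y ^ CARD('n uprod) * (1 / real N) + 27 * y ^ (CARD('n uprod) - 1)"
  proof -
    have "(\<Sum>p\<in>S. 1 / (real p)\<^sup>2) \<le> (\<Sum>p\<in>{N<..N + Y}. 1 / (real p)\<^sup>2)"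
      by (intro sum_mono2) (auto simp: S_def)
    also have "\<dots> \<le> 1 / real N - 1 / real (N + Y)" using N by (intro sum_inverse_squares) simp
    also have "\<dots> \<le> 1 / real N" by simp
    finally show ?thesis using y by (simp add: sum_distrib_left[symmetric] del: times_divide_eq_right)
  qed
  finally show ?thesis by (simp add: y_def)
qed

end

section \<open>Comparing weighted counts\<close>

lemma wsum_nonneg: "(\<And>x. 0 \<le> f x) \<Longrightarrow> X > 0 \<Longrightarrow> 0 \<le> wsum f A X"
  unfolding wsum_def by (intro divide_nonneg_pos infsum_nonneg) auto

lemma wsum_mono:
  assumes "adm f" "\<And>x. 0 \<le> f x" "X > 0" "A \<subseteq> B"
  shows "wsum f A X \<le> wsum f B X"
proof -
  have "A \<union> (B - A) = B" using assms(4) by blast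
  then have "wsum f B X = wsum f A X + wsum f (B - A) X" using wsum_union[OF assms(1,3), of A "B - A"] by auto
  then show ?thesis using wsum_nonneg[of f X "B - A"] assms by auto
qed

lemma wsum_Un_le:
  assumes "adm f" "\<And>x. 0 \<le> f x" "X > 0"
  shows "wsum f (A \<union> B) X \<le> wsum f A X + wsum f B X"
proof -
  have "wsum f (A \<union> B) X = wsum f A X + wsum f (B - A) X" using wsum_union[OF assms(1,3), of A "B - A"] by auto
  moreover have "wsum f (B - A) X \<le> wsum f B X" using assms by (intro wsum_mono) auto
  ultimately show ?thesis by linarith
qed

lemma wsum_UN_le:
  assumes "adm f" "\<And>x. 0 \<le> f x" "X > 0" "finite S"
  shows "wsum f (\<Union>p\<in>S. A p) X \<le> (\<Sum>p\<in>S. wsum f (A p) X)"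
  using assms(4)
proof induction
  case empty
  show ?case by (simp add: wsum_def)
next
  case (insert p S)
  have "wsum f (A p \<union> (\<Union>p\<in>S. A p)) X \<le> wsum f (A p) X + wsum f (\<Union>p\<in>S. A p) X"
    by (intro wsum_Un_le assms)
  then show ?case using insert by simp
qed

lemma wsum_diff:
  assumes "adm f" "X > 0" "A \<subseteq> B"
  shows "\<bar>wsum f B X - wsum f A X\<bar> \<le> wsum (\<lambda>x. \<bar>f x\<bar>) (B - A) X"
proof -
  have "A \<union> (B - A) = B" using assms(3) by blast
  then have "wsum f B X - wsum f A X = wsum f (B - A) X" using wsum_union[OF assms(1,2), of A "B - A"] by auto
  moreover have "\<bar>\<Sum>\<^sub>\<infinity>Q\<in>B - A. f (real_qform Q /\<^sub>R X)\<bar> \<le> (\<Sum>\<^sub>\<infinity>Q\<in>B - A. \<bar>f (real_qform Q /\<^sub>R X)\<bar>)"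
    using norm_infsum_bound[of "\<lambda>Q. f (real_qform Q /\<^sub>R X)" "B - A"] adm_summable[OF adm_abs[OF assms(1)] assms(2), of "B - A"]
    by simp
  ultimately show ?thesis using assms(2) by (simp add: wsum_def abs_divide divide_right_mono)
qed

lemma wsum_indicator: "wsum (\<lambda>x. f x * indicator A x) B X = wsum f {Q \<in> B. real_qform Q /\<^sub>R X \<in> A} X"
proof -
  have "(\<Sum>\<^sub>\<infinity>Q\<in>B. f (real_qform Q /\<^sub>R X) * indicator A (real_qform Q /\<^sub>R X)) =
    (\<Sum>\<^sub>\<infinity>Q\<in>{Q \<in> B. real_qform Q /\<^sub>R X \<in> A}. f (real_qform Q /\<^sub>R X))"
    by (rule infsum_cong_neutral) (auto simp: indicator_def)
  then show ?thesis by (simp add: wsum_def)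
qed

lemma wsum_UNIV:
  assumes "adm (f :: real ^ 'm \<Rightarrow> real)"
  shows "((\<lambda>X. wsum f UNIV X) \<longlongrightarrow> integral\<^sup>L lebesgue f) at_top"
proof -
  have "periodic 1 (UNIV :: (int ^ 'm) set)" by (simp add: periodic_def)
  then show ?thesis using wsum_periodic[OF assms, of 1 UNIV] by (simp add: rdens_UNIV)
qed

lemma has_probability_wsum:
  assumes "adm D" "integral\<^sup>L lebesgue D = 1" "(wsum D {Q. P Q} \<longlongrightarrow> \<rho>) at_top"
  shows "has_probability D P \<rho>"
  unfolding has_probability_def
proof (rule Lim_transform_eventually)
  show "((\<lambda>X. wsum D {Q. P Q} X / wsum D UNIV X) \<longlongrightarrow> \<rho>) at_top"
    using tendsto_divide[OF assms(3) wsum_UNIV[OF assms(1)]] assms(2) by simp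
  show "\<forall>\<^sub>F X in at_top. wsum D {Q. P Q} X / wsum D UNIV X =
      (\<Sum>\<^sub>\<infinity>Q\<in>{Q. P Q}. D (real_qform Q /\<^sub>R X)) / (\<Sum>\<^sub>\<infinity>Q. D (real_qform Q /\<^sub>R X))"
    using eventually_gt_at_top[of 0] by eventually_elim (simp add: wsum_def)
qed

lemma wsum_finite_le:
  fixes B :: "(int ^ 'm) set"
  assumes "\<And>x. f x \<le> C" "finite B" "X > 0"
  shows "wsum f B X \<le> C * real (card B) / X ^ CARD('m)"
proof -
  have "(\<Sum>Q\<in>B. f (real_qform Q /\<^sub>R X)) \<le> (\<Sum>Q\<in>B. C)" by (intro sum_mono assms)
  then show ?thesis using assms by (simp add: wsum_def divide_right_mono mult.commute)
qed

lemma integral_tail: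
  fixes g :: "real ^ 'm \<Rightarrow> real"
  assumes "adm g" "eps > 0" "\<And>x. 0 \<le> g x"
  shows "\<exists>R::nat. R \<ge> 1 \<and> integral\<^sup>L lebesgue (\<lambda>x. g x * indicator {x. norm x > real R} x) < eps"
proof -
  let ?h = "\<lambda>R x. g x * indicator {x. norm x > real R} x"
  have meas: "?h R \<in> borel_measurable lebesgue" for R
    using assms(1) by (auto simp: adm_def intro!: borel_measurable_times borel_measurable_indicator)
  have "(\<lambda>R. integral\<^sup>L lebesgue (?h R)) \<longlonglongrightarrow> integral\<^sup>L lebesgue (\<lambda>x :: real ^ 'm. 0 :: real)"
  proof (rule integral_dominated_convergence[where w = g])
    show "integrable lebesgue g" by (rule adm_integrable[OF assms(1)])
    have "(\<lambda>R. ?h R x) \<longlonglongrightarrow> 0" for x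
    proof (rule tendsto_eventually)
      obtain r :: nat where "norm x \<le> real r" using real_arch_simple by blast
      then show "\<forall>\<^sub>F R in sequentially. ?h R x = 0"
        by (intro eventually_sequentiallyI[of r]) (auto simp: indicator_def)
    qed
    then show "AE x in lebesgue. (\<lambda>R. ?h R x) \<longlonglongrightarrow> 0" by simp
    show "AE x in lebesgue. norm (?h R x) \<le> g x" for R
      using assms(3) by (auto simp: indicator_def)
  qed (use meas in auto)
  then have "\<forall>\<^sub>F R in sequentially. integral\<^sup>L lebesgue (?h R) < eps"
    using assms(2) by (intro order_tendstoD(2)) auto
  then have "\<forall>\<^sub>F R in sequentially. R \<ge> 1 \<and> integral\<^sup>L lebesgue (?h R) < eps"
    using eventually_ge_at_top[of 1] by eventually_elim auto
  then show ?thesis using eventually_happens sequentially_bot by blast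
qed

section \<open>The tail estimate for quaternary forms\<close>

text \<open>Outside a ball of radius R the weight has small integral. Inside it is bounded, and the
  forms lie in a box of size about R X, where \<open>tail_card\<close> applies. The three errors
  come from the complement of the ball, from the term in 1 / N and from the lower power of the box
  size.\<close>

lemma (in four_indices) tail_small:
  fixes g :: "real ^ 'n uprod \<Rightarrow> real"
  assumes g: "adm g" "\<And>x. 0 \<le> g x" and e: "eps > 0"
  shows "\<exists>N0. \<forall>N\<ge>N0. \<forall>\<^sub>F X in at_top.
    wsum g {c. \<exists>p. prime p \<and> p > N \<and> int p dvd disc3 c i j k \<and> int p dvd disc3 c i j l} X < eps"
proof -
  let ?m = "CARD('n uprod)"
  let ?T = "\<lambda>N. {c. \<exists>p. prime p \<and> p > N \<and> int p dvd disc3 c i j k \<and> int p dvd disc3 c i j l}"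
  obtain C where C: "C \<ge> 0" "\<And>x. \<bar>g x\<bar> \<le> C * wfun x" using g(1) by (auto simp: adm_def)
  have gC: "g x \<le> C" for x
  proof -
    have "1 + norm x \<ge> 1" by simp
    then have "1 / (1 + norm x) \<le> 1" by (subst divide_le_eq_1_pos) linarith+
    then have "wfun x \<le> 1" unfolding wfun_def by (intro power_le_one) auto
    then have "C * wfun x \<le> C" using C(1) by (simp add: mult_left_le)
    then show ?thesis using C(2)[of x] by linarith
  qed
  obtain R :: nat where R: "R \<ge> 1" "integral\<^sup>L lebesgue (\<lambda>x. g x * indicator {x. norm x > real R} x) < eps / 3"
    using integral_tail[OF g(1) _ g(2), of "eps / 3"] e by auto
  define h where "h = (\<lambda>x. g x * indicator {x. norm x > real R} x)"
  have "frontier {x :: real ^ 'n uprod. norm x > real R} = frontier (cball 0 (real R))"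
  proof -
    have "{x :: real ^ 'n uprod. norm x > real R} = - cball 0 (real R)" by auto
    then show ?thesis by (simp only: frontier_complement)
  qed
  then have "negligible (frontier {x :: real ^ 'n uprod. norm x > real R})"
    using negligible_convex_frontier[OF convex_cball] by metis
  then have h: "adm h" unfolding h_def by (rule adm_indicator[OF g(1)])
  have "\<forall>\<^sub>F X in at_top. wsum h UNIV X < eps / 3"
    using R(2) by (intro order_tendstoD(2)[OF wsum_UNIV[OF h]]) (simp add: h_def)
  note ev1 = this
  \<comment> \<open>Bounds 2 Y + 1 by A X, since Y exceeds R X by at most 1 and X is at least
    1.\<close>
  define A where "A = 2 * real R + 3"
  have A: "A \<ge> 0" by (simp add: A_def)
  obtain N0 :: nat where N0: "C * 9 * A ^ ?m * 3 / eps < real N0" using reals_Archimedean2 by blast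
  have "((\<lambda>X. C * 27 * A ^ (?m - 1) / X) \<longlongrightarrow> 0) at_top"
    by (intro tendsto_divide_0[OF tendsto_const] filterlim_at_top_imp_at_infinity filterlim_ident)
  then have ev2: "\<forall>\<^sub>F X in at_top. C * 27 * A ^ (?m - 1) / X < eps / 3"
    using e by (intro order_tendstoD(2)) auto
  have "\<forall>\<^sub>F X in at_top. wsum g (?T N) X < eps" if N: "N \<ge> max 2 N0" for N
    using ev1 ev2 eventually_ge_at_top[of 8]
  proof eventually_elim
    case (elim X)
    have X: "X > 0" "X \<ge> 8" using elim by auto
    define Y where "Y = nat \<lceil>real R * X\<rceil>"
    have "X \<le> real R * X" using R(1) X by (simp add: mult_le_cancel_right1)
    then have RX: "real R * X \<ge> 8" using X by linarith
    then have Y: "real R * X \<le> real Y" "real Y \<le> real R * X + 1" unfolding Y_def by linarith+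
    have Y8: "Y \<ge> 8" using RX Y(1) by linarith
    let ?B = "{c \<in> box_zero Y {}. \<exists>p. prime p \<and> p > N \<and> int p dvd disc3 c i j k \<and> int p dvd disc3 c i j l}"
    have sub: "?T N \<subseteq> {Q \<in> UNIV. real_qform Q /\<^sub>R X \<in> {x. norm x > real R}} \<union> ?B"
    proof
      fix Q assume Q: "Q \<in> ?T N"
      show "Q \<in> {Q \<in> UNIV. real_qform Q /\<^sub>R X \<in> {x. norm x > real R}} \<union> ?B"
      proof (cases "norm (real_qform Q /\<^sub>R X) > real R")
        case False
        have "\<bar>Q $ u\<bar> \<le> int Y" for u
        proof -
          have "\<bar>(real_qform Q /\<^sub>R X) $ u\<bar> \<le> real R"
            using component_le_norm_cart[of "real_qform Q /\<^sub>R X" u] False by linarith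
          then have "inverse X * \<bar>real_of_int (Q $ u)\<bar> \<le> real R" using X by (simp add: abs_mult)
          then have "X * (inverse X * \<bar>real_of_int (Q $ u)\<bar>) \<le> X * real R" using X by (intro mult_left_mono) auto
          moreover have "X * (inverse X * a) = a" for a using X by (simp add: field_simps)
          ultimately have "\<bar>real_of_int (Q $ u)\<bar> \<le> real R * X" by (simp only: mult.commute[of "real R"])
          then have "\<bar>real_of_int (Q $ u)\<bar> \<le> real Y" using Y by linarith
          then show ?thesis by linarith
        qed
        then show ?thesis using Q by (simp add: box_zero_def)
      qed simp
    qed
    have fB: "finite ?B" by (rule finite_subset[OF _ box_zero_card(1)[of Y "{}"]]) blast
    have "wsum g (?T N) X \<le> wsum g ({Q \<in> UNIV. real_qform Q /\<^sub>R X \<in> {x. norm x > real R}} \<union> ?B) X"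
      by (rule wsum_mono[OF g X(1) sub])
    also have "\<dots> \<le> wsum g {Q \<in> UNIV. real_qform Q /\<^sub>R X \<in> {x. norm x > real R}} X + wsum g ?B X"
      by (rule wsum_Un_le[OF g X(1)])
    also have "wsum g {Q \<in> UNIV. real_qform Q /\<^sub>R X \<in> {x. norm x > real R}} X = wsum h UNIV X"
      unfolding h_def by (rule wsum_indicator[symmetric])
    also have "wsum g ?B X \<le> C * real (card ?B) / X ^ ?m" by (rule wsum_finite_le[OF gC fB X(1)])
    also have "\<dots> \<le> C * (9 * (A * X) ^ ?m / real N + 27 * (A * X) ^ (?m - 1)) / X ^ ?m"
    proof -
      have "2 * real Y + 1 \<le> A * X" using Y(2) X(2) by (simp add: A_def algebra_simps)
      then have "9 * (2 * real Y + 1) ^ ?m / real N + 27 * (2 * real Y + 1) ^ (?m - 1) \<le>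
        9 * (A * X) ^ ?m / real N + 27 * (A * X) ^ (?m - 1)"
        by (intro add_mono divide_right_mono mult_left_mono power_mono) auto
      then have "real (card ?B) \<le> 9 * (A * X) ^ ?m / real N + 27 * (A * X) ^ (?m - 1)"
        using tail_card[OF Y8, of N] N by linarith
      then show ?thesis using C(1) X by (intro divide_right_mono mult_left_mono) auto
    qed
    also have "\<dots> = C * 9 * A ^ ?m / real N + C * 27 * A ^ (?m - 1) / X"
    proof -
      have "X ^ ?m = X * X ^ (?m - 1)" by (simp flip: power_Suc)
      then have "27 * (A * X) ^ (?m - 1) / X ^ ?m = 27 * A ^ (?m - 1) / X"
        using X by (simp add: power_mult_distrib)
      moreover have "9 * (A * X) ^ ?m / real N / X ^ ?m = 9 * A ^ ?m / real N"
        using X by (simp add: power_mult_distrib)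
      ultimately show ?thesis
        by (simp only: times_divide_eq_right[symmetric] add_divide_distrib distrib_left mult.assoc)
    qed
    also have "C * 9 * A ^ ?m / real N < eps / 3"
    proof -
      have "C * 9 * A ^ ?m * 3 / eps < real N" using N0 N by linarith
      then have "C * 9 * A ^ ?m * 3 < real N * eps" using e by (simp add: divide_less_eq)
      then show ?thesis using N by (simp add: divide_less_eq mult.commute)
    qed
    finally show ?case using elim by simp
  qed
  then show ?thesis by blast
qed

section \<open>The density of isotropic forms\<close>

text \<open>Descent on the sum of absolute values: a zero that is not primitive is divided by
  p.\<close>

lemma primitive_zero:
  fixes c :: "int ^ ('n::{finite,linorder}) uprod"
  assumes p: "prime p" and x: "x \<noteq> 0" "qev c x = 0"
  shows "\<exists>y. primitive p y \<and> qev c y = 0"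
  using x
proof (induction "nat (\<Sum>i\<in>UNIV. \<bar>x $ i\<bar>)" arbitrary: x rule: less_induct)
  case less
  show ?case
  proof (cases "primitive p x")
    case False
    then have "\<forall>i. \<exists>y. x $ i = int p * y" by (auto simp: primitive_def dvd_def)
    from choice[OF this] obtain y' where y': "\<forall>i. x $ i = int p * y' i" ..
    define y :: "int ^ ('n::_)" where "y = (\<chi> i. y' i)"
    have y: "x = int p *s y" using y' by (simp add: vec_eq_iff y_def)
    have p0: "int p \<ge> 2" using prime_ge_2_nat[OF p] by simp
    have y0: "y \<noteq> 0" using less.prems(1) y by auto
    have qy: "qev c y = 0" using less.prems(2) p0 unfolding y qev_scale by simp
    obtain i where "y $ i \<noteq> 0" using y0 by (auto simp: vec_eq_iff)
    then have "0 < (\<Sum>i\<in>UNIV. \<bar>y $ i\<bar>)" by (intro sum_pos2[of _ i]) auto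
    moreover have "(\<Sum>i\<in>UNIV. \<bar>x $ i\<bar>) = int p * (\<Sum>i\<in>UNIV. \<bar>y $ i\<bar>)"
      by (simp add: y abs_mult sum_distrib_left)
    moreover have "2 * (\<Sum>i\<in>UNIV. \<bar>y $ i\<bar>) \<le> int p * (\<Sum>i\<in>UNIV. \<bar>y $ i\<bar>)"
      using p0 by (intro mult_right_mono) (auto intro: sum_nonneg)
    ultimately have "nat (\<Sum>i\<in>UNIV. \<bar>y $ i\<bar>) < nat (\<Sum>i\<in>UNIV. \<bar>x $ i\<bar>)" by linarith
    then show ?thesis using less.hyps y0 qy by blast
  qed (use less in blast)
qed

definition approx :: "nat \<Rightarrow> nat \<Rightarrow> (int ^ ('n::{finite,linorder}) uprod) set" where
  "approx N k = {Q. real_qform Q \<in> real_iso \<and> (\<forall>p\<in>primes_le N. zero_mod p k Q)}"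

definition globiso :: "(int ^ ('n::{finite,linorder}) uprod) set" where
  "globiso = {Q. isotropic ring_of_type Q}"

definition zdens :: "('n::{finite,linorder}) itself \<Rightarrow> nat \<Rightarrow> nat \<Rightarrow> real" where
  "zdens _ k p = rdens (int p ^ k) {c :: int ^ 'n uprod. zero_mod p k c}"

lemma globiso_subset: "globiso \<subseteq> (approx N k :: (int ^ ('n::{finite,linorder}) uprod) set)"
proof
  fix Q :: "int ^ 'n uprod" assume "Q \<in> globiso"
  then obtain x where x: "x \<noteq> 0" "qev Q x = 0" by (auto simp: globiso_def isotropic_iff_qev)
  have "rvec x \<noteq> 0" using x(1) by (auto simp: rvec_def vec_eq_iff)
  moreover have "qev (rvec Q) (rvec x) = 0" using x(2) by (simp add: qev_rvec)
  ultimately have "rvec Q \<in> real_iso" by (auto simp: real_iso_def isotropic_iff_qev)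
  moreover have "zero_mod p k Q" if "prime p" for p
    using primitive_zero[OF that x] by (auto simp: zero_mod_def)
  ultimately show "Q \<in> approx N k" by (simp add: approx_def rvec_def primes_le_def)
qed

text \<open>Real isotropy is invariant under scaling, so it moves into the weight as an indicator;
  the remaining conditions are periodic and independent at different primes.\<close>

lemma wsum_approx:
  fixes f :: "real ^ ('n::{finite,linorder}) uprod \<Rightarrow> real"
  assumes f: "adm f"
  shows "((\<lambda>X. wsum f (approx N k) X) \<longlongrightarrow>
    (\<Prod>p\<in>primes_le N. zdens TYPE('n) k p) * integral\<^sup>L lebesgue (\<lambda>x. f x * indicator real_iso x)) at_top"
proof -
  let ?A = "\<lambda>p. {c :: int ^ 'n uprod. zero_mod p k c}"
  let ?M = "\<Prod>p\<in>primes_le N. int p ^ k"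
  have pr: "prime p" if "p \<in> primes_le N" for p using that by (simp add: primes_le_def)
  have M: "?M > 0" using pr by (auto intro!: prod_pos simp: prime_gt_0_nat)
  have *: "periodic ?M (\<Inter>p\<in>primes_le N. ?A p)"
    "rdens ?M (\<Inter>p\<in>primes_le N. ?A p) = (\<Prod>p\<in>primes_le N. zdens TYPE('n) k p)"
    using rdens_prime_powers[of "primes_le N" k ?A] pr periodic_zero_mod by (auto simp: zdens_def)
  have "adm (\<lambda>x. f x * indicator real_iso x)" by (intro adm_indicator f negligible_frontier_real_iso)
  from wsum_periodic[OF this M *(1)]
  have lim: "((\<lambda>X. wsum (\<lambda>x. f x * indicator real_iso x) (\<Inter>p\<in>primes_le N. ?A p) X) \<longlongrightarrow>
    (\<Prod>p\<in>primes_le N. zdens TYPE('n) k p) * integral\<^sup>L lebesgue (\<lambda>x. f x * indicator real_iso x)) at_top"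
    unfolding *(2) .
  show ?thesis
  proof (rule Lim_transform_eventually[OF lim])
    show "\<forall>\<^sub>F X in at_top. wsum (\<lambda>x. f x * indicator real_iso x) (\<Inter>p\<in>primes_le N. ?A p) X = wsum f (approx N k) X"
      using eventually_gt_at_top[of 0]
    proof eventually_elim
      case (elim X)
      have "{Q \<in> (\<Inter>p\<in>primes_le N. ?A p). real_qform Q /\<^sub>R X \<in> real_iso} = approx N k"
        using real_iso_scale[OF elim] by (auto simp: approx_def)
      then show ?case by (simp add: wsum_indicator)
    qed
  qed
qed

lemma det_dvd_small:
  fixes g :: "real ^ ('n::{finite,linorder}) uprod \<Rightarrow> real"
  assumes g: "adm g" "\<And>x. 0 \<le> g x" and e: "eps > 0" and p: "prime p"
  shows "\<exists>j. \<forall>\<^sub>F X in at_top. wsum g {c. int p ^ j dvd det (gram c)} X < eps"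
proof -
  let ?I = "integral\<^sup>L lebesgue g"
  have I: "?I \<ge> 0" using g(2) by (intro Bochner_Integration.integral_nonneg) auto
  have "eps / (?I + 1) > 0" using e I by simp
  from det_density[OF p this] obtain j where
    j: "rdens (int p ^ j) {c :: int ^ 'n uprod. int p ^ j dvd det (gram c)} < eps / (?I + 1)" by blast
  have per: "periodic (int p ^ j) {c :: int ^ 'n uprod. int p ^ j dvd det (gram c)}"
  proof (rule periodicI)
    fix c d :: "int ^ 'n uprod"
    assume "\<And>u. [c $ u = d $ u] (mod int p ^ j)" "c \<in> {c. int p ^ j dvd det (gram c)}"
    then show "d \<in> {c. int p ^ j dvd det (gram c)}" using cong_dvd_iff[OF det_dvd_cong, of c d "int p ^ j"] by simp
  qed
  have pos: "int p ^ j > 0" using p by (simp add: prime_gt_0_nat)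
  let ?F = "rdens (int p ^ j) {c :: int ^ 'n uprod. int p ^ j dvd det (gram c)}"
  have "?F * (?I + 1) < eps" using j I by (simp add: less_divide_eq)
  moreover have "?F * ?I \<le> ?F * (?I + 1)" using rdens_nonneg[OF pos] by (intro mult_left_mono) auto
  ultimately have "?F * ?I < eps" by linarith
  then show ?thesis using order_tendstoD(2)[OF wsum_periodic[OF g(1) pos per]] by blast
qed

text \<open>In four variables, a form of the approximation whose determinant is not too divisible by
  any p \<le> N, and whose two ternary discriminants have no common prime factor beyond N, is
  soluble at every prime and hence isotropic. The remainder is covered by the two exceptional
  sets.\<close>

lemma remainder_small:
  fixes g :: "real ^ ('n::{finite,linorder}) uprod \<Rightarrow> real"
  assumes g: "adm g" "\<And>x. 0 \<le> g x" and e: "eps > 0" and n: "CARD('n) \<ge> 4"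
  shows "\<exists>N0. \<forall>N\<ge>N0. \<exists>k0. \<forall>k\<ge>k0. \<forall>\<^sub>F X in at_top. wsum g (approx N k - globiso) X < eps"
proof (cases "CARD('n) = 4")
  case False
  then have n5: "CARD('n) \<ge> 5" using n by simp
  \<comment> \<open>In five or more variables only determinant 0 has to be excluded; the prime 2 is
    an arbitrary choice for bounding its density.\<close>
  obtain j where j: "\<forall>\<^sub>F X in at_top. wsum g {c. int 2 ^ j dvd det (gram c)} X < eps"
    using det_dvd_small[OF g e, of 2] by auto
  have "approx N k - globiso \<subseteq> {c :: int ^ 'n uprod. int 2 ^ j dvd det (gram c)}" for N k
  proof
    fix c :: "int ^ 'n uprod" assume c: "c \<in> approx N k - globiso"
    then have "isotropic ring_of_type (rvec c)" by (simp add: approx_def real_iso_def rvec_def)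
    then have "det (gram c) = 0" using isotropic_quinary[OF _ _ n5, of c] c by (auto simp: globiso_def)
    then show "c \<in> {c. int 2 ^ j dvd det (gram c)}" by simp
  qed
  then have le: "wsum g (approx N k - globiso) X \<le> wsum g {c. int 2 ^ j dvd det (gram c)} X" if "X > 0" for N k X
    using that by (intro wsum_mono g) auto
  have "\<forall>\<^sub>F X in at_top. wsum g (approx N k - globiso) X < eps" for N k
    using j eventually_gt_at_top[of 0]
  proof eventually_elim
    case (elim X)
    then show ?case using le[of X N k] by linarith
  qed
  then show ?thesis by blast
next
  case n4: True
  have "finite (UNIV :: 'n set)" by simp
  from ex_bij_betw_nat_finite[OF this] obtain f where "bij_betw f {0..<CARD('n)} (UNIV :: 'n set)" by blast
  then have inj: "inj_on f {0..<4}" unfolding n4 by (rule bij_betw_imp_inj_on)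
  have f_ne: "f a \<noteq> f b" if "a < 4" "b < 4" "a \<noteq> b" for a b
    using that inj_on_eq_iff[OF inj, of a b] by simp
  interpret four_indices "f 0" "f 1" "f 2" "f 3"
    by unfold_locales (simp_all add: f_ne)
  let ?T = "\<lambda>N. {c. \<exists>p. prime p \<and> p > N \<and> int p dvd disc3 c (f 0) (f 1) (f 2) \<and> int p dvd disc3 c (f 0) (f 1) (f 3)}"
  have e2: "eps / 2 > 0" using e by simp
  obtain N0 where N0: "\<And>N. N \<ge> N0 \<Longrightarrow> \<forall>\<^sub>F X in at_top. wsum g (?T N) X < eps / 2"
    using tail_small[OF g e2] by blast
  have "\<exists>k0. \<forall>k\<ge>k0. \<forall>\<^sub>F X in at_top. wsum g (approx N k - globiso) X < eps" if N: "N \<ge> max 2 N0" for N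
  proof -
    let ?S = "primes_le N"
    have S: "finite ?S" "2 \<in> ?S" using N by (auto simp: primes_le_def)
    \<comment> \<open>Half of eps is shared among the primes up to N, the other half is for the
      primes beyond N.\<close>
    define \<delta> where "\<delta> = eps / (2 * real (card ?S))"
    have cS: "card ?S > 0" using S card_gt_0_iff by blast
    have d: "\<delta> > 0" using e cS by (simp add: \<delta>_def)
    have "\<forall>p. \<exists>j. prime p \<longrightarrow> (\<forall>\<^sub>F X in at_top. wsum g {c. int p ^ j dvd det (gram c)} X < \<delta>)"
      using det_dvd_small[OF g d] by blast
    from choice[OF this] obtain J where
      J: "\<And>p. prime p \<Longrightarrow> \<forall>\<^sub>F X in at_top. wsum g {c. int p ^ J p dvd det (gram c)} X < \<delta>" by blast
    define k0 where "k0 = (\<Sum>p\<in>?S. 2 * J p + 1)"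
    have k0: "2 * J p + 1 \<le> k0" if "p \<in> ?S" for p
      unfolding k0_def using that S(1) by (intro member_le_sum) auto
    have "\<forall>\<^sub>F X in at_top. wsum g (approx N k - globiso) X < eps" if k: "k \<ge> k0" for k
    proof -
      let ?D = "\<lambda>p. {c :: int ^ 'n uprod. int p ^ J p dvd det (gram c)}"
      have sub: "approx N k - globiso \<subseteq> (\<Union>p\<in>?S. ?D p) \<union> ?T N"
      proof (rule subsetI, rule ccontr)
        fix c :: "int ^ 'n uprod"
        assume c: "c \<in> approx N k - globiso" "c \<notin> (\<Union>p\<in>?S. ?D p) \<union> ?T N"
        have "locsol p c" if p: "prime p" for p
        proof (cases "p \<le> N")
          case True
          then have pS: "p \<in> ?S" using p by (simp add: primes_le_def)
          then have nd: "\<not> int p ^ J p dvd det (gram c)" using c(2) by blast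
          have "int p ^ J p dvd int p ^ (J p + 1)" by simp
          then have nd': "\<not> int p ^ (J p + 1) dvd det (gram c)" using nd dvd_trans by blast
          have "zero_mod p k c" using c(1) pS by (simp add: approx_def)
          then have "zero_mod p (2 * J p + 1) c" by (rule zero_mod_mono) (use k0[OF pS] k in linarith)
          then show ?thesis by (rule locsol_of_det[OF p nd'])
        next
          case False
          then have p2: "p > 2" using N by simp
          have "\<not> int p dvd disc3 c (f 0) (f 1) (f 2) \<or> \<not> int p dvd disc3 c (f 0) (f 1) (f 3)"
            using c(2) p False by auto
          then show ?thesis
          proof
            assume "\<not> int p dvd disc3 c (f 0) (f 1) (f 2)"
            then show ?thesis by (rule locsol_of_disc3[OF p p2 ne(1-3)])
          next
            assume "\<not> int p dvd disc3 c (f 0) (f 1) (f 3)"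
            then show ?thesis by (rule locsol_of_disc3[OF p p2 ne(1,4,5)])
          qed
        qed
        moreover have "isotropic ring_of_type (rvec c)" using c(1) by (simp add: approx_def real_iso_def rvec_def)
        \<comment> \<open>N \<ge> 2 has two uses: the prime 2 in the finite set excludes determinant
          0, and the primes beyond N are odd.\<close>
        moreover have "det (gram c) \<noteq> 0"
        proof
          assume "det (gram c) = 0"
          then have "c \<in> ?D 2" by simp
          then show False using c(2) S(2) by blast
        qed
        ultimately have "isotropic ring_of_type c" using isotropic_quaternary[OF _ _ n4, of c] by blast
        then show False using c(1) by (simp add: globiso_def)
      qed
      have "\<forall>\<^sub>F X in at_top. \<forall>p\<in>?S. wsum g (?D p) X < \<delta>"
        using J by (intro eventually_ball_finite[OF S(1)]) (simp add: primes_le_def)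
      moreover have "\<forall>\<^sub>F X in at_top. wsum g (?T N) X < eps / 2" using N0 N by simp
      ultimately show ?thesis using eventually_gt_at_top[of 0]
      proof eventually_elim
        case (elim X)
        have "wsum g (approx N k - globiso) X \<le> wsum g ((\<Union>p\<in>?S. ?D p) \<union> ?T N) X"
          by (rule wsum_mono[OF g elim(3) sub])
        also have "\<dots> \<le> wsum g (\<Union>p\<in>?S. ?D p) X + wsum g (?T N) X" by (rule wsum_Un_le[OF g elim(3)])
        also have "wsum g (\<Union>p\<in>?S. ?D p) X \<le> (\<Sum>p\<in>?S. wsum g (?D p) X)" by (rule wsum_UN_le[OF g elim(3) S(1)])
        also have "\<dots> \<le> (\<Sum>p\<in>?S. \<delta>)" using elim(1) by (intro sum_mono) (auto intro: less_imp_le)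
        also have "\<dots> = real (card ?S) * (eps / (2 * real (card ?S)))" unfolding \<delta>_def by (rule sum_constant)
        also have "\<dots> = eps / 2"
        proof -
          have "c * (eps / (2 * c)) = eps / 2" if "c > 0" for c :: real using that by (simp add: field_simps)
          then show ?thesis using cS by (simp only: of_nat_0_less_iff)
        qed
        finally show ?case using elim(2) by simp
      qed
    qed
    then show ?thesis by blast
  qed
  then show ?thesis by blast
qed

lemma padic_product_converges:
  "\<exists>L. (\<lambda>N. \<Prod>p\<in>primes_le N. padic_isotropy_prob TYPE('n::{finite,linorder}) p) \<longlonglongrightarrow> L"
proof -
  let ?\<rho> = "padic_isotropy_prob TYPE('n)"
  let ?P = "\<lambda>N. \<Prod>p\<in>primes_le N. ?\<rho> p"
  have b: "0 \<le> ?\<rho> p" "?\<rho> p \<le> 1" if "p \<in> primes_le N" for p N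
    using padic_isotropy_prob_bounds[of p, where 'n = 'n] that by (auto simp: primes_le_def)
  have "decseq ?P"
  proof (rule decseq_SucI)
    fix N
    have sub: "primes_le N \<subseteq> primes_le (Suc N)" by (auto simp: primes_le_def)
    have "?P (Suc N) = (\<Prod>p\<in>primes_le (Suc N) - primes_le N. ?\<rho> p) * ?P N"
      by (rule prod.subset_diff[OF sub]) simp
    also have "\<dots> \<le> 1 * ?P N"
      using b by (intro mult_right_mono prod_le_1 prod_nonneg) auto
    finally show "?P (Suc N) \<le> ?P N" by simp
  qed
  moreover have "bdd_below (range ?P)"
    using b by (intro bdd_belowI[of _ 0]) (auto intro!: prod_nonneg)
  ultimately show ?thesis using LIMSEQ_decseq_INF by blast
qed

lemma zdens_limit: "prime p \<Longrightarrow> (\<lambda>k. zdens TYPE('n::{finite,linorder}) k p) \<longlonglongrightarrow> padic_isotropy_prob TYPE('n) p"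
  unfolding zdens_def by (rule padic_isotropy_limit)

lemma padic_product_zero:
  assumes n: "CARD('n::{finite,linorder}) \<le> 3"
  shows "(\<lambda>N. \<Prod>p\<in>primes_le N. padic_isotropy_prob TYPE('n) p) \<longlonglongrightarrow> 0"
proof -
  let ?\<rho> = "padic_isotropy_prob TYPE('n)"
  define a where "a = (4 / 27 :: real)"
  \<comment> \<open>The factor \<open>exp a\<close> at p = 2 outweighs exp (-a / 2), as only the
    trivial bound 1 is used there; a is the constant of \<open>anisotropic_density\<close>.\<close>
  have bound: "?\<rho> p \<le> exp (- (a / real p)) * (if p = 2 then exp a else 1)" if p: "prime p" for p
  proof (cases "p = 2")
    case True
    have "?\<rho> 2 \<le> 1" using padic_isotropy_prob_bounds[of 2, where 'n = 'n] by simp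
    also have "1 \<le> exp (- (a / 2)) * exp a" by (simp add: a_def flip: exp_add)
    finally show ?thesis using True by simp
  next
    case False
    then have p2: "p > 2" using prime_ge_2_nat[OF p] by simp
    have "?\<rho> p \<le> rdens (int p ^ 2) {c :: int ^ 'n uprod. zero_mod p 2 c}"
      using decseq_ge[OF padic_isotropy_limit(2,1)[OF p, where 'n = 'n], of 2] by simp
    also have "\<dots> \<le> 1 - a / real p" using anisotropic_density[OF p p2 n] by (simp add: a_def)
    also have "\<dots> \<le> exp (- (a / real p))" using exp_ge_add_one_self[of "- (a / real p)"] by simp
    finally show ?thesis using False by simp
  qed
  have le: "(\<Prod>p\<in>primes_le N. ?\<rho> p) \<le> exp a * exp (- a * (\<Sum>p\<in>primes_le N. 1 / real p))" for N
  proof -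
    have "(\<Prod>p\<in>primes_le N. ?\<rho> p) \<le> (\<Prod>p\<in>primes_le N. exp (- (a / real p)) * (if p = 2 then exp a else 1))"
      using bound padic_isotropy_prob_bounds(1) by (intro prod_mono) (auto simp: primes_le_def)
    also have "\<dots> = exp (- a * (\<Sum>p\<in>primes_le N. 1 / real p)) * (if 2 \<in> primes_le N then exp a else 1)"
      by (simp add: prod.distrib prod.delta exp_sum[symmetric] sum_distrib_left sum_negf)
    also have "\<dots> \<le> exp (- a * (\<Sum>p\<in>primes_le N. 1 / real p)) * exp a"
      by (intro mult_left_mono) (auto simp: a_def)
    finally show ?thesis by (simp add: mult.commute)
  qed
  have "filterlim (\<lambda>N. - a * (\<Sum>p\<in>primes_le N. 1 / real p)) at_bot sequentially"
    by (rule filterlim_tendsto_neg_mult_at_bot[OF tendsto_const _ sum_inverse_primes_diverges]) (simp add: a_def)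
  then have "(\<lambda>N. exp (- a * (\<Sum>p\<in>primes_le N. 1 / real p))) \<longlonglongrightarrow> 0"
    by (rule filterlim_compose[OF exp_at_bot])
  then have lim: "(\<lambda>N. exp a * exp (- a * (\<Sum>p\<in>primes_le N. 1 / real p))) \<longlonglongrightarrow> 0"
    by (rule tendsto_mult_right_zero)
  have nonneg: "0 \<le> (\<Prod>p\<in>primes_le N. ?\<rho> p)" for N
    using padic_isotropy_prob_bounds(1) by (intro prod_nonneg) (auto simp: primes_le_def)
  show ?thesis
    by (rule tendsto_sandwich[OF always_eventually[OF allI[OF nonneg]] always_eventually[OF allI[OF le]] tendsto_const lim])
qed

text \<open>In at most three variables L = 0, so the approximating set itself has small weight.
  Otherwise N and then k are taken large enough both for the product of densities and for the
  remainder estimate.\<close>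

lemma approximation:
  fixes g :: "real ^ ('n::{finite,linorder}) uprod \<Rightarrow> real"
  assumes g: "adm g" "\<And>x. 0 \<le> g x" and e: "eps > 0"
    and L: "(\<lambda>N. \<Prod>p\<in>primes_le N. padic_isotropy_prob TYPE('n) p) \<longlonglongrightarrow> L"
  shows "\<exists>N k. \<bar>(\<Prod>p\<in>primes_le N. zdens TYPE('n) k p) - L\<bar> < eps \<and>
    (\<forall>\<^sub>F X in at_top. wsum g (approx N k - globiso) X < eps)"
proof -
  let ?P = "\<lambda>N. \<Prod>p\<in>primes_le N. padic_isotropy_prob TYPE('n) p"
  let ?Z = "\<lambda>N k. \<Prod>p\<in>primes_le N. zdens TYPE('n) k p"
  have Z: "?Z N \<longlonglongrightarrow> ?P N" for N
    by (intro tendsto_prod zdens_limit) (simp add: primes_le_def)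
  have close: "\<exists>N1. \<forall>N\<ge>N1. \<exists>k1. \<forall>k\<ge>k1. \<bar>?Z N k - L\<bar> < \<delta>" if d: "\<delta> > 0" for \<delta>
  proof -
    obtain N1 where N1: "\<And>N. N \<ge> N1 \<Longrightarrow> \<bar>?P N - L\<bar> < \<delta> / 2"
      using LIMSEQ_D[OF L, of "\<delta> / 2"] d by auto
    have "\<exists>k1. \<forall>k\<ge>k1. \<bar>?Z N k - L\<bar> < \<delta>" if "N \<ge> N1" for N
    proof -
      obtain k1 where k1: "\<And>k. k \<ge> k1 \<Longrightarrow> \<bar>?Z N k - ?P N\<bar> < \<delta> / 2"
        using LIMSEQ_D[OF Z, of "\<delta> / 2" N] d by auto
      have "\<bar>?Z N k - L\<bar> < \<delta>" if "k \<ge> k1" for k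
        using k1[OF that] N1[OF \<open>N \<ge> N1\<close>] by linarith
      then show ?thesis by blast
    qed
    then show ?thesis by blast
  qed
  show ?thesis
  proof (cases "CARD('n) \<le> 3")
    case True
    have L0: "L = 0" using LIMSEQ_unique[OF L padic_product_zero[OF True]] .
    let ?I = "integral\<^sup>L lebesgue (\<lambda>x. g x * indicator real_iso x)"
    have I: "?I \<ge> 0" using g(2) by (intro Bochner_Integration.integral_nonneg) auto
    define \<delta> where "\<delta> = min eps (eps / (?I + 1))"
    have d: "\<delta> > 0" "\<delta> \<le> eps" "\<delta> * (?I + 1) \<le> eps"
    proof -
      show "\<delta> > 0" "\<delta> \<le> eps" using e I by (simp_all add: \<delta>_def)
      have "\<delta> \<le> eps / (?I + 1)" by (simp add: \<delta>_def)
      then show "\<delta> * (?I + 1) \<le> eps" using I by (simp add: le_divide_eq)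
    qed
    obtain N k where Nk: "\<bar>?Z N k - L\<bar> < \<delta>" using close[OF d(1)] by blast
    have "?Z N k * ?I \<le> \<delta> * ?I" using Nk I unfolding L0 by (intro mult_right_mono) auto
    then have "?Z N k * ?I < eps" using d by (simp add: distrib_left)
    then have "\<forall>\<^sub>F X in at_top. wsum g (approx N k) X < eps" by (rule order_tendstoD(2)[OF wsum_approx[OF g(1)]])
    then have "\<forall>\<^sub>F X in at_top. wsum g (approx N k - globiso) X < eps"
      using eventually_gt_at_top[of 0]
    proof eventually_elim
      case (elim X)
      have "wsum g (approx N k - globiso) X \<le> wsum g (approx N k) X" by (rule wsum_mono[OF g elim(2)]) blast
      then show ?case using elim(1) by linarith
    qed
    then show ?thesis using Nk d(2) by (intro exI[of _ N] exI[of _ k]) simp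
  next
    case False
    then have n: "CARD('n) \<ge> 4" by simp
    obtain N0 where N0: "\<And>N. N \<ge> N0 \<Longrightarrow> \<exists>k0. \<forall>k\<ge>k0. \<forall>\<^sub>F X in at_top. wsum g (approx N k - globiso) X < eps"
      using remainder_small[OF g e n] by blast
    obtain N1 where N1: "\<And>N. N \<ge> N1 \<Longrightarrow> \<exists>k1. \<forall>k\<ge>k1. \<bar>?Z N k - L\<bar> < eps" using close[OF e] by blast
    define N where "N = max N0 N1"
    obtain k0 where k0: "\<And>k. k \<ge> k0 \<Longrightarrow> \<forall>\<^sub>F X in at_top. wsum g (approx N k - globiso) X < eps"
      using N0[of N] by (auto simp: N_def)
    obtain k1 where k1: "\<And>k. k \<ge> k1 \<Longrightarrow> \<bar>?Z N k - L\<bar> < eps" using N1[of N] by (auto simp: N_def)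
    show ?thesis using k0[of "max k0 k1"] k1[of "max k0 k1"] by (intro exI[of _ N] exI[of _ "max k0 k1"]) simp
  qed
qed

theorem theorem1:
  fixes D :: "real ^ ('n::{finite,linorder}) uprod \<Rightarrow> real"
  assumes "nice_distribution D"
  shows "\<exists>\<rho>_inf L.
    has_probability D (\<lambda>Q. isotropic (ring_of_type :: real ring) (real_qform Q)) \<rho>_inf \<and>
    (\<lambda>N. \<Prod>p | prime p \<and> p \<le> N. padic_isotropy_prob TYPE('n) p) \<longlonglongrightarrow> L \<and>
    has_probability D (isotropic (ring_of_type :: int ring)) (\<rho>_inf * L)"
proof -
  have D: "adm D" by (rule nice_adm[OF assms])
  have one: "integral\<^sup>L lebesgue D = 1" using assms by (simp add: nice_distribution_def)
  note gD = adm_abs[OF D]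
  define \<rho> where "\<rho> = integral\<^sup>L lebesgue (\<lambda>x. D x * indicator real_iso x)"
  obtain L where L: "(\<lambda>N. \<Prod>p\<in>primes_le N. padic_isotropy_prob TYPE('n) p) \<longlonglongrightarrow> L"
    using padic_product_converges by blast
  \<comment> \<open>Without primes the approximating set is given by real isotropy alone, so the
    same limit yields the probability at the real place.\<close>
  have "primes_le 0 = {}" by (auto simp: primes_le_def)
  then have "approx 0 0 = {Q :: int ^ 'n uprod. isotropic ring_of_type (real_qform Q)}"
    by (simp add: approx_def real_iso_def)
  then have "has_probability D (\<lambda>Q. isotropic (ring_of_type :: real ring) (real_qform Q)) \<rho>"
    using wsum_approx[OF D, of 0 0] \<open>primes_le 0 = {}\<close> by (intro has_probability_wsum[OF D one]) (simp add: \<rho>_def)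
  moreover have "(\<lambda>N. \<Prod>p | prime p \<and> p \<le> N. padic_isotropy_prob TYPE('n) p) \<longlonglongrightarrow> L"
    using L by (simp add: primes_le_def)
  moreover have "has_probability D (isotropic (ring_of_type :: int ring)) (\<rho> * L)"
  proof (rule has_probability_wsum[OF D one])
    have "(wsum D globiso \<longlongrightarrow> \<rho> * L) at_top"
    proof (rule tendstoI)
      fix eps :: real assume e: "eps > 0"
      \<comment> \<open>Three errors: \<delta> from the limit of the approximating sum, \<delta>
        from the remainder in the weight |D|, and |\<rho>| \<delta> from replacing L by the product
        at finite level.\<close>
      define \<delta> where "\<delta> = eps / (3 * (\<bar>\<rho>\<bar> + 1))"
      have d: "\<delta> > 0" using e by (simp add: \<delta>_def add_nonneg_pos)
      have "\<bar>\<rho>\<bar> + 1 \<noteq> 0" using abs_ge_zero[of \<rho>] by linarith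
      then have d3: "3 * ((\<bar>\<rho>\<bar> + 1) * \<delta>) = eps" unfolding \<delta>_def by (simp only: mult.assoc[symmetric]) simp
      have r: "\<bar>\<rho>\<bar> * \<delta> \<ge> 0" using d by simp
      obtain N k where Nk: "\<bar>(\<Prod>p\<in>primes_le N. zdens TYPE('n) k p) - L\<bar> < \<delta>"
        "\<forall>\<^sub>F X in at_top. wsum (\<lambda>x. \<bar>D x\<bar>) (approx N k - globiso) X < \<delta>"
        using approximation[OF gD _ d L] by auto
      let ?Z = "\<Prod>p\<in>primes_le N. zdens TYPE('n) k p"
      have "\<bar>?Z * \<rho> - \<rho> * L\<bar> = \<bar>\<rho>\<bar> * \<bar>?Z - L\<bar>" by (simp add: abs_mult[symmetric] algebra_simps)
      also have "\<dots> \<le> \<bar>\<rho>\<bar> * \<delta>" using Nk(1) by (intro mult_left_mono) auto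
      finally have zl: "\<bar>?Z * \<rho> - \<rho> * L\<bar> \<le> \<bar>\<rho>\<bar> * \<delta>" .
      have "\<forall>\<^sub>F X in at_top. dist (wsum D (approx N k) X) (?Z * \<rho>) < \<delta>"
        using wsum_approx[OF D, of N k] d unfolding \<rho>_def[symmetric] by (rule tendstoD)
      then show "\<forall>\<^sub>F X in at_top. dist (wsum D globiso X) (\<rho> * L) < eps"
        using Nk(2) eventually_gt_at_top[of 0]
      proof eventually_elim
        case (elim X)
        have "\<bar>wsum D (approx N k) X - wsum D globiso X\<bar> < \<delta>"
          using wsum_diff[OF D elim(3) globiso_subset[of N k]] elim(2) by linarith
        then have "\<bar>wsum D globiso X - \<rho> * L\<bar> < \<delta> + \<delta> + \<bar>\<rho>\<bar> * \<delta>"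
          using elim(1) zl unfolding dist_real_def by linarith
        also have "\<dots> \<le> 3 * ((\<bar>\<rho>\<bar> + 1) * \<delta>)" using r d by (simp add: distrib_right)
        finally show ?case using d3 by (simp add: dist_real_def)
      qed
    qed
    then show "(wsum D {Q. isotropic (ring_of_type :: int ring) Q} \<longlongrightarrow> \<rho> * L) at_top" by (simp add: globiso_def)
  qed
  ultimately show ?thesis by blast
qed

end
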